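(* Let $0<\alpha<1$, $\theta>-\alpha$, $n\ge1$, let $\eta$ be a finite non-zero non-atomic measure on a Polish space $\mathcal{Y}$, $H=\eta/\eta(\mathcal{Y})$ and $K=\eta(\mathcal{Y})/\alpha$. (i) A random measure with law $\mathcal{PD}_{\alpha,\theta}(d\mu|\eta)$ is representable in distribution as $\mu^*(\cdot)+\sum_{j=1}^{n(\mathbf{p})}J_{j,n}\delta_{Y_j^*}(\cdot)$, where: given $\mathbf{p}$, $L$ is gamma with shape $n(\mathbf{p})+\theta/\alpha$ and rate $K$, and, independently of $L$, $Y_1^*,\dots,Y^*_{n(\mathbf{p})}$ are i.i.d. $H$; given $(L,\mathbf{p},\mathbf{Y}^* )$, $\mu^*$ is a generalised gamma random measure with intensity $\rho_{\alpha,L^{1/\alpha}}(ds)\eta(dy)$, and the $J_{j,n}$ are independent of each other and of $\mu^*$, with gamma distributions of shape $e_{j,n}-\alpha$ and rate $L^{1/\alpha}$. (ii) The distribution of $\mathbf{p}$ is the EPPF $PD(\mathbf{p}|\alpha,\theta)$. In addition the law of $\mu^*$ given $\mathbf{p}$ is $\mathcal{PD}_{\alpha,\theta+n(\mathbf{p})\alpha}(d\mu|\eta)$, its Laplace functional being $\int_0^\infty\mathcal{L}_\mu(g|L,\alpha)\,\mathcal{G}(dL|n(\mathbf{p})+\theta/\alpha,K)$, where $\mathcal{L}_\mu(g|L,\alpha)=e^{-\frac1\alpha\int_{\mathcal{Y}}(g(y)+L^{1/\alpha})^\alpha\eta(dy)}e^{KL}$. (iii) Hence the random probability measure $\mu^*(\cdot)/\mu^*(\mathcal{Y})$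 given $\mathbf{p}$ has law $\mathcal{PD}_{\alpha,\theta+n(\mathbf{p})\alpha}(dP|H)$. (iv) Given $(L,\mathbf{p})$, the random variables $G_{j,n}=L^{1/\alpha}J_{j,n}$ are independent gamma variables with shape $e_{j,n}-\alpha$ and rate $1$, independent of $L$ and $\mu^*$. Moreover, given $\mathbf{p}$, $L^{1/\alpha}\mu^*$ has Laplace functional $$\left[\int_{\mathcal{Y}}(g(y)+1)^\alpha H(dy)\right]^{-(\theta+n(\mathbf{p})\alpha)/\alpha},$$ and $L^{1/\alpha}\mu^*(\mathcal{Y})$ given $\mathbf{p}$ is gamma with shape $\theta+n(\mathbf{p})\alpha$ and rate $1$.
   Context: $\mathcal{G}(dL|a,b)$ is the gamma law with shape $a$ and rate $b$. For $b\ge0$, $\rho_{\alpha,b}(ds)=\frac{1}{\Gamma(1-\alpha)}s^{-\alpha-1}e^{-bs}ds$ on $(0,\infty)$ and $\rho_\alpha=\rho_{\alpha,0}$. $\mathcal{P}(d\mu|\rho,\eta)$ is the law of $\mu(dy)=\int_0^\infty sN(ds,dy)$ with $N$ a Poisson random measure on $(0,\infty)\times\mathcal{Y}$ with intensity $\rho(ds)\eta(dy)$; a generalised gamma random measure with intensity $\rho_{\alpha,b}(ds)\eta(dy)$ is one with law $\mathcal{P}(d\mu|\rho_{\alpha,b},\eta)$; $T=\mu(\mathcal{Y})$. For $\theta>-\alpha$, $\mathcal{PD}_{\alpha,\theta}(d\mu|\eta)=T^{-\theta}\mathcal{P}(d\mu|\rho_\alpha,\eta)/\int T^{-\theta}\mathcal{P}(d\mu|\rho_\alpha,\eta)$,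 and $\mathcal{PD}_{\alpha,\theta}(dP|H)$ is the law of $P=\mu/T$ under it (the two-parameter Poisson–Dirichlet random probability measure). $\mathbf{p}=\{C_1,\dots,C_{n(\mathbf{p})}\}$ ranges over partitions of $\{1,\dots,n\}$, $e_{j,n}=|C_j|$, and $PD(\mathbf{p}|\alpha,\theta)=\frac{\prod_{j=1}^{n(\mathbf{p})-1}(\theta+j\alpha)}{\prod_{j=1}^{n-1}(\theta+j)}\prod_{j=1}^{n(\mathbf{p})}\frac{\Gamma(e_{j,n}-\alpha)}{\Gamma(1-\alpha)}$. *)

theory Defs
  imports "HOL-Probability.Probability"
begin

text \<open>The measurable space of all measures on \<open>K\<close>, generated by the evaluations
  \<open>m \<mapsto> m A\<close>. This is \<^const>\<open>subprob_algebra\<close> without the restriction to subprobabilities.\<close>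

definition measure_algebra :: "'a measure \<Rightarrow> 'a measure measure" where
  "measure_algebra K =
    (SUP A \<in> sets K. vimage_algebra {m. sets m = sets K} (\<lambda>m. emeasure m A) borel)"

definition normalise :: "'a measure \<Rightarrow> 'a measure" where
  "normalise m = scale_measure (inverse (emeasure m (space m))) m"

text \<open>The measure \<open>m + (\<Sum>j\<in>I. w j \<cdot> \<delta>\<^sub>y\<^sub>j)\<close> (the library has no addition of measures).\<close>

definition add_atoms :: "'a measure \<Rightarrow> 'i set \<Rightarrow> ('i \<Rightarrow> real) \<Rightarrow> ('i \<Rightarrow> 'a) \<Rightarrow> 'a measure" where
  "add_atoms m I w y =
    measure_of (space m) (sets m)
      (\<lambda>A. emeasure m A + (\<Sum>j\<in>I. ennreal (w j) * indicator A (y j)))"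

definition poisson_random_measure ::
    "'w measure \<Rightarrow> ('w \<Rightarrow> 'a measure) \<Rightarrow> 'a measure \<Rightarrow> bool" where
  "poisson_random_measure M N \<nu> \<longleftrightarrow>
     prob_space M \<and> N \<in> measurable M (measure_algebra \<nu>) \<and>
     (\<forall>A\<in>sets \<nu>. emeasure \<nu> A < \<infinity> \<longrightarrow>
        (\<forall>k::nat. measure M {\<omega>\<in>space M. emeasure (N \<omega>) A = of_nat k} =
           measure \<nu> A ^ k / fact k * exp (- measure \<nu> A))) \<and>
     (\<forall>A\<in>sets \<nu>. emeasure \<nu> A = \<infinity> \<longrightarrow> (AE \<omega> in M. emeasure (N \<omega>) A = \<infinity>)) \<and>
     (\<forall>F. finite F \<and> F \<subseteq> sets \<nu> \<and> disjoint F \<longrightarrow>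
        prob_space.indep_vars M (\<lambda>_. borel) (\<lambda>A \<omega>. emeasure (N \<omega>) A) F)"

text \<open>The law of a Poisson random measure, realised canonically: under it the identity is a
  Poisson random measure with intensity \<open>\<nu>\<close>. For \<open>\<sigma>\<close>-finite \<open>\<nu>\<close> there is exactly one such law,
  by Poisson superposition and a monotone class argument.\<close>

definition poisson_law :: "'a measure \<Rightarrow> 'a measure measure" where
  "poisson_law \<nu> =
    (THE Q. sets Q = sets (measure_algebra \<nu>) \<and> poisson_random_measure Q (\<lambda>N. N) \<nu>)"

text \<open>\<open>\<P>(d\<mu> | \<rho>, \<eta>)\<close>: the law of \<open>\<mu>(dy) = \<integral> s N(ds, dy)\<close>, i.e. of the image on the second
  coordinate of the measure with density \<open>s\<close> with respect to \<open>N\<close>. The measure \<open>\<rho>\<close> lives on the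
  whole real line and is meant to be concentrated on the positive half-line.\<close>

definition crm_law :: "real measure \<Rightarrow> 'y measure \<Rightarrow> 'y measure measure" where
  "crm_law \<rho> \<eta> =
    distr (poisson_law (\<rho> \<Otimes>\<^sub>M \<eta>)) (measure_algebra \<eta>)
      (\<lambda>N. distr (density N (\<lambda>(s, y). ennreal s)) \<eta> snd)"

definition gamma_law :: "real \<Rightarrow> real \<Rightarrow> real measure" where
  "gamma_law a b = density lborel (\<lambda>x. ennreal
     (if 0 < x then b powr a / Gamma a * x powr (a - 1) * exp (- b * x) else 0))"

definition gg_intensity :: "real \<Rightarrow> real \<Rightarrow> real measure" where
  "gg_intensity \<alpha> b = density lborel (\<lambda>s. ennreal
     (if 0 < s then s powr (- \<alpha> - 1) * exp (- b * s) / Gamma (1 - \<alpha>) else 0))"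

text \<open>The total mass \<open>T\<close> is the real number \<^term>\<open>measure m (space m)\<close>; under the law
  \<open>\<P>(d\<mu> | \<rho>\<^sub>\<alpha>, \<eta>)\<close> one has \<open>0 < T < \<infinity>\<close> almost surely, so its conventional value \<open>0\<close> at measures
  of infinite mass is immaterial.\<close>

definition PD_measure :: "real \<Rightarrow> real \<Rightarrow> 'y measure \<Rightarrow> 'y measure measure" where
  "PD_measure \<alpha> \<theta> \<eta> =
    (let Q = crm_law (gg_intensity \<alpha> 0) \<eta>;
         w = (\<lambda>m. ennreal (measure m (space m) powr (- \<theta>)))
     in density Q (\<lambda>m. w m / (\<integral>\<^sup>+m'. w m' \<partial>Q)))"

definition PD_rpm :: "real \<Rightarrow> real \<Rightarrow> 'y measure \<Rightarrow> 'y measure measure" where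
  "PD_rpm \<alpha> \<theta> \<eta> = distr (PD_measure \<alpha> \<theta> \<eta>) (measure_algebra \<eta>) normalise"

definition PD_eppf :: "nat \<Rightarrow> real \<Rightarrow> real \<Rightarrow> nat set set \<Rightarrow> real" where
  "PD_eppf n \<alpha> \<theta> q =
    (\<Prod>j = 1..card q - 1. \<theta> + real j * \<alpha>) / (\<Prod>j = 1..n - 1. \<theta> + real j) *
    (\<Prod>C\<in>q. Gamma (real (card C) - \<alpha>) / Gamma (1 - \<alpha>))"

definition given :: "'w measure \<Rightarrow> ('w \<Rightarrow> 'b) \<Rightarrow> 'b \<Rightarrow> 'w measure" where
  "given M p q = uniform_measure M {\<omega> \<in> space M. p \<omega> = q}"

text \<open>The random partition is \<open>p\<close>; the families \<open>Y\<close> and \<open>J\<close> are indexed by the blocks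
  themselves, so \<open>Y C\<close> and \<open>J C\<close> stand for \<open>Y\<^sub>j\<^sup>*\<close> and \<open>J\<^sub>j\<^sub>,\<^sub>n\<close> when \<open>C = C\<^sub>j\<close>, and only the values at
  \<open>C \<in> p \<omega>\<close> matter. The last clause is the law of \<open>(L, Y\<^sup>*, \<mu>\<^sup>*, J)\<close> given \<open>p = q\<close>, obtained by
  mixing over \<open>L\<close> the product of the laws of \<open>Y\<^sup>*\<close>, \<open>\<mu>\<^sup>*\<close> and \<open>J\<close> given \<open>L = l\<close>: a product, because
  given \<open>(L, p)\<close> the law of \<open>(\<mu>\<^sup>*, J)\<close> does not depend on \<open>Y\<^sup>*\<close>, and \<open>Y\<^sup>*\<close> is independent of \<open>L\<close>.
  Nothing is required of the law of \<open>p\<close> here.\<close>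

definition PD_hierarchy ::
    "real \<Rightarrow> real \<Rightarrow> nat \<Rightarrow> 'y measure \<Rightarrow> 'w measure \<Rightarrow> ('w \<Rightarrow> nat set set) \<Rightarrow> ('w \<Rightarrow> real) \<Rightarrow>
     (nat set \<Rightarrow> 'w \<Rightarrow> 'y) \<Rightarrow> (nat set \<Rightarrow> 'w \<Rightarrow> real) \<Rightarrow> ('w \<Rightarrow> 'y measure) \<Rightarrow> bool" where
  "PD_hierarchy \<alpha> \<theta> n \<eta> M p L Y J \<mu> \<longleftrightarrow>
     prob_space M \<and>
     p \<in> measurable M (count_space {q. partition_on {1..n} q}) \<and>
     L \<in> measurable M borel \<and>
     (\<forall>C\<subseteq>{1..n}. Y C \<in> measurable M \<eta> \<and> J C \<in> measurable M borel) \<and>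
     \<mu> \<in> measurable M (measure_algebra \<eta>) \<and>
     (\<forall>q. partition_on {1..n} q \<and> 0 < measure M {\<omega> \<in> space M. p \<omega> = q} \<longrightarrow>
        distr (given M p q)
          (borel \<Otimes>\<^sub>M PiM q (\<lambda>_. \<eta>) \<Otimes>\<^sub>M measure_algebra \<eta> \<Otimes>\<^sub>M PiM q (\<lambda>_. borel))
          (\<lambda>\<omega>. (L \<omega>, (\<lambda>C\<in>q. Y C \<omega>), \<mu> \<omega>, (\<lambda>C\<in>q. J C \<omega>))) =
        gamma_law (real (card q) + \<theta> / \<alpha>) (measure \<eta> (space \<eta>) / \<alpha>) \<bind> (\<lambda>l.
          return borel l \<Otimes>\<^sub>M
          PiM q (\<lambda>_. normalise \<eta>) \<Otimes>\<^sub>M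
          crm_law (gg_intensity \<alpha> (l powr (1 / \<alpha>))) \<eta> \<Otimes>\<^sub>M
          PiM q (\<lambda>C. gamma_law (real (card C) - \<alpha>) (l powr (1 / \<alpha>)))))"

text \<open>\<open>e\<^sup>-\<^sup>x\<close> for \<open>x \<in> [0, \<infinity>]\<close>, with \<open>e\<^sup>-\<^sup>\<infinity> = 0\<close>.\<close>

definition exp_minus :: "ennreal \<Rightarrow> real" where
  "exp_minus x = (if x = \<infinity> then 0 else exp (- enn2real x))"

definition laplace_functional :: "'y measure measure \<Rightarrow> ('y \<Rightarrow> real) \<Rightarrow> real" where
  "laplace_functional Q g = (\<integral>m. exp_minus (\<integral>\<^sup>+y. ennreal (g y) \<partial>m) \<partial>Q)"

definition gg_laplace :: "real \<Rightarrow> 'y measure \<Rightarrow> ('y \<Rightarrow> real) \<Rightarrow> real \<Rightarrow> real" where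
  "gg_laplace \<alpha> \<eta> g l =
    exp_minus (ennreal (1 / \<alpha>) * (\<integral>\<^sup>+y. ennreal ((g y + l powr (1 / \<alpha>)) powr \<alpha>) \<partial>\<eta>)) *
    exp (measure \<eta> (space \<eta>) / \<alpha> * l)"

end

theory Submission
  imports Defs "HOL-Probability.Probability"
begin

text \<open>
  The law of a random measure is determined by its Laplace functional. For \<open>b \<ge> 0\<close> the law
  \<open>\<P>(\<rho>\<^bsub>\<alpha>,b\<^esub>, \<eta>)\<close> has Laplace functional \<open>exp (- (1/\<alpha>) \<integral> ((g + b)\<^sup>\<alpha> - b\<^sup>\<alpha>) d\<eta>)\<close>; hence it is the law
  \<open>\<P>(\<rho>\<^sub>\<alpha>, \<eta>)\<close> exponentially tilted by \<open>exp (K b\<^sup>\<alpha> - b T)\<close>. Mixing these tilts with \<open>b = L\<^bsup>1/\<alpha>\<^esup>\<close> over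
  the gamma law of \<open>L\<close> and substituting \<open>z = L\<^bsup>1/\<alpha>\<^esup> T\<close> leaves the polynomial tilt \<open>T\<^bsup>-(\<theta> + n(p) \<alpha>)\<^esup>\<close> times
  an independent gamma variable \<open>z\<close>, which gives the laws of \<open>\<mu>\<^sup>*\<close> and \<open>L\<^bsup>1/\<alpha>\<^esup> \<mu>\<^sup>*(\<Y>)\<close> given \<open>p\<close>.

  For the representation itself, write \<open>T\<^bsup>-\<theta>\<^esup>\<close> as a multiple of \<open>\<integral> b\<^bsup>\<theta>+n-1\<^esup> T\<^sup>n exp (- b T) db\<close>. The
  expectation of \<open>T\<^sup>n exp (- b T - \<mu>(g))\<close> is an \<open>n\<close>-th derivative in \<open>b\<close> of
  \<open>exp (- \<psi>(b)) = exp (- (1/\<alpha>) \<integral> (g + b)\<^sup>\<alpha> d\<eta>)\<close>, which Faa di Bruno's formula expands into a sum over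
  the partitions \<open>q\<close> of \<open>{1..n}\<close> with one factor \<open>\<plusminus> \<psi>\<^bsup>(|C|)\<^esup>(b)\<close> for each block \<open>C\<close>. Each such factor is
  the Laplace transform of an atom with gamma mass of shape \<open>|C| - \<alpha>\<close> at a point with law \<open>H\<close>, and
  collecting the constants yields the EPPF as the weight of \<open>q\<close>.
\<close>

text \<open>The law of a Poisson random measure is given by a definite description, so nothing can
  be said about it before existence and uniqueness are shown; afterwards it enters through its
  Laplace functional. For \<theta> \<le> 0 the gamma integral of
  \<open>b powr (\<theta> - 1) * exp (- b * T)\<close> diverges. The factor \<open>T^n\<close>
  replaces the exponent \<theta> by \<theta> + n, which is positive because \<theta> > - \<alpha> >
  - 1 and n \<ge> 1; this factor is what forces the n derivatives, and with them the partitions. For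
  the same reason the gamma mixture of tilts yields the normalising constant of the polynomial tilt
  only for positive exponents. For all \<theta> > - \<alpha> the constant is read off from the
  partition identity itself, with n = 1 and g = 0, where the mixture has total mass 1. Derivatives
  are taken for bounded test functions, which already determine a law. The Laplace formulas for
  unbounded g come directly from the mixture over L; integrals may be infinite there, hence
  \<open>exp_minus\<close> on [0, \<infinity>] in place of the real exponential.\<close>

section \<open>A multiplicative class theorem\<close>

text \<open>Bernstein polynomials carry the equality of integrals from the powers of \<open>f \<in> C\<close> to the
  indicators of \<open>{f < a}\<close>, one function of the family at a time.\<close>

lemma multiplicative_class_eq:
  fixes P Q :: "'a measure" and C :: "('a \<Rightarrow> real) set"
  assumes "finite_measure P" "finite_measure Q" and sets_eq: "sets P = sets Q"
    and meas: "\<And>f. f \<in> C \<Longrightarrow> f \<in> borel_measurable P"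
    and bnd: "\<And>f x. f \<in> C \<Longrightarrow> x \<in> space P \<Longrightarrow> 0 \<le> f x \<and> f x \<le> 1"
    and one: "(\<lambda>_. 1) \<in> C" and times: "\<And>f g. f \<in> C \<Longrightarrow> g \<in> C \<Longrightarrow> (\<lambda>x. f x * g x) \<in> C"
    and eq: "\<And>f. f \<in> C \<Longrightarrow> (\<integral>x. f x \<partial>P) = (\<integral>x. f x \<partial>Q)"
    and gen: "(\<lambda>x. x) \<in> measurable (sigma (space P) {f -` {..<a} \<inter> space P | f a. f \<in> C}) P"
  shows "P = Q"
proof -
  interpret P: finite_measure P by fact
  interpret Q: finite_measure Q by fact
  have sp: "space Q = space P" using sets_eq by (metis sets_eq_imp_space_eq)
  have mQ: "f \<in> borel_measurable Q" if "f \<in> borel_measurable P" for f :: "'a \<Rightarrow> real"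
    using that measurable_cong_sets[OF sets_eq refl] by blast
  \<comment> \<open>A list of pairs \<open>(f, a)\<close> encodes the finite intersection of the
    sets \<open>{f < a}\<close>. Its indicator is written as a product, so that the pairs can be
    exchanged one at a time.\<close>
  define I where "I xs x = (\<Prod>(f,a)\<leftarrow>xs. indicator {..<a} (f x) :: real)"
    for xs :: "(('a \<Rightarrow> real) \<times> real) list" and x
  have I_bnd: "0 \<le> I xs x \<and> I xs x \<le> 1" for xs x
    by (induction xs) (auto simp: I_def mult_le_one split: split_indicator)
  have I_meas: "set xs \<subseteq> C \<times> UNIV \<Longrightarrow> I xs \<in> borel_measurable P" for xs
  proof (induction xs)
    case (Cons y xs)
    obtain f a where y: "y = (f, a)" by force
    have [measurable]: "f \<in> borel_measurable P" "I xs \<in> borel_measurable P"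
      using Cons y meas by auto
    have "(\<lambda>x. indicator {..<a} (f x) * I xs x) \<in> borel_measurable P" by measurable
    then show ?case by (simp add: I_def[abs_def] y)
  qed (simp add: I_def[abs_def])
  \<comment> \<open>A spare factor \<open>g\<close> from \<open>C\<close> is carried along: in the
    induction step it absorbs the powers of the new \<open>f\<close>, because \<open>f^k * g\<close>
    lies in \<open>C\<close> again.\<close>
  have key: "\<forall>g\<in>C. (\<integral>x. g x * I xs x \<partial>P) = (\<integral>x. g x * I xs x \<partial>Q)"
    if "set xs \<subseteq> C \<times> UNIV" for xs
    using that
  proof (induction xs)
    case Nil
    then show ?case using eq by (simp add: I_def)
  next
    case (Cons y xs)
    obtain f a where y: "y = (f, a)" by force
    have fC: "f \<in> C" and xs: "set xs \<subseteq> C \<times> UNIV" using Cons y by auto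
    note IH = Cons.IH[OF xs]
    have [measurable]: "I xs \<in> borel_measurable P" "f \<in> borel_measurable P"
      using I_meas[OF xs] meas[OF fC] by auto
    note mI[measurable] = mQ[OF I_meas[OF xs]] mQ[OF meas[OF fC]]
    show ?case
    proof
      fix g assume g: "g \<in> C"
      have [measurable]: "g \<in> borel_measurable P" using meas g by auto
      note mg[measurable] = mQ[OF this]
      have gb: "0 \<le> g x * I xs x \<and> g x * I xs x \<le> 1" if "x \<in> space P" for x
        using bnd[OF g that] I_bnd[of xs x] by (auto intro: mult_le_one)
      have fb: "f x \<in> {0..1}" if "x \<in> space P" for x using bnd[OF fC that] by auto
      define good where "good \<phi> \<longleftrightarrow>
        (\<integral>x. \<phi> (f x) * (g x * I xs x) \<partial>P) = (\<integral>x. \<phi> (f x) * (g x * I xs x) \<partial>Q)" for \<phi> :: "real \<Rightarrow> real"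
      have int: "integrable P (\<lambda>x. \<phi> (f x) * (g x * I xs x))"
           "integrable Q (\<lambda>x. \<phi> (f x) * (g x * I xs x))"
        if [measurable]: "\<phi> \<in> borel_measurable borel" and b: "\<And>x. x \<in> {0..1} \<Longrightarrow> \<bar>\<phi> x\<bar> \<le> B"
        for \<phi> and B :: real
      proof -
        have *: "norm (\<phi> (f x) * (g x * I xs x)) \<le> B" if "x \<in> space P" for x
        proof -
          have "\<bar>\<phi> (f x)\<bar> * \<bar>g x * I xs x\<bar> \<le> B * 1"
            using b[OF fb[OF that]] gb[OF that] by (intro mult_mono) auto
          then show ?thesis by (simp add: abs_mult)
        qed
        show "integrable P (\<lambda>x. \<phi> (f x) * (g x * I xs x))"
          by (rule P.integrable_const_bound[where B=B]) (use * in \<open>auto intro!: AE_I2\<close>)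
        show "integrable Q (\<lambda>x. \<phi> (f x) * (g x * I xs x))"
          by (rule Q.integrable_const_bound[where B=B]) (use * sp in \<open>auto intro!: AE_I2\<close>)
      qed
      have pw: "(\<lambda>x. f x ^ k * g x) \<in> C" for k
      proof (induction k)
        case (Suc k)
        show ?case using times[OF fC Suc] by (simp add: mult.assoc)
      qed (use g in simp)
      have pw_le: "\<bar>x ^ k * (1 - x) ^ j\<bar> \<le> 1" if "x \<in> {0..1::real}" for x k j
        using that by (auto simp: abs_mult intro!: mult_le_one power_le_one)
      \<comment> \<open>\<open>C\<close> is closed under products only and need not contain
        \<open>1 - f\<close>. The powers of \<open>1 - f\<close> are therefore removed one by one by
        linearity of the integral, each time raising the power of \<open>f\<close>.\<close>
      have good_mono: "good (\<lambda>x. x ^ k * (1 - x) ^ j)" for k j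
      proof (induction j arbitrary: k)
        case 0
        show ?case using IH[rule_format, OF pw[of k]] by (simp add: good_def mult.assoc)
      next
        case (Suc j)
        have e: "f x ^ k * (1 - f x) ^ Suc j * (g x * I xs x) =
          f x ^ k * (1 - f x) ^ j * (g x * I xs x) - f x ^ Suc k * (1 - f x) ^ j * (g x * I xs x)" for x
          by (simp add: algebra_simps)
        show ?case unfolding good_def e
          by (subst (1 2) Bochner_Integration.integral_diff)
             (use Suc[of k] Suc[of "Suc k"] pw_le in
               \<open>auto intro!: int[where B=1] simp: good_def simp del: power_Suc\<close>)
      qed
      have good_cont: "good \<phi>" if c: "continuous_on {0..1} \<phi>"
        and [measurable]: "\<phi> \<in> borel_measurable borel" for \<phi>
      proof -
        obtain B where B: "\<And>x. x \<in> {0..1} \<Longrightarrow> \<bar>\<phi> x\<bar> \<le> B"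
          using compact_imp_bounded[OF compact_continuous_image[OF c]]
          unfolding bounded_iff by (auto simp del: atLeastAtMost_iff)
        let ?B = "\<lambda>n x. \<Sum>k\<le>n. \<phi> (k/n) * Bernstein n k x"
        have bern: "\<exists>N. \<forall>n\<ge>N. \<forall>x\<in>{0..1}. \<bar>\<phi> x - ?B n x\<bar> < e" if "e > 0" for e
          using Bernstein_Weierstrass[OF c that] by blast
        have [measurable]: "Bernstein n k \<in> borel_measurable borel" for n k
          unfolding Bernstein_def[abs_def] by measurable
        have gB: "good (?B n)" for n
        proof -
          have i: "integrable M (\<lambda>x. \<phi> (k/n) * (Bernstein n k (f x) * (g x * I xs x)))"
            if "M = P \<or> M = Q" for k M
          proof -
            have e: "\<phi> (k/n) * (Bernstein n k (f x) * (g x * I xs x)) =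
              (\<phi> (k/n) * (n choose k)) * (f x ^ k * (1 - f x) ^ (n - k) * (g x * I xs x))" for x
              by (simp add: Bernstein_def)
            show ?thesis unfolding e using int[where \<phi>="\<lambda>x. x ^ k * (1 - x) ^ (n - k)", OF _ pw_le] that
              by (auto intro!: integrable_mult_right)
          qed
          have l: "(\<integral>x. ?B n (f x) * (g x * I xs x) \<partial>M) =
            (\<Sum>k\<le>n. \<phi> (k/n) * (n choose k) * (\<integral>x. f x ^ k * (1 - f x) ^ (n - k) * (g x * I xs x) \<partial>M))"
            if "M = P \<or> M = Q" for M
          proof -
            have "(\<integral>x. ?B n (f x) * (g x * I xs x) \<partial>M) =
              (\<integral>x. (\<Sum>k\<le>n. \<phi> (k/n) * (Bernstein n k (f x) * (g x * I xs x))) \<partial>M)"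
              by (simp add: sum_distrib_right mult.assoc)
            also have "\<dots> = (\<Sum>k\<le>n. \<integral>x. \<phi> (k/n) * (Bernstein n k (f x) * (g x * I xs x)) \<partial>M)"
              by (rule Bochner_Integration.integral_sum) (rule i[OF that])
            also have "\<dots> = (\<Sum>k\<le>n. \<phi> (k/n) * (n choose k) * (\<integral>x. f x ^ k * (1 - f x) ^ (n - k) * (g x * I xs x) \<partial>M))"
              by (simp add: Bernstein_def mult.assoc)
            finally show ?thesis .
          qed
          show ?thesis unfolding good_def using good_mono
            by (simp only: l[of P, simplified] l[of Q, simplified] good_def)
        qed
        have lim: "(\<lambda>n. \<integral>x. ?B n (f x) * (g x * I xs x) \<partial>M) \<longlonglongrightarrow>
            (\<integral>x. \<phi> (f x) * (g x * I xs x) \<partial>M)" if M: "M = P \<or> M = Q" for M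
        proof -
          have spM: "space M = space P" using M sp by auto
          obtain N where N: "\<And>n x. n \<ge> N \<Longrightarrow> x \<in> {0..1} \<Longrightarrow> \<bar>\<phi> x - ?B n x\<bar> < 1"
            using bern[of 1] by (metis zero_less_one)
          \<comment> \<open>The Bernstein polynomials are known to be within 1 of \<phi> only from
            index \<open>N\<close> on; after the shift the constant \<open>B + 1\<close>
            dominates.\<close>
          have "(\<lambda>n. \<integral>x. ?B (n+N) (f x) * (g x * I xs x) \<partial>M) \<longlonglongrightarrow>
            (\<integral>x. \<phi> (f x) * (g x * I xs x) \<partial>M)"
          proof (rule integral_dominated_convergence[where w="\<lambda>_. B + 1"])
            show "integrable M (\<lambda>_. B + 1)" using M by auto
            show "(\<lambda>x. \<phi> (f x) * (g x * I xs x)) \<in> borel_measurable M" using M by auto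
            show "(\<lambda>x. ?B (n+N) (f x) * (g x * I xs x)) \<in> borel_measurable M" for n using M by auto
            show "AE x in M. norm (?B (n+N) (f x) * (g x * I xs x)) \<le> B + 1" for n
            proof (rule AE_I2)
              fix x assume "x \<in> space M"
              then have x: "x \<in> space P" using spM by simp
              have "\<bar>?B (n+N) (f x)\<bar> \<le> B + 1"
                using N[of "n+N" "f x"] B[OF fb[OF x]] fb[OF x] by auto
              then have "\<bar>?B (n+N) (f x)\<bar> * \<bar>g x * I xs x\<bar> \<le> (B + 1) * 1"
                using gb[OF x] by (intro mult_mono) auto
              then show "norm (?B (n+N) (f x) * (g x * I xs x)) \<le> B + 1" by (simp add: abs_mult)
            qed
            show "AE x in M. (\<lambda>n. ?B (n+N) (f x) * (g x * I xs x)) \<longlonglongrightarrow> \<phi> (f x) * (g x * I xs x)"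
            proof (rule AE_I2)
              fix x assume "x \<in> space M"
              then have x: "f x \<in> {0..1}" using spM fb by simp
              have "(\<lambda>n. ?B n (f x)) \<longlonglongrightarrow> \<phi> (f x)"
              proof (rule LIMSEQ_I)
                fix r :: real assume "0 < r"
                then obtain N where "\<forall>n\<ge>N. \<forall>x\<in>{0..1}. \<bar>\<phi> x - ?B n x\<bar> < r" using bern by blast
                then show "\<exists>no. \<forall>n\<ge>no. norm (?B n (f x) - \<phi> (f x)) < r"
                  using x unfolding real_norm_def by (subst abs_minus_commute) blast
              qed
              then have "(\<lambda>n. ?B (n+N) (f x)) \<longlonglongrightarrow> \<phi> (f x)" by (rule LIMSEQ_ignore_initial_segment)
              then show "(\<lambda>n. ?B (n+N) (f x) * (g x * I xs x)) \<longlonglongrightarrow> \<phi> (f x) * (g x * I xs x)"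
                by (intro tendsto_intros)
            qed
          qed
          then show ?thesis by (rule LIMSEQ_offset)
        qed
        show ?thesis unfolding good_def
          by (rule LIMSEQ_unique[OF lim[of P]]) (use lim[of Q] gB in \<open>simp_all add: good_def\<close>)
      qed
      \<comment> \<open>Continuous ramps that vanish on \<open>{a..}\<close> and increase to the
        indicator of \<open>{..<a}\<close>.\<close>
      let ?\<phi> = "\<lambda>n t. min 1 (real n * max 0 (a - t))"
      have lim: "(\<lambda>n. \<integral>x. ?\<phi> n (f x) * (g x * I xs x) \<partial>M) \<longlonglongrightarrow>
          (\<integral>x. indicator {..<a} (f x) * (g x * I xs x) \<partial>M)" if M: "M = P \<or> M = Q" for M
      proof (rule integral_dominated_convergence[where w="\<lambda>_. 1"])
        have spM: "space M = space P" using M sp by auto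
        show "integrable M (\<lambda>_. 1::real)" using M by auto
        show "(\<lambda>x. indicator {..<a} (f x) * (g x * I xs x)) \<in> borel_measurable M" using M by auto
        show "(\<lambda>x. ?\<phi> n (f x) * (g x * I xs x)) \<in> borel_measurable M" for n using M by auto
        show "AE x in M. norm (?\<phi> n (f x) * (g x * I xs x)) \<le> 1" for n
        proof (rule AE_I2)
          fix x assume "x \<in> space M"
          then have x: "x \<in> space P" using spM by simp
          have "\<bar>?\<phi> n (f x)\<bar> * \<bar>g x * I xs x\<bar> \<le> 1 * 1"
            using gb[OF x] by (intro mult_mono) auto
          then show "norm (?\<phi> n (f x) * (g x * I xs x)) \<le> 1" by (simp add: abs_mult)
        qed
        show "AE x in M. (\<lambda>n. ?\<phi> n (f x) * (g x * I xs x)) \<longlonglongrightarrow> indicator {..<a} (f x) * (g x * I xs x)"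
        proof (rule AE_I2)
          fix x
          have "(\<lambda>n. ?\<phi> n (f x)) \<longlonglongrightarrow> indicator {..<a} (f x)"
          proof (cases "f x < a")
            case True
            obtain N :: nat where N: "1 / (a - f x) < N" using reals_Archimedean2 by blast
            have "?\<phi> n (f x) = 1" if "n \<ge> N" for n
            proof -
              have "1 / (a - f x) < real n" using N that by (meson less_le_trans of_nat_mono)
              then have "1 < real n * (a - f x)" using True by (simp add: field_simps)
              then show ?thesis using True by (simp add: max_def)
            qed
            then have "\<forall>\<^sub>F n in sequentially. ?\<phi> n (f x) = indicator {..<a} (f x)"
              using True by (auto simp: eventually_sequentially)
            then show ?thesis by (rule tendsto_eventually)
          qed (auto simp: max_def)
          then show "(\<lambda>n. ?\<phi> n (f x) * (g x * I xs x)) \<longlonglongrightarrow> indicator {..<a} (f x) * (g x * I xs x)"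
            by (intro tendsto_intros)
        qed
      qed
      have "good (?\<phi> n)" for n by (rule good_cont) (auto intro!: continuous_intros)
      then have "(\<integral>x. indicator {..<a} (f x) * (g x * I xs x) \<partial>P) =
         (\<integral>x. indicator {..<a} (f x) * (g x * I xs x) \<partial>Q)"
        by (intro LIMSEQ_unique[OF lim[of P]]) (use lim[of Q] in \<open>simp_all add: good_def\<close>)
      moreover have "g x * I (y # xs) x = indicator {..<a} (f x) * (g x * I xs x)" for x
        by (simp add: I_def y)
      ultimately show "(\<integral>x. g x * I (y # xs) x \<partial>P) = (\<integral>x. g x * I (y # xs) x \<partial>Q)" by (simp only:)
    qed
  qed
  define S where "S xs = {x \<in> space P. \<forall>(f,a)\<in>set xs. f x < a}"
    for xs :: "(('a \<Rightarrow> real) \<times> real) list"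
  have IS: "I xs x = indicator (S xs) x" if "x \<in> space P" for xs x
    using that by (induction xs) (auto simp: I_def S_def split: split_indicator)
  let ?E = "S ` {xs. set xs \<subseteq> C \<times> UNIV}"
  have S_meas: "S xs \<in> sets P" if "set xs \<subseteq> C \<times> UNIV" for xs
  proof -
    have "I xs -` {1} \<inter> space P \<in> sets P" using I_meas[OF that] by measurable
    also have "I xs -` {1} \<inter> space P = S xs"
      using IS[of _ xs] by (auto simp: S_def split: split_indicator_asm)
    finally show ?thesis .
  qed
  show ?thesis
  proof (rule measure_eqI_generator_eq[where E="?E" and \<Omega>="space P" and A="\<lambda>_. space P"])
    show "Int_stable ?E"
    proof (rule Int_stableI)
      fix a b assume "a \<in> ?E" "b \<in> ?E"
      then obtain xs ys where *: "a = S xs" "b = S ys" "set xs \<subseteq> C \<times> UNIV" "set ys \<subseteq> C \<times> UNIV" by auto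
      then have "a \<inter> b = S (xs @ ys)" by (auto simp: S_def)
      then show "a \<inter> b \<in> ?E" using * by auto
    qed
    show "?E \<subseteq> Pow (space P)" by (auto simp: S_def)
    show P: "sets P = sigma_sets (space P) ?E"
    proof
      show "sigma_sets (space P) ?E \<subseteq> sets P"
        by (rule sets.sigma_sets_subset) (use S_meas in auto)
      let ?G = "{f -` {..<a} \<inter> space P | f a. f \<in> C}"
      have "sets P \<subseteq> sigma_sets (space P) ?G"
      proof
        fix A assume A: "A \<in> sets P"
        have "(\<lambda>x. x) -` A \<inter> space (sigma (space P) ?G) \<in> sets (sigma (space P) ?G)"
          using gen A by (rule measurable_sets)
        moreover have "?G \<subseteq> Pow (space P)" by auto
        ultimately show "A \<in> sigma_sets (space P) ?G"
          using sets.sets_into_space[OF A] by (simp add: space_measure_of_conv Int_absorb2)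
      qed
      also have "\<dots> \<subseteq> sigma_sets (space P) ?E"
      proof (rule sigma_sets_mono', safe)
        fix f a assume "f \<in> C"
        then show "f -` {..<a} \<inter> space P \<in> ?E"
          by (intro image_eqI[where x="[(f, a)]"]) (auto simp: S_def)
      qed
      finally show "sets P \<subseteq> sigma_sets (space P) ?E" .
    qed
    show "sets Q = sigma_sets (space P) ?E" using P sets_eq by simp
    have "space P = S []" by (simp add: S_def)
    then show "range (\<lambda>_. space P) \<subseteq> ?E" by auto
    fix X assume "X \<in> ?E"
    then obtain xs where xs: "X = S xs" "set xs \<subseteq> C \<times> UNIV" by auto
    have "measure P X = (\<integral>x. I xs x \<partial>P)"
      using S_meas[OF xs(2)] by (subst Bochner_Integration.integral_cong[OF refl IS]) (auto simp: xs S_def)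
    also have "\<dots> = (\<integral>x. I xs x \<partial>Q)" using key[OF xs(2)] one by force
    also have "\<dots> = measure Q X"
      using S_meas[OF xs(2)] sets_eq sp by (subst Bochner_Integration.integral_cong[OF refl IS]) (auto simp: xs S_def)
    finally show "emeasure P X = emeasure Q X"
      by (simp add: P.emeasure_eq_measure Q.emeasure_eq_measure)
  qed auto
qed

section \<open>Laplace functionals\<close>

lemma exp_minus_zero [simp]: "exp_minus 0 = 1"
  by (simp add: exp_minus_def)

lemma exp_minus_top [simp]: "exp_minus \<top> = 0"
  by (simp add: exp_minus_def)

lemma exp_minus_ennreal: "0 \<le> x \<Longrightarrow> exp_minus (ennreal x) = exp (- x)"
  by (simp add: exp_minus_def)

lemma exp_minus_nonneg [simp]: "0 \<le> exp_minus x"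
  by (simp add: exp_minus_def)

lemma exp_minus_le_one [simp]: "exp_minus x \<le> 1"
  by (simp add: exp_minus_def)

lemma exp_minus_add: "exp_minus (x + y) = exp_minus x * exp_minus y"
  by (cases x; cases y) (simp_all add: exp_minus_ennreal exp_add[symmetric] flip: ennreal_plus)

lemma exp_minus_sum: "exp_minus (\<Sum>i\<in>I. f i) = (\<Prod>i\<in>I. exp_minus (f i))"
  by (induction I rule: infinite_finite_induct) (simp_all add: exp_minus_add)

text \<open>Through this formula the evaluations \<open>emeasure m A\<close> become measurable for
  the sigma-algebra generated by Laplace transforms.\<close>

lemma exp_minus_inverse:
  "x = (if exp_minus x \<le> 0 then \<top> else ennreal (- ln (exp_minus x)))"
  by (cases x) (simp_all add: exp_minus_ennreal)

lemma borel_measurable_exp_minus [measurable]: "exp_minus \<in> borel_measurable borel"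
  unfolding exp_minus_def[abs_def] by measurable

text \<open>The point \<infinity> needs its own argument: near it \<open>f x\<close> exceeds
  \<open>- ln a\<close> for every \<open>a > 0\<close>, and this makes
  \<open>exp_minus (f x)\<close> smaller than \<open>a\<close>.\<close>

lemma tendsto_exp_minus:
  assumes "(f \<longlongrightarrow> l) F"
  shows "((\<lambda>x. exp_minus (f x)) \<longlongrightarrow> exp_minus l) F"
proof (cases l)
  case (real r)
  have "((\<lambda>x. exp (- enn2real (f x))) \<longlongrightarrow> exp (- r)) F"
    using assms real by (intro tendsto_intros tendsto_enn2real) auto
  moreover have "\<forall>\<^sub>F x in F. exp (- enn2real (f x)) = exp_minus (f x)"
    using order_tendstoD(2)[OF assms, of \<top>] real
    by (auto simp: exp_minus_def elim!: eventually_mono)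
  ultimately show ?thesis using real by (simp add: exp_minus_ennreal tendsto_cong)
next
  case top
  have "((\<lambda>x. exp_minus (f x)) \<longlongrightarrow> 0) F"
  proof (rule order_tendstoI)
    fix a :: real assume "a < 0"
    then show "\<forall>\<^sub>F x in F. a < exp_minus (f x)"
      by (intro always_eventually allI) (rule less_le_trans[OF _ exp_minus_nonneg])
  next
    fix a :: real assume a: "0 < a"
    have "\<forall>\<^sub>F x in F. ennreal (max 0 (- ln a)) < f x"
      using order_tendstoD(1)[OF assms, of "ennreal (max 0 (- ln a))"] top by simp
    then show "\<forall>\<^sub>F x in F. exp_minus (f x) < a"
    proof eventually_elim
      case (elim x)
      show ?case
      proof (cases "f x")
        case (real r)
        with elim have "ennreal (max 0 (- ln a)) < ennreal r" by simp
        then have "max 0 (- ln a) < r" by (simp only: ennreal_less_iff max.cobounded1)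
        then have "- ln a < r" by simp
        then have "- r < ln a" by simp
        then have "exp (- r) < exp (ln a)" by (subst exp_less_cancel_iff)
        then have "exp (- r) < a" using a by simp
        then show ?thesis using real by (simp add: exp_minus_ennreal)
      qed (use a in simp)
    qed
  qed
  then show ?thesis using top by simp
qed

section \<open>The sigma-algebra on the space of measures\<close>

lemma space_measure_algebra: "space (measure_algebra K) = {m. sets m = sets K}"
  by (auto simp add: measure_algebra_def space_Sup_eq_UN)

lemma measure_algebra_cong: "sets K = sets K' \<Longrightarrow> measure_algebra K = measure_algebra K'"
  by (simp add: measure_algebra_def)

lemma measurable_emeasure_measure_algebra [measurable]:
  "A \<in> sets K \<Longrightarrow> (\<lambda>m. emeasure m A) \<in> borel_measurable (measure_algebra K)"
  by (auto intro!: measurable_Sup1 measurable_vimage_algebra1 simp: measure_algebra_def)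

lemma measurable_measure_algebra:
  "(\<And>a. a \<in> space M \<Longrightarrow> sets (f a) = sets K) \<Longrightarrow>
  (\<And>A. A \<in> sets K \<Longrightarrow> (\<lambda>a. emeasure (f a) A) \<in> borel_measurable M) \<Longrightarrow>
  f \<in> measurable M (measure_algebra K)"
  by (auto intro!: measurable_Sup2 measurable_vimage_algebra2 simp: measure_algebra_def)

lemma nn_integral_measurable_measure_algebra [measurable]:
  assumes f: "f \<in> borel_measurable K"
  shows "(\<lambda>m. integral\<^sup>N m f) \<in> borel_measurable (measure_algebra K)" (is "_ \<in> ?B")
  using f
proof induct
  case (cong f g)
  then have "(\<lambda>m. integral\<^sup>N m f) \<in> ?B \<longleftrightarrow> (\<lambda>m. integral\<^sup>N m g) \<in> ?B"
    by (intro measurable_cong nn_integral_cong) (auto simp: space_measure_algebra dest: sets_eq_imp_space_eq)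
  with cong show ?case by simp
next
  case (set A)
  then have "(\<lambda>m. integral\<^sup>N m (indicator A)) \<in> ?B \<longleftrightarrow> (\<lambda>m. emeasure m A) \<in> ?B"
    by (intro measurable_cong nn_integral_indicator) (simp add: space_measure_algebra)
  with set show ?case by simp
next
  case (mult u c)
  then have "(\<lambda>m. integral\<^sup>N m (\<lambda>x. c * u x)) \<in> ?B \<longleftrightarrow> (\<lambda>m. c * integral\<^sup>N m u) \<in> ?B"
    by (intro measurable_cong nn_integral_cmult) (auto simp: space_measure_algebra cong: measurable_cong_sets)
  with mult show ?case by simp
next
  case (add u v)
  then have "(\<lambda>m. integral\<^sup>N m (\<lambda>x. v x + u x)) \<in> ?B \<longleftrightarrow> (\<lambda>m. integral\<^sup>N m v + integral\<^sup>N m u) \<in> ?B"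
    by (intro measurable_cong nn_integral_add) (auto simp: space_measure_algebra cong: measurable_cong_sets)
  with add show ?case by simp
next
  case (seq F)
  have "(\<lambda>m. integral\<^sup>N m (SUP i. F i)) \<in> ?B \<longleftrightarrow> (\<lambda>m. SUP i. integral\<^sup>N m (F i)) \<in> ?B"
  proof (rule measurable_cong)
    fix m assume "m \<in> space (measure_algebra K)"
    then have "F i \<in> borel_measurable m" for i
      using seq(1)[of i] by (simp add: space_measure_algebra cong: measurable_cong_sets)
    moreover have "(SUP i. F i) = (\<lambda>x. SUP i. F i x)" by (auto simp: fun_eq_iff image_comp)
    ultimately show "integral\<^sup>N m (SUP i. F i) = (SUP i. integral\<^sup>N m (F i))"
      using nn_integral_monotone_convergence_SUP[OF \<open>incseq F\<close>] by simp
  qed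
  moreover have "(\<lambda>m. SUP i. integral\<^sup>N m (F i)) \<in> ?B"
    using seq(3) by (intro borel_measurable_SUP) auto
  ultimately show ?case by (simp only:)
qed

lemma measurable_space_measure_algebra [measurable]:
  "(\<lambda>m. emeasure m (space m)) \<in> borel_measurable (measure_algebra K)"
  using measurable_emeasure_measure_algebra[OF sets.top, of K]
  by (rule measurable_cong[THEN iffD1, rotated])
     (auto simp: space_measure_algebra dest: sets_eq_imp_space_eq)

text \<open>The functionals with bounded \<open>g\<close> form a multiplicative class, because
  exponents add. They generate the sigma-algebra, because with the indicator of \<open>A\<close> in
  place of \<open>g\<close> the value \<open>emeasure m A\<close> is recovered by
  \<open>exp_minus_inverse\<close>; so bounded test functions are enough.\<close>

lemma laplace_functional_eqI:
  fixes P Q :: "'a measure measure"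
  assumes fin: "finite_measure P" "finite_measure Q"
    and sets: "sets P = sets (measure_algebra K)" "sets Q = sets (measure_algebra K)"
    and eq: "\<And>g B. g \<in> borel_measurable K \<Longrightarrow> (\<And>y. 0 \<le> g y) \<Longrightarrow> (\<And>y. g y \<le> B) \<Longrightarrow>
      laplace_functional P g = laplace_functional Q g"
  shows "P = Q"
proof -
  define G where "G = {g. g \<in> borel_measurable K \<and> (\<forall>y. 0 \<le> g y) \<and> (\<exists>B::real. \<forall>y. g y \<le> B)}"
  \<comment> \<open>The value 1 away from the space of measures keeps both closure conditions true
    as equations between functions on the whole type: the constant 1 is
    \<open>e (\<lambda>_. 0)\<close>, and a product is \<open>e\<close> of a sum.\<close>
  define e where "e g m = (if sets m = sets K then exp_minus (\<integral>\<^sup>+y. ennreal (g y) \<partial>m) else 1)"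
    for g :: "'a \<Rightarrow> real" and m
  have spP: "space P = {m. sets m = sets K}" and spQ: "space Q = {m. sets m = sets K}"
    using sets[THEN sets_eq_imp_space_eq] by (simp_all add: space_measure_algebra)
  show ?thesis
  proof (rule multiplicative_class_eq[where C="e ` G"])
    fix f assume "f \<in> e ` G"
    then obtain g where g: "f = e g" "g \<in> G" by auto
    then have [measurable]: "g \<in> borel_measurable K" by (simp add: G_def)
    have "(\<lambda>m. exp_minus (\<integral>\<^sup>+y. ennreal (g y) \<partial>m)) \<in> borel_measurable (measure_algebra K)"
      by measurable
    then have "(\<lambda>m. exp_minus (\<integral>\<^sup>+y. ennreal (g y) \<partial>m)) \<in> borel_measurable P"
      by (simp add: sets cong: measurable_cong_sets)
    then show "f \<in> borel_measurable P"
      by (rule measurable_cong[THEN iffD1, rotated]) (simp add: spP e_def g)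
    show "0 \<le> f x \<and> f x \<le> 1" for x by (simp add: g e_def)
    have "(\<integral>x. f x \<partial>P) = laplace_functional P g" "(\<integral>x. f x \<partial>Q) = laplace_functional Q g"
      unfolding laplace_functional_def
      by (auto intro!: Bochner_Integration.integral_cong simp: g e_def spP spQ)
    then show "(\<integral>x. f x \<partial>P) = (\<integral>x. f x \<partial>Q)"
      using eq[of g] g by (auto simp: G_def)
  next
    show "(\<lambda>_. 1) \<in> e ` G"
      by (rule image_eqI[where x="\<lambda>_. 0"]) (auto simp: e_def G_def intro!: exI[of _ 0])
  next
    fix f g assume "f \<in> e ` G" "g \<in> e ` G"
    then obtain f' g' where *: "f = e f'" "g = e g'" "f' \<in> G" "g' \<in> G" by auto
    have "(\<lambda>x. e f' x * e g' x) = e (\<lambda>y. f' y + g' y)"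
    proof
      fix m
      show "e f' m * e g' m = e (\<lambda>y. f' y + g' y) m"
      proof (cases "sets m = sets K")
        case True
        then have "f' \<in> borel_measurable m" "g' \<in> borel_measurable m"
          using *(3,4) by (auto simp: G_def cong: measurable_cong_sets)
        then show ?thesis using *(3,4)
          by (simp add: e_def G_def ennreal_plus nn_integral_add exp_minus_add)
      qed (simp add: e_def)
    qed
    moreover have "(\<lambda>y. f' y + g' y) \<in> G"
      using *(3,4) unfolding G_def by (auto; meson add_mono)
    ultimately show "(\<lambda>x. f x * g x) \<in> e ` G" using * by auto
  next
    let ?S = "sigma (space P) {f -` {..<a} \<inter> space P | f a. f \<in> e ` G}"
    have spS: "space ?S = space P" by (auto simp: space_measure_of_conv)
    have "(\<lambda>x. x) \<in> measurable ?S (measure_algebra K)"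
    proof (rule measurable_measure_algebra)
      fix A assume A: "A \<in> sets K"
      then have iG: "(indicator A :: 'a \<Rightarrow> real) \<in> G"
        by (auto simp: G_def intro!: exI[of _ 1])
      have [measurable]: "e (indicator A) \<in> borel_measurable ?S"
      proof (subst borel_measurable_iff_less, intro allI)
        fix a
        have "e (indicator A) -` {..<a} \<inter> space P \<in> sets ?S"
          by (intro in_measure_of) (use iG in auto)
        moreover have "e (indicator A) -` {..<a} \<inter> space P = {w \<in> space ?S. e (indicator A) w < a}"
          unfolding spS by auto
        ultimately show "{w \<in> space ?S. e (indicator A) w < a} \<in> sets ?S" by simp
      qed
      have "(\<lambda>m. if e (indicator A) m \<le> 0 then \<top> else ennreal (- ln (e (indicator A) m))) \<in> borel_measurable ?S"
        by measurable
      then show "(\<lambda>m. emeasure m A) \<in> borel_measurable ?S"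
      proof (rule measurable_cong[THEN iffD1, rotated])
        fix m assume "m \<in> space ?S"
        then have m: "sets m = sets K" using spS spP by blast
        then have "e (indicator A) m = exp_minus (emeasure m A)"
          using A by (simp add: e_def ennreal_indicator)
        then show "(if e (indicator A) m \<le> 0 then \<top> else ennreal (- ln (e (indicator A) m))) = emeasure m A"
          by (simp only: exp_minus_inverse[symmetric])
      qed
    qed (use spS spP in blast)
    then show "(\<lambda>x. x) \<in> measurable ?S P"
      by (simp add: sets cong: measurable_cong_sets)
  qed (use fin sets in \<open>auto simp: spP\<close>)
qed

section \<open>Poisson random measures\<close>

lemma laplace_functional_eq_enn2real:
  assumes "sets Q = sets (measure_algebra K)" "g \<in> borel_measurable K"
  shows "laplace_functional Q g = enn2real (\<integral>\<^sup>+m. ennreal (exp_minus (\<integral>\<^sup>+y. ennreal (g y) \<partial>m)) \<partial>Q)"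
proof -
  note [measurable_cong] = assms(1) and [measurable] = assms(2)
  show ?thesis unfolding laplace_functional_def by (rule integral_eq_nn_integral) auto
qed

text \<open>Serves to pass from a Laplace functional, tested on combinations of indicators of
  disjoint sets, to the joint law of the counts, which may be infinite. The exponentials are closed
  under products, and a unit vector \<open>t\<close> isolates one coordinate.\<close>

lemma PiM_ennreal_eqI:
  fixes P Q :: "('i \<Rightarrow> ennreal) measure"
  assumes F: "finite F" and fin: "finite_measure P" "finite_measure Q"
    and sets: "sets P = sets (PiM F (\<lambda>_. borel))" "sets Q = sets (PiM F (\<lambda>_. borel))"
    and eq: "\<And>t :: 'i \<Rightarrow> real. (\<And>i. 0 \<le> t i) \<Longrightarrow>
      (\<integral>\<^sup>+x. ennreal (exp_minus (\<Sum>i\<in>F. ennreal (t i) * x i)) \<partial>P) =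
      (\<integral>\<^sup>+x. ennreal (exp_minus (\<Sum>i\<in>F. ennreal (t i) * x i)) \<partial>Q)"
  shows "P = Q"
proof -
  define e where "e t x = exp_minus (\<Sum>i\<in>F. ennreal (t i) * x i)" for t :: "'i \<Rightarrow> real" and x
  define C where "C = e ` {t. \<forall>i. 0 \<le> t i}"
  note [measurable_cong] = sets
  have e_meas: "e t \<in> borel_measurable (PiM F (\<lambda>_. borel))" for t
    unfolding e_def[abs_def] by measurable
  have spP: "space P = space (PiM F (\<lambda>_. borel))" using sets(1) by (rule sets_eq_imp_space_eq)
  show ?thesis
  proof (rule multiplicative_class_eq[where C=C])
    fix f assume "f \<in> C"
    then obtain t where t: "f = e t" "\<And>i. 0 \<le> t i" by (auto simp: C_def)
    show [measurable]: "f \<in> borel_measurable P" using e_meas[of t] t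
      by (simp add: sets cong: measurable_cong_sets)
    show "0 \<le> f x \<and> f x \<le> 1" for x using t by (simp add: e_def)
    have "e t \<in> borel_measurable Q" using e_meas[of t] by (simp add: sets cong: measurable_cong_sets)
    then show "(\<integral>x. f x \<partial>P) = (\<integral>x. f x \<partial>Q)"
      using eq[OF t(2)] \<open>f \<in> borel_measurable P\<close>
      by (subst (1 2) integral_eq_nn_integral) (auto simp: t e_def)
  next
    show "(\<lambda>_. 1) \<in> C"
      unfolding C_def by (rule image_eqI[where x="\<lambda>_. 0"]) (auto simp: e_def)
  next
    fix f g assume "f \<in> C" "g \<in> C"
    then obtain t s where t: "f = e t" "\<And>i. 0 \<le> t i" "g = e s" "\<And>i. 0 \<le> s i" by (auto simp: C_def)
    have "(\<lambda>x. f x * g x) = e (\<lambda>i. t i + s i)"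
      using t by (auto simp: e_def exp_minus_add[symmetric] sum.distrib[symmetric] ennreal_plus distrib_right)
    then show "(\<lambda>x. f x * g x) \<in> C" using t by (auto simp: C_def)
  next
    let ?S = "sigma (space P) {f -` {..<a} \<inter> space P | f a. f \<in> C}"
    have spS: "space ?S = space P" by (auto simp: space_measure_of_conv)
    have "(\<lambda>x. x) \<in> measurable ?S (PiM F (\<lambda>_. borel))"
    proof (rule measurable_PiM_single')
      fix i assume i: "i \<in> F"
      define t where "t = (\<lambda>j. if j = i then 1 else 0 :: real)"
      have et: "e t x = exp_minus (x i)" for x
      proof -
        have "(\<Sum>j\<in>F. ennreal (t j) * x j) = (\<Sum>j\<in>{i}. ennreal (t j) * x j)"
          by (rule sum.mono_neutral_right) (use i F in \<open>auto simp: t_def\<close>)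
        then show ?thesis by (simp add: e_def t_def)
      qed
      have eC: "e t \<in> C" by (auto simp: C_def t_def)
      have [measurable]: "e t \<in> borel_measurable ?S"
      proof (subst borel_measurable_iff_less, intro allI)
        fix a
        have "e t -` {..<a} \<inter> space P \<in> sets ?S"
          by (intro in_measure_of) (use eC in auto)
        moreover have "e t -` {..<a} \<inter> space P = {w \<in> space ?S. e t w < a}"
          unfolding spS by auto
        ultimately show "{w \<in> space ?S. e t w < a} \<in> sets ?S" by simp
      qed
      have "(\<lambda>x. if e t x \<le> 0 then \<top> else ennreal (- ln (e t x))) \<in> borel_measurable ?S"
        by measurable
      then show "(\<lambda>x. x i) \<in> borel_measurable ?S"
        by (simp only: et exp_minus_inverse[symmetric])
    qed (use spS spP in \<open>auto simp: space_PiM PiE_def\<close>)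
    then show "(\<lambda>x. x) \<in> measurable ?S P"
      by (simp add: sets cong: measurable_cong_sets)
  qed (use fin sets in auto)
qed

lemma exp_minus_mult_of_nat: "exp_minus (x * of_nat k) = exp_minus x ^ k"
  by (induction k) (simp_all add: distrib_left exp_minus_add)

lemma poisson_generating_function:
  assumes "0 \<le> c" "0 \<le> x"
  shows "(\<Sum>k. ennreal (c ^ k / fact k * exp (- c)) * ennreal (x ^ k)) = ennreal (exp (- (c * (1 - x))))"
proof -
  have "(\<lambda>k. exp (- c) * ((c * x) ^ k /\<^sub>R fact k)) sums (exp (- c) * exp (c * x))"
    by (intro sums_mult exp_converges)
  moreover have "exp (- c) * ((c * x) ^ k /\<^sub>R fact k) = c ^ k / fact k * exp (- c) * x ^ k" for k
    by (simp add: power_mult_distrib divide_inverse)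
  moreover have "exp (- c) * exp (c * x) = exp (- (c * (1 - x)))"
    by (simp add: exp_add[symmetric] algebra_simps)
  ultimately have *: "(\<lambda>k. c ^ k / fact k * exp (- c) * x ^ k) sums exp (- (c * (1 - x)))" by simp
  have "(\<Sum>k. ennreal (c ^ k / fact k * exp (- c)) * ennreal (x ^ k)) =
    (\<Sum>k. ennreal (c ^ k / fact k * exp (- c) * x ^ k))"
    using assms by (intro suminf_cong ennreal_mult[symmetric]) auto
  also have "\<dots> = ennreal (exp (- (c * (1 - x))))"
    using assms by (intro suminf_ennreal_eq *) auto
  finally show ?thesis .
qed

text \<open>The library's \<^const>\<open>poisson_pmf\<close> excludes the rate \<open>0\<close>.\<close>

definition poisson0_pmf :: "real \<Rightarrow> nat pmf" where
  "poisson0_pmf c = (if 0 < c then poisson_pmf c else return_pmf 0)"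

lemma pmf_poisson0: "0 \<le> c \<Longrightarrow> pmf (poisson0_pmf c) k = c ^ k / fact k * exp (- c)"
  by (cases k) (auto simp: poisson0_pmf_def)

definition poisson_dist :: "ennreal \<Rightarrow> ennreal measure" where
  "poisson_dist c = (if c = \<top> then return borel \<top>
     else distr (measure_pmf (poisson0_pmf (enn2real c))) borel of_nat)"

lemma sets_poisson_dist [simp, measurable_cong]: "sets (poisson_dist c) = sets borel"
  by (simp add: poisson_dist_def)

lemma prob_space_poisson_dist: "prob_space (poisson_dist c)"
  by (auto simp: poisson_dist_def intro!: prob_space_return measure_pmf.prob_space_distr)

lemma nn_integral_poisson0_power:
  assumes "0 \<le> c" "0 \<le> x"
  shows "(\<integral>\<^sup>+k. ennreal (x ^ k) \<partial>measure_pmf (poisson0_pmf c)) = ennreal (exp (- (c * (1 - x))))"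
  using poisson_generating_function[OF assms]
  by (simp add: nn_integral_measure_pmf nn_integral_count_space_nat pmf_poisson0 assms)

lemma exp_minus_mult_ennreal: "0 \<le> x \<Longrightarrow> c < \<top> \<Longrightarrow> exp_minus (c * ennreal x) = exp (- (enn2real c * x))"
  by (cases c) (simp_all add: exp_minus_ennreal flip: ennreal_mult)

lemma nn_integral_poisson_dist:
  "(\<integral>\<^sup>+x. ennreal (exp_minus (t * x)) \<partial>poisson_dist c) =
    ennreal (exp_minus (c * ennreal (1 - exp_minus t)))"
proof (cases "c = \<top>")
  case True
  \<comment> \<open>At rate \<infinity> the right side depends on whether
    \<open>1 - exp_minus t\<close> vanishes, since \<open>\<top> * 0 = 0\<close>; this happens for
    \<open>t = 0\<close> alone.\<close>
  have "exp_minus t = 1 \<longleftrightarrow> t = 0"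
    by (cases t) (simp_all add: exp_minus_ennreal)
  then show ?thesis using True exp_minus_le_one[of t]
    by (cases "t = 0")
       (auto simp: poisson_dist_def nn_integral_return ennreal_mult_top ennreal_top_mult less_le
         simp del: exp_minus_le_one)
next
  case False
  then have "(\<integral>\<^sup>+x. ennreal (exp_minus (t * x)) \<partial>poisson_dist c) =
    (\<integral>\<^sup>+k. ennreal (exp_minus t ^ k) \<partial>measure_pmf (poisson0_pmf (enn2real c)))"
    by (simp add: poisson_dist_def nn_integral_distr exp_minus_mult_of_nat)
  also have "\<dots> = ennreal (exp (- (enn2real c * (1 - exp_minus t))))"
    by (rule nn_integral_poisson0_power) auto
  finally show ?thesis using False by (simp add: exp_minus_mult_ennreal less_top)
qed

text \<open>For finite intensity the definition prescribes only the probabilities of the counts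
  \<open>k\<close>. These add up to 1, so the count is almost surely a natural number, and the
  transform is the Poisson generating function at \<open>exp_minus t\<close>.\<close>

lemma poisson_random_measure_marginal:
  assumes prm: "poisson_random_measure M N \<nu>" and A: "A \<in> sets \<nu>"
  shows "(\<integral>\<^sup>+\<omega>. ennreal (exp_minus (t * emeasure (N \<omega>) A)) \<partial>M) =
    ennreal (exp_minus (emeasure \<nu> A * ennreal (1 - exp_minus t)))"
proof -
  interpret prob_space M using prm by (simp add: poisson_random_measure_def)
  have N: "N \<in> measurable M (measure_algebra \<nu>)"
    using prm by (simp add: poisson_random_measure_def)
  note [measurable] = A measurable_compose[OF N measurable_emeasure_measure_algebra[OF A]]
  show ?thesis
  proof (cases "emeasure \<nu> A = \<top>")
    case True
    then have "AE \<omega> in M. emeasure (N \<omega>) A = \<top>"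
      using prm A unfolding poisson_random_measure_def infinity_ennreal_def by blast
    then have "(\<integral>\<^sup>+\<omega>. ennreal (exp_minus (t * emeasure (N \<omega>) A)) \<partial>M) =
      (\<integral>\<^sup>+\<omega>. ennreal (exp_minus (t * \<top>)) \<partial>M)"
      by (intro nn_integral_cong_AE) auto
    also have "\<dots> = (\<integral>\<^sup>+x. ennreal (exp_minus (t * x)) \<partial>poisson_dist \<top>)"
      by (simp add: poisson_dist_def nn_integral_return emeasure_space_1)
    finally show ?thesis unfolding nn_integral_poisson_dist by (simp add: True)
  next
    case False
    define c where "c = measure \<nu> A"
    have c: "0 \<le> c" by (simp add: c_def)
    define E where "E k = {\<omega>\<in>space M. emeasure (N \<omega>) A = of_nat k}" for k :: nat
    have Em[measurable]: "E k \<in> sets M" for k unfolding E_def by measurable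
    have PE: "emeasure M (E k) = ennreal (c ^ k / fact k * exp (- c))" for k
    proof -
      have "emeasure \<nu> A < \<infinity>" using False by (simp add: less_top)
      then have "measure M (E k) = c ^ k / fact k * exp (- c)"
        using prm A unfolding poisson_random_measure_def E_def c_def by blast
      then show ?thesis by (simp only: emeasure_eq_measure)
    qed
    have dis: "disjoint_family E" by (auto simp: disjoint_family_on_def E_def)
    have "emeasure M (\<Union>k. E k) = (\<Sum>k. emeasure M (E k))"
      using dis by (intro suminf_emeasure[symmetric]) auto
    also have "\<dots> = 1" using poisson_generating_function[OF c, of 1] by (simp add: PE)
    finally have "emeasure M (\<Union>k. E k) = 1" .
    then have AE: "AE \<omega> in M. \<omega> \<in> (\<Union>k. E k)" by (intro AE_prob_1) (simp add: emeasure_eq_measure)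
    have eq: "ennreal (exp_minus (t * emeasure (N \<omega>) A)) =
      (\<Sum>k. ennreal (exp_minus t ^ k) * indicator (E k) \<omega>)" if E: "\<omega> \<in> (\<Union>k. E k)" for \<omega>
    proof -
      obtain k where k: "\<omega> \<in> E k" using E by auto
      have "(\<Sum>j. ennreal (exp_minus t ^ j) * indicator (E j) \<omega>) =
        (\<Sum>j\<in>{k}. ennreal (exp_minus t ^ j) * indicator (E j) \<omega>)"
        using dis k by (intro suminf_finite) (auto simp: disjoint_family_on_def split: split_indicator)
      moreover have "emeasure (N \<omega>) A = of_nat k" using k by (simp add: E_def)
      ultimately show ?thesis using k by (simp add: exp_minus_mult_of_nat)
    qed
    have "(\<integral>\<^sup>+\<omega>. ennreal (exp_minus (t * emeasure (N \<omega>) A)) \<partial>M) =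
      (\<integral>\<^sup>+\<omega>. (\<Sum>k. ennreal (exp_minus t ^ k) * indicator (E k) \<omega>) \<partial>M)"
      by (rule nn_integral_cong_AE, rule eventually_mono[OF AE]) (rule eq)
    also have "\<dots> = (\<Sum>k. \<integral>\<^sup>+\<omega>. ennreal (exp_minus t ^ k) * indicator (E k) \<omega> \<partial>M)"
      by (rule nn_integral_suminf) measurable
    also have "\<dots> = (\<Sum>k. ennreal (exp_minus t ^ k) * emeasure M (E k))"
      by (simp only: nn_integral_cmult_indicator[OF Em])
    also have "\<dots> = (\<Sum>k. ennreal (c ^ k / fact k * exp (- c)) * ennreal (exp_minus t ^ k))"
      unfolding PE by (intro suminf_cong mult.commute)
    also have "\<dots> = ennreal (exp (- (c * (1 - exp_minus t))))"
      by (rule poisson_generating_function[OF c exp_minus_nonneg])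
    also have "\<dots> = ennreal (exp_minus (emeasure \<nu> A * ennreal (1 - exp_minus t)))"
    proof -
      have "emeasure \<nu> A < \<top>" using False by (simp add: less_top)
      then show ?thesis unfolding c_def measure_def by (subst exp_minus_mult_ennreal) auto
    qed
    finally show ?thesis .
  qed
qed

lemma poisson_random_measure_disjoint:
  assumes prm: "poisson_random_measure M N \<nu>" and F: "finite F" "F \<subseteq> sets \<nu>" "disjoint F"
  shows "(\<integral>\<^sup>+\<omega>. ennreal (exp_minus (\<Sum>A\<in>F. t A * emeasure (N \<omega>) A)) \<partial>M) =
    ennreal (exp_minus (\<Sum>A\<in>F. emeasure \<nu> A * ennreal (1 - exp_minus (t A))))"
proof -
  interpret prob_space M using prm by (simp add: poisson_random_measure_def)
  have ind: "indep_vars (\<lambda>_. borel) (\<lambda>A \<omega>. emeasure (N \<omega>) A) F"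
    using prm F unfolding poisson_random_measure_def by blast
  have "indep_vars (\<lambda>_. borel) (\<lambda>A. (\<lambda>x. ennreal (exp_minus (t A * x))) \<circ> (\<lambda>\<omega>. emeasure (N \<omega>) A)) F"
    by (rule indep_vars_compose[OF ind]) measurable
  then have "(\<integral>\<^sup>+\<omega>. (\<Prod>A\<in>F. ennreal (exp_minus (t A * emeasure (N \<omega>) A))) \<partial>M) =
    (\<Prod>A\<in>F. \<integral>\<^sup>+\<omega>. ennreal (exp_minus (t A * emeasure (N \<omega>) A)) \<partial>M)"
    using F by (intro indep_vars_nn_integral) (auto simp: comp_def)
  also have "\<dots> = (\<Prod>A\<in>F. ennreal (exp_minus (emeasure \<nu> A * ennreal (1 - exp_minus (t A)))))"
    using F by (intro prod.cong poisson_random_measure_marginal[OF prm]) auto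
  finally show ?thesis
    by (simp add: prod_ennreal exp_minus_sum)
qed

lemma exp_minus_le_cancel: "x \<le> y \<Longrightarrow> exp_minus y \<le> exp_minus x"
  by (cases x; cases y) (auto simp: exp_minus_ennreal top_unique)

text \<open>A simple function is constant on finitely many disjoint level sets, whose counts are
  independent. General \<open>g\<close> is an increasing limit: the inner integrals converge
  monotonically, and their exponentials are dominated by 1.\<close>

lemma poisson_random_measure_laplace:
  fixes g :: "'a \<Rightarrow> ennreal"
  assumes prm: "poisson_random_measure M N \<nu>" and g: "g \<in> borel_measurable \<nu>"
  shows "(\<integral>\<^sup>+\<omega>. ennreal (exp_minus (\<integral>\<^sup>+x. g x \<partial>N \<omega>)) \<partial>M) =
    ennreal (exp_minus (\<integral>\<^sup>+x. ennreal (1 - exp_minus (g x)) \<partial>\<nu>))"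
proof -
  interpret prob_space M using prm by (simp add: poisson_random_measure_def)
  have N[measurable]: "N \<in> measurable M (measure_algebra \<nu>)"
    using prm by (simp add: poisson_random_measure_def)
  have setsN: "sets (N \<omega>) = sets \<nu>" if "\<omega> \<in> space M" for \<omega>
    using measurable_space[OF N that] by (simp add: space_measure_algebra)
  have Nm[measurable]: "(\<lambda>\<omega>. \<integral>\<^sup>+x. k x \<partial>N \<omega>) \<in> borel_measurable M" if "k \<in> borel_measurable \<nu>" for k
    using measurable_compose[OF N nn_integral_measurable_measure_algebra[OF that]] .
  note g[measurable]
  obtain f where f: "\<And>i. simple_function \<nu> (f i)" "incseq f"
    "\<And>x. (SUP i. f i x) = g x" "\<And>i x. f i x < \<top>"
    using borel_measurable_implies_simple_function_sequence'[OF g] by (metis)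
  have fm[measurable]: "f i \<in> borel_measurable \<nu>" for i using f(1) by (rule borel_measurable_simple_function)
  have simple: "(\<integral>\<^sup>+\<omega>. ennreal (exp_minus (\<integral>\<^sup>+x. f i x \<partial>N \<omega>)) \<partial>M) =
    ennreal (exp_minus (\<integral>\<^sup>+x. ennreal (1 - exp_minus (f i x)) \<partial>\<nu>))" for i
  proof -
    \<comment> \<open>Independence is formulated for families of sets indexed by themselves, so sums
      over values are reindexed by level sets. Level sets of attained values are non-empty and
      disjoint, which makes \<open>h\<close> injective on \<open>V\<close> and gives it the inverse
      \<open>t\<close>.\<close>
    define h where "h v = f i -` {v} \<inter> space \<nu>" for v
    define V where "V = f i ` space \<nu>"
    have V: "finite V" using f(1)[of i] by (simp add: V_def simple_function_def)
    have inj: "inj_on h V" by (auto simp: inj_on_def h_def V_def)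
    define t where "t = the_inv_into V h"
    have t: "t (h v) = v" if "v \<in> V" for v using that inj by (simp add: t_def the_inv_into_f_f)
    have sum: "(\<Sum>v\<in>V. k v * l (h v)) = (\<Sum>A\<in>h ` V. k (t A) * l A)" for k and l :: "_ \<Rightarrow> ennreal"
      by (subst sum.reindex[OF inj]) (simp add: t)
    have int: "(\<integral>\<^sup>+x. k (f i x) \<partial>m) = (\<Sum>A\<in>h ` V. k (t A) * emeasure m A)" if m: "sets m = sets \<nu>" for m k
    proof -
      have sp: "space m = space \<nu>" using m by (rule sets_eq_imp_space_eq)
      have "simple_function m (\<lambda>x. k (f i x))"
        using simple_function_compose1[OF f(1), of k i] m
        by (simp add: simple_function_def sp)
      then have "(\<integral>\<^sup>+x. k (f i x) \<partial>m) = (\<integral>\<^sup>Sx. k (f i x) \<partial>m)" by (rule nn_integral_eq_simple_integral)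
      also have "\<dots> = (\<Sum>v\<in>V. k v * emeasure m (h v))"
      proof -
        have "simple_function m (f i)" using f(1)[of i] m by (simp add: simple_function_def sp)
        then have "(\<integral>\<^sup>Sx. k (f i x) \<partial>m) = (\<Sum>y\<in>f i ` space m. k y * emeasure m (f i -` {y} \<inter> space m))"
          by (subst simple_function_partition[where g="f i" and v=k])
             (auto simp: sp vimage_def Int_def conj_commute intro!: sum.cong arg_cong2[where f=emeasure] \<open>simple_function m (\<lambda>x. k (f i x))\<close>)
        then show ?thesis by (simp add: V_def h_def sp)
      qed
      finally show ?thesis by (simp add: sum)
    qed
    have F: "finite (h ` V)" "h ` V \<subseteq> sets \<nu>" "disjoint (h ` V)"
      using V f(1)[of i] by (auto simp: h_def V_def simple_function_def disjoint_def)
    have "(\<integral>\<^sup>+\<omega>. ennreal (exp_minus (\<integral>\<^sup>+x. f i x \<partial>N \<omega>)) \<partial>M) =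
      (\<integral>\<^sup>+\<omega>. ennreal (exp_minus (\<Sum>A\<in>h ` V. t A * emeasure (N \<omega>) A)) \<partial>M)"
      using int[OF setsN, of _ "\<lambda>x. x"] by (intro nn_integral_cong) auto
    also have "\<dots> = ennreal (exp_minus (\<Sum>A\<in>h ` V. emeasure \<nu> A * ennreal (1 - exp_minus (t A))))"
      by (rule poisson_random_measure_disjoint[OF prm F])
    also have "(\<Sum>A\<in>h ` V. emeasure \<nu> A * ennreal (1 - exp_minus (t A))) = (\<integral>\<^sup>+x. ennreal (1 - exp_minus (f i x)) \<partial>\<nu>)"
      using int[OF refl, of "\<lambda>x. ennreal (1 - exp_minus x)"] by (simp add: mult.commute)
    finally show ?thesis .
  qed
  have fmono: "f i x \<le> f j x" if "i \<le> j" for i j x using f(2) that by (auto simp: incseq_def le_fun_def)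
  have lim_f: "(\<lambda>i. f i x) \<longlonglongrightarrow> g x" for x
    using LIMSEQ_SUP[of "\<lambda>i. f i x"] fmono f(3)[of x] by (simp add: incseq_def)
  have "(\<lambda>i. \<integral>\<^sup>+\<omega>. ennreal (exp_minus (\<integral>\<^sup>+x. f i x \<partial>N \<omega>)) \<partial>M) \<longlonglongrightarrow>
      (\<integral>\<^sup>+\<omega>. ennreal (exp_minus (\<integral>\<^sup>+x. g x \<partial>N \<omega>)) \<partial>M)"
  proof (rule nn_integral_dominated_convergence[where w="\<lambda>_. 1"])
    show "AE \<omega> in M. (\<lambda>i. ennreal (exp_minus (\<integral>\<^sup>+x. f i x \<partial>N \<omega>))) \<longlonglongrightarrow> ennreal (exp_minus (\<integral>\<^sup>+x. g x \<partial>N \<omega>))"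
    proof (rule AE_I2)
      fix \<omega> assume \<omega>: "\<omega> \<in> space M"
      have "(\<lambda>i. \<integral>\<^sup>+x. f i x \<partial>N \<omega>) \<longlonglongrightarrow> (\<integral>\<^sup>+x. g x \<partial>N \<omega>)"
        by (rule nn_integral_LIMSEQ)
           (use f(2) lim_f setsN[OF \<omega>] in \<open>auto simp: cong: measurable_cong_sets\<close>)
      then show "(\<lambda>i. ennreal (exp_minus (\<integral>\<^sup>+x. f i x \<partial>N \<omega>))) \<longlonglongrightarrow> ennreal (exp_minus (\<integral>\<^sup>+x. g x \<partial>N \<omega>))"
        by (intro tendsto_ennrealI tendsto_exp_minus)
    qed
  qed (auto simp: emeasure_space_1 intro: Nm g)
  moreover have "(\<lambda>i. ennreal (exp_minus (\<integral>\<^sup>+x. ennreal (1 - exp_minus (f i x)) \<partial>\<nu>))) \<longlonglongrightarrow>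
      ennreal (exp_minus (\<integral>\<^sup>+x. ennreal (1 - exp_minus (g x)) \<partial>\<nu>))"
  proof (rule tendsto_ennrealI, rule tendsto_exp_minus, rule nn_integral_LIMSEQ)
    show "incseq (\<lambda>i x. ennreal (1 - exp_minus (f i x)))"
      using fmono by (auto simp: incseq_def le_fun_def intro!: ennreal_leI exp_minus_le_cancel)
    show "(\<lambda>i. ennreal (1 - exp_minus (f i x))) \<longlonglongrightarrow> ennreal (1 - exp_minus (g x))" for x
      by (intro tendsto_ennrealI tendsto_exp_minus tendsto_diff tendsto_const lim_f)
  qed measurable
  ultimately show ?thesis unfolding simple by (rule LIMSEQ_unique)
qed

lemma enn2real_emeasure: "enn2real (emeasure M A) = measure M A"
  by (simp add: measure_def)

text \<open>Counts, infinite counts and independence all follow from the joint law on disjoint sets,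
  and that law is determined by testing the functional on combinations of indicators. A random
  measure is thus recognised as Poisson from a single formula.\<close>

lemma poisson_random_measureI:
  assumes M: "prob_space M" and N[measurable]: "N \<in> measurable M (measure_algebra \<nu>)"
    and laplace: "\<And>g. g \<in> borel_measurable \<nu> \<Longrightarrow>
      (\<integral>\<^sup>+\<omega>. ennreal (exp_minus (\<integral>\<^sup>+x. g x \<partial>N \<omega>)) \<partial>M) =
      ennreal (exp_minus (\<integral>\<^sup>+x. ennreal (1 - exp_minus (g x)) \<partial>\<nu>))"
  shows "poisson_random_measure M N \<nu>"
proof -
  interpret prob_space M by fact
  have setsN: "sets (N \<omega>) = sets \<nu>" if "\<omega> \<in> space M" for \<omega>
    using measurable_space[OF N that] by (simp add: space_measure_algebra)
  have NA[measurable]: "(\<lambda>\<omega>. emeasure (N \<omega>) A) \<in> borel_measurable M" if "A \<in> sets \<nu>" for A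
    using measurable_compose[OF N measurable_emeasure_measure_algebra[OF that]] .
  interpret D: product_prob_space "\<lambda>A. poisson_dist (emeasure \<nu> A)" UNIV
    by (simp add: product_prob_space_def product_prob_space_axioms_def product_sigma_finite_def
       prob_space_poisson_dist prob_space_imp_sigma_finite)
  have joint: "distr M (PiM F (\<lambda>_. borel)) (\<lambda>\<omega>. \<lambda>A\<in>F. emeasure (N \<omega>) A) =
      PiM F (\<lambda>A. poisson_dist (emeasure \<nu> A))"
    if F: "finite F" "F \<subseteq> sets \<nu>" "disjoint F" for F
  proof (rule PiM_ennreal_eqI[OF F(1)])
    have Fm[measurable]: "(\<lambda>\<omega>. \<lambda>A\<in>F. emeasure (N \<omega>) A) \<in> measurable M (PiM F (\<lambda>_. borel))"
      using F by (intro measurable_restrict NA) auto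
    show "finite_measure (distr M (PiM F (\<lambda>_. borel)) (\<lambda>\<omega>. \<lambda>A\<in>F. emeasure (N \<omega>) A))"
      by (intro prob_space.finite_measure prob_space_distr) simp
    show "finite_measure (PiM F (\<lambda>A. poisson_dist (emeasure \<nu> A)))"
      by (intro prob_space.finite_measure prob_space_PiM prob_space_poisson_dist)
    show "sets (PiM F (\<lambda>A. poisson_dist (emeasure \<nu> A))) = sets (PiM F (\<lambda>_. borel))"
      by (intro sets_PiM_cong) auto
    fix t :: "'b set \<Rightarrow> real" assume t: "\<And>A. 0 \<le> t A"
    define g where "g x = (\<Sum>A\<in>F. ennreal (t A) * indicator A x)" for x
    have [measurable]: "A \<in> sets \<nu>" if "A \<in> F" for A using F that by auto
    have g: "g \<in> borel_measurable \<nu>" unfolding g_def by measurable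
    have "(\<integral>\<^sup>+x. ennreal (exp_minus (\<Sum>i\<in>F. ennreal (t i) * x i)) \<partial>distr M (PiM F (\<lambda>_. borel)) (\<lambda>\<omega>. \<lambda>A\<in>F. emeasure (N \<omega>) A)) =
       (\<integral>\<^sup>+\<omega>. ennreal (exp_minus (\<Sum>A\<in>F. ennreal (t A) * emeasure (N \<omega>) A)) \<partial>M)"
      by (subst nn_integral_distr) auto
    also have "\<dots> = (\<integral>\<^sup>+\<omega>. ennreal (exp_minus (\<integral>\<^sup>+x. g x \<partial>N \<omega>)) \<partial>M)"
    proof (rule nn_integral_cong)
      fix \<omega> assume "\<omega> \<in> space M"
      then have *: "A \<in> sets (N \<omega>)" if "A \<in> F" for A using F that setsN by auto
      have "(\<integral>\<^sup>+x. g x \<partial>N \<omega>) = (\<Sum>A\<in>F. \<integral>\<^sup>+x. ennreal (t A) * indicator A x \<partial>N \<omega>)"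
        unfolding g_def using * by (intro nn_integral_sum) auto
      also have "\<dots> = (\<Sum>A\<in>F. ennreal (t A) * emeasure (N \<omega>) A)"
        using * by (intro sum.cong nn_integral_cmult_indicator) auto
      finally show "ennreal (exp_minus (\<Sum>A\<in>F. ennreal (t A) * emeasure (N \<omega>) A)) = ennreal (exp_minus (\<integral>\<^sup>+x. g x \<partial>N \<omega>))"
        by simp
    qed
    also have "\<dots> = ennreal (exp_minus (\<integral>\<^sup>+x. ennreal (1 - exp_minus (g x)) \<partial>\<nu>))"
      by (rule laplace[OF g])
    also have "(\<integral>\<^sup>+x. ennreal (1 - exp_minus (g x)) \<partial>\<nu>) =
      (\<integral>\<^sup>+x. (\<Sum>A\<in>F. ennreal (1 - exp_minus (ennreal (t A))) * indicator A x) \<partial>\<nu>)"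
    proof (rule nn_integral_cong)
      fix x
      \<comment> \<open>At most one set of the disjoint family contains \<open>x\<close>, so
        \<open>g x\<close> is 0 or a single coefficient, and \<open>1 - exp_minus\<close> passes
        through the sum.\<close>
      show "ennreal (1 - exp_minus (g x)) = (\<Sum>A\<in>F. ennreal (1 - exp_minus (ennreal (t A))) * indicator A x)"
      proof (cases "\<exists>A\<in>F. x \<in> A")
        case True
        then obtain A where A: "A \<in> F" "x \<in> A" by auto
        have uniq: "x \<notin> B" if "B \<in> F - {A}" for B
          using F(3) A that by (auto simp: disjoint_def)
        have *: "(\<Sum>B\<in>F. k B * indicator B x) = k A" for k :: "_ \<Rightarrow> ennreal"
        proof -
          have "(\<Sum>B\<in>F. k B * indicator B x) = (\<Sum>B\<in>{A}. k B * indicator B x)"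
            by (rule sum.mono_neutral_right) (use A F uniq in auto)
          then show ?thesis using A by simp
        qed
        show ?thesis unfolding g_def * ..
      next
        case False
        then have *: "(\<Sum>B\<in>F. k B * indicator B x) = 0" for k :: "_ \<Rightarrow> ennreal"
          by (intro sum.neutral) auto
        show ?thesis unfolding g_def * by simp
      qed
    qed
    also have "\<dots> = (\<Sum>A\<in>F. \<integral>\<^sup>+x. ennreal (1 - exp_minus (ennreal (t A))) * indicator A x \<partial>\<nu>)"
      by (intro nn_integral_sum) auto
    also have "\<dots> = (\<Sum>A\<in>F. ennreal (1 - exp_minus (ennreal (t A))) * emeasure \<nu> A)"
      by (intro sum.cong nn_integral_cmult_indicator) auto
    also have "\<dots> = (\<Sum>A\<in>F. emeasure \<nu> A * ennreal (1 - exp_minus (ennreal (t A))))"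
      by (simp only: mult.commute)
    also have "ennreal (exp_minus \<dots>) = (\<Prod>A\<in>F. ennreal (exp_minus (emeasure \<nu> A * ennreal (1 - exp_minus (ennreal (t A))))))"
      by (simp add: exp_minus_sum prod_ennreal)
    also have "\<dots> = (\<Prod>A\<in>F. \<integral>\<^sup>+x. ennreal (exp_minus (ennreal (t A) * x)) \<partial>poisson_dist (emeasure \<nu> A))"
      unfolding nn_integral_poisson_dist ..
    also have "\<dots> = (\<integral>\<^sup>+x. (\<Prod>A\<in>F. ennreal (exp_minus (ennreal (t A) * x A))) \<partial>PiM F (\<lambda>A. poisson_dist (emeasure \<nu> A)))"
      using F by (intro D.product_nn_integral_prod[symmetric]) auto
    also have "\<dots> = (\<integral>\<^sup>+x. ennreal (exp_minus (\<Sum>i\<in>F. ennreal (t i) * x i)) \<partial>PiM F (\<lambda>A. poisson_dist (emeasure \<nu> A)))"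
      by (simp add: exp_minus_sum prod_ennreal)
    finally show "(\<integral>\<^sup>+x. ennreal (exp_minus (\<Sum>i\<in>F. ennreal (t i) * x i)) \<partial>distr M (PiM F (\<lambda>_. borel)) (\<lambda>\<omega>. \<lambda>A\<in>F. emeasure (N \<omega>) A)) =
      (\<integral>\<^sup>+x. ennreal (exp_minus (\<Sum>i\<in>F. ennreal (t i) * x i)) \<partial>PiM F (\<lambda>A. poisson_dist (emeasure \<nu> A)))" .
  qed simp
  have marg: "distr M borel (\<lambda>\<omega>. emeasure (N \<omega>) A) = poisson_dist (emeasure \<nu> A)" if A: "A \<in> sets \<nu>" for A
  proof -
    have Am[measurable]: "(\<lambda>\<omega>. \<lambda>B\<in>{A}. emeasure (N \<omega>) B) \<in> measurable M (PiM {A} (\<lambda>_. borel))"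
      using A by (intro measurable_restrict NA) auto
    have "distr M borel (\<lambda>\<omega>. emeasure (N \<omega>) A) =
      distr (distr M (PiM {A} (\<lambda>_. borel)) (\<lambda>\<omega>. \<lambda>B\<in>{A}. emeasure (N \<omega>) B)) borel (\<lambda>x. x A)"
      by (subst distr_distr) (auto simp: comp_def)
    also have "\<dots> = distr (PiM {A} (\<lambda>A. poisson_dist (emeasure \<nu> A))) borel (\<lambda>x. x A)"
      by (subst joint) (use A in auto)
    also have "\<dots> = distr (PiM {A} (\<lambda>A. poisson_dist (emeasure \<nu> A))) (poisson_dist (emeasure \<nu> A)) (\<lambda>x. x A)"
      by (intro distr_cong) auto
    also have "\<dots> = poisson_dist (emeasure \<nu> A)"
      by (rule distr_PiM_component) (auto simp: prob_space_poisson_dist)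
    finally show ?thesis .
  qed
  show ?thesis unfolding poisson_random_measure_def
  proof (intro conjI ballI allI impI)
    fix A k assume A: "A \<in> sets \<nu>" and fin: "emeasure \<nu> A < \<infinity>"
    have "measure M {\<omega>\<in>space M. emeasure (N \<omega>) A = of_nat k} =
      measure (distr M borel (\<lambda>\<omega>. emeasure (N \<omega>) A)) {of_nat k}"
      using A by (subst measure_distr) (auto simp: vimage_def Int_def conj_commute)
    also have "\<dots> = measure (measure_pmf (poisson0_pmf (measure \<nu> A))) (of_nat -` {of_nat k :: ennreal})"
      unfolding marg[OF A] poisson_dist_def using fin
      by (auto simp: measure_distr enn2real_emeasure)
    also have "of_nat -` {of_nat k :: ennreal} = {k}" by auto
    finally show "measure M {\<omega>\<in>space M. emeasure (N \<omega>) A = of_nat k} =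
           measure \<nu> A ^ k / fact k * exp (- measure \<nu> A)"
      by (simp add: measure_pmf_single pmf_poisson0)
  next
    fix A assume A: "A \<in> sets \<nu>" and inf: "emeasure \<nu> A = \<infinity>"
    have "AE x in distr M borel (\<lambda>\<omega>. emeasure (N \<omega>) A). x = \<infinity>"
      unfolding marg[OF A] inf poisson_dist_def by (simp add: AE_return)
    then show "AE \<omega> in M. emeasure (N \<omega>) A = \<infinity>"
      by (rule AE_distrD[rotated]) (rule NA[OF A])
  next
    fix F assume F: "finite F \<and> F \<subseteq> sets \<nu> \<and> disjoint F"
    show "indep_vars (\<lambda>_. borel) (\<lambda>A \<omega>. emeasure (N \<omega>) A) F"
    proof (cases "F = {}")
      case True
      then show ?thesis by (simp add: indep_vars_def indep_sets_def)
    next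
      case False
      show ?thesis
      proof (subst indep_vars_iff_distr_eq_PiM'[OF False])
        show "(\<lambda>\<omega>. emeasure (N \<omega>) A) \<in> borel_measurable M" if "A \<in> F" for A
          using F that by (intro NA) auto
        have "PiM F (\<lambda>A. distr M borel (\<lambda>\<omega>. emeasure (N \<omega>) A)) = PiM F (\<lambda>A. poisson_dist (emeasure \<nu> A))"
          using F by (intro PiM_cong refl marg) auto
        then show "distr M (PiM F (\<lambda>_. borel)) (\<lambda>x. \<lambda>A\<in>F. emeasure (N x) A) =
          PiM F (\<lambda>A. distr M borel (\<lambda>\<omega>. emeasure (N \<omega>) A))"
          using joint[of F] F by simp
      qed
    qed
  qed (use M N in auto)
qed

section \<open>Construction of a Poisson random measure\<close>

lemma nn_integral_PiM_prod:
  assumes M: "\<And>i. prob_space (M i)" and J: "finite J" and f: "\<And>i. i \<in> J \<Longrightarrow> f i \<in> borel_measurable (M i)"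
  shows "(\<integral>\<^sup>+x. (\<Prod>i\<in>J. f i (x i)) \<partial>PiM UNIV M) = (\<Prod>i\<in>J. \<integral>\<^sup>+x. f i x \<partial>M i)"
proof -
  interpret product_prob_space M UNIV
    using M by (simp add: product_prob_space_def product_prob_space_axioms_def product_sigma_finite_def
       prob_space_imp_sigma_finite)
  have [measurable]: "(\<lambda>x. \<Prod>i\<in>J. f i (x i)) \<in> borel_measurable (PiM J M)"
  proof (rule borel_measurable_prod_ennreal)
    fix i assume i: "i \<in> J"
    show "(\<lambda>x. f i (x i)) \<in> borel_measurable (PiM J M)"
      using measurable_component_singleton[OF i, of M] f[OF i] by (rule measurable_compose)
  qed
  have "(\<Prod>i\<in>J. \<integral>\<^sup>+x. f i x \<partial>M i) = (\<integral>\<^sup>+x. (\<Prod>i\<in>J. f i (x i)) \<partial>PiM J M)"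
    using J f by (rule product_nn_integral_prod[symmetric])
  also have "PiM J M = distr (PiM UNIV M) (PiM J M) (\<lambda>x. restrict x J)"
    using J by (intro distr_PiM_restrict_finite[symmetric]) auto
  also have "(\<integral>\<^sup>+x. (\<Prod>i\<in>J. f i (x i)) \<partial>distr (PiM UNIV M) (PiM J M) (\<lambda>x. restrict x J)) =
      (\<integral>\<^sup>+x. (\<Prod>i\<in>J. f i (restrict x J i)) \<partial>PiM UNIV M)"
    by (intro nn_integral_distr measurable_restrict_subset) auto
  also have "\<dots> = (\<integral>\<^sup>+x. (\<Prod>i\<in>J. f i (x i)) \<partial>PiM UNIV M)"
    by (intro nn_integral_cong prod.cong) auto
  finally show ?thesis by simp
qed

text \<open>On a set of finite intensity \<open>c\<close> a Poisson number of independent points is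
  placed. Given \<open>k\<close> points the transform is \<open>e^k\<close>, with \<open>e\<close>
  the mean of \<open>exp_minus (g x)\<close>. Averaging over \<open>k\<close> gives
  \<open>exp (- c * (1 - e))\<close>, and \<open>c * e\<close> is the integral of
  \<open>exp_minus (g x)\<close> over \<open>A\<close>.\<close>

lemma nn_integral_poisson_points:
  fixes \<nu> :: "'a measure" and g :: "'a \<Rightarrow> ennreal"
  assumes A[measurable]: "A \<in> sets \<nu>" and fin: "emeasure \<nu> A < \<top>" and g[measurable]: "g \<in> borel_measurable \<nu>"
    and P: "prob_space P" "sets P = sets \<nu>" and PA: "0 < measure \<nu> A \<Longrightarrow> P = uniform_measure \<nu> A"
  defines "\<Omega> \<equiv> measure_pmf (poisson0_pmf (measure \<nu> A)) \<Otimes>\<^sub>M PiM UNIV (\<lambda>_::nat. P)"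
  shows "(\<integral>\<^sup>+z. ennreal (exp_minus (\<Sum>i. if i < fst z then g (snd z i) else 0)) \<partial>\<Omega>) =
    ennreal (exp_minus (\<integral>\<^sup>+x. ennreal (1 - exp_minus (g x)) * indicator A x \<partial>\<nu>))"
proof -
  interpret P: prob_space P by fact
  interpret PP: prob_space "PiM UNIV (\<lambda>_::nat. P)" by (intro prob_space_PiM P)
  have gP[measurable]: "g \<in> borel_measurable P" using g by (simp cong: measurable_cong_sets add: P)
  define c where "c = measure \<nu> A"
  have c: "0 \<le> c" "emeasure \<nu> A = ennreal c"
    using fin by (auto simp: c_def emeasure_eq_ennreal_measure)
  define e where "e = enn2real (\<integral>\<^sup>+x. ennreal (exp_minus (g x)) \<partial>P)"
  have "(\<integral>\<^sup>+x. ennreal (exp_minus (g x)) \<partial>P) \<le> (\<integral>\<^sup>+x. 1 \<partial>P)"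
    by (intro nn_integral_mono) simp
  then have fe: "(\<integral>\<^sup>+x. ennreal (exp_minus (g x)) \<partial>P) = ennreal e"
    unfolding e_def by (subst ennreal_enn2real) (auto simp: P.emeasure_space_1 le_less_trans)
  have e: "0 \<le> e" by (simp add: e_def)
  have "(\<integral>\<^sup>+z. ennreal (exp_minus (\<Sum>i. if i < fst z then g (snd z i) else 0)) \<partial>\<Omega>) =
    (\<integral>\<^sup>+k. \<integral>\<^sup>+x. ennreal (exp_minus (\<Sum>i. if i < k then g (x i) else 0)) \<partial>PiM UNIV (\<lambda>_. P) \<partial>measure_pmf (poisson0_pmf c))"
    unfolding \<Omega>_def c_def by (subst PP.nn_integral_fst[symmetric]) (simp_all cong: if_cong)
  also have "\<dots> = (\<integral>\<^sup>+k. ennreal (e ^ k) \<partial>measure_pmf (poisson0_pmf c))"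
  proof (rule nn_integral_cong)
    fix k
    have "(\<Sum>i. if i < k then g (x i) else 0) = (\<Sum>i<k. g (x i))" for x
    proof -
      have "(\<Sum>i. if i < k then g (x i) else 0) = (\<Sum>i\<in>{..<k}. if i < k then g (x i) else 0)"
        by (rule suminf_finite) auto
      then show ?thesis by simp
    qed
    then have "(\<integral>\<^sup>+x. ennreal (exp_minus (\<Sum>i. if i < k then g (x i) else 0)) \<partial>PiM UNIV (\<lambda>_. P)) =
      (\<integral>\<^sup>+x. (\<Prod>i<k. ennreal (exp_minus (g (x i)))) \<partial>PiM UNIV (\<lambda>_. P))"
      by (simp add: exp_minus_sum prod_ennreal)
    also have "\<dots> = (\<Prod>i<k. \<integral>\<^sup>+x. ennreal (exp_minus (g x)) \<partial>P)"
      by (rule nn_integral_PiM_prod) (auto intro: P)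
    also have "\<dots> = ennreal (e ^ k)" using e by (simp add: fe ennreal_power)
    finally show "(\<integral>\<^sup>+x. ennreal (exp_minus (\<Sum>i. if i < k then g (x i) else 0)) \<partial>PiM UNIV (\<lambda>_. P)) = ennreal (e ^ k)" .
  qed
  also have "\<dots> = ennreal (exp (- (c * (1 - e))))"
    by (rule nn_integral_poisson0_power[OF c(1) e])
  also have "\<dots> = ennreal (exp_minus (\<integral>\<^sup>+x. ennreal (1 - exp_minus (g x)) * indicator A x \<partial>\<nu>))"
  \<comment> \<open>On a null set nothing ties the law \<open>P\<close> of the points to \<nu>, but
    then no point is drawn.\<close>
  proof (cases "c = 0")
    case True
    then have "A \<in> null_sets \<nu>" using c by auto
    then show ?thesis using True by (simp add: nn_integral_null_set)
  next
    case False
    then have cp: "0 < c" using c by simp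
    define a where "a = (\<integral>\<^sup>+x. ennreal (1 - exp_minus (g x)) * indicator A x \<partial>\<nu>)"
    define b where "b = (\<integral>\<^sup>+x. ennreal (exp_minus (g x)) * indicator A x \<partial>\<nu>)"
    have "a + b = (\<integral>\<^sup>+x. ennreal (1 - exp_minus (g x)) * indicator A x + ennreal (exp_minus (g x)) * indicator A x \<partial>\<nu>)"
      unfolding a_def b_def by (rule nn_integral_add[symmetric]) auto
    also have "\<dots> = (\<integral>\<^sup>+x. indicator A x \<partial>\<nu>)"
      by (intro nn_integral_cong) (auto split: split_indicator simp flip: ennreal_plus)
    finally have ab: "a + b = ennreal c" by (simp add: c)
    then obtain a' b' where a': "a = ennreal a'" "0 \<le> a'" and b': "b = ennreal b'" "0 \<le> b'"
      by (cases a; cases b) (auto simp: top_add add_top)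
    have sum: "a' + b' = c" using ab a' b' c by (simp flip: ennreal_plus)
    have "ennreal e = b / ennreal c"
      using PA[folded c_def, OF cp] by (simp add: b_def fe[symmetric] nn_integral_uniform_measure c)
    then have "e = b' / c" using b' cp e by (simp add: divide_ennreal)
    then have "c * (1 - e) = a'" using sum cp by (simp add: field_simps)
    then show ?thesis using a' by (simp add: a_def[symmetric] exp_minus_ennreal)
  qed
  finally show ?thesis .
qed

text \<open>Superposition: the space is cut into countably many disjoint cells of finite intensity,
  each cell receives its own independent cloud of points, and the Laplace exponents of the cells add
  up.\<close>

lemma poisson_random_measure_exists:
  fixes \<nu> :: "'a measure"
  assumes "sigma_finite_measure \<nu>" "space \<nu> \<noteq> {}"
  shows "\<exists>Q. sets Q = sets (measure_algebra \<nu>) \<and> poisson_random_measure Q (\<lambda>N. N) \<nu>"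
proof -
  interpret sigma_finite_measure \<nu> by fact
  obtain A :: "nat \<Rightarrow> 'a set" where A: "range A \<subseteq> sets \<nu>" "(\<Union>i. A i) = space \<nu>"
      "\<And>i. emeasure \<nu> (A i) \<noteq> \<infinity>" "disjoint_family A"
    using sigma_finite_disjoint by metis
  have Am[measurable]: "A i \<in> sets \<nu>" for i using A(1) by auto
  obtain x0 where x0: "x0 \<in> space \<nu>" using assms(2) by auto
  \<comment> \<open>A point mass stands in on null cells, so that \<open>P m\<close> is a
    probability law for every \<open>m\<close>.\<close>
  define P where "P m = (if measure \<nu> (A m) = 0 then return \<nu> x0 else uniform_measure \<nu> (A m))" for m
  have P: "prob_space (P m)" for m
    using A(3)[of m] x0 by (auto simp: P_def prob_space_return measure_def intro!: prob_space_uniform_measure)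
  have setsP[measurable_cong]: "sets (P m) = sets \<nu>" for m by (simp add: P_def)
  define \<Omega> where "\<Omega> m = measure_pmf (poisson0_pmf (measure \<nu> (A m))) \<Otimes>\<^sub>M PiM UNIV (\<lambda>_::nat. P m)" for m
  have pp: "prob_space (PiM UNIV (\<lambda>_::nat. P m))" for m
    by (intro prob_space_PiM P)
  have prob\<Omega>: "prob_space (\<Omega> m)" for m
    unfolding \<Omega>_def by (intro prob_space_pair prob_space_measure_pmf pp)
  define M where "M = PiM UNIV \<Omega>"
  interpret M: prob_space M unfolding M_def by (intro prob_space_PiM prob\<Omega>)
  \<comment> \<open>Points are counted with multiplicity: \<open>N \<omega>\<close> is the image of
    the counting measure on the pairs (cell, number of the point) that are in use.\<close>
  define N where "N \<omega> = distr (count_space {(m, i). i < fst (\<omega> m)}) \<nu> (\<lambda>(m, i). snd (\<omega> m) i)"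
    for \<omega> :: "nat \<Rightarrow> nat \<times> (nat \<Rightarrow> 'a)"
  define Z where "Z g z = (\<Sum>i. if i < fst z then g (snd z i) else 0)"
    for g :: "'a \<Rightarrow> ennreal" and z :: "nat \<times> (nat \<Rightarrow> 'a)"
  have Zm: "Z g \<in> borel_measurable (\<Omega> m)" if [measurable]: "g \<in> borel_measurable \<nu>" for g m
    unfolding Z_def[abs_def] \<Omega>_def by measurable
  have Zcomp: "(\<lambda>\<omega>. Z g (\<omega> m)) \<in> borel_measurable M" if "g \<in> borel_measurable \<nu>" for g m
    unfolding M_def using measurable_component_singleton[OF UNIV_I, of m \<Omega>] Zm[OF that, of m]
    by (rule measurable_compose)
  have X: "snd (\<omega> m) i \<in> space \<nu>" if "\<omega> \<in> space M" for \<omega> m i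
  proof -
    have "\<omega> m \<in> space (\<Omega> m)" using that by (auto simp: M_def space_PiM)
    then have "snd (\<omega> m) \<in> space (PiM UNIV (\<lambda>_::nat. P m))" by (auto simp: \<Omega>_def space_pair_measure)
    then show ?thesis using sets_eq_imp_space_eq[OF setsP[of m]] by (auto simp: space_PiM PiE_def Pi_def)
  qed
  have nnN: "(\<integral>\<^sup>+x. g x \<partial>N \<omega>) = (\<Sum>m. Z g (\<omega> m))"
    if [measurable]: "g \<in> borel_measurable \<nu>" and \<omega>: "\<omega> \<in> space M" for g \<omega>
  proof -
    let ?S = "{(m, i). i < fst (\<omega> m)}"
    have "(\<integral>\<^sup>+x. g x \<partial>N \<omega>) = (\<integral>\<^sup>+z. g (case z of (m, i) \<Rightarrow> snd (\<omega> m) i) \<partial>count_space ?S)"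
      unfolding N_def using X[OF \<omega>] by (intro nn_integral_distr) auto
    also have "\<dots> = (\<integral>\<^sup>+z. g (case z of (m, i) \<Rightarrow> snd (\<omega> m) i) * indicator ?S z \<partial>count_space UNIV)"
      by (rule nn_integral_count_space_indicator) simp
    also have "\<dots> = (\<integral>\<^sup>+m. \<integral>\<^sup>+i. g (snd (\<omega> m) i) * indicator ?S (m, i) \<partial>count_space UNIV \<partial>count_space UNIV)"
      by (subst nn_integral_fst_count_space[symmetric]) simp
    also have "\<dots> = (\<Sum>m. Z g (\<omega> m))"
      by (simp add: nn_integral_count_space_nat Z_def indicator_def of_bool_def if_distrib cong: if_cong)
    finally show ?thesis .
  qed
  have Nm[measurable]: "N \<in> measurable M (measure_algebra \<nu>)"
  proof (rule measurable_measure_algebra)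
    fix B assume B[measurable]: "B \<in> sets \<nu>"
    have [measurable]: "(\<lambda>\<omega>. Z (indicator B) (\<omega> m)) \<in> borel_measurable M" for m
      by (rule Zcomp) simp
    have "(\<lambda>\<omega>. \<Sum>m. Z (indicator B) (\<omega> m)) \<in> borel_measurable M"
      by measurable
    moreover have "(\<Sum>m. Z (indicator B) (\<omega> m)) = emeasure (N \<omega>) B" if "\<omega> \<in> space M" for \<omega>
    proof -
      have "B \<in> sets (N \<omega>)" by (simp add: N_def B)
      then show ?thesis using nnN[of "indicator B" \<omega>] that by simp
    qed
    ultimately show "(\<lambda>\<omega>. emeasure (N \<omega>) B) \<in> borel_measurable M"
      by (simp cong: measurable_cong)
  qed (simp add: N_def)
  have prm: "poisson_random_measure M N \<nu>"
  proof (rule poisson_random_measureI[OF M.prob_space_axioms Nm])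
    fix g :: "'a \<Rightarrow> ennreal" assume g[measurable]: "g \<in> borel_measurable \<nu>"
    define a where "a m = (\<integral>\<^sup>+x. ennreal (1 - exp_minus (g x)) * indicator (A m) x \<partial>\<nu>)" for m
    have aZ: "(\<integral>\<^sup>+z. ennreal (exp_minus (Z g z)) \<partial>\<Omega> m) = ennreal (exp_minus (a m))" for m
      unfolding Z_def a_def \<Omega>_def
      by (rule nn_integral_poisson_points) (use A(3)[of m] P in \<open>auto simp: setsP less_top P_def\<close>)
    have Zgm[measurable]: "(\<lambda>\<omega>. Z g (\<omega> m)) \<in> borel_measurable M" for m
      by (rule Zcomp[OF g])
    have fin: "(\<integral>\<^sup>+\<omega>. ennreal (exp_minus (\<Sum>m<n. Z g (\<omega> m))) \<partial>M) = ennreal (exp_minus (\<Sum>m<n. a m))" for n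
    proof -
      have "(\<integral>\<^sup>+\<omega>. ennreal (exp_minus (\<Sum>m<n. Z g (\<omega> m))) \<partial>M) =
        (\<integral>\<^sup>+\<omega>. (\<Prod>m<n. ennreal (exp_minus (Z g (\<omega> m)))) \<partial>M)"
        by (simp add: exp_minus_sum prod_ennreal)
      also have "\<dots> = (\<Prod>m<n. \<integral>\<^sup>+z. ennreal (exp_minus (Z g z)) \<partial>\<Omega> m)"
        unfolding M_def
        by (rule nn_integral_PiM_prod) (auto intro: prob\<Omega> measurable_compose[OF Zm[OF g]])
      finally show ?thesis by (simp add: aZ exp_minus_sum prod_ennreal)
    qed
    have "(\<lambda>n. \<integral>\<^sup>+\<omega>. ennreal (exp_minus (\<Sum>m<n. Z g (\<omega> m))) \<partial>M) \<longlonglongrightarrow>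
      (\<integral>\<^sup>+\<omega>. ennreal (exp_minus (\<Sum>m. Z g (\<omega> m))) \<partial>M)"
    proof (rule nn_integral_dominated_convergence[where w="\<lambda>_. 1"])
      show "AE \<omega> in M. (\<lambda>n. ennreal (exp_minus (\<Sum>m<n. Z g (\<omega> m)))) \<longlonglongrightarrow> ennreal (exp_minus (\<Sum>m. Z g (\<omega> m)))"
        by (intro AE_I2 tendsto_ennrealI tendsto_exp_minus summable_LIMSEQ) auto
    qed (auto simp: M.emeasure_space_1)
    moreover have "(\<lambda>n. ennreal (exp_minus (\<Sum>m<n. a m))) \<longlonglongrightarrow> ennreal (exp_minus (\<Sum>m. a m))"
      by (intro tendsto_ennrealI tendsto_exp_minus summable_LIMSEQ) auto
    ultimately have "(\<integral>\<^sup>+\<omega>. ennreal (exp_minus (\<Sum>m. Z g (\<omega> m))) \<partial>M) = ennreal (exp_minus (\<Sum>m. a m))"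
      unfolding fin by (rule LIMSEQ_unique)
    moreover have "(\<Sum>m. a m) = (\<integral>\<^sup>+x. ennreal (1 - exp_minus (g x)) \<partial>\<nu>)"
    proof -
      have "(\<Sum>m. a m) = (\<integral>\<^sup>+x. (\<Sum>m. ennreal (1 - exp_minus (g x)) * indicator (A m) x) \<partial>\<nu>)"
        unfolding a_def by (rule nn_integral_suminf[symmetric]) measurable
      also have "\<dots> = (\<integral>\<^sup>+x. ennreal (1 - exp_minus (g x)) \<partial>\<nu>)"
      proof (rule nn_integral_cong)
        fix x assume "x \<in> space \<nu>"
        then have "(\<Sum>m. indicator (A m) x :: ennreal) = 1"
          using suminf_indicator[OF A(4), of x] A(2) by (simp add: indicator_def)
        then show "(\<Sum>m. ennreal (1 - exp_minus (g x)) * indicator (A m) x) = ennreal (1 - exp_minus (g x))"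
          by (simp add: ennreal_suminf_cmult)
      qed
      finally show ?thesis .
    qed
    ultimately have "(\<integral>\<^sup>+\<omega>. ennreal (exp_minus (\<Sum>m. Z g (\<omega> m))) \<partial>M) =
      ennreal (exp_minus (\<integral>\<^sup>+x. ennreal (1 - exp_minus (g x)) \<partial>\<nu>))" by simp
    then show "(\<integral>\<^sup>+\<omega>. ennreal (exp_minus (\<integral>\<^sup>+x. g x \<partial>N \<omega>)) \<partial>M) =
      ennreal (exp_minus (\<integral>\<^sup>+x. ennreal (1 - exp_minus (g x)) \<partial>\<nu>))"
      by (subst nn_integral_cong[where v="\<lambda>\<omega>. ennreal (exp_minus (\<Sum>m. Z g (\<omega> m)))"]) (auto simp: nnN)
  qed
  \<comment> \<open>Passing to the image law turns the identity into the Poisson random measure,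
    which is the canonical form that \<open>poisson_law\<close> asks for.\<close>
  have "poisson_random_measure (distr M (measure_algebra \<nu>) N) (\<lambda>N. N) \<nu>"
  proof (rule poisson_random_measureI)
    fix g :: "'a \<Rightarrow> ennreal" assume g[measurable]: "g \<in> borel_measurable \<nu>"
    show "(\<integral>\<^sup>+\<omega>. ennreal (exp_minus (\<integral>\<^sup>+x. g x \<partial>\<omega>)) \<partial>distr M (measure_algebra \<nu>) N) =
      ennreal (exp_minus (\<integral>\<^sup>+x. ennreal (1 - exp_minus (g x)) \<partial>\<nu>))"
      by (subst nn_integral_distr) (auto simp: poisson_random_measure_laplace[OF prm])
  qed (auto intro: M.prob_space_distr)
  then show ?thesis by (intro exI[of _ "distr M (measure_algebra \<nu>) N"]) simp
qed

lemma poisson_random_measure_unique: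
  assumes "sets Q = sets (measure_algebra \<nu>)" "poisson_random_measure Q (\<lambda>N. N) \<nu>"
    and "sets Q' = sets (measure_algebra \<nu>)" "poisson_random_measure Q' (\<lambda>N. N) \<nu>"
  shows "Q = Q'"
proof (rule laplace_functional_eqI)
  show "finite_measure Q" "finite_measure Q'"
    using assms(2,4) by (auto simp: poisson_random_measure_def prob_space.finite_measure)
  fix g :: "_ \<Rightarrow> real" assume [measurable]: "g \<in> borel_measurable \<nu>"
  show "laplace_functional Q g = laplace_functional Q' g"
    using assms by (simp add: laplace_functional_eq_enn2real poisson_random_measure_laplace)
qed fact+

text \<open>Existence and uniqueness together give the definite description in
  \<open>poisson_law\<close> its meaning.\<close>

lemma poisson_law:
  assumes "sigma_finite_measure \<nu>" "space \<nu> \<noteq> {}"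
  shows "sets (poisson_law \<nu>) = sets (measure_algebra \<nu>)" "poisson_random_measure (poisson_law \<nu>) (\<lambda>N. N) \<nu>"
proof -
  let ?R = "\<lambda>Q. sets Q = sets (measure_algebra \<nu>) \<and> poisson_random_measure Q (\<lambda>N. N) \<nu>"
  have "?R (poisson_law \<nu>)"
    unfolding poisson_law_def
    by (rule theI') (use poisson_random_measure_exists[OF assms] poisson_random_measure_unique in blast)
  then show "sets (poisson_law \<nu>) = sets (measure_algebra \<nu>)" "poisson_random_measure (poisson_law \<nu>) (\<lambda>N. N) \<nu>"
    by auto
qed

section \<open>Completely random measures\<close>

lemma sets_crm_law [simp, measurable_cong]: "sets (crm_law \<rho> \<eta>) = sets (measure_algebra \<eta>)"
  by (simp add: crm_law_def)

text \<open>The integral of \<open>g\<close> against \<mu> is the integral of \<open>s * g y\<close>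
  against \<open>N\<close>, so the functional of \<mu> is that of \<open>N\<close> at
  \<open>(s, y) \<mapsto> s * g y\<close>. Tonelli places the integral over \<open>s\<close> inside,
  where it becomes the Laplace exponent of \<rho>.\<close>

lemma crm_law:
  fixes \<rho> :: "real measure" and \<eta> :: "'a measure"
  assumes \<rho>: "sigma_finite_measure \<rho>" "sets \<rho> = sets borel" and \<eta>: "sigma_finite_measure \<eta>" "space \<eta> \<noteq> {}"
  shows prob_space_crm_law: "prob_space (crm_law \<rho> \<eta>)"
    and nn_integral_crm_law: "g \<in> borel_measurable \<eta> \<Longrightarrow>
      (\<integral>\<^sup>+m. ennreal (exp_minus (\<integral>\<^sup>+y. g y \<partial>m)) \<partial>crm_law \<rho> \<eta>) =
      ennreal (exp_minus (\<integral>\<^sup>+y. \<integral>\<^sup>+s. ennreal (1 - exp_minus (ennreal s * g y)) \<partial>\<rho> \<partial>\<eta>))"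
proof -
  interpret \<rho>: sigma_finite_measure \<rho> by fact
  interpret \<eta>: sigma_finite_measure \<eta> by fact
  interpret pair_sigma_finite \<rho> \<eta> ..
  note [measurable_cong] = \<rho>(2)
  let ?Q = "poisson_law (\<rho> \<Otimes>\<^sub>M \<eta>)"
  have "space (\<rho> \<Otimes>\<^sub>M \<eta>) \<noteq> {}"
    using \<eta>(2) sets_eq_imp_space_eq[OF \<rho>(2)] by (simp add: space_pair_measure)
  note Q = poisson_law[OF P.sigma_finite_measure_axioms this]
  interpret Q: prob_space ?Q using Q(2) by (simp add: poisson_random_measure_def)
  let ?T = "\<lambda>N. distr (density N (\<lambda>(s, y). ennreal s)) \<eta> snd :: 'a measure"
  have spQ: "space ?Q = {m. sets m = sets (\<rho> \<Otimes>\<^sub>M \<eta>)}"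
    using sets_eq_imp_space_eq[OF Q(1)] by (simp add: space_measure_algebra)
  have T: "(\<integral>\<^sup>+y. g y \<partial>?T N) = (\<integral>\<^sup>+z. ennreal (fst z) * g (snd z) \<partial>N)"
    if [measurable]: "g \<in> borel_measurable \<eta>" and N: "N \<in> space ?Q" for g N
  proof -
    have [measurable_cong]: "sets N = sets (\<rho> \<Otimes>\<^sub>M \<eta>)" using N by (simp add: spQ)
    show ?thesis by (subst nn_integral_distr; simp?; subst nn_integral_density) (auto simp: split_beta')
  qed
  have Tm[measurable]: "?T \<in> measurable ?Q (measure_algebra \<eta>)"
  proof (rule measurable_measure_algebra)
    fix A assume A[measurable]: "A \<in> sets \<eta>"
    have "(\<lambda>N. \<integral>\<^sup>+z. ennreal (fst z) * indicator A (snd z) \<partial>N) \<in> borel_measurable (measure_algebra (\<rho> \<Otimes>\<^sub>M \<eta>))"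
      by (rule nn_integral_measurable_measure_algebra) measurable
    then have "(\<lambda>N. \<integral>\<^sup>+z. ennreal (fst z) * indicator A (snd z) \<partial>N) \<in> borel_measurable ?Q"
      by (simp add: Q(1) cong: measurable_cong_sets)
    moreover have "(\<integral>\<^sup>+z. ennreal (fst z) * indicator A (snd z) \<partial>N) = emeasure (?T N) A" if "N \<in> space ?Q" for N
      using T[OF _ that, of "indicator A"] by simp
    ultimately show "(\<lambda>N. emeasure (?T N) A) \<in> borel_measurable ?Q"
      by (simp cong: measurable_cong)
  qed simp
  show "prob_space (crm_law \<rho> \<eta>)"
    unfolding crm_law_def by (rule Q.prob_space_distr) simp
  assume g[measurable]: "g \<in> borel_measurable \<eta>"
  have "(\<integral>\<^sup>+m. ennreal (exp_minus (\<integral>\<^sup>+y. g y \<partial>m)) \<partial>crm_law \<rho> \<eta>) =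
    (\<integral>\<^sup>+N. ennreal (exp_minus (\<integral>\<^sup>+z. ennreal (fst z) * g (snd z) \<partial>N)) \<partial>?Q)"
    unfolding crm_law_def by (subst nn_integral_distr) (auto simp: T cong: nn_integral_cong)
  also have "\<dots> = ennreal (exp_minus (\<integral>\<^sup>+z. ennreal (1 - exp_minus (ennreal (fst z) * g (snd z))) \<partial>(\<rho> \<Otimes>\<^sub>M \<eta>)))"
    by (rule poisson_random_measure_laplace[OF Q(2)]) measurable
  also have "(\<integral>\<^sup>+z. ennreal (1 - exp_minus (ennreal (fst z) * g (snd z))) \<partial>(\<rho> \<Otimes>\<^sub>M \<eta>)) =
    (\<integral>\<^sup>+y. \<integral>\<^sup>+s. ennreal (1 - exp_minus (ennreal s * g y)) \<partial>\<rho> \<partial>\<eta>)"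
    by (subst nn_integral_snd[symmetric]) simp_all
  finally show "(\<integral>\<^sup>+m. ennreal (exp_minus (\<integral>\<^sup>+y. g y \<partial>m)) \<partial>crm_law \<rho> \<eta>) =
      ennreal (exp_minus (\<integral>\<^sup>+y. \<integral>\<^sup>+s. ennreal (1 - exp_minus (ennreal s * g y)) \<partial>\<rho> \<partial>\<eta>))" .
qed

section \<open>Gamma integrals\<close>

text \<open>The derivative of \<open>x powr p\<close> may blow up at 0, so the substitution is made
  on compact intervals inside the open half-line; both sides converge monotonically as the intervals
  exhaust it.\<close>

lemma nn_integral_powr_substitution:
  fixes f :: "real \<Rightarrow> ennreal"
  assumes p: "0 < p" and f[measurable]: "f \<in> borel_measurable borel"
  shows "(\<integral>\<^sup>+x. f (x powr p) * ennreal (p * x powr (p - 1)) * indicator {0<..} x \<partial>lborel) =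
    (\<integral>\<^sup>+x. f x * indicator {0<..} x \<partial>lborel)"
proof -
  \<comment> \<open>\<open>1 / (n + 2) < n + 2\<close> for every natural \<open>n\<close>, so no
    interval is degenerate.\<close>
  let ?a = "\<lambda>n. 1 / (real n + 2)" and ?b = "\<lambda>n. real n + 2"
  have eq: "(\<integral>\<^sup>+x. f x * indicator {?a n powr p..?b n powr p} x \<partial>lborel) =
    (\<integral>\<^sup>+x. f (x powr p) * ennreal (p * x powr (p - 1)) * indicator {?a n..?b n} x \<partial>lborel)" for n
  proof (rule nn_integral_substitution_aux)
    have "?a n \<le> 1" "1 < ?b n" by auto
    then show "?a n < ?b n" by linarith
    have pos: "0 < x" if "x \<in> {?a n..?b n}" for x
    proof -
      have "0 < ?a n" by simp
      also have "\<dots> \<le> x" using that by simp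
      finally show ?thesis .
    qed
    show "((\<lambda>x. x powr p) has_real_derivative p * x powr (p - 1)) (at x)" if "x \<in> {?a n..?b n}" for x
      using pos[OF that] by (rule has_real_derivative_powr)
    show "continuous_on {?a n..?b n} (\<lambda>x. p * x powr (p - 1))"
      by (intro continuous_intros) (use pos in auto)
  qed (use p in auto)
  have mono_a: "?a m \<le> ?a n" if "n \<le> m" for n m by (rule divide_left_mono) (use that in auto)
  have ev: "\<forall>\<^sub>F n in sequentially. ?a n \<le> x \<and> x \<le> ?b n" if "0 < x" for x
  proof -
    obtain N :: nat where N: "max x (1 / x) < real N" using reals_Archimedean2 by blast
    have "?a n \<le> x \<and> x \<le> ?b n" if "n \<ge> N" for n
    proof -
      have "real N \<le> real n" using that by simp
      then have "1 / x < ?b n" "x < ?b n" using N by auto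
      then show ?thesis using \<open>0 < x\<close> by (auto simp: field_simps)
    qed
    then show ?thesis by (auto simp: eventually_sequentially)
  qed
  have "(\<lambda>n. \<integral>\<^sup>+x. f x * indicator {?a n powr p..?b n powr p} x \<partial>lborel) \<longlonglongrightarrow>
    (\<integral>\<^sup>+x. f x * indicator {0<..} x \<partial>lborel)"
  proof (rule nn_integral_LIMSEQ)
    show "incseq (\<lambda>n x. f x * indicator {?a n powr p..?b n powr p} x)"
    proof (rule incseq_SucI, rule le_funI)
      fix n x
      have "?a (Suc n) powr p \<le> ?a n powr p" "?b n powr p \<le> ?b (Suc n) powr p"
        using p mono_a[of n "Suc n"] by (auto intro!: powr_mono2)
      then show "f x * indicator {?a n powr p..?b n powr p} x \<le> f x * indicator {?a (Suc n) powr p..?b (Suc n) powr p} x"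
        by (intro mult_left_mono) (auto split: split_indicator)
    qed
    show "(\<lambda>n. f x * indicator {?a n powr p..?b n powr p} x) \<longlonglongrightarrow> f x * indicator {0<..} x" for x
    proof (rule tendsto_eventually)
      show "\<forall>\<^sub>F n in sequentially. f x * indicator {?a n powr p..?b n powr p} x = f x * indicator {0<..} x"
      proof (cases "0 < x")
        case True
        have "\<forall>\<^sub>F n in sequentially. ?a n \<le> x powr (1/p) \<and> x powr (1/p) \<le> ?b n"
          by (rule ev) (use True in simp)
        then show ?thesis
        proof eventually_elim
          case (elim n)
          then have "?a n powr p \<le> (x powr (1/p)) powr p" "(x powr (1/p)) powr p \<le> ?b n powr p"
            using p by (auto intro!: powr_mono2)
          then show ?case using p True by (simp add: powr_powr)
        qed
      next
        case False
        have "\<not> ?a n powr p \<le> x" for n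
        proof -
          have "0 < ?a n powr p" by simp
          then show ?thesis using False by linarith
        qed
        then show ?thesis using False by simp
      qed
    qed
  qed measurable
  moreover have "(\<lambda>n. \<integral>\<^sup>+x. f (x powr p) * ennreal (p * x powr (p - 1)) * indicator {?a n..?b n} x \<partial>lborel) \<longlonglongrightarrow>
    (\<integral>\<^sup>+x. f (x powr p) * ennreal (p * x powr (p - 1)) * indicator {0<..} x \<partial>lborel)"
  proof (rule nn_integral_LIMSEQ)
    show "incseq (\<lambda>n x. f (x powr p) * ennreal (p * x powr (p - 1)) * indicator {?a n..?b n} x)"
    proof (rule incseq_SucI, rule le_funI)
      fix n x
      show "f (x powr p) * ennreal (p * x powr (p - 1)) * indicator {?a n..?b n} x \<le>
        f (x powr p) * ennreal (p * x powr (p - 1)) * indicator {?a (Suc n)..?b (Suc n)} x"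
        using mono_a[of n "Suc n"] by (intro mult_left_mono) (auto split: split_indicator)
    qed
    show "(\<lambda>n. f (x powr p) * ennreal (p * x powr (p - 1)) * indicator {?a n..?b n} x) \<longlonglongrightarrow>
      f (x powr p) * ennreal (p * x powr (p - 1)) * indicator {0<..} x" for x
    proof (rule tendsto_eventually)
      show "\<forall>\<^sub>F n in sequentially. f (x powr p) * ennreal (p * x powr (p - 1)) * indicator {?a n..?b n} x =
        f (x powr p) * ennreal (p * x powr (p - 1)) * indicator {0<..} x"
      proof (cases "0 < x")
        case True
        from ev[OF True] show ?thesis by eventually_elim (use True in auto)
      next
        case False
        have "\<not> ?a n \<le> x" for n
        proof -
          have "0 < ?a n" by simp
          then show ?thesis using False by linarith
        qed
        then show ?thesis using False by simp
      qed
    qed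
  qed measurable
  ultimately show ?thesis unfolding eq by (rule LIMSEQ_unique[THEN sym])
qed

lemma nn_integral_Gamma_rate:
  assumes a: "0 < a" and c: "0 < c"
  shows "(\<integral>\<^sup>+s. ennreal (if 0 < s then s powr (a - 1) * exp (- c * s) else 0) \<partial>lborel) = ennreal (Gamma a / c powr a)"
proof -
  let ?f = "\<lambda>t. ennreal (indicator {0..} t * t powr (a - 1) / exp t)"
  have "ennreal (Gamma a) = (\<integral>\<^sup>+t. ?f t \<partial>lborel)" by (rule Gamma_conv_nn_integral_real[OF a])
  also have "\<dots> = ennreal \<bar>c\<bar> * (\<integral>\<^sup>+s. ?f (0 + c * s) \<partial>lborel)"
    by (rule nn_integral_real_affine) (use c in auto)
  also have "(\<integral>\<^sup>+s. ?f (0 + c * s) \<partial>lborel) =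
    (\<integral>\<^sup>+s. ennreal (c powr (a - 1)) * ennreal (if 0 < s then s powr (a - 1) * exp (- c * s) else 0) \<partial>lborel)"
    using c by (intro nn_integral_cong)
      (auto simp: indicator_def powr_mult exp_minus field_simps zero_le_mult_iff simp flip: ennreal_mult)
  also have "\<dots> = ennreal (c powr (a - 1)) * (\<integral>\<^sup>+s. ennreal (if 0 < s then s powr (a - 1) * exp (- c * s) else 0) \<partial>lborel)"
    by (rule nn_integral_cmult) simp
  also have "ennreal \<bar>c\<bar> * (ennreal (c powr (a - 1)) * (\<integral>\<^sup>+s. ennreal (if 0 < s then s powr (a - 1) * exp (- c * s) else 0) \<partial>lborel)) =
    ennreal (c powr a) * (\<integral>\<^sup>+s. ennreal (if 0 < s then s powr (a - 1) * exp (- c * s) else 0) \<partial>lborel)"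
    using c by (simp add: mult.assoc[symmetric] powr_mult_base flip: ennreal_mult)
  finally have *: "ennreal (Gamma a) = ennreal (c powr a) * (\<integral>\<^sup>+s. ennreal (if 0 < s then s powr (a - 1) * exp (- c * s) else 0) \<partial>lborel)" .
  have "ennreal (1 / c powr a) * ennreal (Gamma a) =
    (\<integral>\<^sup>+s. ennreal (if 0 < s then s powr (a - 1) * exp (- c * s) else 0) \<partial>lborel)"
    unfolding * using c by (simp add: mult.assoc[symmetric] flip: ennreal_mult)
  then show ?thesis using a by (simp add: Gamma_real_nonneg flip: ennreal_mult)
qed

lemma sets_gamma_law [simp, measurable_cong]: "sets (gamma_law a b) = sets borel"
  by (simp add: gamma_law_def)

lemma space_gamma_law [simp]: "space (gamma_law a b) = UNIV"
  by (simp add: gamma_law_def)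

lemma nn_integral_gamma_law:
  assumes [measurable]: "f \<in> borel_measurable borel" and "0 < a" "0 \<le> b"
  shows "(\<integral>\<^sup>+x. f x \<partial>gamma_law a b) = ennreal (b powr a / Gamma a) *
    (\<integral>\<^sup>+x. f x * ennreal (x powr (a - 1) * exp (- b * x)) * indicator {0<..} x \<partial>lborel)"
proof -
  have G: "Gamma a \<noteq> 0" using Gamma_real_pos[of a] assms by linarith
  have "(\<integral>\<^sup>+x. f x \<partial>gamma_law a b) = (\<integral>\<^sup>+x. ennreal (if 0 < x then b powr a / Gamma a * x powr (a - 1) * exp (- b * x) else 0) * f x \<partial>lborel)"
    unfolding gamma_law_def by (subst nn_integral_density) auto
  also have "\<dots> = (\<integral>\<^sup>+x. ennreal (b powr a / Gamma a) * (f x * ennreal (x powr (a - 1) * exp (- b * x)) * indicator {0<..} x) \<partial>lborel)"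
  proof (rule nn_integral_cong)
    fix x
    have "ennreal (b powr a / Gamma a * x powr (a - 1) * exp (- b * x)) =
      ennreal (b powr a / Gamma a) * ennreal (x powr (a - 1) * exp (- b * x))"
      using G assms by (subst ennreal_mult[symmetric]) (auto simp: mult.assoc)
    then show "ennreal (if 0 < x then b powr a / Gamma a * x powr (a - 1) * exp (- b * x) else 0) * f x =
      ennreal (b powr a / Gamma a) * (f x * ennreal (x powr (a - 1) * exp (- b * x)) * indicator {0<..} x)"
      by (auto simp: mult_ac split: split_indicator)
  qed
  also have "\<dots> = ennreal (b powr a / Gamma a) *
    (\<integral>\<^sup>+x. f x * ennreal (x powr (a - 1) * exp (- b * x)) * indicator {0<..} x \<partial>lborel)"
    by (rule nn_integral_cmult) measurable
  finally show ?thesis .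
qed

lemma prob_space_gamma_law:
  assumes a: "0 < a" and b: "0 < b" shows "prob_space (gamma_law a b)"
proof (rule prob_spaceI)
  have G: "Gamma a \<noteq> 0" using Gamma_real_pos[of a] assms by linarith
  have "emeasure (gamma_law a b) (space (gamma_law a b)) = (\<integral>\<^sup>+x. 1 \<partial>gamma_law a b)" by simp
  also have "\<dots> = ennreal (b powr a / Gamma a) * (\<integral>\<^sup>+x. ennreal (if 0 < x then x powr (a - 1) * exp (- b * x) else 0) \<partial>lborel)"
    using a b by (subst nn_integral_gamma_law) (auto intro!: arg_cong2[where f="(*)"] nn_integral_cong split: split_indicator)
  also have "\<dots> = 1" unfolding nn_integral_Gamma_rate[OF a b]
    using a b G by (subst ennreal_mult[symmetric]) auto
  finally show "emeasure (gamma_law a b) (space (gamma_law a b)) = 1" .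
qed

lemma AE_gamma_law: "AE x in gamma_law a b. 0 < x"
  unfolding gamma_law_def by (subst AE_density) (auto intro!: AE_I2)

lemma laplace_gamma_law:
  assumes a: "0 < a" and b: "0 < b" and t: "0 \<le> t"
  shows "(\<integral>\<^sup>+x. ennreal (exp_minus (ennreal x * ennreal t)) \<partial>gamma_law a b) = ennreal ((b / (b + t)) powr a)"
proof -
  have G: "Gamma a \<noteq> 0" using Gamma_real_pos[of a] assms by linarith
  have "(\<integral>\<^sup>+x. ennreal (exp_minus (ennreal x * ennreal t)) \<partial>gamma_law a b) = ennreal (b powr a / Gamma a) *
    (\<integral>\<^sup>+x. ennreal (exp_minus (ennreal x * ennreal t)) * ennreal (x powr (a - 1) * exp (- b * x)) * indicator {0<..} x \<partial>lborel)"
    using a b by (intro nn_integral_gamma_law) auto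
  also have "(\<integral>\<^sup>+x. ennreal (exp_minus (ennreal x * ennreal t)) * ennreal (x powr (a - 1) * exp (- b * x)) * indicator {0<..} x \<partial>lborel) =
    (\<integral>\<^sup>+x. ennreal (if 0 < x then x powr (a - 1) * exp (- (b + t) * x) else 0) \<partial>lborel)"
  proof (rule nn_integral_cong)
    fix x :: real
    show "ennreal (exp_minus (ennreal x * ennreal t)) * ennreal (x powr (a - 1) * exp (- b * x)) * indicator {0<..} x =
      ennreal (if 0 < x then x powr (a - 1) * exp (- (b + t) * x) else 0)"
    proof (cases "0 < x")
      case True
      then have "exp_minus (ennreal x * ennreal t) = exp (- (x * t))"
        using t by (simp add: exp_minus_ennreal flip: ennreal_mult)
      moreover have "exp (- (x * t)) * (x powr (a - 1) * exp (- b * x)) = x powr (a - 1) * exp (- (b + t) * x)"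
        by (simp add: algebra_simps flip: exp_add)
      ultimately show ?thesis using True by (simp flip: ennreal_mult)
    qed simp
  qed
  also have "\<dots> = ennreal (Gamma a / (b + t) powr a)"
    using a b t by (intro nn_integral_Gamma_rate) auto
  also have "ennreal (b powr a / Gamma a) * \<dots> = ennreal ((b / (b + t)) powr a)"
    using G a b t by (subst ennreal_mult[symmetric]) (auto simp: powr_divide)
  finally show ?thesis .
qed

section \<open>Generalised gamma random measures\<close>

lemma sets_gg_intensity [simp, measurable_cong]: "sets (gg_intensity \<alpha> b) = sets borel"
  by (simp add: gg_intensity_def)

lemma sigma_finite_gg_intensity: "sigma_finite_measure (gg_intensity \<alpha> b)"
  unfolding gg_intensity_def by (subst sigma_finite_measure.sigma_finite_iff_density_finite[OF sigma_finite_lborel]) auto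

text \<open>The integrand is singular at the left end when \<open>b = 0\<close>. The integrals of
  \<open>x powr (\<alpha> - 1)\<close> from 0 are known, so the integral over \<open>{0..b}\<close>
  is added on both sides and cancelled afterwards, being finite.\<close>

lemma nn_integral_powr_Icc:
  assumes \<alpha>: "0 < \<alpha>" and b: "0 \<le> b" and u: "0 \<le> u"
  shows "(\<integral>\<^sup>+v. ennreal ((b + v) powr (\<alpha> - 1)) * indicator {0..u} v \<partial>lborel) =
    ennreal (((u + b) powr \<alpha> - b powr \<alpha>) / \<alpha>)"
proof -
  let ?f = "\<lambda>x::real. ennreal (x powr (\<alpha> - 1))"
  have I: "(\<integral>\<^sup>+x. ?f x * indicator {0..c} x \<partial>lborel) = ennreal (c powr \<alpha> / \<alpha>)" if "0 \<le> c" for c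
    using nn_integral_has_integral_lebesgue'[OF _ has_integral_powr_from_0[of "\<alpha> - 1" c]] that \<alpha> by simp
  have mono: "b powr \<alpha> \<le> (u + b) powr \<alpha>" using b u \<alpha> by (intro powr_mono2) auto
  have shift: "(\<integral>\<^sup>+v. ?f (b + v) * indicator {0..u} v \<partial>lborel) = (\<integral>\<^sup>+x. ?f x * indicator {b..u + b} x \<partial>lborel)"
    by (subst nn_integral_real_affine[where c=1 and t=b])
       (auto intro!: nn_integral_cong split: split_indicator)
  have "(\<integral>\<^sup>+x. ?f x * indicator {b..u + b} x \<partial>lborel) + ennreal (b powr \<alpha> / \<alpha>) =
    (\<integral>\<^sup>+x. ?f x * indicator {b..u + b} x \<partial>lborel) + (\<integral>\<^sup>+x. ?f x * indicator {0..b} x \<partial>lborel)"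
    using I[OF b] by simp
  also have "\<dots> = (\<integral>\<^sup>+x. ?f x * indicator {b..u + b} x + ?f x * indicator {0..b} x \<partial>lborel)"
    by (rule nn_integral_add[symmetric]) auto
  also have "\<dots> = (\<integral>\<^sup>+x. ?f x * indicator {0..u + b} x \<partial>lborel)"
  proof (rule nn_integral_cong_AE)
    have "AE x in lborel. x \<noteq> b" by (rule AE_lborel_singleton)
    then show "AE x in lborel. ?f x * indicator {b..u + b} x + ?f x * indicator {0..b} x = ?f x * indicator {0..u + b} x"
      by eventually_elim (use b u in \<open>auto split: split_indicator\<close>)
  qed
  also have "\<dots> = ennreal ((u + b) powr \<alpha> / \<alpha>)" using b u by (intro I) auto
  also have "\<dots> = ennreal (((u + b) powr \<alpha> - b powr \<alpha>) / \<alpha>) + ennreal (b powr \<alpha> / \<alpha>)"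
    using \<alpha> mono by (subst ennreal_plus[symmetric]) (auto simp: diff_divide_distrib intro!: divide_right_mono)
  finally have "ennreal (b powr \<alpha> / \<alpha>) + (\<integral>\<^sup>+x. ?f x * indicator {b..u + b} x \<partial>lborel) =
    ennreal (b powr \<alpha> / \<alpha>) + ennreal (((u + b) powr \<alpha> - b powr \<alpha>) / \<alpha>)"
    by (simp only: add.commute)
  then show ?thesis unfolding shift by (subst (asm) ennreal_add_left_cancel) simp
qed

text \<open>Tonelli for \<open>1 - exp (- u s) = \<integral>\<^sub>0\<^sup>u s exp (- v s) dv\<close>.\<close>

lemma gg_intensity_laplace_exponent:
  assumes \<alpha>: "0 < \<alpha>" "\<alpha> < 1" and b: "0 \<le> b" and u: "0 \<le> u"
  shows "(\<integral>\<^sup>+s. ennreal (1 - exp_minus (ennreal s * ennreal u)) \<partial>gg_intensity \<alpha> b) =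
    ennreal (((u + b) powr \<alpha> - b powr \<alpha>) / \<alpha>)"
proof -
  let ?G = "Gamma (1 - \<alpha>)"
  have G: "0 < ?G" using \<alpha> by (intro Gamma_real_pos) auto
  let ?k = "\<lambda>s v. (if 0 < s then ennreal (1 / ?G * (s powr (1 - \<alpha> - 1) * exp (- (b + v) * s))) else 0) * indicator {0..u} v :: ennreal"
  have "(\<integral>\<^sup>+s. ennreal (1 - exp_minus (ennreal s * ennreal u)) \<partial>gg_intensity \<alpha> b) =
    (\<integral>\<^sup>+s. ennreal (if 0 < s then s powr (- \<alpha> - 1) * exp (- b * s) / ?G else 0) * ennreal (1 - exp_minus (ennreal s * ennreal u)) \<partial>lborel)"
    unfolding gg_intensity_def by (rule nn_integral_density) auto
  also have "\<dots> = (\<integral>\<^sup>+s. \<integral>\<^sup>+v. ?k s v \<partial>lborel \<partial>lborel)"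
  proof (rule nn_integral_cong)
    fix s :: real
    show "ennreal (if 0 < s then s powr (- \<alpha> - 1) * exp (- b * s) / ?G else 0) * ennreal (1 - exp_minus (ennreal s * ennreal u)) =
      (\<integral>\<^sup>+v. ?k s v \<partial>lborel)"
    proof (cases "0 < s")
      case True
      have e: "exp_minus (ennreal s * ennreal u) = exp (- (s * u))"
        using u True by (simp add: exp_minus_ennreal flip: ennreal_mult)
      have "(\<integral>\<^sup>+v. ennreal (s * exp (- v * s)) * indicator {0..u} v \<partial>lborel) = ennreal (- exp (- u * s) - - exp (- 0 * s))"
        using u True by (intro nn_integral_FTC_Icc) (auto intro!: derivative_eq_intros)
      then have i: "ennreal (1 - exp_minus (ennreal s * ennreal u)) = (\<integral>\<^sup>+v. ennreal (s * exp (- v * s)) * indicator {0..u} v \<partial>lborel)"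
        by (simp add: e mult.commute)
      have "ennreal (s powr (- \<alpha> - 1) * exp (- b * s) / ?G) * (\<integral>\<^sup>+v. ennreal (s * exp (- v * s)) * indicator {0..u} v \<partial>lborel) =
        (\<integral>\<^sup>+v. ennreal (s powr (- \<alpha> - 1) * exp (- b * s) / ?G) * (ennreal (s * exp (- v * s)) * indicator {0..u} v) \<partial>lborel)"
        by (rule nn_integral_cmult[symmetric]) measurable
      also have "\<dots> = (\<integral>\<^sup>+v. ?k s v \<partial>lborel)"
      proof (rule nn_integral_cong)
        fix v
        have sp: "s powr (- \<alpha> - 1) * s = s powr (1 - \<alpha> - 1)"
          using True by (simp add: powr_mult_base mult.commute)
        have "s powr (- \<alpha> - 1) * exp (- b * s) / ?G * (s * exp (- v * s)) =
          1 / ?G * ((s powr (- \<alpha> - 1) * s) * (exp (- b * s) * exp (- v * s)))" by simp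
        also have "\<dots> = 1 / ?G * (s powr (1 - \<alpha> - 1) * exp (- (b + v) * s))"
          unfolding sp by (simp add: exp_add[symmetric] algebra_simps)
        finally show "ennreal (s powr (- \<alpha> - 1) * exp (- b * s) / ?G) * (ennreal (s * exp (- v * s)) * indicator {0..u} v) = ?k s v"
          using True G by (simp add: mult.assoc[symmetric] flip: ennreal_mult)
      qed
      finally show ?thesis using True i by simp
    qed simp
  qed
  also have "\<dots> = (\<integral>\<^sup>+v. \<integral>\<^sup>+s. ?k s v \<partial>lborel \<partial>lborel)"
    by (rule lborel_pair.Fubini') measurable
  also have "\<dots> = (\<integral>\<^sup>+v. ennreal ((b + v) powr (\<alpha> - 1)) * indicator {0..u} v \<partial>lborel)"
  proof (rule nn_integral_cong_AE)
    \<comment> \<open>For \<open>b = 0\<close> the inner integral diverges at \<open>v = 0\<close>,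
      where its rate \<open>b + v\<close> vanishes; this single point is discarded.\<close>
    have "AE x in lborel. x \<noteq> (0::real)" by (rule AE_lborel_singleton)
    then show "AE v in lborel. (\<integral>\<^sup>+s. ?k s v \<partial>lborel) = ennreal ((b + v) powr (\<alpha> - 1)) * indicator {0..u} v"
    proof eventually_elim
      case (elim v)
      show ?case
      proof (cases "v \<in> {0..u}")
        case True
        with elim b have c: "0 < b + v" by auto
        have "(\<integral>\<^sup>+s. ?k s v \<partial>lborel) =
          (\<integral>\<^sup>+s. ennreal (1 / ?G) * ennreal (if 0 < s then s powr (1 - \<alpha> - 1) * exp (- (b + v) * s) else 0) \<partial>lborel)"
          using True G by (intro nn_integral_cong) (auto simp flip: ennreal_mult)
        also have "\<dots> = ennreal (1 / ?G) * (\<integral>\<^sup>+s. ennreal (if 0 < s then s powr (1 - \<alpha> - 1) * exp (- (b + v) * s) else 0) \<partial>lborel)"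
          by (rule nn_integral_cmult) measurable
        also have "\<dots> = ennreal (1 / ?G) * ennreal (?G / (b + v) powr (1 - \<alpha>))"
          using \<alpha> c by (subst nn_integral_Gamma_rate) auto
        also have "\<dots> = ennreal ((b + v) powr (\<alpha> - 1))"
        proof -
          have "(b + v) powr (\<alpha> - 1) = 1 / (b + v) powr (1 - \<alpha>)"
            using powr_minus_divide[of "b + v" "1 - \<alpha>"] by simp
          then show ?thesis using G c by (simp flip: ennreal_mult)
        qed
        finally show ?thesis using True by simp
      qed simp
    qed
  qed
  also have "\<dots> = ennreal (((u + b) powr \<alpha> - b powr \<alpha>) / \<alpha>)"
    using \<alpha> b u by (intro nn_integral_powr_Icc) auto
  finally show ?thesis .
qed

locale gg_setting =
  fixes \<alpha> :: real and \<eta> :: "'y measure"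
  assumes \<alpha>: "0 < \<alpha>" "\<alpha> < 1" and fin: "finite_measure \<eta>" and nonzero: "emeasure \<eta> (space \<eta>) \<noteq> 0"
begin

sublocale \<eta>: finite_measure \<eta> by (fact fin)

text \<open>Under \<open>Q0\<close> the total mass has Laplace transform
  \<open>exp (- (K * b powr \<alpha>))\<close>. Hence tilting by
  \<open>b = l powr (1 / \<alpha>)\<close> costs the factor \<open>exp (K * l)\<close>, and a gamma
  law of rate \<open>K\<close> is the one that cancels it.\<close>

definition K :: real where "K = measure \<eta> (space \<eta>) / \<alpha>"

abbreviation gg :: "real \<Rightarrow> 'y measure measure" where
  "gg b \<equiv> crm_law (gg_intensity \<alpha> b) \<eta>"

lemma mass_pos: "0 < measure \<eta> (space \<eta>)"
  using nonzero \<eta>.emeasure_eq_measure[of "space \<eta>"] by (simp add: zero_less_measure_iff)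

lemma K_pos: "0 < K"
  using mass_pos \<alpha> by (simp add: K_def)

lemma space_nonempty: "space \<eta> \<noteq> {}"
  using nonzero by auto

lemma prob_space_gg: "prob_space (gg b)"
  by (intro prob_space_crm_law sigma_finite_gg_intensity sets_gg_intensity space_nonempty)
     unfold_locales

lemma space_gg: "space (gg b) = {m. sets m = sets \<eta>}"
  using sets_eq_imp_space_eq[OF sets_crm_law[of "gg_intensity \<alpha> b" \<eta>]] by (simp add: space_measure_algebra)

text \<open>The subtracted term \<open>b powr \<alpha>\<close> integrates to the finite constant
  \<open>K * b powr \<alpha>\<close>. It is moved out as a factor because the remaining integral may
  be infinite.\<close>

lemma nn_integral_gg:
  assumes g[measurable]: "g \<in> borel_measurable \<eta>" "\<And>y. 0 \<le> g y" and b: "0 \<le> b"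
  shows "(\<integral>\<^sup>+m. ennreal (exp_minus (\<integral>\<^sup>+y. ennreal (g y) \<partial>m)) \<partial>gg b) =
    ennreal (exp_minus (\<integral>\<^sup>+y. ennreal ((g y + b) powr \<alpha> / \<alpha>) \<partial>\<eta>) * exp (K * b powr \<alpha>))"
proof -
  have "(\<integral>\<^sup>+m. ennreal (exp_minus (\<integral>\<^sup>+y. ennreal (g y) \<partial>m)) \<partial>gg b) =
    ennreal (exp_minus (\<integral>\<^sup>+y. \<integral>\<^sup>+s. ennreal (1 - exp_minus (ennreal s * ennreal (g y))) \<partial>gg_intensity \<alpha> b \<partial>\<eta>))"
    by (intro nn_integral_crm_law sigma_finite_gg_intensity sets_gg_intensity space_nonempty)
       (unfold_locales, measurable)
  also have "\<dots> = ennreal (exp_minus (\<integral>\<^sup>+y. ennreal (((g y + b) powr \<alpha> - b powr \<alpha>) / \<alpha>) \<partial>\<eta>))"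
    using \<alpha> b g(2) by (simp add: gg_intensity_laplace_exponent)
  also have "exp_minus (\<integral>\<^sup>+y. ennreal (((g y + b) powr \<alpha> - b powr \<alpha>) / \<alpha>) \<partial>\<eta>) =
    exp_minus (\<integral>\<^sup>+y. ennreal ((g y + b) powr \<alpha> / \<alpha>) \<partial>\<eta>) * exp (K * b powr \<alpha>)"
  proof -
    have "(\<integral>\<^sup>+y. ennreal ((g y + b) powr \<alpha> / \<alpha>) \<partial>\<eta>) =
      (\<integral>\<^sup>+y. ennreal (((g y + b) powr \<alpha> - b powr \<alpha>) / \<alpha>) + ennreal (b powr \<alpha> / \<alpha>) \<partial>\<eta>)"
    proof (rule nn_integral_cong)
      fix y
      have "b powr \<alpha> \<le> (g y + b) powr \<alpha>" using b g(2)[of y] \<alpha> by (intro powr_mono2) auto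
      then show "ennreal ((g y + b) powr \<alpha> / \<alpha>) =
        ennreal (((g y + b) powr \<alpha> - b powr \<alpha>) / \<alpha>) + ennreal (b powr \<alpha> / \<alpha>)"
        using \<alpha> by (subst ennreal_plus[symmetric]) (auto simp: diff_divide_distrib intro!: divide_right_mono)
    qed
    also have "\<dots> = (\<integral>\<^sup>+y. ennreal (((g y + b) powr \<alpha> - b powr \<alpha>) / \<alpha>) \<partial>\<eta>) + ennreal (K * b powr \<alpha>)"
      using \<alpha> by (subst nn_integral_add)
        (auto simp: K_def \<eta>.emeasure_eq_measure mult.commute simp flip: ennreal_mult)
    finally have *: "(\<integral>\<^sup>+y. ennreal ((g y + b) powr \<alpha> / \<alpha>) \<partial>\<eta>) =
      (\<integral>\<^sup>+y. ennreal (((g y + b) powr \<alpha> - b powr \<alpha>) / \<alpha>) \<partial>\<eta>) + ennreal (K * b powr \<alpha>)" .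
    show ?thesis unfolding * exp_minus_add using K_pos
      by (simp add: exp_minus_ennreal flip: exp_add)
  qed
  finally show ?thesis .
qed

abbreviation Q0 :: "'y measure measure" where "Q0 \<equiv> gg 0"

abbreviation mass :: "'y measure \<Rightarrow> ennreal" where "mass m \<equiv> emeasure m (space m)"

text \<open>Tilting by \<open>exp (- b * T)\<close> amounts to adding the constant \<open>b\<close>
  to the test function.\<close>

lemma nn_integral_tilt:
  assumes g[measurable]: "g \<in> borel_measurable \<eta>" "\<And>y. 0 \<le> g y" and b: "0 \<le> b"
  shows "(\<integral>\<^sup>+m. ennreal (exp_minus (\<integral>\<^sup>+y. ennreal (g y) \<partial>m) * exp_minus (ennreal b * mass m)) \<partial>Q0) =
    ennreal (exp_minus (\<integral>\<^sup>+y. ennreal ((g y + b) powr \<alpha> / \<alpha>) \<partial>\<eta>))"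
proof -
  have "(\<integral>\<^sup>+m. ennreal (exp_minus (\<integral>\<^sup>+y. ennreal (g y) \<partial>m) * exp_minus (ennreal b * mass m)) \<partial>Q0) =
    (\<integral>\<^sup>+m. ennreal (exp_minus (\<integral>\<^sup>+y. ennreal (g y + b) \<partial>m)) \<partial>Q0)"
  proof (rule nn_integral_cong)
    fix m assume "m \<in> space Q0"
    then have [measurable_cong]: "sets m = sets \<eta>" by (simp add: space_gg)
    have "(\<integral>\<^sup>+y. ennreal (g y + b) \<partial>m) = (\<integral>\<^sup>+y. ennreal (g y) + ennreal b \<partial>m)"
      using g(2) b by (simp add: ennreal_plus)
    also have "\<dots> = (\<integral>\<^sup>+y. ennreal (g y) \<partial>m) + ennreal b * mass m"
      by (subst nn_integral_add) auto
    finally show "ennreal (exp_minus (\<integral>\<^sup>+y. ennreal (g y) \<partial>m) * exp_minus (ennreal b * mass m)) =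
      ennreal (exp_minus (\<integral>\<^sup>+y. ennreal (g y + b) \<partial>m))" by (simp add: exp_minus_add)
  qed
  also have "\<dots> = ennreal (exp_minus (\<integral>\<^sup>+y. ennreal ((g y + b) powr \<alpha> / \<alpha>) \<partial>\<eta>))"
    using b g by (subst nn_integral_gg) auto
  finally show ?thesis .
qed

text \<open>Both sides have the same Laplace functional. All laws \<open>gg b\<close> become
  densities with respect to the one law \<open>Q0\<close>, so that mixing over \<open>b\<close> can
  be carried out under the integral.\<close>

lemma gg_eq_tilt:
  assumes b: "0 \<le> b"
  shows "gg b = density Q0 (\<lambda>m. ennreal (exp_minus (ennreal b * mass m) * exp (K * b powr \<alpha>)))"
    (is "_ = density _ ?w")
proof (rule laplace_functional_eqI)
  have w[measurable]: "?w \<in> borel_measurable Q0" by measurable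
  have L: "(\<integral>\<^sup>+m. ennreal (exp_minus (\<integral>\<^sup>+y. ennreal (g y) \<partial>m)) \<partial>density Q0 ?w) =
     (\<integral>\<^sup>+m. ennreal (exp_minus (\<integral>\<^sup>+y. ennreal (g y) \<partial>m)) \<partial>gg b)"
    if g[measurable]: "g \<in> borel_measurable \<eta>" "\<And>y. 0 \<le> g y" for g
  proof -
    have "(\<integral>\<^sup>+m. ennreal (exp_minus (\<integral>\<^sup>+y. ennreal (g y) \<partial>m)) \<partial>density Q0 ?w) =
      (\<integral>\<^sup>+m. ?w m * ennreal (exp_minus (\<integral>\<^sup>+y. ennreal (g y) \<partial>m)) \<partial>Q0)"
      by (rule nn_integral_density) measurable
    also have "\<dots> = (\<integral>\<^sup>+m. ennreal (exp (K * b powr \<alpha>)) * ennreal (exp_minus (\<integral>\<^sup>+y. ennreal (g y) \<partial>m) * exp_minus (ennreal b * mass m)) \<partial>Q0)"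
      by (intro nn_integral_cong) (simp add: mult_ac flip: ennreal_mult)
    also have "\<dots> = ennreal (exp (K * b powr \<alpha>)) * (\<integral>\<^sup>+m. ennreal (exp_minus (\<integral>\<^sup>+y. ennreal (g y) \<partial>m) * exp_minus (ennreal b * mass m)) \<partial>Q0)"
      by (rule nn_integral_cmult) measurable
    also have "\<dots> = (\<integral>\<^sup>+m. ennreal (exp_minus (\<integral>\<^sup>+y. ennreal (g y) \<partial>m)) \<partial>gg b)"
      using g b by (simp add: nn_integral_tilt nn_integral_gg mult_ac flip: ennreal_mult)
    finally show ?thesis .
  qed
  interpret B: prob_space "gg b" by (rule prob_space_gg)
  show "finite_measure (gg b)" by unfold_locales
  show "finite_measure (density Q0 ?w)"
  proof (rule finite_measureI)
    have "emeasure (density Q0 ?w) (space (density Q0 ?w)) = (\<integral>\<^sup>+m. 1 \<partial>density Q0 ?w)" by simp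
    also have "\<dots> = (\<integral>\<^sup>+m. ennreal (exp_minus (\<integral>\<^sup>+y. ennreal 0 \<partial>m)) \<partial>density Q0 ?w)" by simp
    also have "\<dots> = (\<integral>\<^sup>+m. 1 \<partial>gg b)" by (subst L) auto
    finally show "emeasure (density Q0 ?w) (space (density Q0 ?w)) \<noteq> \<infinity>" by (simp add: B.emeasure_space_1)
  qed
  fix g :: "'y \<Rightarrow> real" assume g: "g \<in> borel_measurable \<eta>" "\<And>y. 0 \<le> g y"
  show "laplace_functional (gg b) g = laplace_functional (density Q0 ?w) g"
    using L[OF g] g by (subst (1 2) laplace_functional_eq_enn2real[where K=\<eta>]) auto
qed auto

lemma laplace_mass:
  assumes "0 \<le> b"
  shows "(\<integral>\<^sup>+m. ennreal (exp_minus (ennreal b * mass m)) \<partial>Q0) = ennreal (exp (- (K * b powr \<alpha>)))"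
proof -
  have "(\<integral>\<^sup>+m. ennreal (exp_minus (ennreal b * mass m)) \<partial>Q0) =
    (\<integral>\<^sup>+m. ennreal (exp_minus (\<integral>\<^sup>+y. ennreal 0 \<partial>m) * exp_minus (ennreal b * mass m)) \<partial>Q0)" by simp
  also have "\<dots> = ennreal (exp_minus (\<integral>\<^sup>+y. ennreal ((0 + b) powr \<alpha> / \<alpha>) \<partial>\<eta>))"
    using assms by (intro nn_integral_tilt) auto
  also have "(\<integral>\<^sup>+y. ennreal ((0 + b) powr \<alpha> / \<alpha>) \<partial>\<eta>) = ennreal (K * b powr \<alpha>)"
    using \<alpha> by (simp add: K_def \<eta>.emeasure_eq_measure mult.commute flip: ennreal_mult)
  finally show ?thesis using K_pos by (simp add: exp_minus_ennreal)
qed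

text \<open>\<open>exp_minus (b * T)\<close> tends to the indicator of \<open>T < \<top>\<close> as
  \<open>b\<close> tends to 0 and to that of \<open>T = 0\<close> as \<open>b\<close> tends to
  infinity, while its mean \<open>exp (- (K * b powr \<alpha>))\<close> tends to 1 and to 0.\<close>

lemma AE_mass: "AE m in Q0. 0 < mass m \<and> mass m < \<top>"
proof -
  interpret Q0: prob_space Q0 by (rule prob_space_gg)
  have lim: "emeasure Q0 A = ennreal r"
    if b: "\<And>n. 0 \<le> b n" and A[measurable]: "A \<in> sets Q0"
      and l: "\<And>m. m \<in> space Q0 \<Longrightarrow> (\<lambda>n. exp_minus (ennreal (b n) * mass m)) \<longlonglongrightarrow> indicator A m"
      and r: "(\<lambda>n. exp (- (K * b n powr \<alpha>))) \<longlonglongrightarrow> r" for b A r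
  proof -
    have "(\<lambda>n. \<integral>\<^sup>+m. ennreal (exp_minus (ennreal (b n) * mass m)) \<partial>Q0) \<longlonglongrightarrow> (\<integral>\<^sup>+m. ennreal (indicator A m) \<partial>Q0)"
      by (rule nn_integral_dominated_convergence[where w="\<lambda>_. 1"])
         (auto simp: Q0.emeasure_space_1 intro!: tendsto_ennrealI l)
    moreover have "(\<lambda>n. \<integral>\<^sup>+m. ennreal (exp_minus (ennreal (b n) * mass m)) \<partial>Q0) \<longlonglongrightarrow> ennreal r"
      unfolding laplace_mass[OF b] by (intro tendsto_ennrealI r)
    ultimately have "(\<integral>\<^sup>+m. ennreal (indicator A m) \<partial>Q0) = ennreal r" by (rule LIMSEQ_unique)
    then show ?thesis using nn_integral_indicator[OF A] by (simp only: ennreal_indicator)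
  qed
  have inf: "emeasure Q0 {m\<in>space Q0. mass m < \<top>} = ennreal 1"
  proof (rule lim[of "\<lambda>n. 1 / (real n + 1)"])
    have b0: "(\<lambda>n. 1 / (real n + 1)) \<longlonglongrightarrow> 0"
      using LIMSEQ_inverse_real_of_nat by (simp add: inverse_eq_divide add.commute)
    show "(\<lambda>n. exp (- (K * (1 / (real n + 1)) powr \<alpha>))) \<longlonglongrightarrow> 1"
    proof -
      have "(\<lambda>n. (1 / (real n + 1)) powr \<alpha>) \<longlonglongrightarrow> 0"
        using tendsto_powr2[OF b0 tendsto_const] \<alpha> by (auto simp: eventually_sequentially)
      then have "(\<lambda>n. exp (- (K * (1 / (real n + 1)) powr \<alpha>))) \<longlonglongrightarrow> exp (- (K * 0))"
        by (intro tendsto_intros)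
      then show ?thesis by simp
    qed
    show "{m\<in>space Q0. mass m < \<top>} \<in> sets Q0" by measurable
    fix m assume m: "m \<in> space Q0"
    show "(\<lambda>n. exp_minus (ennreal (1 / (real n + 1)) * mass m)) \<longlonglongrightarrow> indicator {m\<in>space Q0. mass m < \<top>} m"
    proof (cases "mass m")
      case (real r)
      have "(\<lambda>n. exp (- (1 / (real n + 1) * r))) \<longlonglongrightarrow> exp (- (0 * r))"
        by (intro tendsto_intros b0)
      then show ?thesis using real m by (simp add: exp_minus_ennreal flip: ennreal_mult)
    next
      case top
      have "ennreal (1 / (real n + 1)) * mass m = \<top>" for n by (simp add: top ennreal_mult_top)
      then show ?thesis using top by simp
    qed
  qed simp
  have zero: "emeasure Q0 {m\<in>space Q0. mass m = 0} = ennreal 0"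
  proof (rule lim[of "\<lambda>n. real n"])
    have a: "filterlim (\<lambda>n. real n powr \<alpha>) at_top sequentially"
      using \<alpha> by (intro filterlim_compose[OF real_powr_at_top filterlim_real_sequentially]) auto
    have "filterlim (\<lambda>n. K * real n powr \<alpha>) at_top sequentially"
      by (rule filterlim_tendsto_pos_mult_at_top[OF tendsto_const K_pos a])
    then show "(\<lambda>n. exp (- (K * real n powr \<alpha>))) \<longlonglongrightarrow> 0"
      by (intro filterlim_compose[OF exp_at_bot]) (simp add: filterlim_uminus_at_bot)
    show "{m\<in>space Q0. mass m = 0} \<in> sets Q0" by measurable
    fix m assume m: "m \<in> space Q0"
    show "(\<lambda>n. exp_minus (ennreal (real n) * mass m)) \<longlonglongrightarrow> indicator {m\<in>space Q0. mass m = 0} m"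
    proof (cases "mass m = 0")
      case False
      have "(\<lambda>n. exp_minus (ennreal (real n) * mass m)) \<longlonglongrightarrow> 0"
      proof (cases "mass m")
        case (real r)
        with False have r: "0 < r" by (cases "r = 0") auto
        have "filterlim (\<lambda>n. r * real n) at_top sequentially"
          by (rule filterlim_tendsto_pos_mult_at_top[OF tendsto_const r filterlim_real_sequentially])
        then have "(\<lambda>n. exp (- (r * real n))) \<longlonglongrightarrow> 0"
          by (intro filterlim_compose[OF exp_at_bot]) (simp add: filterlim_uminus_at_bot)
        then show ?thesis using real
          by (simp add: exp_minus_ennreal mult.commute flip: ennreal_mult)
      next
        case top
        have "\<forall>\<^sub>F n in sequentially. exp_minus (ennreal (real n) * mass m) = 0"
          using eventually_gt_at_top[of 0] by eventually_elim (simp add: top ennreal_mult_top)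
        then show ?thesis by (rule tendsto_eventually)
      qed
      then show ?thesis using False by simp
    qed (use m in simp)
  qed simp
  have 1: "AE m in Q0. mass m < \<top>"
  proof (rule Q0.AE_prob_1[of "{m\<in>space Q0. mass m < \<top>}", THEN eventually_mono])
    show "measure Q0 {m\<in>space Q0. mass m < \<top>} = 1" using inf by (simp add: measure_def)
  qed auto
  have 2: "AE m in Q0. mass m \<noteq> 0"
  proof (rule AE_I)
    show "{m\<in>space Q0. mass m = 0} \<in> sets Q0" by measurable
    show "emeasure Q0 {m\<in>space Q0. mass m = 0} = 0" using zero by simp
  qed auto
  from 1 2 show ?thesis by eventually_elim (auto simp: zero_less_iff_neq_zero)
qed

end

section \<open>Sums over set partitions\<close>

text \<open>Deleting \<open>x\<close> from its block, and the block too if nothing is left of it,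
  recovers a partition of \<open>A\<close>; this inverts both ways of inserting \<open>x\<close>.
  The identity drives the recursion of the EPPF as well as the step to one more derivative in Faa di
  Bruno's formula.\<close>

lemma sum_partition_on_insert:
  fixes F :: "'a set set \<Rightarrow> 'b::comm_monoid_add"
  assumes A: "finite A" and x: "x \<notin> A"
  shows "(\<Sum>q | partition_on (insert x A) q. F q) =
    (\<Sum>q | partition_on A q. F (insert {x} q) + (\<Sum>C\<in>q. F (insert (insert x C) (q - {C}))))"
proof -
  let ?P = "{q. partition_on A q}"
  let ?j = "\<lambda>(q, C). insert (insert x C) (q - {C})"
  have fin: "finite ?P" by (rule finitely_many_partition_on[OF A])
  have finq: "finite q" if "q \<in> ?P" for q using that A finite_elements by auto
  have xq: "x \<notin> C" if "q \<in> ?P" "C \<in> q" for q C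
    using that x by (auto simp: partition_on_def)
  have split: "partition_on (A - C) (q - {C}) \<and> C \<subseteq> A \<and> C \<noteq> {}" if q: "q \<in> ?P" "C \<in> q" for q C
  proof -
    have "disjnt C (\<Union>(q - {C}))" using q by (auto simp: partition_on_def disjnt_def disjoint_def)
    moreover have "partition_on A (insert C (q - {C}))" using q by (simp add: insert_absorb)
    ultimately show ?thesis using partition_on_insert by blast
  qed
  have S1: "partition_on (insert x A) (insert {x} q)" if "q \<in> ?P" for q
  proof -
    have "disjnt {x} (\<Union>q)" using xq[OF that] by (auto simp: disjnt_def)
    then show ?thesis using that x by (simp add: partition_on_insert)
  qed
  have S2: "partition_on (insert x A) (insert (insert x C) (q - {C}))" if q: "q \<in> ?P" "C \<in> q" for q C
  proof -
    have "disjnt (insert x C) (\<Union>(q - {C}))"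
      using q xq[OF q(1)] by (auto simp: partition_on_def disjnt_def disjoint_def)
    moreover have "insert x A - insert x C = A - C" using x by auto
    ultimately show ?thesis using split[OF q] by (auto simp: partition_on_insert)
  qed
  have eq: "{q. partition_on (insert x A) q} = insert {x} ` ?P \<union> ?j ` Sigma ?P (\<lambda>q. q)"
  proof (intro equalityI subsetI)
    fix r assume "r \<in> {q. partition_on (insert x A) q}"
    then have r: "partition_on (insert x A) r" by simp
    then obtain B where B: "B \<in> r" "x \<in> B" by (auto simp: partition_on_def)
    have d: "disjnt B (\<Union>(r - {B}))" using r B by (auto simp: partition_on_def disjnt_def disjoint_def)
    have rB: "r = insert B (r - {B})" using B by auto
    have p: "partition_on (insert x A - B) (r - {B})" "B \<subseteq> insert x A"
      using r partition_on_insert[OF d, of "insert x A"] rB by auto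
    show "r \<in> insert {x} ` ?P \<union> ?j ` Sigma ?P (\<lambda>q. q)"
    proof (cases "B = {x}")
      case True
      then have "partition_on A (r - {B})" using p x by simp
      then show ?thesis using rB True by (intro UnI1 image_eqI[where x="r - {B}"]) auto
    next
      case False
      define C where "C = B - {x}"
      have C: "C \<noteq> {}" "C \<subseteq> A" "B = insert x C" using False B p by (auto simp: C_def)
      have "disjnt C (\<Union>(r - {B}))" using d by (auto simp: disjnt_def C_def)
      moreover have "insert x A - B = A - C" using C x by auto
      ultimately have q: "partition_on A (insert C (r - {B}))"
        using p C by (simp add: partition_on_insert)
      have "C \<notin> r - {B}"
      proof
        assume "C \<in> r - {B}"
        then have "C \<subseteq> \<Union>(r - {B})" by auto
        then show False using d C by (auto simp: disjnt_def)
      qed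
      then have "insert C (r - {B}) - {C} = r - {B}" by auto
      then have "r = ?j (insert C (r - {B}), C)" using rB C by auto
      then show ?thesis using q by (intro UnI2 image_eqI[where x="(insert C (r - {B}), C)"]) auto
    qed
  qed (use S1 S2 in auto)
  have inj1: "inj_on (insert {x}) ?P"
  proof (rule inj_onI)
    fix q r assume *: "q \<in> ?P" "r \<in> ?P" "insert {x} q = insert {x} r"
    have "{x} \<notin> q" "{x} \<notin> r" using xq *(1,2) by blast+
    then show "q = r" using *(3) by (simp add: insert_ident)
  qed
  \<comment> \<open>After the insertion exactly one block contains \<open>x\<close>, and it
    determines \<open>C\<close>. This gives the injectivity of \<open>?j\<close> and its
    disjointness from the singleton case.\<close>
  have xj: "x \<in> D \<longleftrightarrow> D = insert x C" if "q \<in> ?P" "C \<in> q" "D \<in> ?j (q, C)" for q C D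
    using that xq[OF that(1)] by auto
  have nin: "insert x C \<notin> q - {C}" if "q \<in> ?P" for q C
    using xq[OF that] by auto
  have inj2: "inj_on ?j (Sigma ?P (\<lambda>q. q))"
  proof (rule inj_onI, clarify)
    fix q C r D assume *: "partition_on A q" "C \<in> q" "partition_on A r" "D \<in> r"
      "insert (insert x C) (q - {C}) = insert (insert x D) (r - {D})"
    have "insert x C = insert x D"
      using xj[of r D "insert x C"] * by auto
    moreover have "x \<notin> C" "x \<notin> D" using xq * by auto
    ultimately have CD: "C = D" by auto
    have "q - {C} = r - {D}"
      using *(5) nin[of q C] nin[of r D] *(1,3) unfolding CD by (metis insert_ident mem_Collect_eq)
    then have "insert C (q - {C}) = insert D (r - {D})" using CD by simp
    then show "q = r \<and> C = D" using CD * by (simp add: insert_absorb)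
  qed
  have disj: "insert {x} ` ?P \<inter> ?j ` Sigma ?P (\<lambda>q. q) = {}"
  proof (rule equals0I)
    fix r assume "r \<in> insert {x} ` ?P \<inter> ?j ` Sigma ?P (\<lambda>q. q)"
    then have r: "{x} \<in> r" "r \<in> ?j ` Sigma ?P (\<lambda>q. q)" by blast+
    from r(2) obtain q C where q: "q \<in> ?P" "C \<in> q" "r = ?j (q, C)" by auto
    note q = q r(1)
    then have "{x} = insert x C" using xj[of q C "{x}"] by auto
    then have "C = {}" using xq[OF q(1,2)] by auto
    then show False using split[OF q(1,2)] by simp
  qed
  have "(\<Sum>q | partition_on (insert x A) q. F q) =
    sum F (insert {x} ` ?P) + sum F (?j ` Sigma ?P (\<lambda>q. q))"
    unfolding eq by (rule sum.union_disjoint) (use fin finq disj in auto)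
  also have "sum F (insert {x} ` ?P) = (\<Sum>q\<in>?P. F (insert {x} q))"
    by (simp add: sum.reindex[OF inj1])
  also have "sum F (?j ` Sigma ?P (\<lambda>q. q)) = (\<Sum>q\<in>?P. \<Sum>C\<in>q. F (insert (insert x C) (q - {C})))"
    using fin finq by (subst sum.reindex[OF inj2], subst sum.Sigma) (auto simp: comp_def split_beta')
  finally show ?thesis by (simp add: sum.distrib)
qed

lemma partition_on_blockD:
  assumes "partition_on A q" "finite A" "C \<in> q"
  shows "finite C" "0 < card C"
  using assms by (auto simp: partition_on_def card_gt_0_iff intro: finite_subset)

lemma partition_on_card_pos:
  fixes n :: nat
  assumes "partition_on {1..n} q" "1 \<le> n" shows "0 < card q"
proof -
  have "finite q" by (rule finite_elements[OF _ assms(1)]) simp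
  moreover have "q \<noteq> {}" using assms by (auto simp: partition_on_def)
  ultimately show ?thesis by (simp add: card_gt_0_iff)
qed

lemma sum_card_partition_on:
  fixes n :: nat
  assumes "partition_on {1..n} q"
  shows "(\<Sum>C\<in>q. card C) = n"
  using product_partition[OF assms] partition_on_blockD[OF assms] by simp

lemma prod_partition_insert_singleton:
  fixes f :: "nat \<Rightarrow> real"
  assumes "partition_on A q" "finite A" "x \<notin> A"
  shows "(\<Prod>D\<in>insert {x} q. f (card D)) = f 1 * (\<Prod>D\<in>q. f (card D))"
    "card (insert {x} q) = Suc (card q)"
proof -
  have "{x} \<notin> q" using assms by (auto simp: partition_on_def)
  moreover have "finite q" using assms finite_elements by auto
  ultimately show "(\<Prod>D\<in>insert {x} q. f (card D)) = f 1 * (\<Prod>D\<in>q. f (card D))"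
    "card (insert {x} q) = Suc (card q)" by auto
qed

lemma prod_partition_insert_block:
  fixes f :: "nat \<Rightarrow> real"
  assumes "partition_on A q" "finite A" "x \<notin> A" "C \<in> q"
  shows "(\<Prod>D\<in>insert (insert x C) (q - {C}). f (card D)) = f (Suc (card C)) * (\<Prod>D\<in>q - {C}. f (card D))"
    "card (insert (insert x C) (q - {C})) = card q"
proof -
  have "insert x C \<notin> q - {C}" using assms by (auto simp: partition_on_def)
  moreover have q: "finite q" using assms finite_elements by auto
  moreover have "x \<notin> C" "finite C" using assms by (auto simp: partition_on_def intro: finite_subset)
  moreover have "0 < card q" using q assms(4) card_gt_0_iff by blast
  ultimately show "(\<Prod>D\<in>insert (insert x C) (q - {C}). f (card D)) = f (Suc (card C)) * (\<Prod>D\<in>q - {C}. f (card D))"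
    "card (insert (insert x C) (q - {C})) = card q"
    using assms(4) by (auto simp: card_insert_if)
qed

text \<open>The Chinese restaurant recursion: going from \<open>n\<close> to \<open>n + 1\<close>
  multiplies the weight of a partition with \<open>k\<close> blocks by
  \<open>(\<theta> + k * \<alpha>) / (\<theta> + n)\<close> for a new block and by
  \<open>(card C - \<alpha>) / (\<theta> + n)\<close> for joining \<open>C\<close>. These factors
  add up to 1 because the block sizes sum to \<open>n\<close>.\<close>

lemma sum_PD_eppf:
  assumes \<alpha>: "0 < \<alpha>" "\<alpha> < 1" "- \<alpha> < \<theta>" and n: "1 \<le> n"
  shows "(\<Sum>q | partition_on {1..n} q. PD_eppf n \<alpha> \<theta> q) = 1"
  using n
proof (induction n rule: dec_induct)
  case base
  have "0 < Gamma (1 - \<alpha>)" using \<alpha> by (intro Gamma_real_pos) auto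
  then have "Gamma (1 - \<alpha>) \<noteq> 0" by linarith
  then show ?case using sum_partition_on_insert[of "{}" "1::nat" "PD_eppf 1 \<alpha> \<theta>"]
    by (simp add: partition_on_empty PD_eppf_def)
next
  case (step n)
  let ?A = "{1..n}" and ?x = "Suc n"
  define f where "f e = Gamma (real e - \<alpha>) / Gamma (1 - \<alpha>)" for e
  have "0 < Gamma (1 - \<alpha>)" using \<alpha> by (intro Gamma_real_pos) auto
  then have G: "Gamma (1 - \<alpha>) \<noteq> 0" by linarith
  have f1: "f 1 = 1" using G by (simp add: f_def)
  have fS: "f (Suc e) = (real e - \<alpha>) * f e" if "0 < e" for e
  proof -
    have "0 < real e - \<alpha>" using that \<alpha> by (cases e) auto
    then have "real e - \<alpha> \<notin> \<int>\<^sub>\<le>\<^sub>0" by (auto elim!: nonpos_Ints_cases)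
    then have "Gamma (real e - \<alpha> + 1) = (real e - \<alpha>) * Gamma (real e - \<alpha>)" by (rule Gamma_plus1)
    then show ?thesis by (simp add: f_def add.commute[of 1] add_diff_eq diff_add_eq)
  qed
  define a where "a k = (\<Prod>j = 1..k - 1. \<theta> + real j * \<alpha>)" for k
  define d where "d = (\<Prod>j = 1..n - 1. \<theta> + real j)"
  have dn: "(\<Prod>j = 1..Suc n - 1. \<theta> + real j) = d * (\<theta> + real n)"
    using step(1) by (cases n) (auto simp: d_def)
  have \<theta>n: "0 < \<theta> + real n" using \<alpha> step(1) by linarith
  have e: "PD_eppf n \<alpha> \<theta> q = a (card q) / d * (\<Prod>C\<in>q. f (card C))" for q
    by (simp add: PD_eppf_def a_def d_def f_def)
  have e': "PD_eppf (Suc n) \<alpha> \<theta> q = a (card q) / (d * (\<theta> + real n)) * (\<Prod>C\<in>q. f (card C))" for q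
    unfolding PD_eppf_def dn a_def f_def ..
  have ins: "{1..Suc n} = insert ?x ?A" by auto
  have "(\<Sum>q | partition_on {1..Suc n} q. PD_eppf (Suc n) \<alpha> \<theta> q) =
    (\<Sum>q | partition_on ?A q. PD_eppf (Suc n) \<alpha> \<theta> (insert {?x} q) +
      (\<Sum>C\<in>q. PD_eppf (Suc n) \<alpha> \<theta> (insert (insert ?x C) (q - {C}))))"
    unfolding ins by (rule sum_partition_on_insert) auto
  also have "\<dots> = (\<Sum>q | partition_on ?A q. PD_eppf n \<alpha> \<theta> q)"
  proof (rule sum.cong[OF refl])
    fix q assume "q \<in> {q. partition_on ?A q}"
    then have q: "partition_on ?A q" by simp
    define p where "p = (\<Prod>C\<in>q. f (card C))"
    have finq: "finite q" using q finite_elements by auto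
    have kq: "0 < card q" using partition_on_card_pos[OF q] step by simp
    \<comment> \<open>The product in \<open>a k\<close> stops at \<open>k - 1\<close>, so the new
      factor has index \<open>k\<close>. For \<open>k = 0\<close> the truncated subtraction would
      break this.\<close>
    have ak: "a (Suc (card q)) = a (card q) * (\<theta> + real (card q) * \<alpha>)"
      using kq by (cases "card q") (auto simp: a_def)
    have 1: "PD_eppf (Suc n) \<alpha> \<theta> (insert {?x} q) = (\<theta> + real (card q) * \<alpha>) * (a (card q) * p / (d * (\<theta> + real n)))"
      unfolding e' using prod_partition_insert_singleton(1)[OF q, of ?x f] prod_partition_insert_singleton(2)[OF q, of ?x]
      using f1 by (simp add: ak p_def)
    have 2: "PD_eppf (Suc n) \<alpha> \<theta> (insert (insert ?x C) (q - {C})) =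
      (real (card C) - \<alpha>) * (a (card q) * p / (d * (\<theta> + real n)))" if C: "C \<in> q" for C
    proof -
      have "f (Suc (card C)) * (\<Prod>D\<in>q - {C}. f (card D)) = (real (card C) - \<alpha>) * p"
        using fS[of "card C"] partition_on_blockD[OF q _ C] prod.remove[OF finq C, of "\<lambda>D. f (card D)"]
        by (simp add: p_def)
      then show ?thesis
        unfolding e' using prod_partition_insert_block(1)[OF q _ _ C, of ?x f]
          prod_partition_insert_block(2)[OF q _ _ C, of ?x] by simp
    qed
    have "(\<Sum>C\<in>q. (real (card C) - \<alpha>) * (a (card q) * p / (d * (\<theta> + real n)))) =
      (\<Sum>C\<in>q. real (card C) - \<alpha>) * (a (card q) * p / (d * (\<theta> + real n)))"
      by (rule sum_distrib_right[symmetric])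
    also have "(\<Sum>C\<in>q. real (card C) - \<alpha>) = real n - real (card q) * \<alpha>"
      using sum_card_partition_on[OF q] by (simp add: sum_subtractf flip: of_nat_sum)
    finally have "PD_eppf (Suc n) \<alpha> \<theta> (insert {?x} q) +
      (\<Sum>C\<in>q. PD_eppf (Suc n) \<alpha> \<theta> (insert (insert ?x C) (q - {C}))) =
      (\<theta> + real (card q) * \<alpha>) * (a (card q) * p / (d * (\<theta> + real n))) +
      (real n - real (card q) * \<alpha>) * (a (card q) * p / (d * (\<theta> + real n)))"
      by (simp only: 1 2 cong: sum.cong)
    also have "\<dots> = (\<theta> + real n) * (a (card q) * p / (d * (\<theta> + real n)))"
      by (simp only: distrib_right[symmetric]) simp
    also have "\<dots> = PD_eppf n \<alpha> \<theta> q" unfolding e using \<theta>n by (simp add: p_def)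
    finally show "PD_eppf (Suc n) \<alpha> \<theta> (insert {?x} q) +
      (\<Sum>C\<in>q. PD_eppf (Suc n) \<alpha> \<theta> (insert (insert ?x C) (q - {C}))) = PD_eppf n \<alpha> \<theta> q" .
  qed
  finally show ?case using step by simp
qed

section \<open>Differentiation under the integral and Faa di Bruno's formula\<close>

text \<open>By the mean value inequality the bound \<open>h\<close> on the derivative also bounds
  every difference quotient, so dominated convergence applies along each sequence tending to
  \<open>b\<close>.\<close>

lemma has_real_derivative_integral:
  fixes f :: "real \<Rightarrow> 'a \<Rightarrow> real"
  assumes b: "b \<in> {l<..<u}"
    and int: "\<And>x. x \<in> {l<..<u} \<Longrightarrow> integrable M (f x)"
    and der: "\<And>x \<omega>. x \<in> {l<..<u} \<Longrightarrow> \<omega> \<in> space M \<Longrightarrow> ((\<lambda>x. f x \<omega>) has_real_derivative f' x \<omega>) (at x)"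
    and bnd: "\<And>x \<omega>. x \<in> {l<..<u} \<Longrightarrow> \<omega> \<in> space M \<Longrightarrow> \<bar>f' x \<omega>\<bar> \<le> h \<omega>"
    and h: "integrable M h" and f'[measurable]: "f' b \<in> borel_measurable M"
  shows "((\<lambda>x. \<integral>\<omega>. f x \<omega> \<partial>M) has_real_derivative (\<integral>\<omega>. f' b \<omega> \<partial>M)) (at b)"
proof -
  let ?S = "{l<..<u}" and ?F = "\<lambda>x. \<integral>\<omega>. f x \<omega> \<partial>M"
  have "(?F has_real_derivative (\<integral>\<omega>. f' b \<omega> \<partial>M)) (at b within ?S)"
    unfolding has_field_derivative_iff tendsto_at_iff_sequentially
  proof (intro allI impI)
    fix X :: "nat \<Rightarrow> real" assume X: "\<forall>i. X i \<in> ?S - {b}" and lim: "X \<longlonglongrightarrow> b"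
    have "(\<lambda>i. \<integral>\<omega>. (f (X i) \<omega> - f b \<omega>) / (X i - b) \<partial>M) \<longlonglongrightarrow> (\<integral>\<omega>. f' b \<omega> \<partial>M)"
    proof (rule integral_dominated_convergence[where w=h])
      show "AE \<omega> in M. (\<lambda>i. (f (X i) \<omega> - f b \<omega>) / (X i - b)) \<longlonglongrightarrow> f' b \<omega>"
      proof (rule AE_I2)
        fix \<omega> assume "\<omega> \<in> space M"
        from der[OF b this] have "((\<lambda>y. (f y \<omega> - f b \<omega>) / (y - b)) \<longlongrightarrow> f' b \<omega>) (at b)"
          by (simp add: has_field_derivative_iff)
        then have "((\<lambda>y. (f y \<omega> - f b \<omega>) / (y - b)) \<circ> X) \<longlonglongrightarrow> f' b \<omega>"
          using X lim unfolding tendsto_at_iff_sequentially by auto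
        then show "(\<lambda>i. (f (X i) \<omega> - f b \<omega>) / (X i - b)) \<longlonglongrightarrow> f' b \<omega>" by (simp add: comp_def)
      qed
      show "AE \<omega> in M. norm ((f (X i) \<omega> - f b \<omega>) / (X i - b)) \<le> h \<omega>" for i
      proof (rule AE_I2)
        fix \<omega> assume \<omega>: "\<omega> \<in> space M"
        have "norm (f (X i) \<omega> - f b \<omega>) \<le> h \<omega> * norm (X i - b)"
        proof (rule field_differentiable_bound[where S="?S" and f'="\<lambda>x. f' x \<omega>"])
          show "((\<lambda>x. f x \<omega>) has_field_derivative f' z \<omega>) (at z within ?S)" if "z \<in> ?S" for z
            using der[OF that \<omega>] by (rule has_field_derivative_at_within)
        qed (use X b bnd \<omega> in auto)
        moreover have "X i \<noteq> b" using X by auto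
        ultimately show "norm ((f (X i) \<omega> - f b \<omega>) / (X i - b)) \<le> h \<omega>"
          by (simp add: field_simps)
      qed
      show "(\<lambda>\<omega>. (f (X i) \<omega> - f b \<omega>) / (X i - b)) \<in> borel_measurable M" for i
      proof -
        have [measurable]: "f (X i) \<in> borel_measurable M" "f b \<in> borel_measurable M"
          using int[of "X i"] int[OF b] X by auto
        show ?thesis by measurable
      qed
    qed (use h in auto)
    moreover have "(\<integral>\<omega>. (f (X i) \<omega> - f b \<omega>) / (X i - b) \<partial>M) = (?F (X i) - ?F b) / (X i - b)" for i
    proof -
      have "integrable M (f (X i))" using int X by blast
      then show ?thesis using int[OF b] by simp
    qed
    ultimately show "((\<lambda>y. (?F y - ?F b) / (y - b)) \<circ> X) \<longlonglongrightarrow> (\<integral>\<omega>. f' b \<omega> \<partial>M)"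
      by (simp only: comp_def)
  qed
  then show ?thesis using b by (simp add: at_within_open[of b ?S])
qed

text \<open>Faa di Bruno's formula for \<open>exp \<circ> (- \<psi>)\<close>.\<close>

lemma has_real_derivative_partition_sum:
  fixes \<psi> :: "nat \<Rightarrow> real \<Rightarrow> real" and E :: "real \<Rightarrow> real"
  assumes E: "(E has_real_derivative - (\<psi> 1 b * E b)) (at b)"
    and \<psi>: "\<And>e. 0 < e \<Longrightarrow> (\<psi> e has_real_derivative - \<psi> (Suc e) b) (at b)"
  shows "((\<lambda>b. \<Sum>q | partition_on {1..n} q. (\<Prod>C\<in>q. \<psi> (card C) b) * E b) has_real_derivative
    - (\<Sum>q | partition_on {1..Suc n} q. (\<Prod>C\<in>q. \<psi> (card C) b) * E b)) (at b)"
proof -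
  let ?A = "{1..n}" and ?x = "Suc n"
  have ins: "{1..Suc n} = insert ?x ?A" by auto
  \<comment> \<open>Product rule: differentiating \<open>E\<close> puts \<open>Suc n\<close> into a
    block of its own, differentiating the factor of \<open>C\<close> enlarges \<open>C\<close> by
    \<open>Suc n\<close>. Every term acquires the same minus sign.\<close>
  have "((\<lambda>b. (\<Prod>C\<in>q. \<psi> (card C) b) * E b) has_real_derivative
      - ((\<Prod>D\<in>insert {?x} q. \<psi> (card D) b) * E b +
        (\<Sum>C\<in>q. (\<Prod>D\<in>insert (insert ?x C) (q - {C}). \<psi> (card D) b) * E b))) (at b)"
    if q: "partition_on ?A q" for q
  proof -
    have "((\<lambda>b. \<Prod>C\<in>q. \<psi> (card C) b) has_real_derivative
      (\<Sum>C\<in>q. - \<psi> (Suc (card C)) b * (\<Prod>D\<in>q - {C}. \<psi> (card D) b))) (at b)"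
      using partition_on_blockD[OF q] by (intro has_field_derivative_prod \<psi>) auto
    from DERIV_mult[OF this E]
    have "((\<lambda>b. (\<Prod>C\<in>q. \<psi> (card C) b) * E b) has_real_derivative
      (\<Sum>C\<in>q. - \<psi> (Suc (card C)) b * (\<Prod>D\<in>q - {C}. \<psi> (card D) b)) * E b
        + - (\<psi> 1 b * E b) * (\<Prod>C\<in>q. \<psi> (card C) b)) (at b)" .
    moreover have "(\<Prod>D\<in>insert {?x} q. \<psi> (card D) b) = \<psi> 1 b * (\<Prod>C\<in>q. \<psi> (card C) b)"
      using prod_partition_insert_singleton(1)[OF q, of ?x "\<lambda>e. \<psi> e b"] by simp
    moreover have "(\<Sum>C\<in>q. (\<Prod>D\<in>insert (insert ?x C) (q - {C}). \<psi> (card D) b) * E b) =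
      (\<Sum>C\<in>q. \<psi> (Suc (card C)) b * (\<Prod>D\<in>q - {C}. \<psi> (card D) b) * E b)"
      using prod_partition_insert_block(1)[OF q, of ?x _ "\<lambda>e. \<psi> e b"]
      by (intro sum.cong) auto
    ultimately show ?thesis
      by (simp add: sum_distrib_left sum_negf algebra_simps)
  qed
  then have "((\<lambda>b. \<Sum>q | partition_on ?A q. (\<Prod>C\<in>q. \<psi> (card C) b) * E b) has_real_derivative
    (\<Sum>q | partition_on ?A q. - ((\<Prod>D\<in>insert {?x} q. \<psi> (card D) b) * E b +
        (\<Sum>C\<in>q. (\<Prod>D\<in>insert (insert ?x C) (q - {C}). \<psi> (card D) b) * E b)))) (at b)"
    by (intro DERIV_sum) auto
  moreover have "- (\<Sum>q | partition_on {1..Suc n} q. (\<Prod>C\<in>q. \<psi> (card C) b) * E b) =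
    (\<Sum>q | partition_on ?A q. - ((\<Prod>D\<in>insert {?x} q. \<psi> (card D) b) * E b +
        (\<Sum>C\<in>q. (\<Prod>D\<in>insert (insert ?x C) (q - {C}). \<psi> (card D) b) * E b)))"
    unfolding ins sum_negf by (subst sum_partition_on_insert) auto
  ultimately show ?thesis by (simp only:)
qed

lemma power_le_exp:
  assumes "0 \<le> (x::real)" shows "x ^ k / fact k \<le> exp x"
proof -
  have "(\<Sum>n\<in>{k}. x ^ n /\<^sub>R fact n) \<le> (\<Sum>n. x ^ n /\<^sub>R fact n)"
    using assms by (intro sum_le_suminf summable_exp_generic) auto
  then show ?thesis by (simp add: exp_def divide_inverse mult.commute)
qed

text \<open>\<open>(c * t) ^ k / fact k\<close> is one term of the series of
  \<open>exp (c * t)\<close>. The bound is uniform in \<open>t\<close>; with the total mass as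
  \<open>t\<close> it supplies constant dominating functions.\<close>

lemma power_mult_exp_bound:
  assumes t: "0 \<le> t" and c: "0 < (c::real)"
  shows "t ^ k * exp (- (c * t)) \<le> fact k / c ^ k"
proof -
  have "t ^ k * c ^ k / fact k \<le> exp (c * t)"
    using power_le_exp[of "c * t" k] t c by (simp add: power_mult_distrib mult.commute)
  then have "t ^ k * c ^ k \<le> exp (c * t) * fact k" by (simp add: field_simps)
  then show ?thesis using c by (simp add: exp_minus field_simps)
qed

text \<open>A power is monotone on the positive half-line, hence largest at an endpoint; adding both
  end values covers either sign of the exponent.\<close>

lemma powr_le_endpoints:
  fixes z :: real
  assumes "0 < lo" "lo \<le> z" "z \<le> hi"
  shows "z powr \<gamma> \<le> lo powr \<gamma> + hi powr \<gamma>"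
proof (cases "0 \<le> \<gamma>")
  case True
  then have "z powr \<gamma> \<le> hi powr \<gamma>" using assms by (intro powr_mono2) auto
  then show ?thesis by (simp add: add_increasing)
next
  case False
  then have "z powr \<gamma> \<le> lo powr \<gamma>" using assms by (intro powr_mono2') auto
  then show ?thesis by (simp add: add_increasing2)
qed

abbreviation tmass :: "'a measure \<Rightarrow> real" where "tmass m \<equiv> measure m (space m)"

lemma borel_measurable_tmass [measurable]: "tmass \<in> borel_measurable (measure_algebra K)"
  unfolding measure_def by measurable

section \<open>The derivatives of the tilted Laplace functional\<close>

text \<open>Bounded \<open>g\<close> is what \<open>laplace_functional_eqI\<close> tests. For
  \<open>b > 0\<close> the values \<open>g y + b\<close> stay between \<open>b\<close> and
  \<open>B + b\<close>, so all their powers, negative ones included, are integrable and can be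
  differentiated under the integral.\<close>

locale gg_test = gg_setting +
  fixes g :: "'a \<Rightarrow> real" and B :: real
  assumes g_meas [measurable]: "g \<in> borel_measurable \<eta>"
    and g_nonneg: "\<And>y. 0 \<le> g y" and g_le: "\<And>y. g y \<le> B"
begin

text \<open>\<open>psi 0\<close> is the Laplace exponent. For \<open>e > 0\<close>,
  \<open>psi e b\<close> is the integral of \<open>s^e * exp (- (g y + b) * s)\<close> against
  \<open>gg_intensity \<alpha> 0\<close> and \<eta>, that is \<open>(-1)^(e - 1)\<close> times the
  \<open>e\<close>-th derivative of \<open>psi 0\<close>; the sign makes it non-negative.\<close>

definition psi :: "nat \<Rightarrow> real \<Rightarrow> real" where
  "psi e b = (if e = 0 then (\<integral>y. (g y + b) powr \<alpha> / \<alpha> \<partial>\<eta>)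
     else Gamma (real e - \<alpha>) / Gamma (1 - \<alpha>) * (\<integral>y. (g y + b) powr (\<alpha> - real e) \<partial>\<eta>))"

definition eg :: "'a measure \<Rightarrow> real" where
  "eg m = exp_minus (\<integral>\<^sup>+y. ennreal (g y) \<partial>m)"

text \<open>On the positive half-line \<open>A n\<close> is \<open>(-1)^n\<close> times the
  \<open>n\<close>-th derivative of \<open>A 0 b = exp (- psi 0 b)\<close>.\<close>

definition A :: "nat \<Rightarrow> real \<Rightarrow> real" where
  "A n b = (\<integral>m. tmass m ^ n * exp (- (b * tmass m)) * eg m \<partial>Q0)"

lemma eg_meas [measurable]: "eg \<in> borel_measurable (measure_algebra \<eta>)"
  unfolding eg_def[abs_def] by measurable

lemma eg_bounds: "0 \<le> eg m" "eg m \<le> 1"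
  by (simp_all add: eg_def)

lemma integrable_shifted_powr:
  assumes "0 < b" shows "integrable \<eta> (\<lambda>y. (g y + b) powr \<beta>)"
proof (rule \<eta>.integrable_const_bound[where B="b powr \<beta> + (B + b) powr \<beta>"])
  show "AE y in \<eta>. norm ((g y + b) powr \<beta>) \<le> b powr \<beta> + (B + b) powr \<beta>"
    using assms g_nonneg g_le by (intro AE_I2) (simp add: powr_le_endpoints)
qed measurable

lemma has_real_derivative_shifted_powr:
  assumes b: "0 < b"
  shows "((\<lambda>x. \<integral>y. (g y + x) powr \<beta> \<partial>\<eta>) has_real_derivative \<beta> * (\<integral>y. (g y + b) powr (\<beta> - 1) \<partial>\<eta>)) (at b)"
proof -
  have "((\<lambda>x. \<integral>y. (g y + x) powr \<beta> \<partial>\<eta>) has_real_derivative (\<integral>y. \<beta> * (g y + b) powr (\<beta> - 1) \<partial>\<eta>)) (at b)"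
  \<comment> \<open>For \<open>x\<close> between \<open>b / 2\<close> and \<open>2 * b\<close> the
    base \<open>g y + x\<close> lies between \<open>b / 2\<close> and \<open>B + 2 * b\<close>,
    whence a constant bound.\<close>
  proof (rule has_real_derivative_integral[where l="b/2" and u="2*b"
      and h="\<lambda>_. \<bar>\<beta>\<bar> * ((b/2) powr (\<beta> - 1) + (B + 2*b) powr (\<beta> - 1))"])
    fix x y assume x: "x \<in> {b/2<..<2*b}"
    then have x0: "0 < x" using b by auto
    show "integrable \<eta> (\<lambda>y. (g y + x) powr \<beta>)" by (rule integrable_shifted_powr[OF x0])
    have "0 < g y + x" using g_nonneg[of y] x0 by simp
    then show "((\<lambda>x. (g y + x) powr \<beta>) has_real_derivative \<beta> * (g y + x) powr (\<beta> - 1)) (at x)"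
      by (auto intro!: derivative_eq_intros simp: powr_diff)
    have "(g y + x) powr (\<beta> - 1) \<le> (b/2) powr (\<beta> - 1) + (B + 2*b) powr (\<beta> - 1)"
      using x b g_nonneg[of y] g_le[of y] by (intro powr_le_endpoints) auto
    then show "\<bar>\<beta> * (g y + x) powr (\<beta> - 1)\<bar> \<le> \<bar>\<beta>\<bar> * ((b/2) powr (\<beta> - 1) + (B + 2*b) powr (\<beta> - 1))"
      by (simp add: abs_mult mult_left_mono)
  qed (use b in auto)
  then show ?thesis by simp
qed

lemma psi_deriv_0: "0 < b \<Longrightarrow> ((\<lambda>x. psi 0 x) has_real_derivative psi 1 b) (at b)"
proof -
  assume b: "0 < b"
  have "0 < Gamma (1 - \<alpha>)" using \<alpha> by (intro Gamma_real_pos) auto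
  then have "Gamma (1 - \<alpha>) \<noteq> 0" by linarith
  moreover have "((\<lambda>x. (\<integral>y. (g y + x) powr \<alpha> \<partial>\<eta>) / \<alpha>) has_real_derivative (\<alpha> * (\<integral>y. (g y + b) powr (\<alpha> - 1) \<partial>\<eta>)) / \<alpha>) (at b)"
    by (rule DERIV_cdivide[OF has_real_derivative_shifted_powr[OF b]])
  ultimately show ?thesis using \<alpha> by (simp add: psi_def[abs_def])
qed

text \<open>Differentiation brings down \<open>\<alpha> - e\<close>, which the functional equation
  of Gamma absorbs, up to the sign, into the constant of \<open>psi (Suc e)\<close>.\<close>

lemma psi_deriv: "0 < b \<Longrightarrow> 0 < e \<Longrightarrow> (psi e has_real_derivative - psi (Suc e) b) (at b)"
proof -
  assume b: "0 < b" and e: "0 < e"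
  have "0 < real e - \<alpha>" using e \<alpha> by (cases e) auto
  then have "real e - \<alpha> \<notin> \<int>\<^sub>\<le>\<^sub>0" by (auto elim!: nonpos_Ints_cases)
  then have "Gamma (real e - \<alpha> + 1) = (real e - \<alpha>) * Gamma (real e - \<alpha>)" by (rule Gamma_plus1)
  then have G: "Gamma (real (Suc e) - \<alpha>) = (real e - \<alpha>) * Gamma (real e - \<alpha>)"
    by (simp add: add.commute[of 1] diff_add_eq)
  have "((\<lambda>x. Gamma (real e - \<alpha>) / Gamma (1 - \<alpha>) * (\<integral>y. (g y + x) powr (\<alpha> - real e) \<partial>\<eta>)) has_real_derivative
    Gamma (real e - \<alpha>) / Gamma (1 - \<alpha>) * ((\<alpha> - real e) * (\<integral>y. (g y + b) powr (\<alpha> - real e - 1) \<partial>\<eta>))) (at b)"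
    by (rule DERIV_cmult[OF has_real_derivative_shifted_powr[OF b]])
  moreover have "Gamma (real e - \<alpha>) / Gamma (1 - \<alpha>) * ((\<alpha> - real e) * (\<integral>y. (g y + b) powr (\<alpha> - real e - 1) \<partial>\<eta>)) = - psi (Suc e) b"
  proof -
    have "\<alpha> - real e - 1 = \<alpha> - real (Suc e)" by simp
    then show ?thesis unfolding psi_def G by (simp add: algebra_simps diff_divide_distrib)
  qed
  ultimately show ?thesis using e by (simp add: psi_def[abs_def])
qed

lemma A_integrable:
  assumes "0 < b" shows "integrable Q0 (\<lambda>m. tmass m ^ n * exp (- (b * tmass m)) * eg m)"
proof -
  interpret Q0: prob_space Q0 by (rule prob_space_gg)
  show ?thesis
  proof (rule Q0.integrable_const_bound[where B="fact n / b ^ n"])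
    show "AE m in Q0. norm (tmass m ^ n * exp (- (b * tmass m)) * eg m) \<le> fact n / b ^ n"
    proof (rule AE_I2)
      fix m
      have "tmass m ^ n * exp (- (b * tmass m)) * eg m \<le> tmass m ^ n * exp (- (b * tmass m)) * 1"
        by (intro mult_left_mono) (auto simp: eg_bounds)
      also have "\<dots> \<le> fact n / b ^ n" using power_mult_exp_bound[OF _ assms, of "tmass m" n] by simp
      finally show "norm (tmass m ^ n * exp (- (b * tmass m)) * eg m) \<le> fact n / b ^ n"
        by (simp add: eg_bounds)
    qed
  qed measurable
qed

lemma A_deriv:
  assumes b: "0 < b" shows "(A n has_real_derivative - A (Suc n) b) (at b)"
proof -
  interpret Q0: prob_space Q0 by (rule prob_space_gg)
  have "((\<lambda>x. \<integral>m. tmass m ^ n * exp (- (x * tmass m)) * eg m \<partial>Q0) has_real_derivative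
    (\<integral>m. - (tmass m ^ Suc n * exp (- (b * tmass m)) * eg m) \<partial>Q0)) (at b)"
  \<comment> \<open>Keeping \<open>x\<close> above \<open>b / 2\<close> leaves
    \<open>T ^ Suc n * exp (- (b / 2 * T))\<close>, which \<open>power_mult_exp_bound\<close> bounds
    by a constant.\<close>
  proof (rule has_real_derivative_integral[where l="b/2" and u="2*b" and h="\<lambda>_. fact (Suc n) / (b/2) ^ Suc n"])
    fix x m assume x: "x \<in> {b/2<..<2*b}"
    then have x0: "0 < x" using b by auto
    show "integrable Q0 (\<lambda>m. tmass m ^ n * exp (- (x * tmass m)) * eg m)" by (rule A_integrable[OF x0])
    show "((\<lambda>x. tmass m ^ n * exp (- (x * tmass m)) * eg m) has_real_derivative
      - (tmass m ^ Suc n * exp (- (x * tmass m)) * eg m)) (at x)"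
      by (auto intro!: derivative_eq_intros)
    have "tmass m ^ Suc n * exp (- (x * tmass m)) * eg m \<le> tmass m ^ Suc n * exp (- (b/2 * tmass m)) * 1"
    proof (intro mult_mono mult_left_mono)
      have "b/2 * tmass m \<le> x * tmass m" using x by (intro mult_right_mono) auto
      then show "exp (- (x * tmass m)) \<le> exp (- (b/2 * tmass m))" by simp
    qed (auto simp: eg_bounds)
    also have "\<dots> \<le> fact (Suc n) / (b/2) ^ Suc n"
      using power_mult_exp_bound[of "tmass m" "b/2" "Suc n"] b by simp
    finally show "\<bar>- (tmass m ^ Suc n * exp (- (x * tmass m)) * eg m)\<bar> \<le> fact (Suc n) / (b/2) ^ Suc n"
      by (simp add: eg_bounds abs_mult)
  qed (use b in \<open>auto intro: Q0.integrable_const\<close>)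
  then show ?thesis by (simp add: A_def[abs_def])
qed

lemma nn_integral_psi0:
  assumes "0 < b"
  shows "(\<integral>\<^sup>+y. ennreal ((g y + b) powr \<alpha> / \<alpha>) \<partial>\<eta>) = ennreal (psi 0 b)" "0 \<le> psi 0 b"
proof -
  have "integrable \<eta> (\<lambda>y. (g y + b) powr \<alpha> / \<alpha>)"
    using integrable_shifted_powr[OF assms, of \<alpha>] by simp
  then show "(\<integral>\<^sup>+y. ennreal ((g y + b) powr \<alpha> / \<alpha>) \<partial>\<eta>) = ennreal (psi 0 b)"
    using \<alpha> unfolding psi_def by (subst nn_integral_eq_integral) auto
  show "0 \<le> psi 0 b" using \<alpha> by (auto simp: psi_def intro!: divide_nonneg_pos)
qed

lemma AE_Q0_mass: "AE m in Q0. mass m = ennreal (tmass m) \<and> 0 < tmass m"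
  using AE_mass
proof eventually_elim
  case (elim m)
  then have "mass m = ennreal (tmass m)" by (intro emeasure_eq_ennreal_measure) auto
  moreover from this have "tmass m \<noteq> 0" using elim by auto
  ultimately show ?case by (simp add: less_le)
qed

lemma A_0:
  assumes b: "0 < b" shows "A 0 b = exp (- psi 0 b)"
proof -
  have "(\<integral>\<^sup>+m. ennreal (exp (- (b * tmass m)) * eg m) \<partial>Q0) =
    (\<integral>\<^sup>+m. ennreal (exp_minus (\<integral>\<^sup>+y. ennreal (g y) \<partial>m) * exp_minus (ennreal b * mass m)) \<partial>Q0)"
    using AE_Q0_mass
  proof (intro nn_integral_cong_AE, eventually_elim)
    case (elim m)
    then have "exp_minus (ennreal b * mass m) = exp (- (b * tmass m))"
      using b by (simp add: exp_minus_ennreal flip: ennreal_mult)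
    then show ?case by (simp add: eg_def mult.commute)
  qed
  also have "\<dots> = ennreal (exp (- psi 0 b))"
    using b g_nonneg nn_integral_psi0[OF b] by (subst nn_integral_tilt) (auto simp: exp_minus_ennreal)
  finally have "(\<integral>\<^sup>+m. ennreal (exp (- (b * tmass m)) * eg m) \<partial>Q0) = ennreal (exp (- psi 0 b))" .
  moreover have "A 0 b = enn2real (\<integral>\<^sup>+m. ennreal (exp (- (b * tmass m)) * eg m) \<partial>Q0)"
    unfolding A_def by (subst integral_eq_nn_integral) (auto simp: eg_bounds)
  ultimately show ?thesis by simp
qed

text \<open>Both sides agree on the open half-line by induction, hence so do their derivatives, and
  these are the negatives of the two sides for \<open>Suc n\<close>. The point \<open>b\<close>
  stays arbitrary because a derivative sees a neighbourhood.\<close>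

lemma A_partition:
  assumes "0 < b"
  shows "A n b = (\<Sum>q | partition_on {1..n} q. (\<Prod>C\<in>q. psi (card C) b) * exp (- psi 0 b))"
  using assms
proof (induction n arbitrary: b)
  case 0
  then show ?case by (simp add: partition_on_empty A_0)
next
  case (Suc n)
  let ?S = "\<lambda>n b. \<Sum>q | partition_on {1..n} q. (\<Prod>C\<in>q. psi (card C) b) * exp (- psi 0 b)"
  have "((\<lambda>x. exp (- psi 0 x)) has_real_derivative - (psi 1 b * exp (- psi 0 b))) (at b)"
    using psi_deriv_0[OF Suc.prems] by (auto intro!: derivative_eq_intros)
  then have "(?S n has_real_derivative - ?S (Suc n) b) (at b)"
    by (rule has_real_derivative_partition_sum) (rule psi_deriv[OF Suc.prems])
  then have "(A n has_real_derivative - ?S (Suc n) b) (at b)"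
    by (rule has_field_derivative_transform_within_open[where S="{0<..}"])
       (use Suc in \<open>auto simp del: One_nat_def\<close>)
  from DERIV_unique[OF this A_deriv[OF Suc.prems]] show ?case by simp
qed

text \<open>With \<open>r = \<theta> + n\<close> the gamma integral turns
  \<open>b powr (r - 1) * exp (- b * T)\<close> into \<open>Gamma r * T powr (- r)\<close>, and the
  factor \<open>T^n\<close> inside \<open>A n\<close> leaves
  \<open>T powr (- \<theta>)\<close>.\<close>

lemma nn_integral_A_mix:
  assumes \<theta>: "0 < \<theta> + real n"
  shows "(\<integral>\<^sup>+b. ennreal (b powr (\<theta> + real n - 1)) * ennreal (A n b) * indicator {0<..} b \<partial>lborel) =
    ennreal (Gamma (\<theta> + real n)) * (\<integral>\<^sup>+m. ennreal (tmass m powr - \<theta>) * ennreal (eg m) \<partial>Q0)"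
proof -
  interpret Q0: prob_space Q0 by (rule prob_space_gg)
  interpret pair_sigma_finite lborel Q0 ..
  let ?r = "\<theta> + real n"
  let ?k = "\<lambda>b m. ennreal (tmass m ^ n * eg m) * ennreal (if 0 < b then b powr (?r - 1) * exp (- tmass m * b) else 0)"
  have "(\<integral>\<^sup>+b. ennreal (b powr (?r - 1)) * ennreal (A n b) * indicator {0<..} b \<partial>lborel) =
    (\<integral>\<^sup>+b. \<integral>\<^sup>+m. ?k b m \<partial>Q0 \<partial>lborel)"
  proof (rule nn_integral_cong)
    fix b :: real
    show "ennreal (b powr (?r - 1)) * ennreal (A n b) * indicator {0<..} b = (\<integral>\<^sup>+m. ?k b m \<partial>Q0)"
    proof (cases "0 < b")
      case True
      have "ennreal (A n b) = (\<integral>\<^sup>+m. ennreal (tmass m ^ n * exp (- (b * tmass m)) * eg m) \<partial>Q0)"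
        unfolding A_def using A_integrable[OF True, of n]
        by (intro nn_integral_eq_integral[symmetric]) (auto simp: eg_bounds)
      then have "ennreal (b powr (?r - 1)) * ennreal (A n b) =
        (\<integral>\<^sup>+m. ennreal (b powr (?r - 1)) * ennreal (tmass m ^ n * exp (- (b * tmass m)) * eg m) \<partial>Q0)"
        by (simp only:) (rule nn_integral_cmult[symmetric], measurable)
      also have "\<dots> = (\<integral>\<^sup>+m. ?k b m \<partial>Q0)"
        using True by (intro nn_integral_cong) (simp add: eg_bounds mult_ac flip: ennreal_mult)
      finally show ?thesis using True by simp
    qed simp
  qed
  also have "\<dots> = (\<integral>\<^sup>+m. \<integral>\<^sup>+b. ?k b m \<partial>lborel \<partial>Q0)"
    by (rule Fubini'[symmetric]) measurable
  also have "\<dots> = (\<integral>\<^sup>+m. ennreal (Gamma ?r) * (ennreal (tmass m powr - \<theta>) * ennreal (eg m)) \<partial>Q0)"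
  proof (rule nn_integral_cong_AE, rule eventually_mono[OF AE_Q0_mass])
    fix m :: "'a measure" assume m: "mass m = ennreal (tmass m) \<and> 0 < tmass m"
    have G: "0 < Gamma ?r" using \<theta> by (rule Gamma_real_pos)
    have "(\<integral>\<^sup>+b. ?k b m \<partial>lborel) = ennreal (tmass m ^ n * eg m) *
      (\<integral>\<^sup>+b. ennreal (if 0 < b then b powr (?r - 1) * exp (- tmass m * b) else 0) \<partial>lborel)"
      by (rule nn_integral_cmult) measurable
    also have "\<dots> = ennreal (tmass m ^ n * eg m) * ennreal (Gamma ?r / tmass m powr ?r)"
      using m \<theta> by (subst nn_integral_Gamma_rate) auto
    also have "\<dots> = ennreal (Gamma ?r * (tmass m powr - \<theta> * eg m))"
    proof -
      have "tmass m ^ n / tmass m powr ?r = tmass m powr (real n - ?r)"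
        using m by (simp only: powr_realpow[symmetric] powr_diff)
      also have "real n - ?r = - \<theta>" by simp
      finally have "Gamma ?r * ((tmass m ^ n / tmass m powr ?r) * eg m) = Gamma ?r * (tmass m powr - \<theta> * eg m)"
        by (simp only:)
      then have "tmass m ^ n * eg m * (Gamma ?r / tmass m powr ?r) = Gamma ?r * (tmass m powr - \<theta> * eg m)"
        by (simp add: mult_ac)
      then show ?thesis using G m by (subst ennreal_mult[symmetric]) (auto simp: eg_bounds)
    qed
    finally show "(\<integral>\<^sup>+b. ?k b m \<partial>lborel) = ennreal (Gamma ?r) * (ennreal (tmass m powr - \<theta>) * ennreal (eg m))"
      using G by (simp add: eg_bounds flip: ennreal_mult)
  qed
  also have "\<dots> = ennreal (Gamma ?r) * (\<integral>\<^sup>+m. ennreal (tmass m powr - \<theta>) * ennreal (eg m) \<partial>Q0)"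
    by (rule nn_integral_cmult) measurable
  finally show ?thesis .
qed

end

section \<open>The mixture over the gamma variable\<close>

text \<open>Rectangles generate the product sigma-algebra and are stable under intersection; on them
  the product measure is a finite product of kernel values, each measurable in
  \<open>x\<close>.\<close>

lemma measurable_PiM_kernel:
  assumes I: "finite I" and K: "\<And>i. i \<in> I \<Longrightarrow> K i \<in> measurable M (subprob_algebra (N i))"
  shows "(\<lambda>x. PiM I (\<lambda>i. K i x)) \<in> measurable M (subprob_algebra (PiM I N))"
proof -
  have emeasure_PiE: "emeasure (PiM I (\<lambda>i. K i x)) (PiE I X) = (\<Prod>i\<in>I. emeasure (K i x) (X i))"
    if x: "x \<in> space M" and X: "\<And>i. i \<in> I \<Longrightarrow> X i \<in> sets (N i)" for x X
  proof -
    \<comment> \<open>The family must be sigma-finite at every index of the type; a point mass fills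
      in outside \<open>I\<close>.\<close>
    define K' where "K' i = (if i \<in> I then K i x else return (count_space UNIV) undefined)" for i
    have "sigma_finite_measure (K' i)" for i
    proof (cases "i \<in> I")
      case True
      then interpret subprob_space "K i x" using subprob_space_kernel[OF K x] by auto
      show ?thesis using True by (simp add: K'_def) unfold_locales
    next
      case False
      interpret prob_space "return (count_space UNIV) undefined :: 'c measure" by (rule prob_space_return) simp
      show ?thesis using False by (simp add: K'_def) unfold_locales
    qed
    then interpret product_sigma_finite K' by (simp add: product_sigma_finite_def)
    have "PiM I (\<lambda>i. K i x) = PiM I K'" by (intro PiM_cong) (auto simp: K'_def)
    moreover have "emeasure (PiM I K') (PiE I X) = (\<Prod>i\<in>I. emeasure (K' i) (X i))"
      using I X sets_kernel[OF K x] by (intro emeasure_PiM) (auto simp: K'_def)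
    ultimately show ?thesis by (simp add: K'_def)
  qed
  have spK: "space (K i x) = space (N i)" if "i \<in> I" "x \<in> space M" for i x
    using sets_kernel[OF K[OF that(1)] that(2)] by (rule sets_eq_imp_space_eq)
  have sp: "(\<Pi>\<^sub>E i\<in>I. space (N i)) = space (PiM I N)" by (simp add: space_PiM)
  have m: "(\<lambda>x. emeasure (PiM I (\<lambda>i. K i x)) (PiE I X)) \<in> borel_measurable M"
    if X: "\<And>i. i \<in> I \<Longrightarrow> X i \<in> sets (N i)" for X
  proof -
    have "(\<lambda>x. \<Prod>i\<in>I. emeasure (K i x) (X i)) \<in> borel_measurable M"
      by (rule borel_measurable_prod_ennreal) (rule measurable_emeasure_kernel[OF K X])
    then show ?thesis using emeasure_PiE[OF _ X] by (simp cong: measurable_cong)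
  qed
  show ?thesis
  proof (rule measurable_subprob_algebra_generated[OF sets_PiM Int_stable_prod_algebra prod_algebra_sets_into_space])
    fix x assume x: "x \<in> space M"
    show s: "sets (PiM I (\<lambda>i. K i x)) = sets (PiM I N)"
      by (intro sets_PiM_cong refl sets_kernel[OF K x])
    have sub: "subprob_space (K i x)" if "i \<in> I" for i by (rule subprob_space_kernel[OF K[OF that] x])
    show "subprob_space (PiM I (\<lambda>i. K i x))"
    proof (rule subprob_spaceI)
      have "space (PiM I (\<lambda>i. K i x)) = (\<Pi>\<^sub>E i\<in>I. space (N i))"
        using sets_eq_imp_space_eq[OF s] by (simp add: space_PiM)
      then have "emeasure (PiM I (\<lambda>i. K i x)) (space (PiM I (\<lambda>i. K i x))) = (\<Prod>i\<in>I. emeasure (K i x) (space (N i)))"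
        by (simp only:) (rule emeasure_PiE[OF x], rule sets.top)
      also have "\<dots> \<le> 1"
      proof -
        have "J \<subseteq> I \<Longrightarrow> (\<Prod>i\<in>J. emeasure (K i x) (space (N i))) \<le> 1" if "finite J" for J
          using that
        proof induction
          case (insert i J)
          then have "emeasure (K i x) (space (N i)) * (\<Prod>i\<in>J. emeasure (K i x) (space (N i))) \<le> 1 * 1"
            using subprob_space.subprob_emeasure_le_1[OF sub] by (intro mult_mono) auto
          then show ?case using insert by simp
        qed simp
        then show ?thesis using I by blast
      qed
      finally show "emeasure (PiM I (\<lambda>i. K i x)) (space (PiM I (\<lambda>i. K i x))) \<le> 1" by simp
      have "space (K i x) \<noteq> {}" if "i \<in> I" for i using sub[OF that] by (rule subprob_space.subprob_not_empty)
      then show "space (PiM I (\<lambda>i. K i x)) \<noteq> {}" by (auto simp: space_PiM PiE_eq_empty_iff)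
    qed
  next
    fix A assume "A \<in> prod_algebra I N"
    then obtain X where "A = PiE I X" "\<And>i. i \<in> I \<Longrightarrow> X i \<in> sets (N i)"
      by (auto simp: prod_algebra_eq_finite[OF I] Pi_iff)
    then show "(\<lambda>x. emeasure (PiM I (\<lambda>i. K i x)) A) \<in> borel_measurable M" using m by simp
  next
    show "(\<lambda>x. emeasure (PiM I (\<lambda>i. K i x)) (\<Pi>\<^sub>E i\<in>I. space (N i))) \<in> borel_measurable M"
      by (rule m) auto
  qed
qed

text \<open>\<open>0 powr a = 0\<close> makes the density vanish. The kernels below are defined for
  every real \<open>l\<close>, and \<open>l = 0\<close> gives the rate 0; this is why they are
  handled as sub-probability kernels.\<close>

lemma gamma_law_rate_0: "0 < a \<Longrightarrow> emeasure (gamma_law a 0) X = 0"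
proof -
  assume a: "0 < a"
  have "gamma_law a 0 = density lborel (\<lambda>_. 0)"
    unfolding gamma_law_def by (intro arg_cong2[where f=density]) auto
  then show ?thesis by (cases "X \<in> sets borel") (auto simp: emeasure_density emeasure_notin_sets)
qed

lemma subprob_space_gamma_law:
  assumes "0 < a" "0 \<le> b" shows "subprob_space (gamma_law a b)"
proof (cases "b = 0")
  case True
  then show ?thesis using assms by (intro subprob_spaceI) (auto simp: gamma_law_rate_0)
next
  case False
  then interpret prob_space "gamma_law a b" using assms by (intro prob_space_gamma_law) auto
  show ?thesis by unfold_locales
qed

lemma measurable_gamma_law:
  assumes a: "0 < a" and [measurable]: "b \<in> borel_measurable M" and b: "\<And>x. x \<in> space M \<Longrightarrow> 0 \<le> b x"
  shows "(\<lambda>x. gamma_law a (b x)) \<in> measurable M (subprob_algebra borel)"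
proof (rule measurable_subprob_algebra)
  fix A :: "real set" assume [measurable]: "A \<in> sets borel"
  have "(\<lambda>x. \<integral>\<^sup>+z. ennreal (if 0 < z then b x powr a / Gamma a * z powr (a - 1) * exp (- b x * z) else 0) * indicator A z \<partial>lborel) \<in> borel_measurable M"
    by (rule lborel.borel_measurable_nn_integral) measurable
  then show "(\<lambda>x. emeasure (gamma_law a (b x)) A) \<in> borel_measurable M"
    by (simp add: gamma_law_def emeasure_density)
qed (use a b in \<open>auto intro: subprob_space_gamma_law\<close>)

lemma sets_normalise [simp, measurable_cong]: "sets (normalise m) = sets m"
  by (simp add: normalise_def)

lemma space_normalise [simp]: "space (normalise m) = space m"
  by (rule sets_eq_imp_space_eq) simp

section \<open>The law of the hierarchy for a fixed partition\<close>

context gg_setting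
begin

abbreviation "H \<equiv> normalise \<eta>"

lemma prob_space_H: "prob_space H"
proof (rule prob_spaceI)
  have "emeasure H (space H) = inverse (ennreal (measure \<eta> (space \<eta>))) * ennreal (measure \<eta> (space \<eta>))"
    unfolding space_normalise by (simp add: normalise_def \<eta>.emeasure_eq_measure)
  then show "emeasure H (space H) = 1"
    using mass_pos by (simp add: inverse_ennreal flip: ennreal_mult)
qed

lemma nn_integral_H:
  assumes "f \<in> borel_measurable \<eta>"
  shows "(\<integral>\<^sup>+y. f y \<partial>\<eta>) = ennreal (measure \<eta> (space \<eta>)) * (\<integral>\<^sup>+y. f y \<partial>H)"
proof -
  have "(\<integral>\<^sup>+y. f y \<partial>H) = inverse (emeasure \<eta> (space \<eta>)) * (\<integral>\<^sup>+y. f y \<partial>\<eta>)"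
    unfolding normalise_def using assms by (rule nn_integral_scale_measure)
  moreover have "ennreal (measure \<eta> (space \<eta>)) * inverse (emeasure \<eta> (space \<eta>)) = 1"
    using mass_pos by (simp add: \<eta>.emeasure_eq_measure inverse_ennreal flip: ennreal_mult)
  ultimately show ?thesis by (simp add: mult.assoc[symmetric])
qed

text \<open>The definition of \<open>gg b\<close> hides its dependence on \<open>b\<close>. By
  \<open>gg_eq_tilt\<close> the mass of a set is an integral against the fixed law \<open>Q0\<close>
  with \<open>b\<close> as a parameter.\<close>

lemma measurable_gg:
  assumes [measurable]: "b \<in> borel_measurable M" and b: "\<And>x. x \<in> space M \<Longrightarrow> 0 \<le> b x"
  shows "(\<lambda>x. gg (b x)) \<in> measurable M (subprob_algebra (measure_algebra \<eta>))"
proof (rule measurable_subprob_algebra)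
  fix x
  interpret prob_space "gg (b x)" by (rule prob_space_gg)
  show "subprob_space (gg (b x))" by unfold_locales
next
  interpret Q0: prob_space Q0 by (rule prob_space_gg)
  fix A assume [measurable]: "A \<in> sets (measure_algebra \<eta>)"
  have "(\<lambda>x. \<integral>\<^sup>+m. ennreal (exp_minus (ennreal (b x) * mass m) * exp (K * b x powr \<alpha>)) * indicator A m \<partial>Q0) \<in> borel_measurable M"
    by (rule Q0.borel_measurable_nn_integral) measurable
  moreover have "emeasure (gg (b x)) A =
    (\<integral>\<^sup>+m. ennreal (exp_minus (ennreal (b x) * mass m) * exp (K * b x powr \<alpha>)) * indicator A m \<partial>Q0)" if "x \<in> space M" for x
    by (subst gg_eq_tilt[OF b[OF that]]) (simp add: emeasure_density)
  ultimately show "(\<lambda>x. emeasure (gg (b x)) A) \<in> borel_measurable M"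
    by (simp cong: measurable_cong)
qed auto

text \<open>Has the exact form of the integrand in \<open>PD_hierarchy\<close>, so that
  \<open>block_law\<close> unfolds to the last clause there. The shape \<open>a\<close> of
  \<open>block_law\<close> is kept as a free parameter until
  \<open>card q + \<theta> / \<alpha>\<close> is inserted for it.\<close>

definition block_kernel :: "nat set set \<Rightarrow> real \<Rightarrow> (real \<times> (nat set \<Rightarrow> 'y) \<times> 'y measure \<times> (nat set \<Rightarrow> real)) measure" where
  "block_kernel q l = return borel l \<Otimes>\<^sub>M PiM q (\<lambda>_. H) \<Otimes>\<^sub>M gg (l powr (1 / \<alpha>)) \<Otimes>\<^sub>M
     PiM q (\<lambda>C. gamma_law (real (card C) - \<alpha>) (l powr (1 / \<alpha>)))"

definition block_law :: "real \<Rightarrow> nat set set \<Rightarrow> (real \<times> (nat set \<Rightarrow> 'y) \<times> 'y measure \<times> (nat set \<Rightarrow> real)) measure" where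
  "block_law a q = gamma_law a K \<bind> block_kernel q"

abbreviation block_space :: "nat set set \<Rightarrow> (real \<times> (nat set \<Rightarrow> 'y) \<times> 'y measure \<times> (nat set \<Rightarrow> real)) measure" where
  "block_space q \<equiv> borel \<Otimes>\<^sub>M PiM q (\<lambda>_. \<eta>) \<Otimes>\<^sub>M measure_algebra \<eta> \<Otimes>\<^sub>M PiM q (\<lambda>_. borel)"

lemma prob_space_PiM_H: "prob_space (PiM q (\<lambda>_. H))"
  by (intro prob_space_PiM prob_space_H)

lemma prob_space_PiM_gamma:
  assumes "\<And>C. C \<in> q \<Longrightarrow> 0 < card C" "0 < b"
  shows "prob_space (PiM q (\<lambda>C. gamma_law (real (card C) - \<alpha>) b))"
proof (intro prob_space_PiM prob_space_gamma_law assms(2))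
  fix C assume "C \<in> q"
  then show "0 < real (card C) - \<alpha>" using assms(1)[of C] \<alpha> by (cases "card C") auto
qed

lemma measurable_block_kernel:
  assumes q: "finite q" "\<And>C. C \<in> q \<Longrightarrow> 0 < card C"
  shows "block_kernel q \<in> measurable borel (subprob_algebra (block_space q))"
  unfolding block_kernel_def[abs_def]
proof (intro measurable_pair_measure)
  show "return borel \<in> measurable borel (subprob_algebra borel)" by (rule return_measurable)
  interpret P: prob_space "PiM q (\<lambda>_. H)" by (rule prob_space_PiM_H)
  have "PiM q (\<lambda>_. H) \<in> space (subprob_algebra (PiM q (\<lambda>_. \<eta>)))"
    by (auto simp: space_subprob_algebra P.subprob_space_axioms intro!: sets_PiM_cong)
  then show "(\<lambda>_. PiM q (\<lambda>_. H)) \<in> measurable borel (subprob_algebra (PiM q (\<lambda>_. \<eta>)))"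
    by (rule measurable_const)
  show "(\<lambda>l. gg (l powr (1 / \<alpha>))) \<in> measurable borel (subprob_algebra (measure_algebra \<eta>))"
    by (rule measurable_gg) auto
  show "(\<lambda>l. PiM q (\<lambda>C. gamma_law (real (card C) - \<alpha>) (l powr (1 / \<alpha>)))) \<in> measurable borel (subprob_algebra (PiM q (\<lambda>_. borel)))"
  proof (rule measurable_PiM_kernel[OF q(1)])
    fix C assume "C \<in> q"
    then have "0 < real (card C) - \<alpha>" using q(2)[of C] \<alpha> by (cases "card C") auto
    then show "(\<lambda>l. gamma_law (real (card C) - \<alpha>) (l powr (1 / \<alpha>))) \<in> measurable borel (subprob_algebra borel)"
      by (rule measurable_gamma_law) auto
  qed
qed

lemma sets_block_law: "sets (block_law a q) = sets (block_space q)"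
  unfolding block_law_def
proof (rule sets_bind)
  show "sets (block_kernel q l) = sets (block_space q)" for l
    unfolding block_kernel_def by (intro sets_pair_measure_cong sets_PiM_cong) auto
qed simp

lemma nn_integral_block_law:
  assumes q: "finite q" "\<And>C. C \<in> q \<Longrightarrow> 0 < card C" and F[measurable]: "F \<in> borel_measurable (block_space q)"
  shows "(\<integral>\<^sup>+z. F z \<partial>block_law a q) =
    (\<integral>\<^sup>+l. \<integral>\<^sup>+y. \<integral>\<^sup>+m. \<integral>\<^sup>+j. F (l, y, m, j) \<partial>PiM q (\<lambda>C. gamma_law (real (card C) - \<alpha>) (l powr (1 / \<alpha>)))
      \<partial>gg (l powr (1 / \<alpha>)) \<partial>PiM q (\<lambda>_. H) \<partial>gamma_law a K)"
proof -
  have "(\<integral>\<^sup>+z. F z \<partial>block_law a q) = (\<integral>\<^sup>+l. \<integral>\<^sup>+z. F z \<partial>block_kernel q l \<partial>gamma_law a K)"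
    unfolding block_law_def
    by (rule nn_integral_bind[OF F]) (use measurable_block_kernel[OF q] in \<open>simp cong: measurable_cong_sets\<close>)
  also have "\<dots> = (\<integral>\<^sup>+l. \<integral>\<^sup>+y. \<integral>\<^sup>+m. \<integral>\<^sup>+j. F (l, y, m, j) \<partial>PiM q (\<lambda>C. gamma_law (real (card C) - \<alpha>) (l powr (1 / \<alpha>)))
      \<partial>gg (l powr (1 / \<alpha>)) \<partial>PiM q (\<lambda>_. H) \<partial>gamma_law a K)"
  \<comment> \<open>For \<open>l \<le> 0\<close> the factors need not be probability laws; the gamma
    law charges only \<open>l > 0\<close>.\<close>
  proof (rule nn_integral_cong_AE, rule eventually_mono[OF AE_gamma_law])
    fix l :: real assume l: "0 < l"
    let ?G = "PiM q (\<lambda>C. gamma_law (real (card C) - \<alpha>) (l powr (1 / \<alpha>)))"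
    interpret G: prob_space ?G using l by (intro prob_space_PiM_gamma q) auto
    interpret Y: prob_space "PiM q (\<lambda>_. H)" by (rule prob_space_PiM_H)
    interpret M: prob_space "gg (l powr (1 / \<alpha>))" by (rule prob_space_gg)
    interpret MG: prob_space "gg (l powr (1 / \<alpha>)) \<Otimes>\<^sub>M ?G"
      by (intro prob_space_pair M.prob_space_axioms G.prob_space_axioms)
    interpret YMG: prob_space "PiM q (\<lambda>_. H) \<Otimes>\<^sub>M gg (l powr (1 / \<alpha>)) \<Otimes>\<^sub>M ?G"
      by (intro prob_space_pair Y.prob_space_axioms MG.prob_space_axioms)
    have s1[measurable_cong]: "sets ?G = sets (PiM q (\<lambda>_. borel))" by (intro sets_PiM_cong) auto
    have s3[measurable_cong]: "sets (return borel l) = sets borel" by simp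
    have s2[measurable_cong]: "sets (PiM q (\<lambda>_. H)) = sets (PiM q (\<lambda>_. \<eta>))" by (intro sets_PiM_cong) auto
    have "(\<integral>\<^sup>+z. F z \<partial>block_kernel q l) = (\<integral>\<^sup>+l'. \<integral>\<^sup>+z. F (l', z) \<partial>(PiM q (\<lambda>_. H) \<Otimes>\<^sub>M gg (l powr (1 / \<alpha>)) \<Otimes>\<^sub>M ?G) \<partial>return borel l)"
      unfolding block_kernel_def by (rule YMG.nn_integral_fst[symmetric]) measurable
    also have "\<dots> = (\<integral>\<^sup>+z. F (l, z) \<partial>(PiM q (\<lambda>_. H) \<Otimes>\<^sub>M gg (l powr (1 / \<alpha>)) \<Otimes>\<^sub>M ?G))"
      by (rule nn_integral_return) (auto intro!: YMG.borel_measurable_nn_integral)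
    also have "\<dots> = (\<integral>\<^sup>+y. \<integral>\<^sup>+w. F (l, y, w) \<partial>(gg (l powr (1 / \<alpha>)) \<Otimes>\<^sub>M ?G) \<partial>PiM q (\<lambda>_. H))"
      by (rule MG.nn_integral_fst[symmetric]) measurable
    also have "\<dots> = (\<integral>\<^sup>+y. \<integral>\<^sup>+m. \<integral>\<^sup>+j. F (l, y, m, j) \<partial>?G \<partial>gg (l powr (1 / \<alpha>)) \<partial>PiM q (\<lambda>_. H))"
    proof (rule nn_integral_cong)
      fix y assume "y \<in> space (PiM q (\<lambda>_. H))"
      then have [measurable]: "y \<in> space (PiM q (\<lambda>_. \<eta>))" using sets_eq_imp_space_eq[OF s2] by simp
      show "(\<integral>\<^sup>+w. F (l, y, w) \<partial>(gg (l powr (1 / \<alpha>)) \<Otimes>\<^sub>M ?G)) = (\<integral>\<^sup>+m. \<integral>\<^sup>+j. F (l, y, m, j) \<partial>?G \<partial>gg (l powr (1 / \<alpha>)))"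
        by (rule G.nn_integral_fst[symmetric]) measurable
    qed
    finally show "(\<integral>\<^sup>+z. F z \<partial>block_kernel q l) =
      (\<integral>\<^sup>+y. \<integral>\<^sup>+m. \<integral>\<^sup>+j. F (l, y, m, j) \<partial>?G \<partial>gg (l powr (1 / \<alpha>)) \<partial>PiM q (\<lambda>_. H))" .
  qed
  finally show ?thesis .
qed

text \<open>The substitution \<open>z = l powr (1 / \<alpha>) * T\<close>, which turns the mixture over \<open>l\<close> of the
  exponentially tilted laws into the polynomially tilted one.\<close>

lemma nn_integral_mixed_tilt:
  assumes a: "0 < a" and F: "case_prod F \<in> borel_measurable (borel \<Otimes>\<^sub>M measure_algebra \<eta>)"
  shows "(\<integral>\<^sup>+l. \<integral>\<^sup>+m. F (l powr (1 / \<alpha>) * tmass m) m \<partial>gg (l powr (1 / \<alpha>)) \<partial>gamma_law a K) =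
    (\<integral>\<^sup>+m. ennreal (\<alpha> * K powr a * Gamma (\<alpha> * a) / Gamma a * tmass m powr - (\<alpha> * a)) *
      (\<integral>\<^sup>+z. F z m \<partial>gamma_law (\<alpha> * a) 1) \<partial>Q0)"
proof -
  interpret Q0: prob_space Q0 by (rule prob_space_gg)
  interpret pair_sigma_finite lborel Q0 ..
  have F'[measurable]: "(\<lambda>x. F (f x) (h x)) \<in> borel_measurable N"
    if [measurable]: "f \<in> borel_measurable N" "h \<in> measurable N (measure_algebra \<eta>)" for f h N
    using measurable_compose[OF measurable_Pair[OF that] F] by simp
  have G: "0 < Gamma a" "0 < Gamma (\<alpha> * a)" using a \<alpha> by (auto intro!: Gamma_real_pos)
  let ?c = "K powr a / Gamma a"
  \<comment> \<open>The tilt contributes \<open>exp (K * l)\<close> and the gamma density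
    \<open>exp (- K * l)\<close>; they cancel, and \<open>k\<close> is what remains of the integrand
    under \<open>Q0\<close>.\<close>
  define k where "k l m = F (l powr (1 / \<alpha>) * tmass m) m * ennreal (exp (- (l powr (1 / \<alpha>) * tmass m)) * l powr (a - 1))" for l m
  have km[measurable]: "(\<lambda>(l, m). k l m) \<in> borel_measurable (borel \<Otimes>\<^sub>M measure_algebra \<eta>)"
    unfolding k_def by measurable
  have eq1: "(\<integral>\<^sup>+l. \<integral>\<^sup>+m. F (l powr (1 / \<alpha>) * tmass m) m \<partial>gg (l powr (1 / \<alpha>)) \<partial>gamma_law a K) =
    ennreal ?c * (\<integral>\<^sup>+l. (\<integral>\<^sup>+m. F (l powr (1 / \<alpha>) * tmass m) m \<partial>gg (l powr (1 / \<alpha>))) *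
       ennreal (l powr (a - 1) * exp (- K * l)) * indicator {0<..} l \<partial>lborel)"
  proof (rule nn_integral_gamma_law)
    show "(\<lambda>l. \<integral>\<^sup>+m. F (l powr (1 / \<alpha>) * tmass m) m \<partial>gg (l powr (1 / \<alpha>))) \<in> borel_measurable borel"
    proof (rule nn_integral_measurable_subprob_algebra2[where N="measure_algebra \<eta>"])
      show "(\<lambda>(l, m). F (l powr (1 / \<alpha>) * tmass m) m) \<in> borel_measurable (borel \<Otimes>\<^sub>M measure_algebra \<eta>)"
        unfolding split_beta' by (rule F') measurable
      show "(\<lambda>l. gg (l powr (1 / \<alpha>))) \<in> measurable borel (subprob_algebra (measure_algebra \<eta>))"
        by (rule measurable_gg) auto
    qed
  qed (use a K_pos in auto)
  have eq2: "(\<integral>\<^sup>+m. F (l powr (1 / \<alpha>) * tmass m) m \<partial>gg (l powr (1 / \<alpha>))) *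
       ennreal (l powr (a - 1) * exp (- K * l)) * indicator {0<..} l = (\<integral>\<^sup>+m. k l m * indicator {0<..} l \<partial>Q0)" for l :: real
  proof (cases "0 < l")
    case True
    let ?b = "l powr (1 / \<alpha>)"
    have bl: "?b powr \<alpha> = l" using True \<alpha> by (simp add: powr_powr)
    have e1: "(\<integral>\<^sup>+m. F (?b * tmass m) m \<partial>gg ?b) =
      (\<integral>\<^sup>+m. ennreal (exp_minus (ennreal ?b * mass m) * exp (K * ?b powr \<alpha>)) * F (?b * tmass m) m \<partial>Q0)"
      by (subst gg_eq_tilt) (simp_all add: nn_integral_density)
    have e2: "(\<integral>\<^sup>+m. ennreal (exp_minus (ennreal ?b * mass m) * exp (K * ?b powr \<alpha>)) * F (?b * tmass m) m \<partial>Q0) * ennreal (l powr (a - 1) * exp (- K * l)) =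
      (\<integral>\<^sup>+m. ennreal (exp_minus (ennreal ?b * mass m) * exp (K * ?b powr \<alpha>)) * F (?b * tmass m) m * ennreal (l powr (a - 1) * exp (- K * l)) \<partial>Q0)"
      by (rule nn_integral_multc[symmetric]) measurable
    have e3: "(\<integral>\<^sup>+m. ennreal (exp_minus (ennreal ?b * mass m) * exp (K * ?b powr \<alpha>)) * F (?b * tmass m) m * ennreal (l powr (a - 1) * exp (- K * l)) \<partial>Q0) = (\<integral>\<^sup>+m. k l m \<partial>Q0)"
    proof (rule nn_integral_cong_AE, rule eventually_mono[OF AE_mass])
      fix m :: "'y measure" assume m: "0 < mass m \<and> mass m < \<top>"
      then have "mass m = ennreal (tmass m)" by (intro emeasure_eq_ennreal_measure) auto
      then have e: "exp_minus (ennreal ?b * mass m) = exp (- (?b * tmass m))"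
        by (simp add: exp_minus_ennreal flip: ennreal_mult)
      have "exp (- (?b * tmass m)) * exp (K * l) * (l powr (a - 1) * exp (- K * l)) = exp (- (?b * tmass m)) * l powr (a - 1)"
        by (simp add: exp_minus)
      then have e': "ennreal (exp (- (?b * tmass m)) * exp (K * l)) * ennreal (l powr (a - 1) * exp (- K * l)) =
        ennreal (exp (- (?b * tmass m)) * l powr (a - 1))"
        by (simp flip: ennreal_mult)
      then show "ennreal (exp_minus (ennreal ?b * mass m) * exp (K * ?b powr \<alpha>)) * F (?b * tmass m) m * ennreal (l powr (a - 1) * exp (- K * l)) = k l m"
        unfolding e bl k_def e'[symmetric] by (simp only: mult_ac)
    qed
    have "(\<integral>\<^sup>+m. F (?b * tmass m) m \<partial>gg ?b) * ennreal (l powr (a - 1) * exp (- K * l)) = (\<integral>\<^sup>+m. k l m \<partial>Q0)"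
      unfolding e1 e2 e3 ..
    then show ?thesis using True by simp
  qed simp
  have eq3: "(\<integral>\<^sup>+l. \<integral>\<^sup>+m. k l m * indicator {0<..} l \<partial>Q0 \<partial>lborel) = (\<integral>\<^sup>+m. \<integral>\<^sup>+l. k l m * indicator {0<..} l \<partial>lborel \<partial>Q0)"
    by (rule Fubini'[symmetric]) measurable
  have eq4: "ennreal ?c * (\<integral>\<^sup>+m. \<integral>\<^sup>+l. k l m * indicator {0<..} l \<partial>lborel \<partial>Q0) =
    (\<integral>\<^sup>+m. ennreal ?c * (\<integral>\<^sup>+l. k l m * indicator {0<..} l \<partial>lborel) \<partial>Q0)"
    by (rule nn_integral_cmult[symmetric]) measurable
  have eq5: "(\<integral>\<^sup>+m. ennreal ?c * (\<integral>\<^sup>+l. k l m * indicator {0<..} l \<partial>lborel) \<partial>Q0) = (\<integral>\<^sup>+m. ennreal (\<alpha> * K powr a * Gamma (\<alpha> * a) / Gamma a * tmass m powr - (\<alpha> * a)) *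
      (\<integral>\<^sup>+z. F z m \<partial>gamma_law (\<alpha> * a) 1) \<partial>Q0)"
  proof (rule nn_integral_cong_AE)
    show "AE m in Q0. ennreal ?c * (\<integral>\<^sup>+l. k l m * indicator {0<..} l \<partial>lborel) =
      ennreal (\<alpha> * K powr a * Gamma (\<alpha> * a) / Gamma a * tmass m powr - (\<alpha> * a)) * (\<integral>\<^sup>+z. F z m \<partial>gamma_law (\<alpha> * a) 1)"
      using AE_mass AE_space
    proof eventually_elim
      case (elim m)
      let ?T = "tmass m"
      have "mass m = ennreal ?T" using elim by (intro emeasure_eq_ennreal_measure) auto
      then have T: "0 < ?T" using elim by (cases "?T = 0") (auto simp: less_le)
      have mm: "m \<in> space (measure_algebra \<eta>)" using elim by (simp add: space_gg space_measure_algebra)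
      have Fm[measurable]: "(\<lambda>x. F (f x) m) \<in> borel_measurable N" if "f \<in> borel_measurable N" for f and N :: "real measure"
        using that mm by (intro F') auto
      \<comment> \<open>Both sides are reduced to \<open>J\<close>. On the left
        \<open>l = x powr \<alpha>\<close> turns \<open>l powr (a - 1)\<close>, with the derivative
        \<open>\<alpha> * x powr (\<alpha> - 1)\<close>, into
        \<open>\<alpha> * x powr (\<alpha> * a - 1)\<close>; on the right \<open>z = ?T * x\<close>
        brings out the power of \<open>?T\<close> that cancels the polynomial tilt.\<close>
      define J where "J = (\<integral>\<^sup>+x. F (x * ?T) m * ennreal (x powr (\<alpha> * a - 1) * exp (- (x * ?T))) * indicator {0<..} x \<partial>lborel)"
      have km1: "(\<lambda>l. k l m) \<in> borel_measurable borel" unfolding k_def by measurable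
      have "(\<integral>\<^sup>+l. k l m * indicator {0<..} l \<partial>lborel) =
        (\<integral>\<^sup>+x. k (x powr \<alpha>) m * ennreal (\<alpha> * x powr (\<alpha> - 1)) * indicator {0<..} x \<partial>lborel)"
        by (rule nn_integral_powr_substitution[OF \<alpha>(1) km1, symmetric])
      also have "\<dots> = (\<integral>\<^sup>+x. ennreal \<alpha> * (F (x * ?T) m * ennreal (x powr (\<alpha> * a - 1) * exp (- (x * ?T))) * indicator {0<..} x) \<partial>lborel)"
      proof (rule nn_integral_cong)
        fix x :: real
        show "k (x powr \<alpha>) m * ennreal (\<alpha> * x powr (\<alpha> - 1)) * indicator {0<..} x =
          ennreal \<alpha> * (F (x * ?T) m * ennreal (x powr (\<alpha> * a - 1) * exp (- (x * ?T))) * indicator {0<..} x)"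
        proof (cases "0 < x")
          case True
          have 1: "(x powr \<alpha>) powr (1 / \<alpha>) = x" using True \<alpha> by (simp add: powr_powr)
          have "(x powr \<alpha>) powr (a - 1) * x powr (\<alpha> - 1) = x powr (\<alpha> * a - 1)"
            by (simp add: powr_powr right_diff_distrib flip: powr_add)
          then have "exp (- (x * ?T)) * (x powr \<alpha>) powr (a - 1) * (\<alpha> * x powr (\<alpha> - 1)) =
            \<alpha> * (x powr (\<alpha> * a - 1) * exp (- (x * ?T)))"
            by (metis (no_types, lifting) mult.assoc mult.commute)
          then have 2: "ennreal (exp (- (x * ?T)) * (x powr \<alpha>) powr (a - 1)) * ennreal (\<alpha> * x powr (\<alpha> - 1)) =
            ennreal \<alpha> * ennreal (x powr (\<alpha> * a - 1) * exp (- (x * ?T)))"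
            using \<alpha> by (simp flip: ennreal_mult)
          show ?thesis using True unfolding k_def 1 by (simp add: mult.assoc 2) (simp add: mult.left_commute)
        qed simp
      qed
      also have "\<dots> = ennreal \<alpha> * J"
        unfolding J_def by (rule nn_integral_cmult) measurable
      finally have L: "(\<integral>\<^sup>+l. k l m * indicator {0<..} l \<partial>lborel) = ennreal \<alpha> * J" .
      let ?h = "\<lambda>z. F z m * ennreal (z powr (\<alpha> * a - 1) * exp (- 1 * z)) * indicator {0<..} z"
      have R1: "(\<integral>\<^sup>+z. F z m \<partial>gamma_law (\<alpha> * a) 1) = ennreal (1 powr (\<alpha> * a) / Gamma (\<alpha> * a)) * (\<integral>\<^sup>+z. ?h z \<partial>lborel)"
        using a \<alpha> by (intro nn_integral_gamma_law) auto
      have "(\<integral>\<^sup>+z. ?h z \<partial>lborel) = ennreal \<bar>?T\<bar> * (\<integral>\<^sup>+x. ?h (0 + ?T * x) \<partial>lborel)"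
        by (rule nn_integral_real_affine) (use T in auto)
      also have "(\<integral>\<^sup>+x. ?h (0 + ?T * x) \<partial>lborel) = (\<integral>\<^sup>+x. ennreal (?T powr (\<alpha> * a - 1)) *
        (F (x * ?T) m * ennreal (x powr (\<alpha> * a - 1) * exp (- (x * ?T))) * indicator {0<..} x) \<partial>lborel)"
      proof (rule nn_integral_cong)
        fix x :: real
        show "?h (0 + ?T * x) = ennreal (?T powr (\<alpha> * a - 1)) *
          (F (x * ?T) m * ennreal (x powr (\<alpha> * a - 1) * exp (- (x * ?T))) * indicator {0<..} x)"
        proof (cases "0 < x")
          case True
          have "ennreal ((?T * x) powr (\<alpha> * a - 1) * exp (- 1 * (?T * x))) =
            ennreal (?T powr (\<alpha> * a - 1)) * ennreal (x powr (\<alpha> * a - 1) * exp (- (x * ?T)))"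
            using T True by (simp add: powr_mult mult_ac flip: ennreal_mult)
          then show ?thesis using T True by (simp add: mult.left_commute mult.commute[of ?T x])
        qed (use T in \<open>auto simp: zero_less_mult_iff\<close>)
      qed
      also have "\<dots> = ennreal (?T powr (\<alpha> * a - 1)) * J"
        unfolding J_def by (rule nn_integral_cmult) measurable
      finally have R2: "(\<integral>\<^sup>+z. ?h z \<partial>lborel) = ennreal \<bar>?T\<bar> * (ennreal (?T powr (\<alpha> * a - 1)) * J)" .
      have "?T * ?T powr (\<alpha> * a - 1) = ?T powr (\<alpha> * a)" using T by (simp add: powr_mult_base)
      then have "\<alpha> * K powr a * Gamma (\<alpha> * a) / Gamma a * ?T powr - (\<alpha> * a) * (1 powr (\<alpha> * a) / Gamma (\<alpha> * a) * (\<bar>?T\<bar> * ?T powr (\<alpha> * a - 1))) =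
        ?c * \<alpha>"
        using T G by (simp add: powr_minus field_simps)
      then have "ennreal (\<alpha> * K powr a * Gamma (\<alpha> * a) / Gamma a * ?T powr - (\<alpha> * a)) * (ennreal (1 powr (\<alpha> * a) / Gamma (\<alpha> * a)) * (ennreal \<bar>?T\<bar> * ennreal (?T powr (\<alpha> * a - 1)))) =
        ennreal ?c * ennreal \<alpha>"
        using G \<alpha> by (simp flip: ennreal_mult)
      then show ?case unfolding L R1 R2 by (metis (no_types, lifting) mult.assoc)
    qed
  qed
  show ?thesis unfolding eq1 eq2 eq3 eq4 eq5 ..
qed

end

lemma nn_integral_distr_indicator:
  assumes "f \<in> measurable M N" "A \<in> sets N"
  shows "emeasure (distr M N f) A = (\<integral>\<^sup>+x. indicator A (f x) \<partial>M)"
proof -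
  have "emeasure (distr M N f) A = (\<integral>\<^sup>+y. indicator A y \<partial>distr M N f)" using assms by simp
  also have "\<dots> = (\<integral>\<^sup>+x. indicator A (f x) \<partial>M)" using assms by (intro nn_integral_distr) auto
  finally show ?thesis .
qed

lemma distr_gamma_law_scale:
  assumes a: "0 < a" and b: "0 < b"
  shows "distr (gamma_law a b) borel (\<lambda>x. b * x) = gamma_law a 1"
proof (rule measure_eqI)
  fix A assume "A \<in> sets (distr (gamma_law a b) borel (\<lambda>x. b * x))"
  then have A[measurable]: "A \<in> sets borel" by simp
  have G: "0 < Gamma a" using a by (rule Gamma_real_pos)
  let ?h = "\<lambda>z. indicator A z * ennreal (z powr (a - 1) * exp (- 1 * z)) * indicator {0<..} z :: ennreal"
  let ?k = "\<lambda>x. indicator A (b * x) * ennreal (x powr (a - 1) * exp (- b * x)) * indicator {0<..} x :: ennreal"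
  have 1: "emeasure (gamma_law a 1) A = ennreal (1 powr a / Gamma a) * (\<integral>\<^sup>+z. ?h z \<partial>lborel)"
    using a by (subst nn_integral_gamma_law[symmetric]) auto
  have "(\<integral>\<^sup>+z. ?h z \<partial>lborel) = ennreal \<bar>b\<bar> * (\<integral>\<^sup>+x. ?h (0 + b * x) \<partial>lborel)"
    by (rule nn_integral_real_affine) (use b in auto)
  also have "(\<integral>\<^sup>+x. ?h (0 + b * x) \<partial>lborel) = (\<integral>\<^sup>+x. ennreal (b powr (a - 1)) * ?k x \<partial>lborel)"
  proof (rule nn_integral_cong)
    fix x :: real
    show "?h (0 + b * x) = ennreal (b powr (a - 1)) * ?k x"
    proof (cases "0 < x")
      case True
      have "ennreal ((b * x) powr (a - 1) * exp (- 1 * (b * x))) = ennreal (b powr (a - 1)) * ennreal (x powr (a - 1) * exp (- b * x))"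
        using b True by (simp add: powr_mult mult_ac flip: ennreal_mult)
      then show ?thesis using b True by (simp add: mult.left_commute)
    qed (use b in \<open>auto simp: zero_less_mult_iff\<close>)
  qed
  also have "\<dots> = ennreal (b powr (a - 1)) * (\<integral>\<^sup>+x. ?k x \<partial>lborel)"
    by (rule nn_integral_cmult) measurable
  finally have 2: "(\<integral>\<^sup>+z. ?h z \<partial>lborel) = ennreal \<bar>b\<bar> * (ennreal (b powr (a - 1)) * (\<integral>\<^sup>+x. ?k x \<partial>lborel))" .
  have 3: "emeasure (distr (gamma_law a b) borel (\<lambda>x. b * x)) A = ennreal (b powr a / Gamma a) * (\<integral>\<^sup>+x. ?k x \<partial>lborel)"
  proof -
    have "emeasure (distr (gamma_law a b) borel (\<lambda>x. b * x)) A = (\<integral>\<^sup>+x. indicator A (b * x) \<partial>gamma_law a b)"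
      by (rule nn_integral_distr_indicator) measurable
    also have "\<dots> = ennreal (b powr a / Gamma a) * (\<integral>\<^sup>+x. ?k x \<partial>lborel)"
      by (rule nn_integral_gamma_law) (use a b in auto)
    finally show ?thesis .
  qed
  have "b * b powr (a - 1) = b powr a" using b by (simp add: powr_mult_base)
  then have "ennreal (1 powr a / Gamma a) * (ennreal \<bar>b\<bar> * ennreal (b powr (a - 1))) = ennreal (b powr a / Gamma a)"
    using G b by (simp flip: ennreal_mult)
  then show "emeasure (distr (gamma_law a b) borel (\<lambda>x. b * x)) A = emeasure (gamma_law a 1) A"
    unfolding 1 2 3 by (metis (no_types, lifting) mult.assoc)
qed simp

text \<open>Total mass 0 and total mass \<infinity> are covered as well, since a positive finite
  factor changes neither of them.\<close>

lemma normalise_scale_measure: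
  assumes "0 < c"
  shows "normalise (scale_measure (ennreal c) m) = normalise m"
proof (rule measure_eqI)
  fix A
  let ?T = "emeasure m (space m)"
  have sp: "space (scale_measure (ennreal c) m) = space m" by (rule sets_eq_imp_space_eq) simp
  have "inverse (ennreal c * ?T) * ennreal c = inverse ?T"
  proof (cases ?T)
    case (real r)
    show ?thesis
    proof (cases "r = 0")
      case False
      then show ?thesis using real assms
        by (simp add: inverse_ennreal flip: ennreal_mult)
    qed (use real assms in \<open>simp add: ennreal_top_mult\<close>)
  next
    case top
    then show ?thesis using assms by (simp add: ennreal_mult_top)
  qed
  then show "emeasure (normalise (scale_measure (ennreal c) m)) A = emeasure (normalise m) A"
    by (simp add: normalise_def sp mult.assoc[symmetric])
qed simp

lemma measurable_scale_measure:
  assumes f[measurable]: "f \<in> measurable M (measure_algebra K)" and r[measurable]: "r \<in> borel_measurable M"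
  shows "(\<lambda>x. scale_measure (r x) (f x)) \<in> measurable M (measure_algebra K)"
proof (rule measurable_measure_algebra)
  show "sets (scale_measure (r x) (f x)) = sets K" if "x \<in> space M" for x
    using measurable_space[OF f that] by (simp add: space_measure_algebra)
  fix A assume "A \<in> sets K"
  then have [measurable]: "(\<lambda>x. emeasure (f x) A) \<in> borel_measurable M"
    by (intro measurable_compose[OF f measurable_emeasure_measure_algebra])
  show "(\<lambda>x. emeasure (scale_measure (r x) (f x)) A) \<in> borel_measurable M" by simp
qed

lemma measurable_normalise [measurable]: "normalise \<in> measurable (measure_algebra K) (measure_algebra K)"
  unfolding normalise_def by (intro measurable_scale_measure) auto

section \<open>Total mass, random measure and jumps under the law of the hierarchy\<close>

context gg_setting
begin

lemma block_gamma_PiM_scale: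
  assumes q: "finite q" "\<And>C. C \<in> q \<Longrightarrow> 0 < card C" and b: "0 < b"
  shows "distr (PiM q (\<lambda>C. gamma_law (real (card C) - \<alpha>) b)) (PiM q (\<lambda>_. borel)) (\<lambda>j. \<lambda>C\<in>q. b * j C) =
    PiM q (\<lambda>C. gamma_law (real (card C) - \<alpha>) 1)"
proof -
  have sh: "0 < real (card C) - \<alpha>" if "C \<in> q" for C using q(2)[OF that] \<alpha> by (cases "card C") auto
  let ?g = "\<lambda>C. gamma_law (real (card C) - \<alpha>)"
  have "distr (PiM q (\<lambda>C. ?g C b)) (PiM q (\<lambda>_. borel)) (compose q ((*) b)) =
    distr (PiM q (\<lambda>C. ?g C b)) (PiM q (\<lambda>C. ?g C 1)) (compose q ((*) b))"
    by (intro distr_cong refl sets_PiM_cong) auto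
  also have "\<dots> = PiM q (\<lambda>C. distr (?g C b) (?g C 1) ((*) b))"
    by (rule distr_PiM_finite_prob_space'[OF q(1)])
       (auto intro!: prob_space_gamma_law sh b)
  also have "\<dots> = PiM q (\<lambda>C. ?g C 1)"
  proof (intro PiM_cong refl)
    fix C assume "C \<in> q"
    have "distr (?g C b) (?g C 1) ((*) b) = distr (?g C b) borel ((*) b)" by (intro distr_cong) auto
    then show "distr (?g C b) (?g C 1) ((*) b) = ?g C 1"
      using distr_gamma_law_scale[OF sh[OF \<open>C \<in> q\<close>] b] by simp
  qed
  finally show ?thesis by (simp add: compose_def[abs_def])
qed

text \<open>A function of \<open>L\<close> and \<mu> alone does not see \<open>Y\<close> and
  \<open>J\<close>, whose laws given \<open>l > 0\<close> have mass 1; what remains is the mixture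
  of \<open>nn_integral_mixed_tilt\<close>.\<close>

lemma nn_integral_block_law_mass:
  assumes q: "finite q" "\<And>C. C \<in> q \<Longrightarrow> 0 < card C"
    and F: "case_prod F \<in> borel_measurable (borel \<Otimes>\<^sub>M measure_algebra \<eta>)"
  shows "(\<integral>\<^sup>+z. F (fst z) (fst (snd (snd z))) \<partial>block_law a q) =
    (\<integral>\<^sup>+l. \<integral>\<^sup>+m. F l m \<partial>gg (l powr (1 / \<alpha>)) \<partial>gamma_law a K)"
proof -
  have [measurable]: "(\<lambda>z. F (fst z) (fst (snd (snd z)))) \<in> borel_measurable (block_space q)"
  proof -
    have "(\<lambda>z. (fst z, fst (snd (snd z)))) \<in> measurable (block_space q) (borel \<Otimes>\<^sub>M measure_algebra \<eta>)"
      by measurable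
    from measurable_compose[OF this F] show ?thesis by simp
  qed
  interpret Y: prob_space "PiM q (\<lambda>_. H)" by (rule prob_space_PiM_H)
  have "(\<integral>\<^sup>+z. F (fst z) (fst (snd (snd z))) \<partial>block_law a q) =
    (\<integral>\<^sup>+l. \<integral>\<^sup>+y. \<integral>\<^sup>+m. \<integral>\<^sup>+j. F l m \<partial>PiM q (\<lambda>C. gamma_law (real (card C) - \<alpha>) (l powr (1 / \<alpha>)))
      \<partial>gg (l powr (1 / \<alpha>)) \<partial>PiM q (\<lambda>_. H) \<partial>gamma_law a K)"
    by (subst nn_integral_block_law[OF q]) auto
  also have "\<dots> = (\<integral>\<^sup>+l. \<integral>\<^sup>+m. F l m \<partial>gg (l powr (1 / \<alpha>)) \<partial>gamma_law a K)"
  proof (rule nn_integral_cong_AE, rule eventually_mono[OF AE_gamma_law])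
    fix l :: real assume "0 < l"
    then interpret G: prob_space "PiM q (\<lambda>C. gamma_law (real (card C) - \<alpha>) (l powr (1 / \<alpha>)))"
      by (intro prob_space_PiM_gamma q) auto
    show "(\<integral>\<^sup>+y. \<integral>\<^sup>+m. \<integral>\<^sup>+j. F l m \<partial>PiM q (\<lambda>C. gamma_law (real (card C) - \<alpha>) (l powr (1 / \<alpha>)))
      \<partial>gg (l powr (1 / \<alpha>)) \<partial>PiM q (\<lambda>_. H)) = (\<integral>\<^sup>+m. F l m \<partial>gg (l powr (1 / \<alpha>)))"
      by (simp add: G.emeasure_space_1 Y.emeasure_space_1)
  qed
  finally show ?thesis .
qed

lemma prob_space_block_law:
  assumes q: "finite q" "\<And>C. C \<in> q \<Longrightarrow> 0 < card C" and a: "0 < a"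
  shows "prob_space (block_law a q)"
proof (rule prob_spaceI)
  interpret \<Gamma>: prob_space "gamma_law a K" using a K_pos by (rule prob_space_gamma_law)
  have "emeasure (block_law a q) (space (block_law a q)) = (\<integral>\<^sup>+z. 1 \<partial>block_law a q)" by simp
  also have "\<dots> = (\<integral>\<^sup>+l. \<integral>\<^sup>+m. 1 \<partial>gg (l powr (1 / \<alpha>)) \<partial>gamma_law a K)"
    using nn_integral_block_law_mass[OF q, of "\<lambda>_ _. 1" a] by simp
  also have "\<dots> = 1"
    using prob_space.emeasure_space_1[OF prob_space_gg] by (simp add: \<Gamma>.emeasure_space_1[simplified])
  finally show "emeasure (block_law a q) (space (block_law a q)) = 1" .
qed

text \<open>A real \<open>c > 0\<close> that normalises the integral forces it to be positive and
  finite, so the quotient of extended numbers in \<open>PD_measure\<close> becomes multiplication by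
  \<open>c\<close>.\<close>

lemma PD_measure_eqI:
  assumes c: "0 < c" and Z: "ennreal c * (\<integral>\<^sup>+m. ennreal (tmass m powr - \<theta>) \<partial>Q0) = 1"
  shows "PD_measure \<alpha> \<theta> \<eta> = density Q0 (\<lambda>m. ennreal (c * tmass m powr - \<theta>))"
proof -
  let ?W = "\<integral>\<^sup>+m. ennreal (tmass m powr - \<theta>) \<partial>Q0"
  obtain w where w: "?W = ennreal w" "0 \<le> w"
    using Z c by (cases ?W) (auto simp: ennreal_mult_top)
  then have "c * w = 1" using Z c by (simp flip: ennreal_mult ennreal_1)
  moreover from this have "0 < w" using w(2) by (cases "w = 0") auto
  ultimately have "0 < w" "1 / w = c" by (auto simp: field_simps)
  then have "ennreal (tmass m powr - \<theta>) / ?W = ennreal (c * tmass m powr - \<theta>)" for m :: "'y measure"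
    unfolding w(1) by (simp add: divide_ennreal) (metis divide_inverse inverse_eq_divide mult.commute)
  then show ?thesis unfolding PD_measure_def Let_def by simp
qed

text \<open>The reciprocal of the mean of \<open>T powr - (\<alpha> * a)\<close> under
  \<open>Q0\<close>. The value is that of the constant in \<open>nn_integral_mixed_tilt\<close>,
  where the integrand 1 makes the left side a total probability.\<close>

definition tilt_const :: "real \<Rightarrow> real" where
  "tilt_const a = \<alpha> * K powr a * Gamma (\<alpha> * a) / Gamma a"

lemma tilt_const_pos: "0 < a \<Longrightarrow> 0 < tilt_const a"
  using \<alpha> K_pos by (auto simp: tilt_const_def intro!: divide_pos_pos mult_pos_pos Gamma_real_pos)

lemma PD_measure_density:
  assumes a: "0 < a"
  shows "PD_measure \<alpha> (\<alpha> * a) \<eta> = density Q0 (\<lambda>m. ennreal (tilt_const a * tmass m powr - (\<alpha> * a)))"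
proof (rule PD_measure_eqI[OF tilt_const_pos[OF a]])
  interpret \<Gamma>: prob_space "gamma_law a K" using a K_pos by (rule prob_space_gamma_law)
  interpret \<Gamma>': prob_space "gamma_law (\<alpha> * a) 1" using a \<alpha> by (intro prob_space_gamma_law) auto
  have "1 = (\<integral>\<^sup>+l. \<integral>\<^sup>+m. 1 \<partial>gg (l powr (1 / \<alpha>)) \<partial>gamma_law a K)"
    using prob_space.emeasure_space_1[OF prob_space_gg] by (simp add: \<Gamma>.emeasure_space_1[simplified])
  also have "\<dots> = (\<integral>\<^sup>+m. ennreal (tilt_const a * tmass m powr - (\<alpha> * a)) * (\<integral>\<^sup>+z. 1 \<partial>gamma_law (\<alpha> * a) 1) \<partial>Q0)"
    unfolding tilt_const_def by (rule nn_integral_mixed_tilt[OF a]) simp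
  also have "\<dots> = (\<integral>\<^sup>+m. ennreal (tilt_const a) * ennreal (tmass m powr - (\<alpha> * a)) \<partial>Q0)"
    using tilt_const_pos[OF a] by (simp add: \<Gamma>'.emeasure_space_1[simplified] ennreal_mult less_imp_le)
  also have "\<dots> = ennreal (tilt_const a) * (\<integral>\<^sup>+m. ennreal (tmass m powr - (\<alpha> * a)) \<partial>Q0)"
    by (rule nn_integral_cmult) measurable
  finally show "ennreal (tilt_const a) * (\<integral>\<^sup>+m. ennreal (tmass m powr - (\<alpha> * a)) \<partial>Q0) = 1" ..
qed

lemma sets_PD_measure [simp, measurable_cong]: "sets (PD_measure \<alpha> \<theta> \<eta>) = sets (measure_algebra \<eta>)"
  by (simp add: PD_measure_def Let_def)

lemma prob_space_PD_measure:
  assumes a: "0 < a" shows "prob_space (PD_measure \<alpha> (\<alpha> * a) \<eta>)"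
proof (rule prob_spaceI)
  interpret \<Gamma>: prob_space "gamma_law a K" using a K_pos by (rule prob_space_gamma_law)
  interpret \<Gamma>': prob_space "gamma_law (\<alpha> * a) 1" using a \<alpha> by (intro prob_space_gamma_law) auto
  have "emeasure (PD_measure \<alpha> (\<alpha> * a) \<eta>) (space (PD_measure \<alpha> (\<alpha> * a) \<eta>)) = (\<integral>\<^sup>+m. 1 \<partial>PD_measure \<alpha> (\<alpha> * a) \<eta>)" by simp
  also have "\<dots> = (\<integral>\<^sup>+m. ennreal (tilt_const a * tmass m powr - (\<alpha> * a)) * 1 \<partial>Q0)"
    unfolding PD_measure_density[OF a] by (rule nn_integral_density) measurable
  also have "\<dots> = (\<integral>\<^sup>+m. ennreal (tilt_const a * tmass m powr - (\<alpha> * a)) * (\<integral>\<^sup>+z. 1 \<partial>gamma_law (\<alpha> * a) 1) \<partial>Q0)"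
    by (simp add: \<Gamma>'.emeasure_space_1[simplified])
  also have "\<dots> = (\<integral>\<^sup>+l. \<integral>\<^sup>+m. 1 \<partial>gg (l powr (1 / \<alpha>)) \<partial>gamma_law a K)"
    unfolding tilt_const_def by (rule nn_integral_mixed_tilt[OF a, symmetric]) simp
  also have "\<dots> = 1"
    using prob_space.emeasure_space_1[OF prob_space_gg] by (simp add: \<Gamma>.emeasure_space_1[simplified])
  finally show "emeasure (PD_measure \<alpha> (\<alpha> * a) \<eta>) (space (PD_measure \<alpha> (\<alpha> * a) \<eta>)) = 1" .
qed

text \<open>Probabilistically: under the mixture \<open>L powr (1 / \<alpha>) * T\<close> is gamma
  with shape \<open>\<alpha> * a\<close> and independent of \<mu>, whose law is the polynomially
  tilted one. Both marginal laws are projections of this.\<close>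

lemma nn_integral_mixed_tilt_PD:
  assumes a: "0 < a" and F: "case_prod F \<in> borel_measurable (borel \<Otimes>\<^sub>M measure_algebra \<eta>)"
  shows "(\<integral>\<^sup>+l. \<integral>\<^sup>+m. F (l powr (1 / \<alpha>) * tmass m) m \<partial>gg (l powr (1 / \<alpha>)) \<partial>gamma_law a K) =
    (\<integral>\<^sup>+m. \<integral>\<^sup>+z. F z m \<partial>gamma_law (\<alpha> * a) 1 \<partial>PD_measure \<alpha> (\<alpha> * a) \<eta>)"
proof -
  interpret \<Gamma>': prob_space "gamma_law (\<alpha> * a) 1" using a \<alpha> by (intro prob_space_gamma_law) auto
  have "(\<lambda>(m, z). F z m) \<in> borel_measurable (measure_algebra \<eta> \<Otimes>\<^sub>M gamma_law (\<alpha> * a) 1)"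
  proof -
    have "(\<lambda>x. (snd x, fst x)) \<in> measurable (measure_algebra \<eta> \<Otimes>\<^sub>M gamma_law (\<alpha> * a) 1) (borel \<Otimes>\<^sub>M measure_algebra \<eta>)"
      by measurable
    from measurable_compose[OF this F] show ?thesis by (simp add: split_beta')
  qed
  then have "(\<lambda>m. \<integral>\<^sup>+z. F z m \<partial>gamma_law (\<alpha> * a) 1) \<in> borel_measurable (measure_algebra \<eta>)"
    by (rule \<Gamma>'.borel_measurable_nn_integral)
  then have "(\<integral>\<^sup>+m. \<integral>\<^sup>+z. F z m \<partial>gamma_law (\<alpha> * a) 1 \<partial>PD_measure \<alpha> (\<alpha> * a) \<eta>) =
    (\<integral>\<^sup>+m. ennreal (tilt_const a * tmass m powr - (\<alpha> * a)) * (\<integral>\<^sup>+z. F z m \<partial>gamma_law (\<alpha> * a) 1) \<partial>Q0)"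
    unfolding PD_measure_density[OF a]
    by (intro nn_integral_density) (simp_all cong: measurable_cong_sets)
  then show ?thesis unfolding tilt_const_def nn_integral_mixed_tilt[OF a F] ..
qed

lemma distr_block_law_mass:
  assumes q: "finite q" "\<And>C. C \<in> q \<Longrightarrow> 0 < card C" and a: "0 < a"
  shows "distr (block_law a q) (measure_algebra \<eta>) (\<lambda>z. fst (snd (snd z))) = PD_measure \<alpha> (\<alpha> * a) \<eta>" (is "?L = _")
    and "distr (block_law a q) borel (\<lambda>z. fst z powr (1 / \<alpha>) * tmass (fst (snd (snd z)))) = gamma_law (\<alpha> * a) 1" (is "?L' = _")
proof -
  interpret \<Gamma>': prob_space "gamma_law (\<alpha> * a) 1" using a \<alpha> by (intro prob_space_gamma_law) auto
  interpret PD: prob_space "PD_measure \<alpha> (\<alpha> * a) \<eta>" by (rule prob_space_PD_measure[OF a])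
  note [measurable_cong] = sets_block_law[of a q]
  show "?L = PD_measure \<alpha> (\<alpha> * a) \<eta>"
  proof (rule measure_eqI)
    fix A assume "A \<in> sets ?L"
    then have A[measurable]: "A \<in> sets (measure_algebra \<eta>)" by simp
    have "emeasure ?L A = (\<integral>\<^sup>+z. indicator A (fst (snd (snd z))) \<partial>block_law a q)"
      by (rule nn_integral_distr_indicator) measurable
    also have "\<dots> = (\<integral>\<^sup>+l. \<integral>\<^sup>+m. indicator A m \<partial>gg (l powr (1 / \<alpha>)) \<partial>gamma_law a K)"
      by (rule nn_integral_block_law_mass[OF q]) measurable
    also have "\<dots> = (\<integral>\<^sup>+m. \<integral>\<^sup>+z. indicator A m \<partial>gamma_law (\<alpha> * a) 1 \<partial>PD_measure \<alpha> (\<alpha> * a) \<eta>)"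
      by (rule nn_integral_mixed_tilt_PD[OF a]) measurable
    also have "\<dots> = emeasure (PD_measure \<alpha> (\<alpha> * a) \<eta>) A"
      by (simp add: \<Gamma>'.emeasure_space_1[simplified])
    finally show "emeasure ?L A = emeasure (PD_measure \<alpha> (\<alpha> * a) \<eta>) A" .
  qed simp
  show "?L' = gamma_law (\<alpha> * a) 1"
  proof (rule measure_eqI)
    fix A assume "A \<in> sets ?L'"
    then have A[measurable]: "A \<in> sets borel" by simp
    have "emeasure ?L' A = (\<integral>\<^sup>+z. indicator A (fst z powr (1 / \<alpha>) * tmass (fst (snd (snd z)))) \<partial>block_law a q)"
      by (rule nn_integral_distr_indicator) measurable
    also have "\<dots> = (\<integral>\<^sup>+l. \<integral>\<^sup>+m. indicator A (l powr (1 / \<alpha>) * tmass m) \<partial>gg (l powr (1 / \<alpha>)) \<partial>gamma_law a K)"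
      by (rule nn_integral_block_law_mass[OF q, of "\<lambda>l m. indicator A (l powr (1 / \<alpha>) * tmass m)"]) measurable
    also have "\<dots> = (\<integral>\<^sup>+m. \<integral>\<^sup>+z. indicator A z \<partial>gamma_law (\<alpha> * a) 1 \<partial>PD_measure \<alpha> (\<alpha> * a) \<eta>)"
      by (rule nn_integral_mixed_tilt_PD[OF a]) measurable
    also have "\<dots> = emeasure (gamma_law (\<alpha> * a) 1) A" by (simp add: PD.emeasure_space_1[simplified])
    finally show "emeasure ?L' A = emeasure (gamma_law (\<alpha> * a) 1) A" .
  qed simp
qed

text \<open>Given \<open>l\<close>, the scaled jumps have gamma laws of rate 1, which depend neither
  on \<open>l\<close> nor on the measure drawn; so they split off as an independent factor.\<close>

lemma distr_block_law_scaled: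
  assumes q: "finite q" "\<And>C. C \<in> q \<Longrightarrow> 0 < card C" and a: "0 < a"
  shows "distr (block_law a q) ((borel \<Otimes>\<^sub>M measure_algebra \<eta>) \<Otimes>\<^sub>M PiM q (\<lambda>_. borel))
      (\<lambda>(l, y, m, j). ((l, m), (\<lambda>C\<in>q. l powr (1 / \<alpha>) * j C))) =
    distr (block_law a q) (borel \<Otimes>\<^sub>M measure_algebra \<eta>) (\<lambda>(l, y, m, j). (l, m)) \<Otimes>\<^sub>M
      PiM q (\<lambda>C. gamma_law (real (card C) - \<alpha>) 1)" (is "?L = ?R \<Otimes>\<^sub>M ?G1")
proof (rule measure_eqI)
  interpret G1: prob_space ?G1 by (rule prob_space_PiM_gamma[OF q(2)]) auto
  interpret Y: prob_space "PiM q (\<lambda>_. H)" by (rule prob_space_PiM_H)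
  have sG1[measurable_cong]: "sets ?G1 = sets (PiM q (\<lambda>_. borel))" by (intro sets_PiM_cong) auto
  note [measurable_cong] = sets_block_law[of a q]
  have sR: "sets (?R \<Otimes>\<^sub>M ?G1) = sets ((borel \<Otimes>\<^sub>M measure_algebra \<eta>) \<Otimes>\<^sub>M PiM q (\<lambda>_. borel))"
    by (rule sets_pair_measure_cong[OF _ sG1]) simp
  then show "sets ?L = sets (?R \<Otimes>\<^sub>M ?G1)" by simp
  fix A assume "A \<in> sets ?L"
  then have A[measurable]: "A \<in> sets ((borel \<Otimes>\<^sub>M measure_algebra \<eta>) \<Otimes>\<^sub>M PiM q (\<lambda>_. borel))" by simp
  have "emeasure ?L A = (\<integral>\<^sup>+z. indicator A (case z of (l, y, m, j) \<Rightarrow> ((l, m), (\<lambda>C\<in>q. l powr (1 / \<alpha>) * j C))) \<partial>block_law a q)"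
    by (rule nn_integral_distr_indicator) measurable
  also have "\<dots> = (\<integral>\<^sup>+l. \<integral>\<^sup>+y. \<integral>\<^sup>+m. \<integral>\<^sup>+j. indicator A ((l, m), (\<lambda>C\<in>q. l powr (1 / \<alpha>) * j C))
      \<partial>PiM q (\<lambda>C. gamma_law (real (card C) - \<alpha>) (l powr (1 / \<alpha>)))
      \<partial>gg (l powr (1 / \<alpha>)) \<partial>PiM q (\<lambda>_. H) \<partial>gamma_law a K)"
    by (subst nn_integral_block_law[OF q]) auto
  also have "\<dots> = (\<integral>\<^sup>+l. \<integral>\<^sup>+m. \<integral>\<^sup>+j. indicator A ((l, m), j) \<partial>?G1 \<partial>gg (l powr (1 / \<alpha>)) \<partial>gamma_law a K)"
  proof (rule nn_integral_cong_AE, rule eventually_mono[OF AE_gamma_law])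
    fix l :: real assume l: "0 < l"
    have "(\<integral>\<^sup>+j. indicator A ((l, m), (\<lambda>C\<in>q. l powr (1 / \<alpha>) * j C)) \<partial>PiM q (\<lambda>C. gamma_law (real (card C) - \<alpha>) (l powr (1 / \<alpha>)))) =
      (\<integral>\<^sup>+j. indicator A ((l, m), j) \<partial>?G1)" if m: "m \<in> space (gg (l powr (1 / \<alpha>)))" for m
    proof -
      have mm: "m \<in> space (measure_algebra \<eta>)" using m by (simp add: space_gg space_measure_algebra)
      let ?Gl = "PiM q (\<lambda>C. gamma_law (real (card C) - \<alpha>) (l powr (1 / \<alpha>)))"
      have [measurable_cong]: "sets ?Gl = sets (PiM q (\<lambda>_. borel))" by (intro sets_PiM_cong) auto
      have [measurable]: "(\<lambda>j. indicator A ((l, m), j) :: ennreal) \<in> borel_measurable (PiM q (\<lambda>_. borel))"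
        using mm by measurable
      have "(\<integral>\<^sup>+j. indicator A ((l, m), j) \<partial>?G1) = (\<integral>\<^sup>+j. indicator A ((l, m), j) \<partial>distr ?Gl (PiM q (\<lambda>_. borel)) (\<lambda>j. \<lambda>C\<in>q. l powr (1 / \<alpha>) * j C))"
        using l by (subst block_gamma_PiM_scale[OF q]) auto
      also have "\<dots> = (\<integral>\<^sup>+j. indicator A ((l, m), (\<lambda>C\<in>q. l powr (1 / \<alpha>) * j C)) \<partial>?Gl)"
        by (rule nn_integral_distr) measurable
      finally show ?thesis ..
    qed
    then show "(\<integral>\<^sup>+y. \<integral>\<^sup>+m. \<integral>\<^sup>+j. indicator A ((l, m), (\<lambda>C\<in>q. l powr (1 / \<alpha>) * j C))
      \<partial>PiM q (\<lambda>C. gamma_law (real (card C) - \<alpha>) (l powr (1 / \<alpha>)))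
      \<partial>gg (l powr (1 / \<alpha>)) \<partial>PiM q (\<lambda>_. H)) = (\<integral>\<^sup>+m. \<integral>\<^sup>+j. indicator A ((l, m), j) \<partial>?G1 \<partial>gg (l powr (1 / \<alpha>)))"
      by (simp add: Y.emeasure_space_1 cong: nn_integral_cong)
  qed
  also have "\<dots> = (\<integral>\<^sup>+z. (\<integral>\<^sup>+j. indicator A ((fst z, fst (snd (snd z))), j) \<partial>?G1) \<partial>block_law a q)"
  proof (rule nn_integral_block_law_mass[OF q, symmetric])
    show "(\<lambda>(l, m). \<integral>\<^sup>+j. indicator A ((l, m), j) \<partial>?G1) \<in> borel_measurable (borel \<Otimes>\<^sub>M measure_algebra \<eta>)"
      unfolding split_beta' by (rule G1.borel_measurable_nn_integral) measurable
  qed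
  also have "\<dots> = (\<integral>\<^sup>+x. \<integral>\<^sup>+j. indicator A (x, j) \<partial>?G1 \<partial>?R)"
    by (subst nn_integral_distr) (auto intro!: G1.borel_measurable_nn_integral nn_integral_cong)
  also have "\<dots> = (\<integral>\<^sup>+w. indicator A w \<partial>(?R \<Otimes>\<^sub>M ?G1))"
    by (rule G1.nn_integral_fst) measurable
  also have "\<dots> = emeasure (?R \<Otimes>\<^sub>M ?G1) A"
    using A unfolding sR[symmetric] by (rule nn_integral_indicator)
  finally show "emeasure ?L A = emeasure (?R \<Otimes>\<^sub>M ?G1) A" .
qed

end

section \<open>Random measures with added atoms\<close>

lemma sets_add_atoms [simp]: "sets (add_atoms m I w y) = sets m"
  by (simp add: add_atoms_def)

lemma space_add_atoms [simp]: "space (add_atoms m I w y) = space m"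
  by (simp add: add_atoms_def)

lemma emeasure_add_atoms:
  assumes A: "A \<in> sets m"
  shows "emeasure (add_atoms m I w y) A = emeasure m A + (\<Sum>j\<in>I. ennreal (w j) * indicator A (y j))"
  unfolding add_atoms_def
proof (rule emeasure_measure_of_sigma[OF sets.sigma_algebra_axioms _ _ A])
  let ?\<mu> = "\<lambda>A. emeasure m A + (\<Sum>j\<in>I. ennreal (w j) * indicator A (y j))"
  show "positive (sets m) ?\<mu>" by (simp add: positive_def)
  show "countably_additive (sets m) ?\<mu>"
  proof (rule countably_additiveI)
    fix A :: "nat \<Rightarrow> _" assume A: "range A \<subseteq> sets m" "disjoint_family A" "(\<Union>i. A i) \<in> sets m"
    have "(\<Sum>i. ?\<mu> (A i)) = (\<Sum>i. emeasure m (A i)) + (\<Sum>i. \<Sum>j\<in>I. ennreal (w j) * indicator (A i) (y j))"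
      by (rule suminf_add[symmetric]) auto
    also have "(\<Sum>i. emeasure m (A i)) = emeasure m (\<Union>i. A i)"
      using A by (intro suminf_emeasure) auto
    also have "(\<Sum>i. \<Sum>j\<in>I. ennreal (w j) * indicator (A i) (y j)) = (\<Sum>j\<in>I. \<Sum>i. ennreal (w j) * indicator (A i) (y j))"
      by (rule suminf_sum) auto
    also have "\<dots> = (\<Sum>j\<in>I. ennreal (w j) * indicator (\<Union>i. A i) (y j))"
      using suminf_indicator[OF A(2)] by (simp add: ennreal_suminf_cmult)
    finally show "(\<Sum>i. ?\<mu> (A i)) = ?\<mu> (\<Union>i. A i)" .
  qed
qed

lemma nn_integral_add_atoms:
  assumes g: "g \<in> borel_measurable m" and y: "\<And>j. j \<in> I \<Longrightarrow> y j \<in> space m"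
  shows "(\<integral>\<^sup>+x. g x \<partial>add_atoms m I w y) = (\<integral>\<^sup>+x. g x \<partial>m) + (\<Sum>j\<in>I. ennreal (w j) * g (y j))"
  using g
proof induct
  case (cong f g)
  have "(\<integral>\<^sup>+x. f x \<partial>add_atoms m I w y) = (\<integral>\<^sup>+x. g x \<partial>add_atoms m I w y)"
    by (rule nn_integral_cong) (simp add: cong(3))
  moreover have "(\<integral>\<^sup>+x. f x \<partial>m) = (\<integral>\<^sup>+x. g x \<partial>m)"
    by (rule nn_integral_cong) (simp add: cong(3))
  \<comment> \<open>The two functions agree only on the space of \<open>m\<close>; the atoms lie in
    it.\<close>
  moreover have "(\<Sum>j\<in>I. ennreal (w j) * f (y j)) = (\<Sum>j\<in>I. ennreal (w j) * g (y j))"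
    using cong y by (intro sum.cong) auto
  ultimately show ?case using cong by simp
next
  case (set A)
  then show ?case by (simp add: emeasure_add_atoms)
next
  case (mult u c)
  have "u \<in> borel_measurable (add_atoms m I w y)" using mult by (simp cong: measurable_cong_sets)
  then show ?case using mult
    by (simp add: nn_integral_cmult distrib_left sum_distrib_left mult_ac)
next
  case (add u v)
  have "u \<in> borel_measurable (add_atoms m I w y)" "v \<in> borel_measurable (add_atoms m I w y)"
    using add by (simp_all cong: measurable_cong_sets)
  then show ?case using add
    by (simp add: nn_integral_add distrib_left sum.distrib add_ac)
next
  case (seq U)
  have U: "U i \<in> borel_measurable (add_atoms m I w y)" for i
    using seq(1)[of i] by (simp cong: measurable_cong_sets)
  have inc: "incseq (\<lambda>i. U i x)" for x using seq(4) by (auto simp: incseq_def le_fun_def)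
  have sup: "(\<Squnion>range U) = (\<lambda>x. SUP i. U i x)" by (auto simp: fun_eq_iff image_comp)
  have "(\<lambda>i. \<integral>\<^sup>+x. U i x \<partial>add_atoms m I w y) \<longlonglongrightarrow> (\<integral>\<^sup>+x. (SUP i. U i x) \<partial>add_atoms m I w y)"
    by (rule nn_integral_LIMSEQ[OF seq(4) U LIMSEQ_SUP[OF inc]])
  moreover have "(\<lambda>i. (\<integral>\<^sup>+x. U i x \<partial>m) + (\<Sum>j\<in>I. ennreal (w j) * U i (y j))) \<longlonglongrightarrow>
    (\<integral>\<^sup>+x. (SUP i. U i x) \<partial>m) + (\<Sum>j\<in>I. ennreal (w j) * (SUP i. U i (y j)))"
    by (intro tendsto_add tendsto_sum ennreal_tendsto_cmult ennreal_less_top tendsto_const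
        nn_integral_LIMSEQ[OF seq(4) seq(1)] LIMSEQ_SUP inc)
  ultimately show ?case unfolding sup seq(3) by (rule LIMSEQ_unique)
qed

text \<open>The index set of the atoms is random but takes countably many values. Where it is fixed,
  the mass of a set is a sum of measurable functions over a fixed index set.\<close>

lemma measurable_add_atoms:
  assumes p: "p \<in> measurable M (count_space P)" "countable P"
    and \<mu>: "\<mu> \<in> measurable M (measure_algebra \<eta>)"
    and JY: "\<And>q C. q \<in> P \<Longrightarrow> C \<in> q \<Longrightarrow> J C \<in> borel_measurable M \<and> Y C \<in> measurable M \<eta>"
  shows "(\<lambda>\<omega>. add_atoms (\<mu> \<omega>) (p \<omega>) (\<lambda>C. J C \<omega>) (\<lambda>C. Y C \<omega>)) \<in> measurable M (measure_algebra \<eta>)"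
proof (rule measurable_compose_countable'[where g=p and I=P, OF _ p])
  fix q assume q: "q \<in> P"
  show "(\<lambda>\<omega>. add_atoms (\<mu> \<omega>) q (\<lambda>C. J C \<omega>) (\<lambda>C. Y C \<omega>)) \<in> measurable M (measure_algebra \<eta>)"
  proof (rule measurable_measure_algebra)
    have s: "sets (\<mu> \<omega>) = sets \<eta>" if "\<omega> \<in> space M" for \<omega>
      using measurable_space[OF \<mu> that] by (simp add: space_measure_algebra)
    then show "sets (add_atoms (\<mu> \<omega>) q (\<lambda>C. J C \<omega>) (\<lambda>C. Y C \<omega>)) = sets \<eta>" if "\<omega> \<in> space M" for \<omega>
      using that by simp
    fix A assume A[measurable]: "A \<in> sets \<eta>"
    have [measurable]: "(\<lambda>\<omega>. emeasure (\<mu> \<omega>) A) \<in> borel_measurable M"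
      by (rule measurable_compose[OF \<mu> measurable_emeasure_measure_algebra[OF A]])
    have "(\<lambda>\<omega>. \<Sum>C\<in>q. ennreal (J C \<omega>) * indicator A (Y C \<omega>)) \<in> borel_measurable M"
    proof (rule borel_measurable_sum)
      fix C assume "C \<in> q"
      then have [measurable]: "J C \<in> borel_measurable M" "Y C \<in> measurable M \<eta>" using JY q by auto
      show "(\<lambda>\<omega>. ennreal (J C \<omega>) * indicator A (Y C \<omega>)) \<in> borel_measurable M" by measurable
    qed
    then have "(\<lambda>\<omega>. emeasure (\<mu> \<omega>) A + (\<Sum>C\<in>q. ennreal (J C \<omega>) * indicator A (Y C \<omega>))) \<in> borel_measurable M"
      by measurable
    then show "(\<lambda>\<omega>. emeasure (add_atoms (\<mu> \<omega>) q (\<lambda>C. J C \<omega>) (\<lambda>C. Y C \<omega>)) A) \<in> borel_measurable M"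
      using A s by (simp add: emeasure_add_atoms cong: measurable_cong)
  qed
qed

text \<open>The recursion starts at \<open>Gamma (x + 1)\<close>, not at \<open>Gamma x\<close>,
  because it is applied to \<theta> and to \<open>\<theta> / \<alpha>\<close>, which may be zero or
  negative but exceed - 1.\<close>

lemma Gamma_rising:
  assumes "- 1 < (x::real)"
  shows "Gamma (x + real (Suc k)) = Gamma (x + 1) * (\<Prod>j = 1..k. x + real j)"
proof (induction k)
  case (Suc k)
  have "0 < x + real (Suc k)" using assms by simp
  then have "x + real (Suc k) \<notin> \<int>\<^sub>\<le>\<^sub>0" by (auto elim!: nonpos_Ints_cases)
  then have "Gamma (x + real (Suc k) + 1) = (x + real (Suc k)) * Gamma (x + real (Suc k))" by (rule Gamma_plus1)
  then show ?case using Suc by (simp add: add_ac)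
qed simp

section \<open>Laplace functionals of the mixtures, and normalisation\<close>

context gg_setting
begin

lemma nn_integral_gg_laplace:
  assumes g[measurable]: "g \<in> borel_measurable \<eta>" "\<And>y. 0 \<le> g y" and l: "0 < l"
  shows "(\<integral>\<^sup>+m. ennreal (exp_minus (\<integral>\<^sup>+y. ennreal (g y) \<partial>m)) \<partial>gg (l powr (1 / \<alpha>))) = ennreal (gg_laplace \<alpha> \<eta> g l)"
proof -
  let ?b = "l powr (1 / \<alpha>)"
  have "(\<integral>\<^sup>+y. ennreal ((g y + ?b) powr \<alpha> / \<alpha>) \<partial>\<eta>) = (\<integral>\<^sup>+y. ennreal (1 / \<alpha>) * ennreal ((g y + ?b) powr \<alpha>) \<partial>\<eta>)"
    using \<alpha> by (intro nn_integral_cong) (simp flip: ennreal_mult)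
  also have "\<dots> = ennreal (1 / \<alpha>) * (\<integral>\<^sup>+y. ennreal ((g y + ?b) powr \<alpha>) \<partial>\<eta>)"
    by (rule nn_integral_cmult) measurable
  finally have *: "(\<integral>\<^sup>+y. ennreal ((g y + ?b) powr \<alpha> / \<alpha>) \<partial>\<eta>) = ennreal (1 / \<alpha>) * (\<integral>\<^sup>+y. ennreal ((g y + ?b) powr \<alpha>) \<partial>\<eta>)" .
  have bl: "?b powr \<alpha> = l" using l \<alpha> by (simp add: powr_powr)
  have "(\<integral>\<^sup>+m. ennreal (exp_minus (\<integral>\<^sup>+y. ennreal (g y) \<partial>m)) \<partial>gg ?b) =
    ennreal (exp_minus (\<integral>\<^sup>+y. ennreal ((g y + ?b) powr \<alpha> / \<alpha>) \<partial>\<eta>) * exp (K * ?b powr \<alpha>))"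
    by (rule nn_integral_gg[OF g]) simp
  then show ?thesis by (simp only: * bl gg_laplace_def K_def)
qed

lemma laplace_block_law:
  assumes q: "finite q" "\<And>C. C \<in> q \<Longrightarrow> 0 < card C"
    and g[measurable]: "g \<in> borel_measurable \<eta>" "\<And>y. 0 \<le> g y"
  shows "laplace_functional (distr (block_law a q) (measure_algebra \<eta>) (\<lambda>z. fst (snd (snd z)))) g =
    (\<integral>l. gg_laplace \<alpha> \<eta> g l \<partial>gamma_law a K)"
proof -
  note [measurable_cong] = sets_block_law[of a q]
  have m: "(\<lambda>l. gg_laplace \<alpha> \<eta> g l) \<in> borel_measurable (gamma_law a K)"
    unfolding gg_laplace_def
    by (intro borel_measurable_times measurable_compose[OF _ borel_measurable_exp_minus]
        borel_measurable_times_ennreal \<eta>.borel_measurable_nn_integral) measurable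
  have "(\<integral>\<^sup>+m. ennreal (exp_minus (\<integral>\<^sup>+y. ennreal (g y) \<partial>m)) \<partial>distr (block_law a q) (measure_algebra \<eta>) (\<lambda>z. fst (snd (snd z)))) =
    (\<integral>\<^sup>+z. ennreal (exp_minus (\<integral>\<^sup>+y. ennreal (g y) \<partial>fst (snd (snd z)))) \<partial>block_law a q)"
    by (rule nn_integral_distr) measurable
  also have "\<dots> = (\<integral>\<^sup>+l. \<integral>\<^sup>+m. ennreal (exp_minus (\<integral>\<^sup>+y. ennreal (g y) \<partial>m)) \<partial>gg (l powr (1 / \<alpha>)) \<partial>gamma_law a K)"
    by (rule nn_integral_block_law_mass[OF q]) measurable
  also have "\<dots> = (\<integral>\<^sup>+l. ennreal (gg_laplace \<alpha> \<eta> g l) \<partial>gamma_law a K)"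
    by (rule nn_integral_cong_AE, rule eventually_mono[OF AE_gamma_law]) (rule nn_integral_gg_laplace[OF g])
  finally have L: "(\<integral>\<^sup>+m. ennreal (exp_minus (\<integral>\<^sup>+y. ennreal (g y) \<partial>m)) \<partial>distr (block_law a q) (measure_algebra \<eta>) (\<lambda>z. fst (snd (snd z)))) =
    (\<integral>\<^sup>+l. ennreal (gg_laplace \<alpha> \<eta> g l) \<partial>gamma_law a K)" .
  have "(\<integral>l. gg_laplace \<alpha> \<eta> g l \<partial>gamma_law a K) = enn2real (\<integral>\<^sup>+l. ennreal (gg_laplace \<alpha> \<eta> g l) \<partial>gamma_law a K)"
    by (rule integral_eq_nn_integral[OF m]) (simp add: gg_laplace_def)
  then show ?thesis unfolding L[symmetric]
    by (simp add: laplace_functional_eq_enn2real[where K=\<eta>])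
qed

text \<open>With \<open>b = l powr (1 / \<alpha>)\<close> one has
  \<open>(b * g y + b) powr \<alpha> = l * (g y + 1) powr \<alpha>\<close>, so given
  \<open>l\<close> the exponent is \<open>l * K * I\<close>. The factor \<open>exp (K * l)\<close>
  cancels against the gamma density, and the gamma integral of rate \<open>K * I\<close> leaves
  \<open>I powr (- a)\<close>; for infinite \<open>I\<close> every conditional transform is
  0.\<close>

lemma laplace_scaled_block_law:
  assumes q: "finite q" "\<And>C. C \<in> q \<Longrightarrow> 0 < card C" and a: "0 < a"
    and g[measurable]: "g \<in> borel_measurable \<eta>" "\<And>y. 0 \<le> g y"
  shows "laplace_functional (distr (block_law a q) (measure_algebra \<eta>)
      (\<lambda>z. scale_measure (ennreal (fst z powr (1 / \<alpha>))) (fst (snd (snd z))))) g =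
    (let I = \<integral>\<^sup>+y. ennreal ((g y + 1) powr \<alpha>) \<partial>H in if I = \<infinity> then 0 else enn2real I powr - a)"
proof -
  note [measurable_cong] = sets_block_law[of a q]
  interpret H: prob_space H by (rule prob_space_H)
  interpret \<Gamma>: prob_space "gamma_law a K" using a K_pos by (rule prob_space_gamma_law)
  define I where "I = (\<integral>\<^sup>+y. ennreal ((g y + 1) powr \<alpha>) \<partial>H)"
  have "(\<integral>\<^sup>+y. 1 \<partial>H) \<le> I" unfolding I_def
    using \<alpha> g(2) by (intro nn_integral_mono) (auto simp: ge_one_powr_ge_zero)
  then have I1: "1 \<le> I" by (simp add: H.emeasure_space_1[simplified])
  have sm[measurable]: "(\<lambda>z. scale_measure (ennreal (fst z powr (1 / \<alpha>))) (fst (snd (snd z)))) \<in> measurable (block_law a q) (measure_algebra \<eta>)"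
    by (rule measurable_scale_measure) measurable
  have inner: "(\<integral>\<^sup>+m. ennreal (exp_minus (\<integral>\<^sup>+y. ennreal (g y) \<partial>scale_measure (ennreal (l powr (1 / \<alpha>))) m)) \<partial>gg (l powr (1 / \<alpha>))) =
    ennreal (exp_minus (ennreal l * (ennreal K * I)) * exp (K * l))" if l: "0 < l" for l
  proof -
    let ?b = "l powr (1 / \<alpha>)"
    have bl: "?b powr \<alpha> = l" using l \<alpha> by (simp add: powr_powr)
    have "(\<integral>\<^sup>+m. ennreal (exp_minus (\<integral>\<^sup>+y. ennreal (g y) \<partial>scale_measure (ennreal ?b) m)) \<partial>gg ?b) =
      (\<integral>\<^sup>+m. ennreal (exp_minus (\<integral>\<^sup>+y. ennreal (?b * g y) \<partial>m)) \<partial>gg ?b)"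
    proof (rule nn_integral_cong)
      fix m assume "m \<in> space (gg ?b)"
      then have [measurable_cong]: "sets m = sets \<eta>" by (simp add: space_gg)
      have "(\<integral>\<^sup>+y. ennreal (?b * g y) \<partial>m) = (\<integral>\<^sup>+y. ennreal ?b * ennreal (g y) \<partial>m)"
        using g(2) by (intro nn_integral_cong) (simp add: ennreal_mult)
      also have "\<dots> = ennreal ?b * (\<integral>\<^sup>+y. ennreal (g y) \<partial>m)" by (rule nn_integral_cmult) measurable
      also have "\<dots> = (\<integral>\<^sup>+y. ennreal (g y) \<partial>scale_measure (ennreal ?b) m)"
        by (rule nn_integral_scale_measure[symmetric]) measurable
      finally show "ennreal (exp_minus (\<integral>\<^sup>+y. ennreal (g y) \<partial>scale_measure (ennreal ?b) m)) =
        ennreal (exp_minus (\<integral>\<^sup>+y. ennreal (?b * g y) \<partial>m))" by simp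
    qed
    also have "\<dots> = ennreal (exp_minus (\<integral>\<^sup>+y. ennreal ((?b * g y + ?b) powr \<alpha> / \<alpha>) \<partial>\<eta>) * exp (K * ?b powr \<alpha>))"
      using g(2) by (intro nn_integral_gg) auto
    finally have 1: "(\<integral>\<^sup>+m. ennreal (exp_minus (\<integral>\<^sup>+y. ennreal (g y) \<partial>scale_measure (ennreal ?b) m)) \<partial>gg ?b) =
      ennreal (exp_minus (\<integral>\<^sup>+y. ennreal ((?b * g y + ?b) powr \<alpha> / \<alpha>) \<partial>\<eta>) * exp (K * ?b powr \<alpha>))" .
    have "(\<integral>\<^sup>+y. ennreal ((?b * g y + ?b) powr \<alpha> / \<alpha>) \<partial>\<eta>) = (\<integral>\<^sup>+y. ennreal (l / \<alpha>) * ennreal ((g y + 1) powr \<alpha>) \<partial>\<eta>)"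
    proof (rule nn_integral_cong)
      fix y
      have "?b * g y + ?b = ?b * (g y + 1)" by (simp add: algebra_simps)
      then have "(?b * g y + ?b) powr \<alpha> / \<alpha> = l / \<alpha> * (g y + 1) powr \<alpha>"
        using g(2)[of y] by (simp add: powr_mult bl)
      then show "ennreal ((?b * g y + ?b) powr \<alpha> / \<alpha>) = ennreal (l / \<alpha>) * ennreal ((g y + 1) powr \<alpha>)"
        using \<alpha> l by (simp flip: ennreal_mult)
    qed
    also have "\<dots> = ennreal (l / \<alpha>) * (\<integral>\<^sup>+y. ennreal ((g y + 1) powr \<alpha>) \<partial>\<eta>)"
      by (rule nn_integral_cmult) measurable
    also have "\<dots> = ennreal (l / \<alpha>) * (ennreal (measure \<eta> (space \<eta>)) * I)"
      unfolding I_def by (subst nn_integral_H) auto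
    also have "\<dots> = ennreal l * (ennreal K * I)"
      using \<alpha> l K_pos by (simp add: K_def mult.assoc[symmetric] flip: ennreal_mult)
    finally show ?thesis unfolding 1 bl by simp
  qed
  have "(\<integral>\<^sup>+m. ennreal (exp_minus (\<integral>\<^sup>+y. ennreal (g y) \<partial>m)) \<partial>distr (block_law a q) (measure_algebra \<eta>)
      (\<lambda>z. scale_measure (ennreal (fst z powr (1 / \<alpha>))) (fst (snd (snd z))))) =
    (\<integral>\<^sup>+z. ennreal (exp_minus (\<integral>\<^sup>+y. ennreal (g y) \<partial>scale_measure (ennreal (fst z powr (1 / \<alpha>))) (fst (snd (snd z))))) \<partial>block_law a q)"
    by (rule nn_integral_distr) measurable
  also have "\<dots> = (\<integral>\<^sup>+l. \<integral>\<^sup>+m. ennreal (exp_minus (\<integral>\<^sup>+y. ennreal (g y) \<partial>scale_measure (ennreal (l powr (1 / \<alpha>))) m)) \<partial>gg (l powr (1 / \<alpha>)) \<partial>gamma_law a K)"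
  proof (rule nn_integral_block_law_mass[OF q, of "\<lambda>l m. ennreal (exp_minus (\<integral>\<^sup>+y. ennreal (g y) \<partial>scale_measure (ennreal (l powr (1 / \<alpha>))) m))"])
    have [measurable]: "(\<lambda>x. scale_measure (ennreal (fst x powr (1 / \<alpha>))) (snd x)) \<in> measurable (borel \<Otimes>\<^sub>M measure_algebra \<eta>) (measure_algebra \<eta>)"
      by (rule measurable_scale_measure) measurable
    show "(\<lambda>(l, m). ennreal (exp_minus (\<integral>\<^sup>+y. ennreal (g y) \<partial>scale_measure (ennreal (l powr (1 / \<alpha>))) m))) \<in> borel_measurable (borel \<Otimes>\<^sub>M measure_algebra \<eta>)"
      unfolding split_beta' by measurable
  qed
  also have "\<dots> = (\<integral>\<^sup>+l. ennreal (exp_minus (ennreal l * (ennreal K * I)) * exp (K * l)) \<partial>gamma_law a K)"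
    by (rule nn_integral_cong_AE, rule eventually_mono[OF AE_gamma_law]) (rule inner)
  finally have L: "(\<integral>\<^sup>+m. ennreal (exp_minus (\<integral>\<^sup>+y. ennreal (g y) \<partial>m)) \<partial>distr (block_law a q) (measure_algebra \<eta>)
      (\<lambda>z. scale_measure (ennreal (fst z powr (1 / \<alpha>))) (fst (snd (snd z))))) =
    (\<integral>\<^sup>+l. ennreal (exp_minus (ennreal l * (ennreal K * I)) * exp (K * l)) \<partial>gamma_law a K)" .
  have "enn2real (\<integral>\<^sup>+l. ennreal (exp_minus (ennreal l * (ennreal K * I)) * exp (K * l)) \<partial>gamma_law a K) =
    (if I = \<infinity> then 0 else enn2real I powr - a)"
  proof (cases I)
    case top
    have "(\<integral>\<^sup>+l. ennreal (exp_minus (ennreal l * (ennreal K * I)) * exp (K * l)) \<partial>gamma_law a K) = (\<integral>\<^sup>+l. 0 \<partial>gamma_law a K)"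
      using K_pos by (intro nn_integral_cong_AE, intro eventually_mono[OF AE_gamma_law])
        (simp add: top ennreal_mult_top)
    then show ?thesis by (simp add: top)
  next
    case (real i)
    then have i: "1 \<le> i" using I1 by simp
    have G: "0 < Gamma a" using a by (rule Gamma_real_pos)
    have "(\<integral>\<^sup>+l. ennreal (exp_minus (ennreal l * (ennreal K * I)) * exp (K * l)) \<partial>gamma_law a K) =
      ennreal (K powr a / Gamma a) * (\<integral>\<^sup>+l. ennreal (exp_minus (ennreal l * (ennreal K * I)) * exp (K * l)) *
        ennreal (l powr (a - 1) * exp (- K * l)) * indicator {0<..} l \<partial>lborel)"
      using a K_pos by (intro nn_integral_gamma_law) auto
    also have "(\<integral>\<^sup>+l. ennreal (exp_minus (ennreal l * (ennreal K * I)) * exp (K * l)) *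
        ennreal (l powr (a - 1) * exp (- K * l)) * indicator {0<..} l \<partial>lborel) =
      (\<integral>\<^sup>+l. ennreal (if 0 < l then l powr (a - 1) * exp (- (K * i) * l) else 0) \<partial>lborel)"
    proof (rule nn_integral_cong)
      fix l :: real
      show "ennreal (exp_minus (ennreal l * (ennreal K * I)) * exp (K * l)) *
        ennreal (l powr (a - 1) * exp (- K * l)) * indicator {0<..} l =
        ennreal (if 0 < l then l powr (a - 1) * exp (- (K * i) * l) else 0)"
      proof (cases "0 < l")
        case True
        have "exp_minus (ennreal l * (ennreal K * I)) = exp (- (l * (K * i)))"
          using True K_pos i by (simp add: real exp_minus_ennreal flip: ennreal_mult)
        moreover have "exp (- (l * (K * i))) * exp (K * l) * (l powr (a - 1) * exp (- K * l)) = l powr (a - 1) * exp (- (K * i) * l)"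
          by (simp add: exp_minus mult_ac)
        ultimately show ?thesis using True by (simp flip: ennreal_mult)
      qed simp
    qed
    also have "\<dots> = ennreal (Gamma a / (K * i) powr a)"
      using a K_pos i by (intro nn_integral_Gamma_rate) auto
    also have "ennreal (K powr a / Gamma a) * \<dots> = ennreal (i powr - a)"
      using G K_pos i by (simp add: powr_mult powr_minus field_simps flip: ennreal_mult)
    finally show ?thesis using real by simp
  qed
  then show ?thesis unfolding I_def[symmetric] Let_def L[symmetric]
    by (subst laplace_functional_eq_enn2real[where K=\<eta>]) auto
qed

lemma gg_setting_H: "gg_setting \<alpha> H"
proof -
  interpret H: prob_space H by (rule prob_space_H)
  show ?thesis using \<alpha> H.emeasure_space_1 by unfold_locales auto
qed

text \<open>Stability: replacing \<open>H\<close> by \<eta> multiplies the random measure by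
  \<open>c = ?M powr (1 / \<alpha>)\<close>, since the exponent is homogeneous of degree \<alpha> in
  \<open>g\<close>. The polynomial tilt changes only by a constant, and normalisation forgets
  \<open>c\<close>.\<close>

lemma PD_rpm_normalise:
  assumes a: "0 < a"
  shows "PD_rpm \<alpha> (\<alpha> * a) \<eta> = PD_rpm \<alpha> (\<alpha> * a) H"
proof -
  interpret H: gg_setting \<alpha> H by (rule gg_setting_H)
  interpret HP: prob_space H by (rule prob_space_H)
  interpret Q: prob_space Q0 by (rule prob_space_gg)
  interpret QH: prob_space H.Q0 by (rule H.prob_space_gg)
  let ?M = "measure \<eta> (space \<eta>)"
  define c where "c = ?M powr (1 / \<alpha>)"
  have c: "0 < c" "c powr \<alpha> = ?M" using mass_pos \<alpha> by (auto simp: c_def powr_powr)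
  have MA: "measure_algebra H = measure_algebra \<eta>" by (rule measure_algebra_cong) simp
  have s[measurable]: "scale_measure (ennreal c) \<in> measurable (measure_algebra \<eta>) (measure_algebra \<eta>)"
    by (rule measurable_scale_measure) auto
  have n[measurable]: "normalise \<in> measurable (measure_algebra \<eta>) (measure_algebra \<eta>)"
    by (rule measurable_normalise)
  have [measurable_cong]: "sets H.Q0 = sets (measure_algebra \<eta>)" by (simp add: MA)
  have Q: "Q0 = distr H.Q0 (measure_algebra \<eta>) (scale_measure (ennreal c))"
  proof (rule laplace_functional_eqI)
    show "finite_measure Q0" by unfold_locales
    show "finite_measure (distr H.Q0 (measure_algebra \<eta>) (scale_measure (ennreal c)))"
      by (intro prob_space.finite_measure QH.prob_space_distr) measurable
    fix g :: "'y \<Rightarrow> real" assume g[measurable]: "g \<in> borel_measurable \<eta>" and g0: "\<And>y. 0 \<le> g y"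
    have gH[measurable]: "g \<in> borel_measurable H" by measurable
    have "(\<integral>\<^sup>+m. ennreal (exp_minus (\<integral>\<^sup>+y. ennreal (g y) \<partial>m)) \<partial>distr H.Q0 (measure_algebra \<eta>) (scale_measure (ennreal c))) =
      (\<integral>\<^sup>+m. ennreal (exp_minus (\<integral>\<^sup>+y. ennreal (g y) \<partial>scale_measure (ennreal c) m)) \<partial>H.Q0)"
      by (rule nn_integral_distr) measurable
    also have "\<dots> = (\<integral>\<^sup>+m. ennreal (exp_minus (\<integral>\<^sup>+y. ennreal (c * g y) \<partial>m)) \<partial>H.Q0)"
    proof (rule nn_integral_cong)
      fix m assume "m \<in> space H.Q0"
      then have [measurable_cong]: "sets m = sets \<eta>" by (simp add: H.space_gg)
      have "(\<integral>\<^sup>+y. ennreal (c * g y) \<partial>m) = (\<integral>\<^sup>+y. ennreal c * ennreal (g y) \<partial>m)"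
        using g0 c by (intro nn_integral_cong) (simp add: ennreal_mult)
      also have "\<dots> = ennreal c * (\<integral>\<^sup>+y. ennreal (g y) \<partial>m)" by (rule nn_integral_cmult) measurable
      finally show "ennreal (exp_minus (\<integral>\<^sup>+y. ennreal (g y) \<partial>scale_measure (ennreal c) m)) =
        ennreal (exp_minus (\<integral>\<^sup>+y. ennreal (c * g y) \<partial>m))" by (subst nn_integral_scale_measure) auto
    qed
    also have "\<dots> = ennreal (exp_minus (\<integral>\<^sup>+y. ennreal ((c * g y + 0) powr \<alpha> / \<alpha>) \<partial>H) * exp (H.K * 0 powr \<alpha>))"
      using g0 c by (intro H.nn_integral_gg) auto
    also have "(\<integral>\<^sup>+y. ennreal ((c * g y + 0) powr \<alpha> / \<alpha>) \<partial>H) = (\<integral>\<^sup>+y. ennreal ((g y + 0) powr \<alpha> / \<alpha>) \<partial>\<eta>)"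
    proof -
      have "(\<integral>\<^sup>+y. ennreal ((c * g y + 0) powr \<alpha> / \<alpha>) \<partial>H) = (\<integral>\<^sup>+y. ennreal ?M * ennreal ((g y + 0) powr \<alpha> / \<alpha>) \<partial>H)"
        using c \<alpha> g0 mass_pos by (intro nn_integral_cong) (simp add: powr_mult flip: ennreal_mult)
      also have "\<dots> = ennreal ?M * (\<integral>\<^sup>+y. ennreal ((g y + 0) powr \<alpha> / \<alpha>) \<partial>H)"
        by (rule nn_integral_cmult) measurable
      finally show ?thesis by (subst nn_integral_H) auto
    qed
    finally have "(\<integral>\<^sup>+m. ennreal (exp_minus (\<integral>\<^sup>+y. ennreal (g y) \<partial>m)) \<partial>distr H.Q0 (measure_algebra \<eta>) (scale_measure (ennreal c))) =
      (\<integral>\<^sup>+m. ennreal (exp_minus (\<integral>\<^sup>+y. ennreal (g y) \<partial>m)) \<partial>Q0)"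
      using g0 \<alpha> by (subst nn_integral_gg) auto
    then show "laplace_functional Q0 g = laplace_functional (distr H.Q0 (measure_algebra \<eta>) (scale_measure (ennreal c))) g"
      by (subst (1 2) laplace_functional_eq_enn2real[where K=\<eta>]) auto
  qed auto
  \<comment> \<open>The two normalising constants differ by exactly the power of \<open>c\<close>
    that scaling the total mass brings out, because
    \<open>K / H.K = c powr \<alpha>\<close>.\<close>
  have tc: "tilt_const a * c powr - (\<alpha> * a) = H.tilt_const a"
  proof -
    have "c powr - (\<alpha> * a) = ?M powr - a" using mass_pos \<alpha> by (simp add: c_def powr_powr)
    then show ?thesis using mass_pos \<alpha> HP.prob_space
      by (simp add: tilt_const_def H.tilt_const_def K_def H.K_def powr_divide powr_minus field_simps)
  qed
  show ?thesis
  proof (rule measure_eqI)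
    fix A assume "A \<in> sets (PD_rpm \<alpha> (\<alpha> * a) \<eta>)"
    then have A[measurable]: "A \<in> sets (measure_algebra \<eta>)" by (simp add: PD_rpm_def)
    have "emeasure (PD_rpm \<alpha> (\<alpha> * a) \<eta>) A = (\<integral>\<^sup>+m. indicator A (normalise m) \<partial>PD_measure \<alpha> (\<alpha> * a) \<eta>)"
      unfolding PD_rpm_def by (rule nn_integral_distr_indicator) (simp_all cong: measurable_cong_sets)
    also have "\<dots> = (\<integral>\<^sup>+m. ennreal (tilt_const a * tmass m powr - (\<alpha> * a)) * indicator A (normalise m) \<partial>Q0)"
      unfolding PD_measure_density[OF a] by (rule nn_integral_density) measurable
    also have "\<dots> = (\<integral>\<^sup>+m. ennreal (tilt_const a * tmass (scale_measure (ennreal c) m) powr - (\<alpha> * a)) *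
        indicator A (normalise (scale_measure (ennreal c) m)) \<partial>H.Q0)"
      by (subst Q, rule nn_integral_distr) measurable
    also have "\<dots> = (\<integral>\<^sup>+m. ennreal (H.tilt_const a * tmass m powr - (\<alpha> * a)) * indicator A (normalise m) \<partial>H.Q0)"
    proof (rule nn_integral_cong)
      fix m :: "'y measure"
      have "space (scale_measure (ennreal c) m) = space m" by (rule sets_eq_imp_space_eq) simp
      then have "tmass (scale_measure (ennreal c) m) = c * tmass m"
        using c by (simp add: measure_def enn2real_mult)
      then have "tilt_const a * tmass (scale_measure (ennreal c) m) powr - (\<alpha> * a) = H.tilt_const a * tmass m powr - (\<alpha> * a)"
        using c by (simp add: powr_mult flip: tc)
      then show "ennreal (tilt_const a * tmass (scale_measure (ennreal c) m) powr - (\<alpha> * a)) *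
        indicator A (normalise (scale_measure (ennreal c) m)) =
        ennreal (H.tilt_const a * tmass m powr - (\<alpha> * a)) * indicator A (normalise m)"
        using normalise_scale_measure[OF c(1), of m] by simp
    qed
    also have "\<dots> = (\<integral>\<^sup>+m. indicator A (normalise m) \<partial>PD_measure \<alpha> (\<alpha> * a) H)"
      unfolding H.PD_measure_density[OF a] by (rule nn_integral_density[symmetric]) measurable
    also have "\<dots> = emeasure (PD_rpm \<alpha> (\<alpha> * a) H) A"
      unfolding PD_rpm_def MA by (rule nn_integral_distr_indicator[symmetric]) (simp_all add: MA cong: measurable_cong_sets)
    finally show "emeasure (PD_rpm \<alpha> (\<alpha> * a) \<eta>) A = emeasure (PD_rpm \<alpha> (\<alpha> * a) H) A" .
  qed (simp add: PD_rpm_def MA)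
qed

end

section \<open>The mixture over partitions\<close>

lemma PD_eppf_pos:
  assumes \<alpha>: "0 < \<alpha>" "\<alpha> < 1" "- \<alpha> < \<theta>" and n: "1 \<le> n" and q: "partition_on {1..n} q"
  shows "0 < PD_eppf n \<alpha> \<theta> q"
proof -
  have "0 < (\<Prod>j = 1..card q - 1. \<theta> + real j * \<alpha>)"
  proof (rule prod_pos)
    fix j assume "j \<in> {1..card q - 1}"
    then have "1 * \<alpha> \<le> real j * \<alpha>" using \<alpha> by (intro mult_right_mono) auto
    then show "0 < \<theta> + real j * \<alpha>" using \<alpha> by linarith
  qed
  moreover have "0 < (\<Prod>j = 1..n - 1. \<theta> + real j)"
  proof (rule prod_pos)
    fix j assume "j \<in> {1..n - 1}"
    then have "1 \<le> real j" by simp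
    then show "0 < \<theta> + real j" using \<alpha> by linarith
  qed
  moreover have "0 < (\<Prod>C\<in>q. Gamma (real (card C) - \<alpha>) / Gamma (1 - \<alpha>))"
  proof (rule prod_pos)
    fix C assume "C \<in> q"
    then have "0 < card C" using partition_on_blockD[OF q] by simp
    then have "0 < real (card C) - \<alpha>" using \<alpha> by (cases "card C") auto
    then have "0 < Gamma (real (card C) - \<alpha>)" by (rule Gamma_real_pos)
    moreover have "0 < Gamma (1 - \<alpha>)" using \<alpha> by (intro Gamma_real_pos) auto
    ultimately show "0 < Gamma (real (card C) - \<alpha>) / Gamma (1 - \<alpha>)" by simp
  qed
  ultimately show ?thesis unfolding PD_eppf_def by simp
qed

context gg_setting
begin

text \<open>The reciprocal of the mean of \<open>T powr (- \<theta>)\<close>. For \<theta> > 0 it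
  equals \<open>tilt_const (\<theta> / \<alpha>)\<close>; both Gamma arguments are raised by 1,
  which keeps them positive for - \<alpha> < \<theta> \<le> 0.\<close>

definition Z_const :: "real \<Rightarrow> real" where
  "Z_const \<theta> = K powr (\<theta> / \<alpha>) * Gamma (\<theta> + 1) / Gamma (\<theta> / \<alpha> + 1)"

end

context gg_test
begin

lemma psi_nonneg: "0 < b \<Longrightarrow> 0 \<le> psi e b"
proof (cases "e = 0")
  case True
  assume "0 < b"
  then show ?thesis using nn_integral_psi0(2) True by simp
next
  case False
  have "0 < Gamma (1 - \<alpha>)" using \<alpha> by (intro Gamma_real_pos) auto
  moreover have "0 < Gamma (real e - \<alpha>)" using False \<alpha> by (intro Gamma_real_pos) (cases e, auto)
  ultimately show ?thesis using False by (simp add: psi_def)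
qed

lemma nn_integral_gg_eg:
  assumes b: "0 < b"
  shows "(\<integral>\<^sup>+m. ennreal (eg m) \<partial>gg b) = ennreal (exp (- psi 0 b) * exp (K * b powr \<alpha>))"
  unfolding eg_def using b g_nonneg nn_integral_psi0[OF b]
  by (subst nn_integral_gg) (auto simp: exp_minus_ennreal)

text \<open>An atom of gamma mass with shape \<open>e - \<alpha>\<close> and rate \<open>b\<close>
  at the point \<open>y\<close> has the transform
  \<open>(b / (b + g y)) powr (e - \<alpha>)\<close>. Averaging over \<open>y\<close> produces the
  integral in \<open>psi e b\<close>; the factor \<open>\<alpha> * K\<close>, the mass of \<eta>,
  converts \<eta> to \<open>H\<close>.\<close>

lemma nn_integral_H_block:
  assumes b: "0 < b" and e: "0 < e"
  shows "(\<integral>\<^sup>+y. ennreal ((b / (b + g y)) powr (real e - \<alpha>)) \<partial>H) =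
    ennreal (b powr (real e - \<alpha>) * (Gamma (1 - \<alpha>) / Gamma (real e - \<alpha>)) / (\<alpha> * K) * psi e b)"
proof -
  have G: "0 < Gamma (1 - \<alpha>)" "0 < Gamma (real e - \<alpha>)" using e \<alpha> by (auto intro!: Gamma_real_pos)
  have \<alpha>K: "\<alpha> * K = measure \<eta> (space \<eta>)" using \<alpha> by (simp add: K_def)
  define I where "I = (\<integral>y. (g y + b) powr (\<alpha> - real e) \<partial>\<eta>)"
  have I0: "0 \<le> I" by (simp add: I_def)
  have I: "(\<integral>\<^sup>+y. ennreal ((g y + b) powr (\<alpha> - real e)) \<partial>\<eta>) = ennreal I"
    unfolding I_def by (rule nn_integral_eq_integral[OF integrable_shifted_powr[OF b]]) simp
  have psi: "Gamma (1 - \<alpha>) / Gamma (real e - \<alpha>) * psi e b = I"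
    using e G by (simp add: psi_def I_def)
  have "(\<integral>\<^sup>+y. ennreal ((b / (b + g y)) powr (real e - \<alpha>)) \<partial>\<eta>) = (\<integral>\<^sup>+y. ennreal (b powr (real e - \<alpha>)) * ennreal ((g y + b) powr (\<alpha> - real e)) \<partial>\<eta>)"
  proof (rule nn_integral_cong)
    fix y
    have "(b / (b + g y)) powr (real e - \<alpha>) = b powr (real e - \<alpha>) / (b + g y) powr (real e - \<alpha>)"
      by (rule powr_divide)
    also have "\<dots> = b powr (real e - \<alpha>) * (g y + b) powr (\<alpha> - real e)"
      using powr_minus_divide[of "g y + b" "real e - \<alpha>"] by (simp add: add.commute)
    finally have "(b / (b + g y)) powr (real e - \<alpha>) = b powr (real e - \<alpha>) * (g y + b) powr (\<alpha> - real e)" .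
    then show "ennreal ((b / (b + g y)) powr (real e - \<alpha>)) = ennreal (b powr (real e - \<alpha>)) * ennreal ((g y + b) powr (\<alpha> - real e))"
      by (simp flip: ennreal_mult)
  qed
  also have "\<dots> = ennreal (b powr (real e - \<alpha>)) * ennreal I"
    unfolding I[symmetric] by (rule nn_integral_cmult) measurable
  finally have "ennreal (\<alpha> * K) * (\<integral>\<^sup>+y. ennreal ((b / (b + g y)) powr (real e - \<alpha>)) \<partial>H) = ennreal (b powr (real e - \<alpha>) * I)"
    unfolding \<alpha>K using I0 by (subst nn_integral_H[symmetric]) (auto simp flip: ennreal_mult)
  then have "ennreal (1 / (\<alpha> * K)) * (ennreal (\<alpha> * K) * (\<integral>\<^sup>+y. ennreal ((b / (b + g y)) powr (real e - \<alpha>)) \<partial>H)) = ennreal (1 / (\<alpha> * K)) * ennreal (b powr (real e - \<alpha>) * I)"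
    by simp
  moreover have "ennreal (1 / (\<alpha> * K)) * ennreal (\<alpha> * K) = 1" using \<alpha> K_pos by (simp flip: ennreal_mult)
  moreover have "ennreal (1 / (\<alpha> * K)) * ennreal (b powr (real e - \<alpha>) * I) = ennreal (b powr (real e - \<alpha>) * (Gamma (1 - \<alpha>) / Gamma (real e - \<alpha>)) / (\<alpha> * K) * psi e b)"
  proof -
    have "b powr (real e - \<alpha>) * (Gamma (1 - \<alpha>) / Gamma (real e - \<alpha>)) / (\<alpha> * K) * psi e b = 1 / (\<alpha> * K) * (b powr (real e - \<alpha>) * I)"
      by (simp add: psi[symmetric] mult_ac)
    then show ?thesis using \<alpha> K_pos I0 by (simp only:) (subst ennreal_mult, auto)
  qed
  ultimately show ?thesis by (simp add: mult.assoc[symmetric])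
qed

text \<open>Given \<open>l\<close> the measure, the points and the masses are independent and the
  exponent is additive, so the transform factorises: masses integrate to powers of
  \<open>b / (b + g y)\<close>, and the points then integrate separately against
  \<open>H\<close>.\<close>

lemma laplace_add_atoms_block_law:
  assumes q: "finite q" "\<And>C. C \<in> q \<Longrightarrow> 0 < card C" and sp: "space \<eta> = UNIV"
  shows "(\<integral>\<^sup>+z. ennreal (exp_minus (\<integral>\<^sup>+y. ennreal (g y) \<partial>add_atoms (fst (snd (snd z))) q (snd (snd (snd z))) (fst (snd z)))) \<partial>block_law a q) =
    (\<integral>\<^sup>+l. ennreal (exp (- psi 0 (l powr (1 / \<alpha>))) * exp (K * l)) *
      (\<Prod>C\<in>q. \<integral>\<^sup>+y. ennreal ((l powr (1 / \<alpha>) / (l powr (1 / \<alpha>) + g y)) powr (real (card C) - \<alpha>)) \<partial>H) \<partial>gamma_law a K)"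
proof -
  note [measurable_cong] = sets_block_law[of a q]
  have sh: "0 < real (card C) - \<alpha>" if "C \<in> q" for C using q(2)[OF that] \<alpha> by (cases "card C") auto
  let ?f = "\<lambda>(l, y, m, j). ennreal (eg m) * (\<Prod>C\<in>q. ennreal (exp_minus (ennreal (j C) * ennreal (g (y C)))))"
  have f[measurable]: "?f \<in> borel_measurable (block_space q)"
  proof -
    have "(\<lambda>z. \<Prod>C\<in>q. ennreal (exp_minus (ennreal (snd (snd (snd z)) C) * ennreal (g (fst (snd z) C))))) \<in> borel_measurable (block_space q)"
    proof (rule borel_measurable_prod_ennreal)
      fix C assume C: "C \<in> q"
      have [measurable]: "(\<lambda>z. snd (snd (snd z)) C) \<in> borel_measurable (block_space q)"
        "(\<lambda>z. fst (snd z) C) \<in> measurable (block_space q) \<eta>"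
        using C by measurable
      show "(\<lambda>z. ennreal (exp_minus (ennreal (snd (snd (snd z)) C) * ennreal (g (fst (snd z) C))))) \<in> borel_measurable (block_space q)"
        by measurable
    qed
    then show ?thesis unfolding split_beta' by measurable
  qed
  have "(\<integral>\<^sup>+z. ennreal (exp_minus (\<integral>\<^sup>+y. ennreal (g y) \<partial>add_atoms (fst (snd (snd z))) q (snd (snd (snd z))) (fst (snd z)))) \<partial>block_law a q) =
    (\<integral>\<^sup>+z. ?f z \<partial>block_law a q)"
  proof (rule nn_integral_cong)
    fix z assume "z \<in> space (block_law a q)"
    then have z: "z \<in> space (block_space q)" using sets_eq_imp_space_eq[OF sets_block_law] by metis
    obtain l y m j where lymj: "z = (l, y, m, j)" by (metis prod.collapse)
    have m[measurable_cong]: "sets m = sets \<eta>" using z by (auto simp: lymj space_pair_measure space_measure_algebra)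
    have "space m = UNIV" using sets_eq_imp_space_eq[OF m] sp by simp
    then have "(\<integral>\<^sup>+y. ennreal (g y) \<partial>add_atoms m q j y) = (\<integral>\<^sup>+y. ennreal (g y) \<partial>m) + (\<Sum>C\<in>q. ennreal (j C) * ennreal (g (y C)))"
      by (intro nn_integral_add_atoms) auto
    then show "ennreal (exp_minus (\<integral>\<^sup>+y. ennreal (g y) \<partial>add_atoms (fst (snd (snd z))) q (snd (snd (snd z))) (fst (snd z)))) = ?f z"
      by (simp add: lymj exp_minus_add exp_minus_sum eg_def prod_ennreal prod_nonneg flip: ennreal_mult)
  qed
  also have "\<dots> = (\<integral>\<^sup>+l. \<integral>\<^sup>+y. \<integral>\<^sup>+m. \<integral>\<^sup>+j. ?f (l, y, m, j) \<partial>PiM q (\<lambda>C. gamma_law (real (card C) - \<alpha>) (l powr (1 / \<alpha>)))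
      \<partial>gg (l powr (1 / \<alpha>)) \<partial>PiM q (\<lambda>_. H) \<partial>gamma_law a K)"
    by (rule nn_integral_block_law[OF q f])
  also have "\<dots> = (\<integral>\<^sup>+l. ennreal (exp (- psi 0 (l powr (1 / \<alpha>))) * exp (K * l)) *
      (\<Prod>C\<in>q. \<integral>\<^sup>+y. ennreal ((l powr (1 / \<alpha>) / (l powr (1 / \<alpha>) + g y)) powr (real (card C) - \<alpha>)) \<partial>H) \<partial>gamma_law a K)"
  proof (rule nn_integral_cong_AE, rule eventually_mono[OF AE_gamma_law])
    fix l :: real assume l: "0 < l"
    let ?b = "l powr (1 / \<alpha>)"
    have b: "0 < ?b" using l by simp
    have bl: "?b powr \<alpha> = l" using l \<alpha> by (simp add: powr_powr)
    let ?G = "PiM q (\<lambda>C. gamma_law (real (card C) - \<alpha>) ?b)"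
    define h where "h C y = ennreal ((?b / (?b + g y)) powr (real (card C) - \<alpha>))" for C :: "nat set" and y
    have [measurable]: "h C \<in> borel_measurable \<eta>" for C unfolding h_def by measurable
    \<comment> \<open>Outside \<open>q\<close> any probability law will do, to make the family
      sigma-finite at every index of the type.\<close>
    define K' where "K' C = (if C \<in> q then gamma_law (real (card C) - \<alpha>) ?b else gamma_law 1 1)" for C :: "nat set"
    have "prob_space (K' C)" for C
      using sh[of C] b by (auto simp: K'_def intro!: prob_space_gamma_law)
    then interpret K': product_sigma_finite K'
      by (simp add: product_sigma_finite_def prob_space_imp_sigma_finite)
    interpret H: product_sigma_finite "\<lambda>_::nat set. H"
      by (simp add: product_sigma_finite_def prob_space_imp_sigma_finite prob_space_H)
    have G: "?G = PiM q K'" by (intro PiM_cong) (auto simp: K'_def)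
    have j: "(\<integral>\<^sup>+j. (\<Prod>C\<in>q. ennreal (exp_minus (ennreal (j C) * ennreal (g (y C))))) \<partial>?G) = (\<Prod>C\<in>q. h C (y C))" for y
    proof -
      have "(\<integral>\<^sup>+j. (\<Prod>C\<in>q. ennreal (exp_minus (ennreal (j C) * ennreal (g (y C))))) \<partial>?G) =
        (\<Prod>C\<in>q. \<integral>\<^sup>+x. ennreal (exp_minus (ennreal x * ennreal (g (y C)))) \<partial>K' C)"
        unfolding G by (rule K'.product_nn_integral_prod[OF q(1)]) (simp add: K'_def)
      also have "\<dots> = (\<Prod>C\<in>q. h C (y C))"
        using b sh g_nonneg by (intro prod.cong refl) (simp add: K'_def h_def laplace_gamma_law)
      finally show ?thesis .
    qed
    have jm: "(\<lambda>j. \<Prod>C\<in>q. ennreal (exp_minus (ennreal (j C) * ennreal (g (y C))))) \<in> borel_measurable ?G" for y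
    proof (rule borel_measurable_prod_ennreal)
      fix C assume "C \<in> q"
      then have [measurable]: "(\<lambda>j. j C) \<in> borel_measurable ?G"
        using measurable_component_singleton[of C q "\<lambda>C. gamma_law (real (card C) - \<alpha>) ?b"] by (simp cong: measurable_cong_sets)
      show "(\<lambda>j. ennreal (exp_minus (ennreal (j C) * ennreal (g (y C))))) \<in> borel_measurable ?G" by measurable
    qed
    have "(\<integral>\<^sup>+m. \<integral>\<^sup>+j. ?f (l, y, m, j) \<partial>?G \<partial>gg ?b) = (\<integral>\<^sup>+m. ennreal (eg m) \<partial>gg ?b) * (\<Prod>C\<in>q. h C (y C))" for y
    proof -
      have "(\<integral>\<^sup>+j. ?f (l, y, m, j) \<partial>?G) = ennreal (eg m) * (\<Prod>C\<in>q. h C (y C))" for m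
        unfolding prod.case nn_integral_cmult[OF jm] j ..
      moreover have "(\<integral>\<^sup>+m. ennreal (eg m) * (\<Prod>C\<in>q. h C (y C)) \<partial>gg ?b) = (\<integral>\<^sup>+m. ennreal (eg m) \<partial>gg ?b) * (\<Prod>C\<in>q. h C (y C))"
        by (rule nn_integral_multc) measurable
      ultimately show ?thesis by (simp only:)
    qed
    note mj = this
    have hm: "(\<lambda>y. \<Prod>C\<in>q. h C (y C)) \<in> borel_measurable (PiM q (\<lambda>_. H))"
    proof (rule borel_measurable_prod_ennreal)
      fix C assume "C \<in> q"
      then have [measurable]: "(\<lambda>y. y C) \<in> measurable (PiM q (\<lambda>_. H)) \<eta>"
        using measurable_component_singleton[of C q "\<lambda>_. H"] by (simp cong: measurable_cong_sets)
      show "(\<lambda>y. h C (y C)) \<in> borel_measurable (PiM q (\<lambda>_. H))" by measurable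
    qed
    have "(\<integral>\<^sup>+y. \<integral>\<^sup>+m. \<integral>\<^sup>+j. ?f (l, y, m, j) \<partial>?G \<partial>gg ?b \<partial>PiM q (\<lambda>_. H)) =
      (\<integral>\<^sup>+m. ennreal (eg m) \<partial>gg ?b) * (\<integral>\<^sup>+y. (\<Prod>C\<in>q. h C (y C)) \<partial>PiM q (\<lambda>_. H))"
      unfolding mj by (rule nn_integral_cmult[OF hm])
    also have "(\<integral>\<^sup>+y. (\<Prod>C\<in>q. h C (y C)) \<partial>PiM q (\<lambda>_. H)) = (\<Prod>C\<in>q. \<integral>\<^sup>+y. h C y \<partial>H)"
      by (rule H.product_nn_integral_prod[OF q(1)]) measurable
    also have "(\<integral>\<^sup>+m. ennreal (eg m) \<partial>gg ?b) = ennreal (exp (- psi 0 ?b) * exp (K * l))"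
      unfolding nn_integral_gg_eg[OF b] bl ..
    finally show "(\<integral>\<^sup>+y. \<integral>\<^sup>+m. \<integral>\<^sup>+j. ?f (l, y, m, j) \<partial>?G \<partial>gg ?b \<partial>PiM q (\<lambda>_. H)) =
      ennreal (exp (- psi 0 ?b) * exp (K * l)) * (\<Prod>C\<in>q. \<integral>\<^sup>+y. ennreal ((?b / (?b + g y)) powr (real (card C) - \<alpha>)) \<partial>H)"
      unfolding h_def .
  qed
  finally show ?thesis .
qed

text \<open>The left side collects the weight of \<open>q\<close>, the constant of the gamma law of
  \<open>L\<close> with the \<alpha> of the substitution, and the constants of the atoms. That the
  result is free of \<open>q\<close> is why the EPPF is the right weight: the sum over
  \<open>q\<close> can then be formed inside the integral.\<close>

lemma eppf_const:
  assumes \<theta>: "- \<alpha> < \<theta>" and n: "1 \<le> n" and q: "partition_on {1..n} q"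
  shows "PD_eppf n \<alpha> \<theta> q * (\<alpha> * K powr (real (card q) + \<theta> / \<alpha>) / Gamma (real (card q) + \<theta> / \<alpha>)) *
      (\<Prod>C\<in>q. Gamma (1 - \<alpha>) / Gamma (real (card C) - \<alpha>) / (\<alpha> * K)) =
    Z_const \<theta> / Gamma (\<theta> + real n)"
proof -
  let ?k = "card q"
  \<comment> \<open>One less than the number of blocks: the EPPF has \<open>k\<close> factors
    \<open>\<theta> + j * \<alpha> = \<alpha> * (\<theta> / \<alpha> + j)\<close>. Their product
    cancels the rising factorial in \<open>Gamma (card q + \<theta> / \<alpha>)\<close>, and
    \<open>\<alpha> ^ k\<close> with one more \<alpha> from the substitution cancels the \<alpha> of
    the atoms.\<close>
  obtain k where k: "?k = Suc k" using partition_on_card_pos[OF q n] by (cases ?k) auto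
  obtain m where m: "n = Suc m" using n by (cases n) auto
  have \<theta>\<alpha>: "- 1 < \<theta> / \<alpha>" using \<theta> \<alpha> by (simp add: field_simps)
  have \<theta>1: "- 1 < \<theta>" using \<theta> \<alpha> by simp
  have G: "Gamma (real (card C) - \<alpha>) \<noteq> 0" if "C \<in> q" for C
  proof -
    have "0 < card C" using partition_on_blockD[OF q _ that] by simp
    then have "0 < Gamma (real (card C) - \<alpha>)" using \<alpha> by (intro Gamma_real_pos) (cases "card C", auto)
    then show ?thesis by linarith
  qed
  have "0 < Gamma (1 - \<alpha>)" using \<alpha> by (intro Gamma_real_pos) auto
  then have G1: "Gamma (1 - \<alpha>) \<noteq> 0" by linarith
  have "0 < Gamma (\<theta> / \<alpha> + 1)" "0 < Gamma (\<theta> + 1)" using \<theta>\<alpha> \<theta>1 by (auto intro!: Gamma_real_pos)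
  then have G2: "Gamma (\<theta> / \<alpha> + 1) \<noteq> 0" "Gamma (\<theta> + 1) \<noteq> 0" by auto
  define P where "P = (\<Prod>j = 1..k. \<theta> / \<alpha> + real j)"
  define R where "R = (\<Prod>j = 1..m. \<theta> + real j)"
  have P: "P \<noteq> 0"
  proof -
    have "0 < \<theta> / \<alpha> + real j" if "j \<in> {1..k}" for j using \<theta>\<alpha> that by (cases j) auto
    then have "0 < P" unfolding P_def by (intro prod_pos) auto
    then show ?thesis by simp
  qed
  have R: "R \<noteq> 0"
  proof -
    have "0 < \<theta> + real j" if "j \<in> {1..m}" for j using \<theta>1 that by (cases j) auto
    then have "0 < R" unfolding R_def by (intro prod_pos) auto
    then show ?thesis by simp
  qed
  have g1: "Gamma (real ?k + \<theta> / \<alpha>) = Gamma (\<theta> / \<alpha> + 1) * P"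
    using Gamma_rising[OF \<theta>\<alpha>, of k] by (simp add: k P_def add.commute)
  have g2: "Gamma (\<theta> + real n) = Gamma (\<theta> + 1) * R"
    using Gamma_rising[OF \<theta>1, of m] by (simp add: m R_def)
  have "(\<Prod>j = 1..k. \<theta> + real j * \<alpha>) = (\<Prod>j = 1..k. \<alpha> * (\<theta> / \<alpha> + real j))"
    using \<alpha> by (intro prod.cong) (auto simp: field_simps)
  also have "\<dots> = \<alpha> ^ k * P" by (simp add: P_def prod.distrib)
  finally have g3: "(\<Prod>j = 1..?k - 1. \<theta> + real j * \<alpha>) = \<alpha> ^ k * P" by (simp add: k)
  have g4: "(\<Prod>j = 1..n - 1. \<theta> + real j) = R" by (simp add: m R_def)
  have e1: "(\<Prod>C\<in>q. Gamma (real (card C) - \<alpha>) / Gamma (1 - \<alpha>)) * (\<Prod>C\<in>q. Gamma (1 - \<alpha>) / Gamma (real (card C) - \<alpha>) / (\<alpha> * K)) =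
    (\<Prod>C\<in>q. 1 / (\<alpha> * K))"
    unfolding prod.distrib[symmetric] using G G1 by (intro prod.cong) auto
  have e2: "(\<Prod>C\<in>q. 1 / (\<alpha> * K)) = 1 / (\<alpha> * K) ^ Suc k" by (simp add: k power_one_over)
  have e3: "K powr (real ?k + \<theta> / \<alpha>) = K ^ Suc k * K powr (\<theta> / \<alpha>)"
    using K_pos by (simp add: k powr_add powr_realpow[symmetric])
  have "PD_eppf n \<alpha> \<theta> q * (\<alpha> * K powr (real ?k + \<theta> / \<alpha>) / Gamma (real ?k + \<theta> / \<alpha>)) *
      (\<Prod>C\<in>q. Gamma (1 - \<alpha>) / Gamma (real (card C) - \<alpha>) / (\<alpha> * K)) =
    (\<alpha> ^ k * P / R) * (\<alpha> * (K ^ Suc k * K powr (\<theta> / \<alpha>)) / (Gamma (\<theta> / \<alpha> + 1) * P)) *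
    ((\<Prod>C\<in>q. Gamma (real (card C) - \<alpha>) / Gamma (1 - \<alpha>)) * (\<Prod>C\<in>q. Gamma (1 - \<alpha>) / Gamma (real (card C) - \<alpha>) / (\<alpha> * K)))"
    unfolding PD_eppf_def g1 g3 g4 e3 by (simp only: mult_ac)
  also have "\<dots> = (\<alpha> ^ k * P / R) * (\<alpha> * (K ^ Suc k * K powr (\<theta> / \<alpha>)) / (Gamma (\<theta> / \<alpha> + 1) * P)) * (1 / (\<alpha> * K) ^ Suc k)"
    unfolding e1 e2 ..
  also have "\<dots> = Z_const \<theta> / Gamma (\<theta> + real n)"
    unfolding Z_const_def g2 using \<alpha> K_pos P R G2 by (simp add: power_mult_distrib field_simps)
  finally show ?thesis .
qed

lemma psi_measurable [measurable]: "psi e \<in> borel_measurable borel"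
proof -
  have "(\<lambda>b. \<integral>y. (g y + b) powr \<beta> \<partial>\<eta>) \<in> borel_measurable borel" for \<beta>
    by (rule \<eta>.borel_measurable_lebesgue_integral) measurable
  moreover have "(\<lambda>b. \<integral>y. (g y + b) powr \<beta> / \<alpha> \<partial>\<eta>) \<in> borel_measurable borel" for \<beta>
    by (rule \<eta>.borel_measurable_lebesgue_integral) measurable
  ultimately show ?thesis unfolding psi_def[abs_def] by (cases "e = 0") simp_all
qed

text \<open>After \<open>l = b powr \<alpha>\<close> the power of \<open>b\<close> is the same for
  all \<open>q\<close>: the atoms give \<open>n - card q * \<alpha>\<close>, the gamma density and
  the derivative give \<open>\<theta> + card q * \<alpha> - 1\<close>. Only the product of the
  \<open>psi\<close> factors still depends on \<open>q\<close>.\<close>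

lemma laplace_block_law_integral:
  assumes \<theta>: "- \<alpha> < \<theta>" and n: "1 \<le> n" and q: "partition_on {1..n} q" and sp: "space \<eta> = UNIV"
  shows "ennreal (PD_eppf n \<alpha> \<theta> q) * (\<integral>\<^sup>+z. ennreal (exp_minus (\<integral>\<^sup>+y. ennreal (g y) \<partial>add_atoms (fst (snd (snd z))) q (snd (snd (snd z))) (fst (snd z))))
      \<partial>block_law (real (card q) + \<theta> / \<alpha>) q) =
    ennreal (Z_const \<theta> / Gamma (\<theta> + real n)) *
    (\<integral>\<^sup>+b. ennreal (b powr (\<theta> + real n - 1)) * ennreal ((\<Prod>C\<in>q. psi (card C) b) * exp (- psi 0 b)) * indicator {0<..} b \<partial>lborel)"
    (is "_ * ?L = _ * (\<integral>\<^sup>+b. ?R b \<partial>lborel)")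
proof -
  define a where "a = real (card q) + \<theta> / \<alpha>"
  have finq: "finite q" by (rule finite_elements[OF _ q]) simp
  have cardq: "0 < card C" if "C \<in> q" for C using partition_on_blockD[OF q _ that] by simp
  have k: "1 \<le> card q" using partition_on_card_pos[OF q n] by simp
  have a: "0 < a"
  proof -
    have "- 1 < \<theta> / \<alpha>" using \<theta> \<alpha> by (simp add: field_simps)
    moreover have "1 \<le> real (card q)" using k by simp
    ultimately show ?thesis by (simp add: a_def)
  qed
  have \<alpha>a: "\<alpha> * a = real (card q) * \<alpha> + \<theta>" using \<alpha> by (simp add: a_def distrib_left mult.commute)
  define c where "c = (\<Prod>C\<in>q. Gamma (1 - \<alpha>) / Gamma (real (card C) - \<alpha>) / (\<alpha> * K))"
  have c: "0 \<le> c" unfolding c_def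
  proof (rule prod_nonneg)
    fix C assume "C \<in> q"
    then have "0 < real (card C) - \<alpha>" using cardq[of C] \<alpha> by (cases "card C") auto
    then have "0 < Gamma (real (card C) - \<alpha>)" by (rule Gamma_real_pos)
    moreover have "0 < Gamma (1 - \<alpha>)" using \<alpha> by (intro Gamma_real_pos) auto
    ultimately show "0 \<le> Gamma (1 - \<alpha>) / Gamma (real (card C) - \<alpha>) / (\<alpha> * K)"
      using \<alpha> K_pos by simp
  qed
  define Pr where "Pr b = (\<Prod>C\<in>q. psi (card C) b)" for b
  have Pr0: "0 \<le> Pr b" if "0 < b" for b unfolding Pr_def using psi_nonneg[OF that] by (intro prod_nonneg) auto
  \<comment> \<open>The sum of the shapes \<open>card C - \<alpha>\<close> over the blocks, as the
    block sizes sum to \<open>n\<close>.\<close>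
  define s where "s = real n - real (card q) * \<alpha>"
  define u where "u l = exp (- psi 0 (l powr (1 / \<alpha>))) * exp (K * l) * ((l powr (1 / \<alpha>)) powr s * c * Pr (l powr (1 / \<alpha>)))" for l
  have um[measurable]: "u \<in> borel_measurable borel" unfolding u_def[abs_def] Pr_def by measurable
  have "?L = (\<integral>\<^sup>+l. ennreal (exp (- psi 0 (l powr (1 / \<alpha>))) * exp (K * l)) *
      (\<Prod>C\<in>q. \<integral>\<^sup>+y. ennreal ((l powr (1 / \<alpha>) / (l powr (1 / \<alpha>) + g y)) powr (real (card C) - \<alpha>)) \<partial>H) \<partial>gamma_law a K)"
    unfolding a_def by (rule laplace_add_atoms_block_law[OF finq cardq sp])
  also have "\<dots> = (\<integral>\<^sup>+l. ennreal (u l) \<partial>gamma_law a K)"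
  proof (rule nn_integral_cong_AE, rule eventually_mono[OF AE_gamma_law])
    fix l :: real assume l: "0 < l"
    let ?b = "l powr (1 / \<alpha>)"
    have b: "0 < ?b" using l by simp
    have "(\<Prod>C\<in>q. \<integral>\<^sup>+y. ennreal ((?b / (?b + g y)) powr (real (card C) - \<alpha>)) \<partial>H) =
      (\<Prod>C\<in>q. ennreal (?b powr (real (card C) - \<alpha>) * (Gamma (1 - \<alpha>) / Gamma (real (card C) - \<alpha>)) / (\<alpha> * K) * psi (card C) ?b))"
      by (intro prod.cong refl nn_integral_H_block[OF b] cardq)
    also have "\<dots> = ennreal (\<Prod>C\<in>q. ?b powr (real (card C) - \<alpha>) * (Gamma (1 - \<alpha>) / Gamma (real (card C) - \<alpha>)) / (\<alpha> * K) * psi (card C) ?b)"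
    proof (rule prod_ennreal)
      fix C assume "C \<in> q"
      then have "0 < real (card C) - \<alpha>" using cardq[of C] \<alpha> by (cases "card C") auto
      then have "0 < Gamma (real (card C) - \<alpha>)" by (rule Gamma_real_pos)
      moreover have "0 < Gamma (1 - \<alpha>)" using \<alpha> by (intro Gamma_real_pos) auto
      ultimately show "0 \<le> ?b powr (real (card C) - \<alpha>) * (Gamma (1 - \<alpha>) / Gamma (real (card C) - \<alpha>)) / (\<alpha> * K) * psi (card C) ?b"
        using \<alpha> K_pos psi_nonneg[OF b] by simp
    qed
    also have "(\<Prod>C\<in>q. ?b powr (real (card C) - \<alpha>) * (Gamma (1 - \<alpha>) / Gamma (real (card C) - \<alpha>)) / (\<alpha> * K) * psi (card C) ?b) =
      (\<Prod>C\<in>q. ?b powr (real (card C) - \<alpha>)) * c * Pr ?b"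
      unfolding c_def Pr_def prod.distrib[symmetric] by (intro prod.cong) auto
    also have "(\<Prod>C\<in>q. ?b powr (real (card C) - \<alpha>)) = ?b powr s"
    proof -
      have "(\<Sum>C\<in>q. real (card C) - \<alpha>) = s"
        using sum_card_partition_on[OF q] by (simp add: s_def sum_subtractf flip: of_nat_sum)
      then show ?thesis using b finq by (simp add: powr_sum[symmetric])
    qed
    finally have "(\<Prod>C\<in>q. \<integral>\<^sup>+y. ennreal ((?b / (?b + g y)) powr (real (card C) - \<alpha>)) \<partial>H) = ennreal (?b powr s * c * Pr ?b)" .
    then show "ennreal (exp (- psi 0 ?b) * exp (K * l)) *
      (\<Prod>C\<in>q. \<integral>\<^sup>+y. ennreal ((?b / (?b + g y)) powr (real (card C) - \<alpha>)) \<partial>H) = ennreal (u l)"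
      using c Pr0[OF b] by (simp add: u_def flip: ennreal_mult)
  qed
  also have "\<dots> = ennreal (K powr a / Gamma a) * (\<integral>\<^sup>+l. ennreal (u l) * ennreal (l powr (a - 1) * exp (- K * l)) * indicator {0<..} l \<partial>lborel)"
    using a K_pos by (intro nn_integral_gamma_law) auto
  finally have L: "?L = ennreal (K powr a / Gamma a) * (\<integral>\<^sup>+l. ennreal (u l) * ennreal (l powr (a - 1) * exp (- K * l)) * indicator {0<..} l \<partial>lborel)" .
  have "(\<integral>\<^sup>+l. ennreal (u l) * ennreal (l powr (a - 1) * exp (- K * l)) * indicator {0<..} l \<partial>lborel) =
    (\<integral>\<^sup>+b. ennreal (u (b powr \<alpha>)) * ennreal ((b powr \<alpha>) powr (a - 1) * exp (- K * (b powr \<alpha>))) * ennreal (\<alpha> * b powr (\<alpha> - 1)) * indicator {0<..} b \<partial>lborel)"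
    by (rule nn_integral_powr_substitution[OF \<alpha>(1), symmetric]) measurable
  also have "\<dots> = (\<integral>\<^sup>+b. ennreal (\<alpha> * c) * ?R b \<partial>lborel)"
  proof (rule nn_integral_cong)
    fix b :: real
    show "ennreal (u (b powr \<alpha>)) * ennreal ((b powr \<alpha>) powr (a - 1) * exp (- K * (b powr \<alpha>))) * ennreal (\<alpha> * b powr (\<alpha> - 1)) * indicator {0<..} b =
      ennreal (\<alpha> * c) * ?R b"
    proof (cases "0 < b")
      case True
      have bb: "(b powr \<alpha>) powr (1 / \<alpha>) = b" using True \<alpha> by (simp add: powr_powr)
      have u0: "0 \<le> u (b powr \<alpha>)" using c Pr0[OF True] by (simp add: u_def bb)
      have ex: "(b powr s * (b powr \<alpha>) powr (a - 1)) * b powr (\<alpha> - 1) = b powr (\<theta> + real n - 1)"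
      proof -
        have "(b powr s * (b powr \<alpha>) powr (a - 1)) * b powr (\<alpha> - 1) = b powr (s + \<alpha> * (a - 1) + (\<alpha> - 1))"
          by (simp only: powr_powr powr_add)
        also have "s + \<alpha> * (a - 1) + (\<alpha> - 1) = \<theta> + real n - 1"
          using \<alpha>a by (simp add: s_def right_diff_distrib)
        finally show ?thesis .
      qed
      have E: "exp (K * b powr \<alpha>) * exp (- K * b powr \<alpha>) = 1" by (simp add: exp_minus)
      have "u (b powr \<alpha>) * ((b powr \<alpha>) powr (a - 1) * exp (- K * b powr \<alpha>)) * (\<alpha> * b powr (\<alpha> - 1)) =
        (exp (K * b powr \<alpha>) * exp (- K * b powr \<alpha>)) *
        (exp (- psi 0 b) * c * Pr b * \<alpha> * ((b powr s * (b powr \<alpha>) powr (a - 1)) * b powr (\<alpha> - 1)))"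
        unfolding u_def bb by (simp only: mult_ac)
      also have "\<dots> = \<alpha> * c * (b powr (\<theta> + real n - 1) * (Pr b * exp (- psi 0 b)))"
        unfolding E ex by (simp only: mult_ac mult_1_left)
      finally have e: "u (b powr \<alpha>) * ((b powr \<alpha>) powr (a - 1) * exp (- K * b powr \<alpha>)) * (\<alpha> * b powr (\<alpha> - 1)) =
        \<alpha> * c * (b powr (\<theta> + real n - 1) * (Pr b * exp (- psi 0 b)))" .
      have "ennreal (u (b powr \<alpha>)) * ennreal ((b powr \<alpha>) powr (a - 1) * exp (- K * (b powr \<alpha>))) * ennreal (\<alpha> * b powr (\<alpha> - 1)) =
        ennreal (u (b powr \<alpha>) * ((b powr \<alpha>) powr (a - 1) * exp (- K * b powr \<alpha>)) * (\<alpha> * b powr (\<alpha> - 1)))"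
        using u0 \<alpha> by (simp add: ennreal_mult)
      also have "\<dots> = ennreal (\<alpha> * c) * (ennreal (b powr (\<theta> + real n - 1)) * ennreal (Pr b * exp (- psi 0 b)))"
        unfolding e using c \<alpha> Pr0[OF True] by (simp add: ennreal_mult)
      finally show ?thesis using True by (simp add: Pr_def)
    qed simp
  qed
  also have "\<dots> = ennreal (\<alpha> * c) * (\<integral>\<^sup>+b. ?R b \<partial>lborel)"
    by (rule nn_integral_cmult) measurable
  finally have R: "(\<integral>\<^sup>+l. ennreal (u l) * ennreal (l powr (a - 1) * exp (- K * l)) * indicator {0<..} l \<partial>lborel) =
    ennreal (\<alpha> * c) * (\<integral>\<^sup>+b. ?R b \<partial>lborel)" .
  have "0 < PD_eppf n \<alpha> \<theta> q" by (rule PD_eppf_pos) (use \<alpha> \<theta> n q in auto)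
  moreover have "0 < Gamma a" using a by (rule Gamma_real_pos)
  moreover have "PD_eppf n \<alpha> \<theta> q * (K powr a / Gamma a * (\<alpha> * c)) = Z_const \<theta> / Gamma (\<theta> + real n)"
    using eppf_const[OF \<theta> n q] unfolding a_def[symmetric] c_def[symmetric] by (simp add: mult_ac)
  ultimately have "ennreal (PD_eppf n \<alpha> \<theta> q) * (ennreal (K powr a / Gamma a) * ennreal (\<alpha> * c)) = ennreal (Z_const \<theta> / Gamma (\<theta> + real n))"
    using c \<alpha> by (simp flip: ennreal_mult)
  then show ?thesis unfolding L R by (metis (no_types, lifting) mult.assoc)
qed

text \<open>All partitions share the same constant and power of \<open>b\<close>, so the sum moves
  inside the integral, where \<open>A_partition\<close> recognises it as \<open>A n b\<close>;
  \<open>nn_integral_A_mix\<close> returns to the polynomial tilt.\<close>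

lemma mixture_laplace:
  assumes \<theta>: "- \<alpha> < \<theta>" and n: "1 \<le> n" and sp: "space \<eta> = UNIV"
  shows "(\<Sum>q | partition_on {1..n} q. ennreal (PD_eppf n \<alpha> \<theta> q) *
      (\<integral>\<^sup>+z. ennreal (exp_minus (\<integral>\<^sup>+y. ennreal (g y) \<partial>add_atoms (fst (snd (snd z))) q (snd (snd (snd z))) (fst (snd z))))
        \<partial>block_law (real (card q) + \<theta> / \<alpha>) q)) =
    ennreal (Z_const \<theta>) * (\<integral>\<^sup>+m. ennreal (tmass m powr - \<theta>) * ennreal (eg m) \<partial>Q0)" (is "?L = _")
proof -
  let ?P = "{q. partition_on {1..n} q}"
  let ?R = "\<lambda>q b. ennreal (b powr (\<theta> + real n - 1)) * ennreal ((\<Prod>C\<in>q. psi (card C) b) * exp (- psi 0 b)) * indicator {0<..} b"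
  have \<theta>n: "0 < \<theta> + real n" using \<theta> \<alpha> n by linarith
  then have G: "0 < Gamma (\<theta> + real n)" by (rule Gamma_real_pos)
  have Z: "0 \<le> Z_const \<theta>"
  proof -
    have "0 < \<theta> / \<alpha> + 1" using \<theta> \<alpha> by (simp add: field_simps)
    then have "0 < Gamma (\<theta> / \<alpha> + 1)" by (rule Gamma_real_pos)
    moreover have "0 < Gamma (\<theta> + 1)" using \<theta> \<alpha> by (intro Gamma_real_pos) auto
    ultimately show ?thesis using K_pos by (simp add: Z_const_def)
  qed
  have "?L = (\<Sum>q\<in>?P. ennreal (Z_const \<theta> / Gamma (\<theta> + real n)) * (\<integral>\<^sup>+b. ?R q b \<partial>lborel))"
    by (rule sum.cong[OF refl]) (rule laplace_block_law_integral[OF \<theta> n _ sp], simp)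
  also have "\<dots> = ennreal (Z_const \<theta> / Gamma (\<theta> + real n)) * (\<integral>\<^sup>+b. (\<Sum>q\<in>?P. ?R q b) \<partial>lborel)"
    by (subst nn_integral_sum) (simp_all add: sum_distrib_left)
  also have "(\<integral>\<^sup>+b. (\<Sum>q\<in>?P. ?R q b) \<partial>lborel) = (\<integral>\<^sup>+b. ennreal (b powr (\<theta> + real n - 1)) * ennreal (A n b) * indicator {0<..} b \<partial>lborel)"
  proof (rule nn_integral_cong)
    fix b :: real
    show "(\<Sum>q\<in>?P. ?R q b) = ennreal (b powr (\<theta> + real n - 1)) * ennreal (A n b) * indicator {0<..} b"
    proof (cases "0 < b")
      case True
      have "ennreal (A n b) = (\<Sum>q\<in>?P. ennreal ((\<Prod>C\<in>q. psi (card C) b) * exp (- psi 0 b)))"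
        unfolding A_partition[OF True] using psi_nonneg[OF True]
        by (intro sum_ennreal[symmetric]) (auto intro!: mult_nonneg_nonneg prod_nonneg)
      then show ?thesis using True by (simp add: sum_distrib_left)
    qed simp
  qed
  also have "\<dots> = ennreal (Gamma (\<theta> + real n)) * (\<integral>\<^sup>+m. ennreal (tmass m powr - \<theta>) * ennreal (eg m) \<partial>Q0)"
    by (rule nn_integral_A_mix[OF \<theta>n])
  finally have "?L = ennreal (Z_const \<theta> / Gamma (\<theta> + real n)) * (ennreal (Gamma (\<theta> + real n)) * (\<integral>\<^sup>+m. ennreal (tmass m powr - \<theta>) * ennreal (eg m) \<partial>Q0))" .
  moreover have "ennreal (Z_const \<theta> / Gamma (\<theta> + real n)) * ennreal (Gamma (\<theta> + real n)) = ennreal (Z_const \<theta>)"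
    using G Z by (simp flip: ennreal_mult)
  ultimately show ?thesis by (simp only: mult.assoc[symmetric])
qed

end

section \<open>Identification with the Poisson-Dirichlet law\<close>

context gg_setting
begin

lemma Z_const_pos:
  assumes \<theta>: "- \<alpha> < \<theta>" shows "0 < Z_const \<theta>"
proof -
  have "0 < \<theta> / \<alpha> + 1" using \<theta> \<alpha> by (simp add: field_simps)
  then have "0 < Gamma (\<theta> / \<alpha> + 1)" by (rule Gamma_real_pos)
  moreover have "0 < Gamma (\<theta> + 1)" using \<theta> \<alpha> by (intro Gamma_real_pos) auto
  ultimately show ?thesis using K_pos by (simp add: Z_const_def)
qed

lemma block_shape_pos:
  fixes n :: nat
  assumes "- \<alpha> < \<theta>" "1 \<le> n" "partition_on {1..n} q"
  shows "0 < real (card q) + \<theta> / \<alpha>"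
proof -
  have "- 1 < \<theta> / \<alpha>" using assms \<alpha> by (simp add: field_simps)
  moreover have "1 \<le> real (card q)" using partition_on_card_pos[OF assms(3,2)] by simp
  ultimately show ?thesis by simp
qed

text \<open>\<open>PD_measure_density\<close> covers positive exponents only. Here
  \<open>mixture_laplace\<close> is evaluated with n = 1 and g = 0: the left side is a mixture of
  probability laws with weights summing to 1, so the right side gives the mean of
  \<open>T powr (- \<theta>)\<close>.\<close>

lemma PD_measure_eq_density:
  assumes \<theta>: "- \<alpha> < \<theta>" and sp: "space \<eta> = UNIV"
  shows "PD_measure \<alpha> \<theta> \<eta> = density Q0 (\<lambda>m. ennreal (Z_const \<theta> * tmass m powr - \<theta>))"
proof (rule PD_measure_eqI[OF Z_const_pos[OF \<theta>]])
  interpret T: gg_test \<alpha> \<eta> "\<lambda>_. 0" 0 by unfold_locales auto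
  have one: "(\<integral>\<^sup>+z. ennreal (exp_minus (\<integral>\<^sup>+y. ennreal 0 \<partial>add_atoms (fst (snd (snd z))) q (snd (snd (snd z))) (fst (snd z))))
        \<partial>block_law (real (card q) + \<theta> / \<alpha>) q) = 1" if q: "partition_on {1..1} q" for q
  proof -
    interpret prob_space "block_law (real (card q) + \<theta> / \<alpha>) q"
      by (rule prob_space_block_law)
         (use finite_elements[OF _ q] partition_on_blockD[OF q] block_shape_pos[OF \<theta> _ q] in auto)
    show ?thesis by (simp add: emeasure_space_1)
  qed
  have "ennreal (Z_const \<theta>) * (\<integral>\<^sup>+m. ennreal (tmass m powr - \<theta>) * ennreal (T.eg m) \<partial>Q0) =
    (\<Sum>q | partition_on {1..1} q. ennreal (PD_eppf 1 \<alpha> \<theta> q) * 1)"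
    unfolding T.mixture_laplace[OF \<theta> order_refl sp, symmetric] by (intro sum.cong refl) (simp only: mem_Collect_eq one)
  also have "\<dots> = ennreal (\<Sum>q | partition_on {1..1} q. PD_eppf 1 \<alpha> \<theta> q)"
    unfolding mult_1_right using PD_eppf_pos[OF \<alpha> \<theta>] by (intro sum_ennreal) (auto intro: less_imp_le)
  also have "\<dots> = 1" using sum_PD_eppf[OF \<alpha> \<theta>, of 1] by simp
  finally show "ennreal (Z_const \<theta>) * (\<integral>\<^sup>+m. ennreal (tmass m powr - \<theta>) \<partial>Q0) = 1"
    by (simp add: T.eg_def)
qed

text \<open>By \<open>mixture_laplace\<close> the functional of \<open>P\<close> is
  \<open>Z_const \<theta>\<close> times a tilted mean under \<open>Q0\<close>, which is that of the
  density in \<open>PD_measure_eq_density\<close>. The test function 0 shows that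
  \<open>PD_measure\<close> is finite, as the uniqueness theorem requires.\<close>

lemma mixture_eq_PD_measure:
  fixes P :: "'y measure measure"
  assumes \<theta>: "- \<alpha> < \<theta>" and n: "1 \<le> n" and sp: "space \<eta> = UNIV"
    and P: "finite_measure P" "sets P = sets (measure_algebra \<eta>)"
    and mix: "\<And>g. g \<in> borel_measurable \<eta> \<Longrightarrow> (\<And>y. 0 \<le> g y) \<Longrightarrow>
      (\<integral>\<^sup>+m. ennreal (exp_minus (\<integral>\<^sup>+y. ennreal (g y) \<partial>m)) \<partial>P) =
      (\<Sum>q | partition_on {1..n} q. ennreal (PD_eppf n \<alpha> \<theta> q) *
      (\<integral>\<^sup>+z. ennreal (exp_minus (\<integral>\<^sup>+y. ennreal (g y) \<partial>add_atoms (fst (snd (snd z))) q (snd (snd (snd z))) (fst (snd z))))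
        \<partial>block_law (real (card q) + \<theta> / \<alpha>) q))"
  shows "P = PD_measure \<alpha> \<theta> \<eta>"
proof -
  have L: "(\<integral>\<^sup>+m. ennreal (exp_minus (\<integral>\<^sup>+y. ennreal (g y) \<partial>m)) \<partial>P) =
    (\<integral>\<^sup>+m. ennreal (exp_minus (\<integral>\<^sup>+y. ennreal (g y) \<partial>m)) \<partial>PD_measure \<alpha> \<theta> \<eta>)"
    if g[measurable]: "g \<in> borel_measurable \<eta>" and g0: "\<And>y. 0 \<le> g y" and gB: "\<And>y. g y \<le> B" for g B
  proof -
    interpret T: gg_test \<alpha> \<eta> g B using that by unfold_locales
    have "(\<integral>\<^sup>+m. ennreal (exp_minus (\<integral>\<^sup>+y. ennreal (g y) \<partial>m)) \<partial>P) =
      ennreal (Z_const \<theta>) * (\<integral>\<^sup>+m. ennreal (tmass m powr - \<theta>) * ennreal (T.eg m) \<partial>Q0)"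
      unfolding mix[OF g g0] by (rule T.mixture_laplace[OF \<theta> n sp])
    also have "\<dots> = (\<integral>\<^sup>+m. ennreal (Z_const \<theta>) * (ennreal (tmass m powr - \<theta>) * ennreal (T.eg m)) \<partial>Q0)"
      by (rule nn_integral_cmult[symmetric]) measurable
    also have "\<dots> = (\<integral>\<^sup>+m. ennreal (Z_const \<theta> * tmass m powr - \<theta>) * ennreal (exp_minus (\<integral>\<^sup>+y. ennreal (g y) \<partial>m)) \<partial>Q0)"
      using Z_const_pos[OF \<theta>] by (intro nn_integral_cong) (simp add: T.eg_def ennreal_mult mult.assoc)
    also have "\<dots> = (\<integral>\<^sup>+m. ennreal (exp_minus (\<integral>\<^sup>+y. ennreal (g y) \<partial>m)) \<partial>PD_measure \<alpha> \<theta> \<eta>)"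
      unfolding PD_measure_eq_density[OF \<theta> sp] by (rule nn_integral_density[symmetric]) measurable
    finally show ?thesis .
  qed
  show ?thesis
  proof (rule laplace_functional_eqI)
    have "emeasure (PD_measure \<alpha> \<theta> \<eta>) (space (PD_measure \<alpha> \<theta> \<eta>)) = (\<integral>\<^sup>+m. 1 \<partial>PD_measure \<alpha> \<theta> \<eta>)" by simp
    also have "\<dots> = (\<integral>\<^sup>+m. 1 \<partial>P)" using L[of "\<lambda>_. 0" 0] by simp
    finally have "emeasure (PD_measure \<alpha> \<theta> \<eta>) (space (PD_measure \<alpha> \<theta> \<eta>)) = emeasure P (space P)" by simp
    then show "finite_measure (PD_measure \<alpha> \<theta> \<eta>)"
      using finite_measure.emeasure_finite[OF P(1)] by (intro finite_measureI) simp
    fix g :: "'y \<Rightarrow> real" and B assume g: "g \<in> borel_measurable \<eta>" "\<And>y. 0 \<le> g y" "\<And>y. g y \<le> B"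
    show "laplace_functional P g = laplace_functional (PD_measure \<alpha> \<theta> \<eta>) g"
      using L[OF g] g(1) P(2) by (subst (1 2) laplace_functional_eq_enn2real[where K=\<eta>]) auto
  qed (use P in auto)
qed

end

text \<open>Total probability: the integral splits over the finitely many values of
  \<open>p\<close>, and positive probabilities undo the division in \<open>given\<close>.\<close>

lemma nn_integral_given:
  assumes "prob_space M" and p[measurable]: "p \<in> measurable M (count_space P)" and P: "finite P"
    and pos: "\<And>q. q \<in> P \<Longrightarrow> 0 < measure M {\<omega> \<in> space M. p \<omega> = q}"
    and F[measurable]: "F \<in> borel_measurable M"
  shows "(\<integral>\<^sup>+\<omega>. F \<omega> \<partial>M) = (\<Sum>q\<in>P. ennreal (measure M {\<omega> \<in> space M. p \<omega> = q}) * (\<integral>\<^sup>+\<omega>. F \<omega> \<partial>given M p q))"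
proof -
  interpret prob_space M by fact
  let ?E = "\<lambda>q. {\<omega> \<in> space M. p \<omega> = q}"
  have E[measurable]: "?E q \<in> sets M" if "q \<in> P" for q
  proof -
    have "?E q = p -` {q} \<inter> space M" by auto
    then show ?thesis using measurable_sets[OF p, of "{q}"] that by simp
  qed
  have 1: "(\<integral>\<^sup>+\<omega>. F \<omega> * indicator (?E q) \<omega> \<partial>M) = ennreal (measure M (?E q)) * (\<integral>\<^sup>+\<omega>. F \<omega> \<partial>given M p q)"
    if q: "q \<in> P" for q
  proof -
    have "(\<integral>\<^sup>+\<omega>. F \<omega> \<partial>given M p q) = (\<integral>\<^sup>+\<omega>. F \<omega> * indicator (?E q) \<omega> \<partial>M) / emeasure M (?E q)"
      unfolding given_def by (rule nn_integral_uniform_measure[OF F E[OF q]])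
    then have "ennreal (measure M (?E q)) * (\<integral>\<^sup>+\<omega>. F \<omega> \<partial>given M p q) =
      (\<integral>\<^sup>+\<omega>. F \<omega> * indicator (?E q) \<omega> \<partial>M) * ennreal (measure M (?E q)) / ennreal (measure M (?E q))"
      unfolding emeasure_eq_measure by (simp only: ennreal_times_divide mult.commute)
    also have "\<dots> = (\<integral>\<^sup>+\<omega>. F \<omega> * indicator (?E q) \<omega> \<partial>M)"
      using pos[OF q] by (intro ennreal_mult_divide_eq) auto
    finally show ?thesis ..
  qed
  have "(\<integral>\<^sup>+\<omega>. F \<omega> \<partial>M) = (\<integral>\<^sup>+\<omega>. (\<Sum>q\<in>P. F \<omega> * indicator (?E q) \<omega>) \<partial>M)"
  proof (rule nn_integral_cong)
    fix \<omega> assume \<omega>: "\<omega> \<in> space M"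
    have "p \<omega> \<in> P" using measurable_space[OF p \<omega>] by simp
    have "(\<Sum>q\<in>P. F \<omega> * indicator (?E q) \<omega>) = (\<Sum>q\<in>{p \<omega>}. F \<omega> * indicator (?E q) \<omega>)"
      by (rule sum.mono_neutral_right) (use P \<open>p \<omega> \<in> P\<close> in \<open>auto simp: indicator_def split: if_splits\<close>)
    then show "F \<omega> = (\<Sum>q\<in>P. F \<omega> * indicator (?E q) \<omega>)" using \<omega> by simp
  qed
  also have "\<dots> = (\<Sum>q\<in>P. \<integral>\<^sup>+\<omega>. F \<omega> * indicator (?E q) \<omega> \<partial>M)"
    by (rule nn_integral_sum) measurable
  finally show ?thesis using 1 by simp
qed

context gg_setting
begin

lemma PD_hierarchyD:
  assumes "PD_hierarchy \<alpha> \<theta> n \<eta> M p L Y J \<mu>"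
  shows "prob_space M" "p \<in> measurable M (count_space {q. partition_on {1..n} q})"
    "L \<in> borel_measurable M" "\<And>C. C \<subseteq> {1..n} \<Longrightarrow> Y C \<in> measurable M \<eta>"
    "\<And>C. C \<subseteq> {1..n} \<Longrightarrow> J C \<in> borel_measurable M" "\<mu> \<in> measurable M (measure_algebra \<eta>)"
    "\<And>q. partition_on {1..n} q \<Longrightarrow> 0 < measure M {\<omega> \<in> space M. p \<omega> = q} \<Longrightarrow>
      distr (given M p q) (block_space q) (\<lambda>\<omega>. (L \<omega>, (\<lambda>C\<in>q. Y C \<omega>), \<mu> \<omega>, (\<lambda>C\<in>q. J C \<omega>))) =
      block_law (real (card q) + \<theta> / \<alpha>) q"
  using assms unfolding PD_hierarchy_def block_law_def block_kernel_def[abs_def] K_def by blast+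

lemma block_tuple_measurable:
  assumes h: "PD_hierarchy \<alpha> \<theta> n \<eta> M p L Y J \<mu>" and q: "partition_on {1..n} q"
  shows "(\<lambda>\<omega>. (L \<omega>, (\<lambda>C\<in>q. Y C \<omega>), \<mu> \<omega>, (\<lambda>C\<in>q. J C \<omega>))) \<in> measurable M (block_space q)"
proof -
  note D = PD_hierarchyD[OF h]
  have sub: "C \<subseteq> {1..n}" if "C \<in> q" for C using q that by (auto simp: partition_on_def)
  show ?thesis
    by (intro measurable_Pair measurable_restrict D sub)
qed

lemma distr_given_block:
  assumes h: "PD_hierarchy \<alpha> \<theta> n \<eta> M p L Y J \<mu>" and q: "partition_on {1..n} q"
    and pos: "0 < measure M {\<omega> \<in> space M. p \<omega> = q}"
    and f: "f \<in> measurable (block_space q) N"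
  shows "distr (given M p q) N (\<lambda>\<omega>. f (L \<omega>, (\<lambda>C\<in>q. Y C \<omega>), \<mu> \<omega>, (\<lambda>C\<in>q. J C \<omega>))) =
    distr (block_law (real (card q) + \<theta> / \<alpha>) q) N f"
proof -
  have "(\<lambda>\<omega>. (L \<omega>, (\<lambda>C\<in>q. Y C \<omega>), \<mu> \<omega>, (\<lambda>C\<in>q. J C \<omega>))) \<in> measurable (given M p q) (block_space q)"
    using block_tuple_measurable[OF h q] by (simp add: given_def cong: measurable_cong_sets)
  from distr_distr[OF f this] show ?thesis
    unfolding PD_hierarchyD(7)[OF h q pos] by (simp add: comp_def)
qed

lemma distr_hierarchy:
  assumes \<theta>: "- \<alpha> < \<theta>" and n: "1 \<le> n" and sp: "space \<eta> = UNIV"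
    and h: "PD_hierarchy \<alpha> \<theta> n \<eta> M p L Y J \<mu>"
    and eppf: "\<And>q. partition_on {1..n} q \<Longrightarrow> measure M {\<omega> \<in> space M. p \<omega> = q} = PD_eppf n \<alpha> \<theta> q"
  shows "distr M (measure_algebra \<eta>) (\<lambda>\<omega>. add_atoms (\<mu> \<omega>) (p \<omega>) (\<lambda>C. J C \<omega>) (\<lambda>C. Y C \<omega>)) = PD_measure \<alpha> \<theta> \<eta>"
proof (rule mixture_eq_PD_measure[OF \<theta> n sp])
  note D = PD_hierarchyD[OF h]
  interpret prob_space M by (rule D(1))
  let ?P = "{q. partition_on {1..n} q}"
  have finP: "finite ?P" by (rule finitely_many_partition_on) simp
  have sub: "C \<subseteq> {1..n}" if "C \<in> q" "q \<in> ?P" for C q using that by (auto simp: partition_on_def)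
  have am[measurable]: "(\<lambda>\<omega>. add_atoms (\<mu> \<omega>) (p \<omega>) (\<lambda>C. J C \<omega>) (\<lambda>C. Y C \<omega>)) \<in> measurable M (measure_algebra \<eta>)"
    by (rule measurable_add_atoms[OF D(2) _ D(6)]) (use finP D(4,5) sub in \<open>auto intro: countable_finite\<close>)
  show "finite_measure (distr M (measure_algebra \<eta>) (\<lambda>\<omega>. add_atoms (\<mu> \<omega>) (p \<omega>) (\<lambda>C. J C \<omega>) (\<lambda>C. Y C \<omega>)))"
    by (intro prob_space.finite_measure prob_space_distr am)
  fix g :: "'y \<Rightarrow> real" assume g[measurable]: "g \<in> borel_measurable \<eta>" and g0: "\<And>y. 0 \<le> g y"
  let ?e = "\<lambda>m. ennreal (exp_minus (\<integral>\<^sup>+y. ennreal (g y) \<partial>m))"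
  have pos: "0 < measure M {\<omega> \<in> space M. p \<omega> = q}" if "q \<in> ?P" for q
    using that PD_eppf_pos[OF \<alpha> \<theta> n] eppf by simp
  have "(\<integral>\<^sup>+m. ?e m \<partial>distr M (measure_algebra \<eta>) (\<lambda>\<omega>. add_atoms (\<mu> \<omega>) (p \<omega>) (\<lambda>C. J C \<omega>) (\<lambda>C. Y C \<omega>))) =
    (\<integral>\<^sup>+\<omega>. ?e (add_atoms (\<mu> \<omega>) (p \<omega>) (\<lambda>C. J C \<omega>) (\<lambda>C. Y C \<omega>)) \<partial>M)"
    by (rule nn_integral_distr) measurable
  also have "\<dots> = (\<Sum>q\<in>?P. ennreal (measure M {\<omega> \<in> space M. p \<omega> = q}) *
    (\<integral>\<^sup>+\<omega>. ?e (add_atoms (\<mu> \<omega>) (p \<omega>) (\<lambda>C. J C \<omega>) (\<lambda>C. Y C \<omega>)) \<partial>given M p q))"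
    by (rule nn_integral_given[OF D(1) D(2) finP pos]) measurable
  also have "\<dots> = (\<Sum>q\<in>?P. ennreal (PD_eppf n \<alpha> \<theta> q) *
      (\<integral>\<^sup>+z. ?e (add_atoms (fst (snd (snd z))) q (snd (snd (snd z))) (fst (snd z)))
        \<partial>block_law (real (card q) + \<theta> / \<alpha>) q))"
  proof (intro sum.cong refl arg_cong2[where f="(*)"])
    fix q assume "q \<in> ?P"
    then have q: "partition_on {1..n} q" by simp
    show "ennreal (measure M {\<omega> \<in> space M. p \<omega> = q}) = ennreal (PD_eppf n \<alpha> \<theta> q)" using eppf[OF q] by simp
    have fm: "(\<lambda>z. add_atoms (fst (snd (snd z))) q (snd (snd (snd z))) (fst (snd z))) \<in> measurable (block_space q) (measure_algebra \<eta>)"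
    proof -
      have "(\<lambda>z. add_atoms (fst (snd (snd z))) ((\<lambda>_. q) z) (\<lambda>C. (\<lambda>C z. snd (snd (snd z)) C) C z) (\<lambda>C. (\<lambda>C z. fst (snd z) C) C z)) \<in> measurable (block_space q) (measure_algebra \<eta>)"
        by (rule measurable_add_atoms[where P="{q}"]) auto
      then show ?thesis by simp
    qed
    have tm: "(\<lambda>\<omega>. (L \<omega>, (\<lambda>C\<in>q. Y C \<omega>), \<mu> \<omega>, (\<lambda>C\<in>q. J C \<omega>))) \<in> measurable (given M p q) (block_space q)"
      using block_tuple_measurable[OF h q] by (simp add: given_def cong: measurable_cong_sets)
    have em: "(\<lambda>z. ?e (add_atoms (fst (snd (snd z))) q (snd (snd (snd z))) (fst (snd z)))) \<in> borel_measurable (block_space q)"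
      by (rule measurable_compose[OF fm]) measurable
    have AE: "AE \<omega> in given M p q. p \<omega> = q"
    proof -
      have "{\<omega> \<in> space M. p \<omega> = q} = p -` {q} \<inter> space M" by auto
      then have "{\<omega> \<in> space M. p \<omega> = q} \<in> sets M" using measurable_sets[OF D(2), of "{q}"] q by simp
      then show ?thesis unfolding given_def
        by (rule AE_uniform_measureI) auto
    qed
    have "(\<integral>\<^sup>+\<omega>. ?e (add_atoms (\<mu> \<omega>) (p \<omega>) (\<lambda>C. J C \<omega>) (\<lambda>C. Y C \<omega>)) \<partial>given M p q) =
      (\<integral>\<^sup>+\<omega>. ?e (add_atoms (\<mu> \<omega>) q (\<lambda>C\<in>q. J C \<omega>) (\<lambda>C\<in>q. Y C \<omega>)) \<partial>given M p q)"
    proof (rule nn_integral_cong_AE, rule eventually_mono[OF AE])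
      fix \<omega> assume "p \<omega> = q"
      \<comment> \<open>Only the values at the blocks enter the sum over \<open>q\<close>.
        Restricting both families to \<open>q\<close> makes the integrand a function of the tuple
        whose law \<open>PD_hierarchy\<close> prescribes.\<close>
      moreover have "add_atoms (\<mu> \<omega>) q (\<lambda>C. J C \<omega>) (\<lambda>C. Y C \<omega>) = add_atoms (\<mu> \<omega>) q (\<lambda>C\<in>q. J C \<omega>) (\<lambda>C\<in>q. Y C \<omega>)"
        unfolding add_atoms_def by (simp cong: sum.cong)
      ultimately show "?e (add_atoms (\<mu> \<omega>) (p \<omega>) (\<lambda>C. J C \<omega>) (\<lambda>C. Y C \<omega>)) = ?e (add_atoms (\<mu> \<omega>) q (\<lambda>C\<in>q. J C \<omega>) (\<lambda>C\<in>q. Y C \<omega>))"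
        by simp
    qed
    also have "\<dots> = (\<integral>\<^sup>+z. ?e (add_atoms (fst (snd (snd z))) q (snd (snd (snd z))) (fst (snd z)))
      \<partial>distr (given M p q) (block_space q) (\<lambda>\<omega>. (L \<omega>, (\<lambda>C\<in>q. Y C \<omega>), \<mu> \<omega>, (\<lambda>C\<in>q. J C \<omega>))))"
      using em by (subst nn_integral_distr[OF tm]) simp_all
    finally show "(\<integral>\<^sup>+\<omega>. ?e (add_atoms (\<mu> \<omega>) (p \<omega>) (\<lambda>C. J C \<omega>) (\<lambda>C. Y C \<omega>)) \<partial>given M p q) =
      (\<integral>\<^sup>+z. ?e (add_atoms (fst (snd (snd z))) q (snd (snd (snd z))) (fst (snd z))) \<partial>block_law (real (card q) + \<theta> / \<alpha>) q)"
      unfolding D(7)[OF q pos[OF \<open>q \<in> ?P\<close>]] .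
  qed
  finally show "(\<integral>\<^sup>+m. ?e m \<partial>distr M (measure_algebra \<eta>) (\<lambda>\<omega>. add_atoms (\<mu> \<omega>) (p \<omega>) (\<lambda>C. J C \<omega>) (\<lambda>C. Y C \<omega>))) =
    (\<Sum>q\<in>?P. ennreal (PD_eppf n \<alpha> \<theta> q) *
      (\<integral>\<^sup>+z. ?e (add_atoms (fst (snd (snd z))) q (snd (snd (snd z))) (fst (snd z)))
        \<partial>block_law (real (card q) + \<theta> / \<alpha>) q))" .
qed simp

text \<open>The partition is drawn with the EPPF as weights and the tuple from
  \<open>block_law\<close> given the partition. The spaces of the tuples vary with \<open>q\<close>,
  so they are embedded in one space that has a coordinate for every subset of
  \<open>{1..n}\<close>.\<close>

lemma PD_hierarchy_exists:
  assumes \<theta>: "- \<alpha> < \<theta>" and n: "1 \<le> n" and sp: "space \<eta> = UNIV"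
  shows "\<exists>(M :: (nat set set \<times> real \<times> (nat set \<Rightarrow> 'y) \<times> (nat set \<Rightarrow> real) \<times> 'y measure) measure) p L Y J \<mu>.
    PD_hierarchy \<alpha> \<theta> n \<eta> M p L Y J \<mu> \<and>
    (\<forall>q. partition_on {1..n} q \<longrightarrow> measure M {\<omega> \<in> space M. p \<omega> = q} = PD_eppf n \<alpha> \<theta> q)"
proof -
  note One_nat_def [simp del]
  let ?P = "{q. partition_on {1..n} q}" and ?B = "Pow {1..n}"
  let ?N = "count_space ?P \<Otimes>\<^sub>M borel \<Otimes>\<^sub>M PiM ?B (\<lambda>_. \<eta>) \<Otimes>\<^sub>M PiM ?B (\<lambda>_. borel) \<Otimes>\<^sub>M measure_algebra \<eta>
    :: (nat set set \<times> real \<times> (nat set \<Rightarrow> 'y) \<times> (nat set \<Rightarrow> real) \<times> 'y measure) measure"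
  let ?a = "\<lambda>q. real (card q) + \<theta> / \<alpha>"
  \<comment> \<open>\<open>undefined\<close> and 0 are placeholders at subsets that are not blocks;
    \<open>undefined\<close> is a legal point because the space of \<eta> is the whole type.\<close>
  define emb where "emb q z = (q, fst z, (\<lambda>C\<in>?B. if C \<in> q then fst (snd z) C else undefined),
      (\<lambda>C\<in>?B. if C \<in> q then snd (snd (snd z)) C else 0), fst (snd (snd z)))"
    for q :: "nat set set" and z :: "real \<times> (nat set \<Rightarrow> 'y) \<times> 'y measure \<times> (nat set \<Rightarrow> real)"
  define R where "R q = distr (block_law (?a q) q) ?N (emb q)" for q
  have finP: "finite ?P" by (rule finitely_many_partition_on) simp
  have emb[measurable]: "emb q \<in> measurable (block_law (?a q) q) ?N" if q: "q \<in> ?P" for q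
  proof -
    have y: "(\<lambda>z. if C \<in> q then fst (snd z) C else undefined) \<in> measurable (block_space q) \<eta>" for C
      using sp by (cases "C \<in> q") auto
    have j: "(\<lambda>z. if C \<in> q then snd (snd (snd z)) C else 0) \<in> borel_measurable (block_space q)" for C
      by (cases "C \<in> q") auto
    have "emb q \<in> measurable (block_space q) ?N"
      unfolding emb_def[abs_def] by (intro measurable_Pair measurable_restrict y j) (use q in auto)
    then show ?thesis by (simp add: sets_block_law cong: measurable_cong_sets)
  qed
  have Rprob: "prob_space (R q)" if q: "q \<in> ?P" for q
  proof -
    have q': "partition_on {1..n} q" using q by simp
    interpret prob_space "block_law (?a q) q"
      by (rule prob_space_block_law)
         (use finite_elements[OF _ q'] partition_on_blockD[OF q'] block_shape_pos[OF \<theta> n q'] in auto)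
    show ?thesis unfolding R_def by (rule prob_space_distr[OF emb[OF q]])
  qed
  have setsR: "sets (R q) = sets ?N" for q by (simp add: R_def)
  let ?D = "density (count_space ?P) (\<lambda>q. ennreal (PD_eppf n \<alpha> \<theta> q))"
  define M where "M = ?D \<bind> R"
  have Rm: "R \<in> measurable ?D (subprob_algebra ?N)"
  proof -
    have "R q \<in> space (subprob_algebra ?N)" if "q \<in> ?P" for q
      using prob_space_imp_subprob_space[OF Rprob[OF that]] by (simp add: space_subprob_algebra setsR)
    then have "R \<in> measurable (count_space ?P) (subprob_algebra ?N)" by simp
    then show ?thesis by (simp cong: measurable_cong_sets)
  qed
  have neP: "?P \<noteq> {}" using sum_PD_eppf[OF \<alpha> \<theta> n] by force
  have setsM: "sets M = sets ?N" unfolding M_def using neP by (intro sets_bind setsR) simp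
  have spM: "space M = space ?N" using setsM by (rule sets_eq_imp_space_eq)
  have eM: "emeasure M X = (\<Sum>q\<in>?P. ennreal (PD_eppf n \<alpha> \<theta> q) * emeasure (R q) X)" if X: "X \<in> sets ?N" for X
  proof -
    have "emeasure M X = (\<integral>\<^sup>+q. emeasure (R q) X \<partial>?D)"
      unfolding M_def using neP by (intro emeasure_bind[OF _ Rm X]) simp
    also have "\<dots> = (\<integral>\<^sup>+q. ennreal (PD_eppf n \<alpha> \<theta> q) * emeasure (R q) X \<partial>count_space ?P)"
      by (rule nn_integral_density) auto
    also have "\<dots> = (\<Sum>q\<in>?P. ennreal (PD_eppf n \<alpha> \<theta> q) * emeasure (R q) X)"
      by (rule nn_integral_count_space_finite[OF finP])
    finally show ?thesis .
  qed
  have e0: "0 < PD_eppf n \<alpha> \<theta> q" if "q \<in> ?P" for q using PD_eppf_pos[OF \<alpha> \<theta> n] that by simp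
  have Mprob: "prob_space M"
  proof (rule prob_spaceI)
    have "emeasure M (space M) = (\<Sum>q\<in>?P. ennreal (PD_eppf n \<alpha> \<theta> q) * 1)"
      unfolding spM eM[OF sets.top]
      using prob_space.emeasure_space_1[OF Rprob] sets_eq_imp_space_eq[OF setsR] by (intro sum.cong) auto
    also have "\<dots> = ennreal (\<Sum>q\<in>?P. PD_eppf n \<alpha> \<theta> q)"
      unfolding mult_1_right using e0 by (intro sum_ennreal) (auto intro: less_imp_le)
    finally show "emeasure M (space M) = 1" using sum_PD_eppf[OF \<alpha> \<theta> n] by simp
  qed
  interpret M: prob_space M by (rule Mprob)
  have E: "{\<omega> \<in> space M. fst \<omega> = q} \<in> sets ?N" if q: "q \<in> ?P" for q
  proof -
    have "{\<omega> \<in> space ?N. fst \<omega> = q} = fst -` {q} \<inter> space ?N" by auto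
    moreover have "fst -` {q} \<inter> space ?N \<in> sets ?N" using q by (intro measurable_sets[OF measurable_fst]) auto
    ultimately show ?thesis by (simp add: spM)
  qed
  \<comment> \<open>Under \<open>R q'\<close> the partition is constantly \<open>q'\<close>, so the
    event \<open>fst \<omega> = q\<close> selects a single summand of the mixture.\<close>
  have RE: "emeasure (R q') ({\<omega> \<in> space M. fst \<omega> = q} \<inter> X) = (if q' = q then emeasure (R q) X else 0)"
    if q: "q \<in> ?P" "q' \<in> ?P" and X: "X \<in> sets ?N" for q q' X
  proof -
    have "emeasure (R q') ({\<omega> \<in> space M. fst \<omega> = q} \<inter> X) = emeasure (block_law (?a q') q') (emb q' -` ({\<omega> \<in> space M. fst \<omega> = q} \<inter> X) \<inter> space (block_law (?a q') q'))"
      unfolding R_def using E[OF q(1)] X by (intro emeasure_distr emb[OF q(2)]) auto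
    also have "emb q' -` ({\<omega> \<in> space M. fst \<omega> = q} \<inter> X) \<inter> space (block_law (?a q') q') =
      (if q' = q then emb q -` X \<inter> space (block_law (?a q) q) else {})"
      using sets.sets_into_space[OF X] by (auto simp: emb_def spM)
    finally show ?thesis
      unfolding R_def using emeasure_distr[OF emb[OF q(1)] X] by auto
  qed
  have eMX: "emeasure M ({\<omega> \<in> space M. fst \<omega> = q} \<inter> X) = ennreal (PD_eppf n \<alpha> \<theta> q) * emeasure (R q) X"
    if q: "q \<in> ?P" and X: "X \<in> sets ?N" for q X
  proof -
    have "emeasure M ({\<omega> \<in> space M. fst \<omega> = q} \<inter> X) = (\<Sum>q'\<in>?P. ennreal (PD_eppf n \<alpha> \<theta> q') * (if q' = q then emeasure (R q) X else 0))"
      using E[OF q] X RE[OF q _ X] by (subst eM) (auto intro!: sum.cong)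
    also have "\<dots> = ennreal (PD_eppf n \<alpha> \<theta> q) * emeasure (R q) X"
      using finP q by (subst sum.mono_neutral_right[of ?P "{q}"]) auto
    finally show ?thesis .
  qed
  have PM: "emeasure M {\<omega> \<in> space M. fst \<omega> = q} = ennreal (PD_eppf n \<alpha> \<theta> q)" if q: "q \<in> ?P" for q
  proof -
    have "{\<omega> \<in> space M. fst \<omega> = q} \<inter> space ?N = {\<omega> \<in> space M. fst \<omega> = q}" by (auto simp: spM)
    then show ?thesis using eMX[OF q sets.top] prob_space.emeasure_space_1[OF Rprob[OF q]]
      sets_eq_imp_space_eq[OF setsR] by simp
  qed
  have PMr: "measure M {\<omega> \<in> space M. fst \<omega> = q} = PD_eppf n \<alpha> \<theta> q" if q: "q \<in> ?P" for q
    using PM[OF q] e0[OF q] by (simp add: measure_def)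
  have giv: "given M fst q = R q" if q: "q \<in> ?P" for q
  proof (rule measure_eqI)
    show "sets (given M fst q) = sets (R q)" by (simp add: given_def setsM setsR)
    fix X assume "X \<in> sets (given M fst q)"
    then have X: "X \<in> sets ?N" by (simp add: given_def setsM)
    have "emeasure (given M fst q) X = emeasure M ({\<omega> \<in> space M. fst \<omega> = q} \<inter> X) / emeasure M {\<omega> \<in> space M. fst \<omega> = q}"
      unfolding given_def using E[OF q] X by (intro emeasure_uniform_measure) (simp_all add: setsM)
    also have "\<dots> = emeasure (R q) X"
      unfolding eMX[OF q X] PM[OF q] using e0[OF q]
      by (subst mult.commute) (simp add: ennreal_mult_divide_eq)
    finally show "emeasure (given M fst q) X = emeasure (R q) X" .
  qed
  have h: "PD_hierarchy \<alpha> \<theta> n \<eta> M fst (\<lambda>\<omega>. fst (snd \<omega>)) (\<lambda>C \<omega>. fst (snd (snd \<omega>)) C)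
    (\<lambda>C \<omega>. fst (snd (snd (snd \<omega>))) C) (\<lambda>\<omega>. snd (snd (snd (snd \<omega>))))"
    unfolding PD_hierarchy_def
  proof (intro conjI allI impI)
    show "prob_space M" by (rule Mprob)
    show "fst \<in> measurable M (count_space ?P)"
      unfolding measurable_cong_sets[OF setsM refl] by (rule measurable_fst)
    show "(\<lambda>\<omega>. fst (snd \<omega>)) \<in> borel_measurable M" by (simp add: setsM cong: measurable_cong_sets)
    show "(\<lambda>\<omega>. snd (snd (snd (snd \<omega>)))) \<in> measurable M (measure_algebra \<eta>)"
      by (simp add: setsM cong: measurable_cong_sets)
    fix C assume "C \<subseteq> {1..n}"
    then have C: "C \<in> ?B" by simp
    have "(\<lambda>\<omega>. fst (snd (snd \<omega>)) C) \<in> measurable ?N \<eta>" "(\<lambda>\<omega>. fst (snd (snd (snd \<omega>))) C) \<in> borel_measurable ?N"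
      using C by measurable
    then show "(\<lambda>\<omega>. fst (snd (snd \<omega>)) C) \<in> measurable M \<eta>" "(\<lambda>\<omega>. fst (snd (snd (snd \<omega>))) C) \<in> borel_measurable M"
      by (simp_all add: setsM cong: measurable_cong_sets)
  next
    fix q assume "partition_on {1..n} q \<and> 0 < measure M {\<omega> \<in> space M. fst \<omega> = q}"
    then have q: "q \<in> ?P" by simp
    have sub: "C \<in> ?B" if "C \<in> q" for C using q that by (auto simp: partition_on_def)
    let ?t = "\<lambda>\<omega>. (fst (snd \<omega>), \<lambda>C\<in>q. fst (snd (snd \<omega>)) C, snd (snd (snd (snd \<omega>))), \<lambda>C\<in>q. fst (snd (snd (snd \<omega>))) C)"
    have t: "?t \<in> measurable ?N (block_space q)"
      by (intro measurable_Pair measurable_restrict) (use sub in measurable)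
    have "distr (given M fst q) (block_space q) ?t = distr (block_law (?a q) q) (block_space q) (?t \<circ> emb q)"
      unfolding giv[OF q] R_def by (rule distr_distr[OF t emb[OF q]])
    also have "\<dots> = distr (block_law (?a q) q) (block_law (?a q) q) (\<lambda>z. z)"
    \<comment> \<open>Restricting an embedded tuple to the blocks gives back the original one,
      because elements of a product space are extensional.\<close>
    proof (rule distr_cong)
      fix z assume "z \<in> space (block_law (?a q) q)"
      then have "z \<in> space (block_space q)" using sets_eq_imp_space_eq[OF sets_block_law] by metis
      then have ext: "fst (snd z) \<in> extensional q" "snd (snd (snd z)) \<in> extensional q"
        by (auto simp: space_pair_measure space_PiM PiE_def)
      have 1: "(\<lambda>C\<in>q. (\<lambda>C\<in>?B. if C \<in> q then fst (snd z) C else undefined) C) = fst (snd z)"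
        using ext(1) sub by (auto simp: fun_eq_iff extensional_def restrict_def)
      have 2: "(\<lambda>C\<in>q. (\<lambda>C\<in>?B. if C \<in> q then snd (snd (snd z)) C else 0) C) = snd (snd (snd z))"
        using ext(2) sub by (auto simp: fun_eq_iff extensional_def restrict_def)
      show "(?t \<circ> emb q) z = z" by (simp only: comp_def emb_def fst_conv snd_conv 1 2 prod.collapse)
    qed (simp_all add: sets_block_law)
    also have "\<dots> = block_law (?a q) q" by (rule distr_id)
    finally show "distr (given M fst q) (block_space q) ?t =
      gamma_law (?a q) (measure \<eta> (space \<eta>) / \<alpha>) \<bind> (\<lambda>l. return borel l \<Otimes>\<^sub>M PiM q (\<lambda>_. H) \<Otimes>\<^sub>M
        gg (l powr (1 / \<alpha>)) \<Otimes>\<^sub>M PiM q (\<lambda>C. gamma_law (real (card C) - \<alpha>) (l powr (1 / \<alpha>))))"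
      unfolding block_law_def block_kernel_def[abs_def] K_def .
  qed
  show ?thesis using h PMr by blast
qed

section \<open>Laws given the partition\<close>

context
  fixes \<theta> :: real and n :: nat and M :: "'w measure" and p L Y J \<mu> q
  assumes \<theta>: "- \<alpha> < \<theta>" and n: "1 \<le> n"
    and h: "PD_hierarchy \<alpha> \<theta> n \<eta> M p L Y J \<mu>" and q: "partition_on {1..n} q"
    and pos: "0 < measure M {\<omega> \<in> space M. p \<omega> = q}"
begin

private lemma finite_q: "finite q"
  by (rule finite_elements[OF _ q]) simp

private lemma card_block: "C \<in> q \<Longrightarrow> 0 < card C"
  by (rule partition_on_blockD(2)[OF q]) simp

text \<open>Translates between the parameter \<open>\<alpha> * a\<close> of the results on
  \<open>block_law\<close>, with \<open>a = card q + \<theta> / \<alpha>\<close>, and the parameter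
  in the claims.\<close>

private lemma shape: "\<alpha> * (real (card q) + \<theta> / \<alpha>) = \<theta> + real (card q) * \<alpha>"
  using \<alpha> by (simp add: distrib_left mult.commute)

private lemma distr_given_rm:
  "distr (given M p q) (measure_algebra \<eta>) \<mu> =
    distr (block_law (real (card q) + \<theta> / \<alpha>) q) (measure_algebra \<eta>) (\<lambda>z. fst (snd (snd z)))"
proof -
  have "(\<lambda>z. fst (snd (snd z))) \<in> measurable (block_space q) (measure_algebra \<eta>)" by measurable
  from distr_given_block[OF h q pos this] show ?thesis unfolding fst_conv snd_conv .
qed

lemma distr_given_eq_PD_measure:
  "distr (given M p q) (measure_algebra \<eta>) \<mu> = PD_measure \<alpha> (\<theta> + real (card q) * \<alpha>) \<eta>"
  unfolding distr_given_rm shape[symmetric]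
  by (rule distr_block_law_mass(1)[OF finite_q card_block block_shape_pos[OF \<theta> n q]])

lemma laplace_functional_given:
  assumes "g \<in> borel_measurable \<eta>" "\<And>y. 0 \<le> g y"
  shows "laplace_functional (distr (given M p q) (measure_algebra \<eta>) \<mu>) g =
    (\<integral>l. gg_laplace \<alpha> \<eta> g l \<partial>gamma_law (real (card q) + \<theta> / \<alpha>) K)"
  unfolding distr_given_rm by (rule laplace_block_law[OF finite_q card_block assms])

lemma distr_given_normalise:
  "distr (given M p q) (measure_algebra \<eta>) (\<lambda>\<omega>. normalise (\<mu> \<omega>)) = PD_rpm \<alpha> (\<theta> + real (card q) * \<alpha>) \<eta>"
proof -
  have "\<mu> \<in> measurable (given M p q) (measure_algebra \<eta>)"
    using PD_hierarchyD(6)[OF h] by (simp add: given_def cong: measurable_cong_sets)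
  from distr_distr[OF measurable_normalise this] show ?thesis
    unfolding PD_rpm_def distr_given_eq_PD_measure comp_def by (rule sym)
qed

lemma distr_given_normalise_H:
  "distr (given M p q) (measure_algebra \<eta>) (\<lambda>\<omega>. normalise (\<mu> \<omega>)) = PD_rpm \<alpha> (\<theta> + real (card q) * \<alpha>) H"
  using PD_rpm_normalise[OF block_shape_pos[OF \<theta> n q]] unfolding distr_given_normalise shape .

lemma distr_given_scaled_jumps:
  "distr (given M p q) ((borel \<Otimes>\<^sub>M measure_algebra \<eta>) \<Otimes>\<^sub>M PiM q (\<lambda>_. borel))
      (\<lambda>\<omega>. ((L \<omega>, \<mu> \<omega>), (\<lambda>C\<in>q. L \<omega> powr (1 / \<alpha>) * J C \<omega>))) =
    distr (given M p q) (borel \<Otimes>\<^sub>M measure_algebra \<eta>) (\<lambda>\<omega>. (L \<omega>, \<mu> \<omega>)) \<Otimes>\<^sub>M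
      PiM q (\<lambda>C. gamma_law (real (card C) - \<alpha>) 1)"
proof -
  let ?f = "\<lambda>(l, y :: nat set \<Rightarrow> 'y, m :: 'y measure, j).
    ((l, m), (\<lambda>C\<in>q. l powr (1 / \<alpha>) * j C)) :: (real \<times> 'y measure) \<times> (nat set \<Rightarrow> real)"
  let ?g = "\<lambda>(l, y :: nat set \<Rightarrow> 'y, m :: 'y measure, j :: nat set \<Rightarrow> real). (l :: real, m)"
  have f: "?f \<in> measurable (block_space q) ((borel \<Otimes>\<^sub>M measure_algebra \<eta>) \<Otimes>\<^sub>M PiM q (\<lambda>_. borel))"
    and g: "?g \<in> measurable (block_space q) (borel \<Otimes>\<^sub>M measure_algebra \<eta>)" by measurable
  have "(\<lambda>C\<in>q. L \<omega> powr (1 / \<alpha>) * (\<lambda>C\<in>q. J C \<omega>) C) = (\<lambda>C\<in>q. L \<omega> powr (1 / \<alpha>) * J C \<omega>)" for \<omega>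
    by (rule restrict_ext) simp
  note 1 = distr_given_block[OF h q pos f, unfolded prod.case this]
    and 2 = distr_given_block[OF h q pos g, unfolded prod.case]
  show ?thesis
    unfolding 1 2 by (rule distr_block_law_scaled[OF finite_q card_block block_shape_pos[OF \<theta> n q]])
qed

lemma laplace_functional_given_scaled:
  assumes "g \<in> borel_measurable \<eta>" "\<And>y. 0 \<le> g y"
  shows "laplace_functional (distr (given M p q) (measure_algebra \<eta>)
      (\<lambda>\<omega>. scale_measure (ennreal (L \<omega> powr (1 / \<alpha>))) (\<mu> \<omega>))) g =
    (let I = \<integral>\<^sup>+y. ennreal ((g y + 1) powr \<alpha>) \<partial>H
     in if I = \<infinity> then 0 else enn2real I powr (- (\<theta> + real (card q) * \<alpha>) / \<alpha>))"
proof -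
  have "(\<lambda>z. scale_measure (ennreal (fst z powr (1 / \<alpha>))) (fst (snd (snd z)))) \<in> measurable (block_space q) (measure_algebra \<eta>)"
    by (rule measurable_scale_measure) measurable
  note 1 = distr_given_block[OF h q pos this, unfolded fst_conv snd_conv]
  have 2: "- (\<theta> + real (card q) * \<alpha>) / \<alpha> = - (real (card q) + \<theta> / \<alpha>)"
    using \<alpha> by (simp add: field_simps)
  show ?thesis
    unfolding 1 2 by (rule laplace_scaled_block_law[OF finite_q card_block block_shape_pos[OF \<theta> n q] assms])
qed

lemma distr_given_scaled_mass:
  "distr (given M p q) borel (\<lambda>\<omega>. L \<omega> powr (1 / \<alpha>) * measure (\<mu> \<omega>) (space (\<mu> \<omega>))) =
    gamma_law (\<theta> + real (card q) * \<alpha>) 1"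
proof -
  have "(\<lambda>z. fst z powr (1 / \<alpha>) * tmass (fst (snd (snd z)))) \<in> borel_measurable (block_space q)" by measurable
  note 1 = distr_given_block[OF h q pos this, unfolded fst_conv snd_conv]
  show ?thesis
    unfolding 1 shape[symmetric]
    by (rule distr_block_law_mass(2)[OF finite_q card_block block_shape_pos[OF \<theta> n q]])
qed

end

end

text \<open>The existential half keeps the universal half from being vacuous; the latter concerns
  every such hierarchy, whatever its probability space. Since each EPPF weight is positive,
  conditioning on \<open>p = q\<close> is meaningful for every partition \<open>q\<close>.\<close>

theorem proposition5p4:
  fixes \<alpha> \<theta> K :: real and n :: nat and \<eta> H :: "'y::polish_space measure"
  assumes "0 < \<alpha>" and "\<alpha> < 1" and "- \<alpha> < \<theta>" and "1 \<le> n"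
    and "sets \<eta> = sets borel" and "finite_measure \<eta>" and "emeasure \<eta> (space \<eta>) \<noteq> 0"
    and "\<forall>y. emeasure \<eta> {y} = 0"
    and "H = normalise \<eta>" and "K = measure \<eta> (space \<eta>) / \<alpha>"
  shows
    "(\<exists>(M :: (nat set set \<times> real \<times> (nat set \<Rightarrow> 'y) \<times> (nat set \<Rightarrow> real) \<times> 'y measure) measure)
        p L Y J \<mu>.
        PD_hierarchy \<alpha> \<theta> n \<eta> M p L Y J \<mu> \<and>
        (\<forall>q. partition_on {1..n} q \<longrightarrow> measure M {\<omega> \<in> space M. p \<omega> = q} = PD_eppf n \<alpha> \<theta> q) \<and>
        distr M (measure_algebra \<eta>) (\<lambda>\<omega>. add_atoms (\<mu> \<omega>) (p \<omega>) (\<lambda>C. J C \<omega>) (\<lambda>C. Y C \<omega>)) =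
          PD_measure \<alpha> \<theta> \<eta>) \<and>
     (\<forall>(M :: 'w measure) p L Y J \<mu>.
        PD_hierarchy \<alpha> \<theta> n \<eta> M p L Y J \<mu> \<and>
        (\<forall>q. partition_on {1..n} q \<longrightarrow> measure M {\<omega> \<in> space M. p \<omega> = q} = PD_eppf n \<alpha> \<theta> q) \<longrightarrow>
        distr M (measure_algebra \<eta>) (\<lambda>\<omega>. add_atoms (\<mu> \<omega>) (p \<omega>) (\<lambda>C. J C \<omega>) (\<lambda>C. Y C \<omega>)) =
          PD_measure \<alpha> \<theta> \<eta> \<and>
        (\<forall>q. partition_on {1..n} q \<longrightarrow>
          0 < measure M {\<omega> \<in> space M. p \<omega> = q} \<and>
          distr (given M p q) (measure_algebra \<eta>) \<mu> =
            PD_measure \<alpha> (\<theta> + real (card q) * \<alpha>) \<eta> \<and>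
          (\<forall>g\<in>borel_measurable borel. (\<forall>y. 0 \<le> g y) \<longrightarrow>
            laplace_functional (distr (given M p q) (measure_algebra \<eta>) \<mu>) g =
              (\<integral>l. gg_laplace \<alpha> \<eta> g l \<partial>gamma_law (real (card q) + \<theta> / \<alpha>) K)) \<and>
          distr (given M p q) (measure_algebra \<eta>) (\<lambda>\<omega>. normalise (\<mu> \<omega>)) =
            PD_rpm \<alpha> (\<theta> + real (card q) * \<alpha>) \<eta> \<and>
          distr (given M p q) (measure_algebra \<eta>) (\<lambda>\<omega>. normalise (\<mu> \<omega>)) =
            PD_rpm \<alpha> (\<theta> + real (card q) * \<alpha>) H \<and>
          distr (given M p q)
              ((borel \<Otimes>\<^sub>M measure_algebra \<eta>) \<Otimes>\<^sub>M PiM q (\<lambda>_. borel))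
              (\<lambda>\<omega>. ((L \<omega>, \<mu> \<omega>), (\<lambda>C\<in>q. L \<omega> powr (1 / \<alpha>) * J C \<omega>))) =
            distr (given M p q) (borel \<Otimes>\<^sub>M measure_algebra \<eta>) (\<lambda>\<omega>. (L \<omega>, \<mu> \<omega>)) \<Otimes>\<^sub>M
            PiM q (\<lambda>C. gamma_law (real (card C) - \<alpha>) 1) \<and>
          (\<forall>g\<in>borel_measurable borel. (\<forall>y. 0 \<le> g y) \<longrightarrow>
            laplace_functional (distr (given M p q) (measure_algebra \<eta>)
                (\<lambda>\<omega>. scale_measure (ennreal (L \<omega> powr (1 / \<alpha>))) (\<mu> \<omega>))) g =
              (let I = (\<integral>\<^sup>+y. ennreal ((g y + 1) powr \<alpha>) \<partial>H)
               in if I = \<infinity> then 0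
                  else enn2real I powr (- (\<theta> + real (card q) * \<alpha>) / \<alpha>))) \<and>
          distr (given M p q) borel
              (\<lambda>\<omega>. L \<omega> powr (1 / \<alpha>) * measure (\<mu> \<omega>) (space (\<mu> \<omega>))) =
            gamma_law (\<theta> + real (card q) * \<alpha>) 1))"
proof -
  interpret S: gg_setting \<alpha> \<eta> by (rule gg_setting.intro) (rule assms)+
  have sp: "space \<eta> = UNIV" using sets_eq_imp_space_eq[OF assms(5)] by simp
  note \<theta> = assms(3) and n = assms(4)
  have gm: "g \<in> borel_measurable \<eta>" if "g \<in> borel_measurable borel" for g :: "'y \<Rightarrow> real"
    using that unfolding measurable_cong_sets[OF assms(5) refl] .
  show ?thesis
    unfolding assms(9,10) S.K_def[symmetric]
  proof (intro conjI allI impI ballI; (elim conjE)?)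
    obtain M :: "(nat set set \<times> real \<times> (nat set \<Rightarrow> 'y) \<times> (nat set \<Rightarrow> real) \<times> 'y measure) measure" and p L Y J \<mu>
      where he: "PD_hierarchy \<alpha> \<theta> n \<eta> M p L Y J \<mu> \<and>
        (\<forall>q. partition_on {1..n} q \<longrightarrow> measure M {\<omega> \<in> space M. p \<omega> = q} = PD_eppf n \<alpha> \<theta> q)"
      using S.PD_hierarchy_exists[OF \<theta> n sp] by (elim exE) (rule that)
    note h = he[THEN conjunct1] and e = he[THEN conjunct2]
    note d = S.distr_hierarchy[OF \<theta> n sp h e[rule_format]]
    show "\<exists>(M :: (nat set set \<times> real \<times> (nat set \<Rightarrow> 'y) \<times> (nat set \<Rightarrow> real) \<times> 'y measure) measure) p L Y J \<mu>.
        PD_hierarchy \<alpha> \<theta> n \<eta> M p L Y J \<mu> \<and>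
        (\<forall>q. partition_on {1..n} q \<longrightarrow> measure M {\<omega> \<in> space M. p \<omega> = q} = PD_eppf n \<alpha> \<theta> q) \<and>
        distr M (measure_algebra \<eta>) (\<lambda>\<omega>. add_atoms (\<mu> \<omega>) (p \<omega>) (\<lambda>C. J C \<omega>) (\<lambda>C. Y C \<omega>)) = PD_measure \<alpha> \<theta> \<eta>"
      by (rule exI[of _ M], rule exI[of _ p], rule exI[of _ L], rule exI[of _ Y], rule exI[of _ J], rule exI[of _ \<mu>])
         (intro conjI h e d)
  next
    fix M :: "'w measure" and p L Y J \<mu>
    assume h: "PD_hierarchy \<alpha> \<theta> n \<eta> M p L Y J \<mu>"
      and eppf: "\<forall>q. partition_on {1..n} q \<longrightarrow> measure M {\<omega> \<in> space M. p \<omega> = q} = PD_eppf n \<alpha> \<theta> q"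
    show "distr M (measure_algebra \<eta>) (\<lambda>\<omega>. add_atoms (\<mu> \<omega>) (p \<omega>) (\<lambda>C. J C \<omega>) (\<lambda>C. Y C \<omega>)) = PD_measure \<alpha> \<theta> \<eta>"
      by (rule S.distr_hierarchy[OF \<theta> n sp h eppf[rule_format]])
    fix q assume q: "partition_on {1..n} q"
    show pos: "0 < measure M {\<omega> \<in> space M. p \<omega> = q}"
      unfolding eppf[rule_format, OF q] by (rule PD_eppf_pos[OF S.\<alpha> \<theta> n q])
    note given = \<theta> n h q pos
    show "distr (given M p q) (measure_algebra \<eta>) \<mu> = PD_measure \<alpha> (\<theta> + real (card q) * \<alpha>) \<eta>"
      by (rule S.distr_given_eq_PD_measure[OF given])
    show "distr (given M p q) (measure_algebra \<eta>) (\<lambda>\<omega>. normalise (\<mu> \<omega>)) = PD_rpm \<alpha> (\<theta> + real (card q) * \<alpha>) \<eta>"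
      by (rule S.distr_given_normalise[OF given])
    show "distr (given M p q) (measure_algebra \<eta>) (\<lambda>\<omega>. normalise (\<mu> \<omega>)) = PD_rpm \<alpha> (\<theta> + real (card q) * \<alpha>) (normalise \<eta>)"
      by (rule S.distr_given_normalise_H[OF given])
    show "distr (given M p q) ((borel \<Otimes>\<^sub>M measure_algebra \<eta>) \<Otimes>\<^sub>M PiM q (\<lambda>_. borel))
          (\<lambda>\<omega>. ((L \<omega>, \<mu> \<omega>), (\<lambda>C\<in>q. L \<omega> powr (1 / \<alpha>) * J C \<omega>))) =
        distr (given M p q) (borel \<Otimes>\<^sub>M measure_algebra \<eta>) (\<lambda>\<omega>. (L \<omega>, \<mu> \<omega>)) \<Otimes>\<^sub>M
          PiM q (\<lambda>C. gamma_law (real (card C) - \<alpha>) 1)"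
      by (rule S.distr_given_scaled_jumps[OF given])
    show "distr (given M p q) borel (\<lambda>\<omega>. L \<omega> powr (1 / \<alpha>) * measure (\<mu> \<omega>) (space (\<mu> \<omega>))) =
        gamma_law (\<theta> + real (card q) * \<alpha>) 1"
      by (rule S.distr_given_scaled_mass[OF given])
    fix g :: "'y \<Rightarrow> real" assume g: "g \<in> borel_measurable borel" "\<forall>y. 0 \<le> g y"
    show "laplace_functional (distr (given M p q) (measure_algebra \<eta>) \<mu>) g =
        (\<integral>l. gg_laplace \<alpha> \<eta> g l \<partial>gamma_law (real (card q) + \<theta> / \<alpha>) S.K)"
      by (rule S.laplace_functional_given[OF given gm[OF g(1)] g(2)[rule_format]])
    show "laplace_functional (distr (given M p q) (measure_algebra \<eta>)
          (\<lambda>\<omega>. scale_measure (ennreal (L \<omega> powr (1 / \<alpha>))) (\<mu> \<omega>))) g =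
        (let I = (\<integral>\<^sup>+y. ennreal ((g y + 1) powr \<alpha>) \<partial>normalise \<eta>)
         in if I = \<infinity> then 0 else enn2real I powr (- (\<theta> + real (card q) * \<alpha>) / \<alpha>))"
      by (rule S.laplace_functional_given_scaled[OF given gm[OF g(1)] g(2)[rule_format]])
  qed
qed

end
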